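(* Let $m\in\mathbb{N}_+$, $V\in L^{\frac{2m+1}{2m}}(\mathbb{R}^2)$, and let $u\in W^{\frac{4m+2}{4m+1}}(\mathbb{R}^2)$ solve $$i\partial_t u-D_x^{2m}u=V(t,x)u\quad\text{in }\mathbb{R}^2_{t,x}$$ (in the sense of distributions). If $u$ vanishes on some half plane of $\mathbb{R}^2$, i.e. $u=0$ on $\{(t,x)\in\mathbb{R}^2:\langle (t,x),v\rangle>c\}$ for some $v\in\mathbb{S}^1$ and $c\in\mathbb{R}$, then $u\equiv 0$ on $\mathbb{R}^2$.
   Context: $D_x=i^{-1}\partial_x$; $\langle\cdot,\cdot\rangle$ is the Euclidean inner product on $\mathbb{R}^2$. For $q\ge 1$, $$W^q(\mathbb{R}^2)=\Big\{u\in\mathscr{S}'(\mathbb{R}^2):\ \mathscr{F}^{-1}\Big(\big((1+\tau^2)^{1/2}+\xi^{2m}\big)\hat u(\tau,\xi)\Big)\in L^q(\mathbb{R}^2)\Big\},$$ where $\hat u=\mathscr{F}u$ is the Fourier transform on $\mathbb{R}^2$ in the variables $(t,x)$, with dual variables $(\tau,\xi)$. *)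

theory Defs
  imports "HOL-Analysis.Analysis"
begin

type_synonym R2 = "real \<times> real"

definition dT :: "(R2 \<Rightarrow> complex) \<Rightarrow> R2 \<Rightarrow> complex" where
  "dT \<phi> = (\<lambda>(t, x). vector_derivative (\<lambda>s. \<phi> (s, x)) (at t))"

definition dX :: "(R2 \<Rightarrow> complex) \<Rightarrow> R2 \<Rightarrow> complex" where
  "dX \<phi> = (\<lambda>(t, x). vector_derivative (\<lambda>y. \<phi> (t, y)) (at x))"

fun pd :: "bool list \<Rightarrow> (R2 \<Rightarrow> complex) \<Rightarrow> R2 \<Rightarrow> complex" where
  "pd [] \<phi> = \<phi>"
| "pd (b # w) \<phi> = (if b then dT else dX) (pd w \<phi>)"

definition smooth2 :: "(R2 \<Rightarrow> complex) \<Rightarrow> bool" where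
  "smooth2 \<phi> \<longleftrightarrow> (\<forall>w. continuous_on UNIV (pd w \<phi>) \<and>
      (\<forall>t x. (\<lambda>s. pd w \<phi> (s, x)) differentiable (at t) \<and>
             (\<lambda>y. pd w \<phi> (t, y)) differentiable (at x)))"

definition test_fun :: "(R2 \<Rightarrow> complex) \<Rightarrow> bool" where
  "test_fun \<phi> \<longleftrightarrow> smooth2 \<phi> \<and> (\<exists>R. \<forall>z. norm z > R \<longrightarrow> \<phi> z = 0)"

definition schwartz :: "(R2 \<Rightarrow> complex) \<Rightarrow> bool" where
  "schwartz \<phi> \<longleftrightarrow> smooth2 \<phi> \<and>
     (\<forall>w (a::nat) (b::nat). bounded (range (\<lambda>(t, x). complex_of_real (t ^ a * x ^ b) * pd w \<phi> (t, x))))"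

definition FT :: "(R2 \<Rightarrow> complex) \<Rightarrow> R2 \<Rightarrow> complex" where
  "FT \<phi> \<zeta> = (\<integral>z. exp (- \<i> * complex_of_real (z \<bullet> \<zeta>)) * \<phi> z \<partial>lborel)"

definition IFT :: "(R2 \<Rightarrow> complex) \<Rightarrow> R2 \<Rightarrow> complex" where
  "IFT g z = complex_of_real (1 / (2 * pi) ^ 2) *
     (\<integral>\<zeta>. exp (\<i> * complex_of_real (z \<bullet> \<zeta>)) * g \<zeta> \<partial>lborel)"

definition symb :: "nat \<Rightarrow> R2 \<Rightarrow> real" where
  "symb m = (\<lambda>(\<tau>, \<xi>). sqrt (1 + \<tau>\<^sup>2) + \<xi> ^ (2 * m))"

definition PD :: "nat \<Rightarrow> (R2 \<Rightarrow> complex) \<Rightarrow> R2 \<Rightarrow> complex" where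
  "PD m \<phi> = IFT (\<lambda>\<zeta>. complex_of_real (symb m \<zeta>) * FT \<phi> \<zeta>)"

definition Lp :: "real \<Rightarrow> (R2 \<Rightarrow> complex) \<Rightarrow> bool" where
  "Lp p f \<longleftrightarrow> f \<in> borel_measurable lborel \<and> integrable lborel (\<lambda>z. norm (f z) powr p)"

text \<open>The space W^q(R^2): u is a (tempered, locally integrable) function such that the
  distribution F^{-1}((1+tau^2)^{1/2}+xi^{2m}) F u) is given by an L^q function f.
  Since the symbol is even and real, the tempered distribution F^{-1}(symb * F u)
  acts on a Schwartz function phi by <u, F^{-1}(symb * F phi)>.\<close>
definition Wq :: "nat \<Rightarrow> real \<Rightarrow> (R2 \<Rightarrow> complex) \<Rightarrow> bool" where
  "Wq m q u \<longleftrightarrow> u \<in> borel_measurable lborel \<and>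
     (\<exists>N::nat. integrable lborel (\<lambda>z. norm (u z) / (1 + norm z) ^ N)) \<and>
     (\<exists>f. Lp q f \<and> (\<forall>\<phi>. schwartz \<phi> \<longrightarrow>
         (\<integral>z. u z * PD m \<phi> z \<partial>lborel) = (\<integral>z. f z * \<phi> z \<partial>lborel)))"

text \<open>u solves i d_t u - D_x^{2m} u = V u in the sense of distributions,
  where D_x = -i d_x, so D_x^{2m} = (-1)^m d_x^{2m}.\<close>
definition solves :: "nat \<Rightarrow> (R2 \<Rightarrow> complex) \<Rightarrow> (R2 \<Rightarrow> complex) \<Rightarrow> bool" where
  "solves m V u \<longleftrightarrow> (\<forall>\<phi>. test_fun \<phi> \<longrightarrow>
     integrable lborel (\<lambda>z. V z * u z * \<phi> z) \<and>
     (\<integral>z. u z * (- \<i> * dT \<phi> z - (-1) ^ m * (dX ^^ (2 * m)) \<phi> z) \<partial>lborel)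
       = (\<integral>z. V z * u z * \<phi> z \<partial>lborel))"

end

theory Submission
  imports Defs "HOL-Probability.Probability" "HOL-Computational_Algebra.Polynomial"
begin

text \<open>Write \<open>q = (4m+2)/(4m+1)\<close> and let \<open>p = 4m+2\<close> be its dual exponent, so that \<open>1/q = 2m/(2m+1) + 1/p\<close>.
The core is a Carleman estimate that is uniform in the weight: conjugating the equation with
\<open>exp (a t + b x)\<close> gives a constant coefficient operator whose parametrix consists of the
propagators \<open>exp (s (i (\<xi> - i b)^(2m) - a))\<close>, cut off in frequency according to the sign of the real part
of the exponent and used forward or backward in time. Van der Corput's lemma gives the dispersive
decay \<open>|s|^(-1/(2m))\<close> uniformly in a and b; interpolating it with the L2 bound and
applying Hardy--Littlewood--Sobolev in time yields the weighted norm of u in Lp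
bounded by that of Vu in Lq, with a constant independent of a and b.

Membership in W^q puts u into Lp and Lq, because the kernel of the inverse symbol is dominated by
\<open>|t|^(-k) |x|^(-k)\<close> with \<open>k = 1/(2m+1)\<close> and is integrable; testing against Gaussians
makes this rigorous. If u vanishes for \<open>z \<bullet> v > c\<close>, take the weight
\<open>exp (l (z \<bullet> v))\<close>: by Hoelder's inequality the contribution of a strip
\<open>c - d < z \<bullet> v \<le> c\<close> on which V has small norm is absorbed, and letting l tend to infinity shows
that u vanishes on a larger half plane. The infimum of all admissible c is therefore minus infinity.\<close>

text \<open>The exponent \<open>ka = 1/(2m+1)\<close> is forced by (1 - ka)/(2m) = ka: interpolation
  at the exponent q weakens the dispersive rate 1/(2m) to (1 - ka)/(2m), and
  Hardy-Littlewood-Sobolev from L^q to L^p in time needs exactly the power ka. The constants ignore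
  the weight because it enters only the lower coefficients of a polynomial of degree 2m: the leading
  coefficient drives the oscillation, and the degree bounds how often the damping changes sign or
  monotonicity. The main obstacle is that u is only a weak solution. The parametrix must be smoothed
  and cut off to serve as a test function, but its L2 norm in x is controlled only uniformly in
  time; the commutators with the cutoff vanish in the limit because the weighted u lies in L2. Hence
  u is needed in L^q as well as in L^p, with q < 2 < p. All smoothing uses Gaussians: their products
  with polynomials are stable under differentiation, their transforms are explicit, and they are
  removed at the end without loss in the constants.\<close>

abbreviation nn_lborel :: "('a::euclidean_space => ennreal) => ennreal" (binder "NINT " [60] 60)
 where "nn_lborel f \<equiv> nn_integral lborel f"

abbreviation "bmeas \<equiv> borel_measurable borel"

abbreviation "intble \<equiv> integrable lborel"

abbreviation "cor \<equiv> complex_of_real"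

section \<open>One-dimensional Hardy-Littlewood-Sobolev inequality\<close>

lemma nn_integral_even_cong_2:
 fixes f :: "real => ennreal"
 assumes [measurable]: "f \<in> bmeas" and even: "!!x. f (- x) = f x"
 shows "(NINT x. f x) = 2 * (NINT x. f x * indicator {0..} x)"
proof -
 have "(NINT x. f x) = (NINT x. f x * indicator {0..} x + f x * indicator {..<0} x)"
  by (intro nn_integral_cong) (auto simp: indicator_def)
 also have "... = (NINT x. f x * indicator {0..} x) + (NINT x. f x * indicator {..<0} x)"
  by (rule nn_integral_add) auto
 also have "(NINT x. f x * indicator {..<0} x)
   = (NINT x. f x * indicator {..<0} (- x))"
  by (subst nn_integral_real_affine[where c="-1" and t=0]) (auto simp: even)
 also have "... = (NINT x. f x * indicator {0..} x)"
  by (rule nn_integral_cong_AE, rule AE_I[where N="{0}"]) (auto simp: indicator_def split: if_splits)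
 finally show ?thesis by (simp add: mult_2)
qed

lemma nn_integral_abs_powr_near:
 fixes e l :: real
 assumes e: "0 < e" "e < 1" and l: "l > 0"
 shows "(NINT x. ennreal (\<bar>x\<bar> powr - e) * indicator {x. \<bar>x\<bar> <= l} x)
  = ennreal (2 * l powr (1 - e) / (1 - e))"
proof -
 have "((%x. x powr - e) has_integral (l powr (- e + 1) / (- e + 1))) {0..l}"
  using e l by (intro has_integral_powr_from_0) auto
 hence "(NINT x. ennreal (x powr - e) * indicator {0..l} x) = ennreal (l powr (1 - e) / (1 - e))"
  by (subst nn_integral_has_integral_lebesgue') auto
 moreover have "(NINT x. ennreal (\<bar>x\<bar> powr - e) * indicator {x. \<bar>x\<bar> <= l} x * indicator {0..} x)
  = (NINT x. ennreal (x powr - e) * indicator {0..l} x)"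
  by (intro nn_integral_cong) (auto simp: indicator_def)
 moreover have "(2::ennreal) * ennreal (l powr (1 - e) / (1 - e)) = ennreal (2 * l powr (1 - e) / (1 - e))"
  using e by (subst ennreal_numeral[symmetric], subst ennreal_mult[symmetric]) auto
 ultimately show ?thesis using e l
  by (subst nn_integral_even_cong_2) (auto simp: indicator_def)
qed

lemma nn_integral_inverse_square_far:
 fixes l :: real
 assumes l: "l > 0"
 shows "(NINT x. ennreal (\<bar>x\<bar> powr - 2) * indicator {x. l < \<bar>x\<bar>} x) <= ennreal (2 / l)"
proof -
 have "((%x. x powr - 2) has_integral -(l powr (- 2 + 1)) / (- 2 + 1)) {l..}"
  using l by (intro has_integral_powr_to_inf) auto
 hence *: "(NINT x. ennreal (x powr - 2) * indicator {l..} x) = ennreal (1 / l)"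
  using l by (subst nn_integral_has_integral_lebesgue') (auto simp: powr_minus field_simps)
 have "(NINT x. ennreal (\<bar>x\<bar> powr - 2) * indicator {x. l < \<bar>x\<bar>} x)
  = 2 * (NINT x. ennreal (\<bar>x\<bar> powr - 2) * indicator {x. l < \<bar>x\<bar>} x * indicator {0..} x)"
  by (subst nn_integral_even_cong_2) (auto simp: indicator_def)
 also have "... <= 2 * (NINT x. ennreal (x powr - 2) * indicator {l..} x)"
  by (intro mult_left_mono nn_integral_mono) (auto simp: indicator_def)
 also have "... = ennreal (2 / l)"
  using l unfolding * by (subst ennreal_numeral[symmetric], subst ennreal_mult[symmetric]) auto
 finally show ?thesis .
qed

lemma nn_integral_shift_real:
 fixes f :: "real => ennreal"
 assumes [measurable]: "f \<in> bmeas"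
 shows "(NINT x. f (x - c)) = (NINT x. f x)"
 by (subst (2) nn_integral_real_affine[where c=1 and t="-c"]) (auto simp: algebra_simps)

lemma nn_integral_reflect_real:
 fixes f :: "real => ennreal"
 assumes [measurable]: "f \<in> bmeas"
 shows "(NINT x. f (c - x)) = (NINT x. f x)"
 by (subst (2) nn_integral_real_affine[where c="-1" and t=c]) (auto simp: algebra_simps)

text \<open>Where g is dominated by the value F of f, the near part of the kernel is bounded
  using g \<le> F and the far part by Young's inequality; the radius F powr (-q) balances the two.\<close>
lemma HLS_inner:
 fixes g :: "real => real" and ka q F s :: real
 assumes [measurable]: "g \<in> bmeas" and g0: "!!t. g t >= 0"
  and k: "0 < ka" "ka < 1" and q: "q = 2 / (2 - ka)"
  and F: "F >= 0"
 shows "(NINT t. ennreal (F * g t * \<bar>s - t\<bar> powr - ka) * indicator {t. g t <= F} t)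
  <= ennreal (F powr q) * (ennreal (2 / (1 - ka) + 2) + (NINT t. ennreal (g t powr q)))"
proof (cases "F = 0")
 case True thus ?thesis by simp
next
 case False
 with F have F: "F > 0" by simp
 define l where "l = F powr - q"
 have l: "l > 0" using F by (simp add: l_def)
 have q1: "q > 1" using k by (simp add: q field_simps)
 \<comment> \<open>The conjugate exponent of q. Since ka * q' = 2, the power q' of the kernel is the
   inverse square, integrable away from 0.\<close>
 define q' where "q' = 2 / ka"
 have q'1: "q' > 1" using k by (simp add: q'_def field_simps)
 have conj: "1 / q + 1 / q' = 1" using k by (simp add: q q'_def field_simps)
 have eq: "(q - 1) / q * q' = 1" using k by (simp add: q q'_def field_simps)
 let ?A = "%t. ennreal (F powr 2) * (ennreal (\<bar>t - s\<bar> powr - ka) * indicator {x. \<bar>x\<bar> <= l} (t - s))"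
 let ?B = "%t. ennreal (F powr q) * ennreal (g t powr q)"
 let ?D = "%t. ennreal (\<bar>t - s\<bar> powr - 2) * indicator {x. l < \<bar>x\<bar>} (t - s)"
 have pt: "ennreal (F * g t * \<bar>s - t\<bar> powr - ka) * indicator {t. g t <= F} t <= ?A t + (?B t + ?D t)" for t
 proof (cases "g t <= F")
  case gF: True
  show ?thesis
  proof (cases "\<bar>t - s\<bar> <= l")
   case True
   have "F * g t * \<bar>s - t\<bar> powr - ka <= F powr 2 * \<bar>t - s\<bar> powr - ka"
    using F gF by (simp add: power2_eq_square abs_minus_commute mult_right_mono)
   hence "ennreal (F * g t * \<bar>s - t\<bar> powr - ka) <= ?A t"
    using True F by (simp add: indicator_def flip: ennreal_mult')
   also have "... <= ?A t + (?B t + ?D t)" by simp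
   finally show ?thesis using gF by simp
  next
   case far: False
   define \<rho> where "\<rho> = \<bar>s - t\<bar> powr - ka"
   \<comment> \<open>The inserted powers of F cancel in the product. They are chosen so that
     multiplying by F afterwards leaves \<open>F powr q * g t powr q\<close> and a kernel term free
     of F.\<close>
   have "g t * \<rho> = (g t * F powr ((q - 1) / q)) * (\<rho> * F powr (- ((q - 1) / q)))"
    using F by (simp add: powr_minus field_simps)
   also have "... <= (g t * F powr ((q - 1) / q)) powr q / q + (\<rho> * F powr (- ((q - 1) / q))) powr q' / q'"
    using g0 by (intro Youngs_inequality q1 q'1 conj) (auto simp: \<rho>_def)
   also have "... <= (g t * F powr ((q - 1) / q)) powr q + (\<rho> * F powr (- ((q - 1) / q))) powr q'"
    using q1 q'1 divide_left_mono[of 1 q] divide_left_mono[of 1 q'] by (intro add_mono) auto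
   also have "(g t * F powr ((q - 1) / q)) powr q = g t powr q * F powr (q - 1)"
    using q1 by (simp add: powr_mult powr_powr)
   also have "(\<rho> * F powr (- ((q - 1) / q))) powr q' = \<rho> powr q' * F powr - 1"
    using eq F by (simp add: powr_mult powr_powr)
   also have "\<rho> powr q' = \<bar>t - s\<bar> powr - 2"
    using k by (simp add: \<rho>_def powr_powr q'_def abs_minus_commute)
   finally have "F * (g t * \<rho>) <= F * (g t powr q * F powr (q - 1) + \<bar>t - s\<bar> powr - 2 * F powr - 1)"
    using F by (intro mult_left_mono) auto
   also have "... = F powr q * g t powr q + \<bar>t - s\<bar> powr - 2"
    using F by (simp add: algebra_simps powr_minus powr_diff)
   finally have "ennreal (F * g t * \<bar>s - t\<bar> powr - ka) <= ?B t + ?D t"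
    using far by (simp add: indicator_def \<rho>_def mult.assoc flip: ennreal_mult' ennreal_plus)
   also have "... <= ?A t + (?B t + ?D t)" by simp
   finally show ?thesis using gF by simp
  qed
 qed simp
 have "(NINT t. ennreal (F * g t * \<bar>s - t\<bar> powr - ka) * indicator {t. g t <= F} t)
   <= (NINT t. ?A t + (?B t + ?D t))"
  by (intro nn_integral_mono pt)
 also have "... = (NINT t. ?A t) + ((NINT t. ?B t) + (NINT t. ?D t))"
  by (simp add: nn_integral_add)
 also have "(NINT t. ?A t) = ennreal (F powr 2) * ennreal (2 * l powr (1 - ka) / (1 - ka))"
  using nn_integral_abs_powr_near[OF k l]
   nn_integral_shift_real[of "%x. ennreal (\<bar>x\<bar> powr - ka) * indicator {x. \<bar>x\<bar> <= l} x" s]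
  by (subst nn_integral_cmult) auto
 also have "... = ennreal (F powr q * (2 / (1 - ka)))"
 proof -
  have "F powr 2 * l powr (1 - ka) = F powr (2 - q * (1 - ka))"
   by (simp add: l_def powr_powr flip: powr_add)
  also have "2 - q * (1 - ka) = q" using k by (simp add: q field_simps)
  finally show ?thesis using k by (simp add: field_simps flip: ennreal_mult')
 qed
 also have "(NINT t. ?B t) = ennreal (F powr q) * (NINT t. ennreal (g t powr q))"
  by (rule nn_integral_cmult) simp
 also have "(NINT t. ?D t) <= ennreal (2 / l)"
  using nn_integral_inverse_square_far[OF l]
   nn_integral_shift_real[of "%x. ennreal (\<bar>x\<bar> powr - 2) * indicator {x. l < \<bar>x\<bar>} x" s] by auto
 also have "2 / l = F powr q * 2" by (simp add: l_def powr_minus field_simps)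
 also have "ennreal (F powr q * (2 / (1 - ka))) +
    (ennreal (F powr q) * (NINT t. ennreal (g t powr q)) + ennreal (F powr q * 2))
  = ennreal (F powr q) * (ennreal (2 / (1 - ka) + 2) + (NINT t. ennreal (g t powr q)))"
 proof -
  have "ennreal (2 / (1 - ka) + 2) = ennreal (2 / (1 - ka)) + ennreal 2"
   using k by (intro ennreal_plus) auto
  thus ?thesis
   by (simp only: ennreal_mult'[OF powr_ge_zero] distrib_left add_ac)
 qed
 finally show ?thesis by (simp add: add_mono)
qed

text \<open>Each pair (s, t) is charged to the larger of \<open>f s\<close> and \<open>g t\<close>.
  Where \<open>f s\<close> dominates, \<open>HLS_inner\<close> applies with F = f s for every s; the
  other part is the same after exchanging the order of integration. Each part costs
  \<open>2 / (1 - ka) + 3\<close>, where 1 of the 3 is the normalised integral.\<close>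

lemma HLS_normalised:
 fixes f g :: "real => real" and ka q :: real
 assumes [measurable]: "f \<in> bmeas" "g \<in> bmeas"
  and f0: "!!t. f t >= 0" and g0: "!!t. g t >= 0"
  and k: "0 < ka" "ka < 1" and q: "q = 2 / (2 - ka)"
  and fn: "(NINT t. ennreal (f t powr q)) <= 1"
  and gn: "(NINT t. ennreal (g t powr q)) <= 1"
 shows "(NINT s. NINT t. ennreal (f s * g t * \<bar>s - t\<bar> powr - ka)) <= ennreal (4 / (1 - ka) + 6)"
proof -
 let ?C = "ennreal (2 / (1 - ka) + 3)"
 have half: "(NINT s. NINT t. ennreal (f s * g t * \<bar>s - t\<bar> powr - ka) * indicator {t. g t <= f s} t) <= ?C"
  if [measurable]: "f \<in> bmeas" "g \<in> bmeas"
  and f0: "!!t. f t >= 0" and g0: "!!t. g t >= 0"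
  and fn: "(NINT t. ennreal (f t powr q)) <= 1"
  and gn: "(NINT t. ennreal (g t powr q)) <= 1" for f g :: "real => real"
 proof -
  have "(NINT s. NINT t. ennreal (f s * g t * \<bar>s - t\<bar> powr - ka) * indicator {t. g t <= f s} t)
   <= (NINT s. ennreal (f s powr q) * ?C)"
  proof (rule nn_integral_mono)
   fix s
   have "(NINT t. ennreal (f s * g t * \<bar>s - t\<bar> powr - ka) * indicator {t. g t <= f s} t)
    <= ennreal (f s powr q) * (ennreal (2 / (1 - ka) + 2) + (NINT t. ennreal (g t powr q)))"
    by (rule HLS_inner) (use that k q in auto)
   also have "... <= ennreal (f s powr q) * (ennreal (2 / (1 - ka) + 2) + 1)"
    using gn by (intro mult_left_mono add_mono) auto
   also have "ennreal (2 / (1 - ka) + 2) + 1 = ?C"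
    using k by (simp flip: ennreal_1 ennreal_plus)
   finally show "(NINT t. ennreal (f s * g t * \<bar>s - t\<bar> powr - ka) * indicator {t. g t <= f s} t)
    <= ennreal (f s powr q) * ?C" .
  qed
  also have "... = (NINT s. ennreal (f s powr q)) * ?C"
   by (rule nn_integral_multc) simp
  also have "... <= 1 * ?C" using fn by (intro mult_right_mono) auto
  finally show ?thesis by simp
 qed
 have "(NINT s. NINT t. ennreal (f s * g t * \<bar>s - t\<bar> powr - ka))
  <= (NINT s. NINT t. ennreal (f s * g t * \<bar>s - t\<bar> powr - ka) * indicator {t. g t <= f s} t +
     ennreal (g t * f s * \<bar>t - s\<bar> powr - ka) * indicator {s. f s <= g t} s)"
  by (intro nn_integral_mono) (auto simp: indicator_def abs_minus_commute mult.commute)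
 also have "... = (NINT s. NINT t. ennreal (f s * g t * \<bar>s - t\<bar> powr - ka) * indicator {t. g t <= f s} t)
  + (NINT s. NINT t. ennreal (g t * f s * \<bar>t - s\<bar> powr - ka) * indicator {s. f s <= g t} s)"
  by (simp add: nn_integral_add)
 also have "(NINT s. NINT t. ennreal (g t * f s * \<bar>t - s\<bar> powr - ka) * indicator {s. f s <= g t} s)
  = (NINT t. NINT s. ennreal (g t * f s * \<bar>t - s\<bar> powr - ka) * indicator {s. f s <= g t} s)"
  by (rule lborel_pair.Fubini') (simp add: indicator_def)
 also have "(NINT s. NINT t. ennreal (f s * g t * \<bar>s - t\<bar> powr - ka) * indicator {t. g t <= f s} t)
  + ... <= ?C + ?C"
  by (intro add_mono half) (use assms in auto)
 also have "... = ennreal (4 / (1 - ka) + 6)" using k by (simp flip: ennreal_plus)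
 finally show ?thesis .
qed

lemma nn_integral_eq_0_powr:
 fixes f :: "'a => real"
 assumes [measurable]: "f \<in> borel_measurable M" and "(\<integral>\<^sup>+t. ennreal (\<bar>f t\<bar> powr q) \<partial>M) = 0"
 shows "AE t in M. f t = 0"
proof -
 have "AE t in M. ennreal (\<bar>f t\<bar> powr q) = 0"
  using assms by (subst (asm) nn_integral_0_iff_AE) auto
 thus ?thesis by eventually_elim (auto simp: ennreal_eq_0_iff)
qed

text \<open>By homogeneity f and g can be divided by their norms. A vanishing norm is treated apart,
  since the function is then 0 almost everywhere.\<close>

lemma HLS:
 fixes f g :: "real => real" and ka q a b :: real
 assumes [measurable]: "f \<in> bmeas" "g \<in> bmeas"
  and f0: "!!t. f t >= 0" and g0: "!!t. g t >= 0"
  and k: "0 < ka" "ka < 1" and q: "q = 2 / (2 - ka)"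
  and ab: "0 <= a" "0 <= b"
  and fn: "(NINT t. ennreal (f t powr q)) = ennreal a"
  and gn: "(NINT t. ennreal (g t powr q)) = ennreal b"
 shows "(NINT s. NINT t. ennreal (f s * g t * \<bar>s - t\<bar> powr - ka))
  <= ennreal ((4 / (1 - ka) + 6) * (a powr (1/q) * b powr (1/q)))"
proof -
 have q1: "q > 1" using k by (simp add: q field_simps)
 consider "a = 0" | "b = 0" | "a > 0" "b > 0" using ab by linarith
 thus ?thesis
 proof cases
  case 1
  hence "AE t in lborel. f t = 0"
   using nn_integral_eq_0_powr[of f lborel q] fn f0 by simp
  hence "AE s in lborel. (NINT t. ennreal (f s * g t * \<bar>s - t\<bar> powr - ka)) = 0"
   by eventually_elim simp
  hence "(NINT s. NINT t. ennreal (f s * g t * \<bar>s - t\<bar> powr - ka)) = 0"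
   by (subst nn_integral_0_iff_AE) auto
  thus ?thesis by simp
 next
  case 2
  hence "AE t in lborel. g t = 0"
   using nn_integral_eq_0_powr[of g lborel q] gn g0 by simp
  hence "(NINT t. ennreal (f s * g t * \<bar>s - t\<bar> powr - ka)) = 0" for s
   by (subst nn_integral_0_iff_AE) (auto elim: eventually_mono)
  thus ?thesis by simp
 next
  case 3
  have norm: "(NINT t. ennreal ((h t / c powr (1/q)) powr q)) <= 1"
   if [measurable]: "h \<in> bmeas" and "!!t. h t >= 0" and c: "c > 0"
    and "(NINT t. ennreal (h t powr q)) = ennreal c" for h :: "real => real" and c
  proof -
   have "(NINT t. ennreal ((h t / c powr (1/q)) powr q)) = (NINT t. ennreal (h t powr q) * ennreal (1 / c))"
    using that q1 by (intro nn_integral_cong) (simp add: powr_divide powr_powr flip: ennreal_mult')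
   also have "... = ennreal c * ennreal (1 / c)"
    using that by (subst nn_integral_multc) auto
   also have "... = 1" using c by (simp flip: ennreal_mult')
   finally show ?thesis by simp
  qed
  let ?A = "a powr (1/q)" let ?B = "b powr (1/q)"
  have AB: "?A > 0" "?B > 0" using 3 by auto
  have "(NINT s. NINT t. ennreal (f s * g t * \<bar>s - t\<bar> powr - ka))
   = (NINT s. NINT t. ennreal (?A * ?B) * ennreal ((f s / ?A) * (g t / ?B) * \<bar>s - t\<bar> powr - ka))"
   using AB by (intro nn_integral_cong) (simp flip: ennreal_mult')
  also have "... = ennreal (?A * ?B) * (NINT s. NINT t. ennreal ((f s / ?A) * (g t / ?B) * \<bar>s - t\<bar> powr - ka))"
   by (simp add: nn_integral_cmult)
  also have "... <= ennreal (?A * ?B) * ennreal (4 / (1 - ka) + 6)"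
   using AB f0 g0 3 by (intro mult_left_mono HLS_normalised[OF _ _ _ _ k q] norm fn gn) auto
  also have "... = ennreal ((4 / (1 - ka) + 6) * (?A * ?B))"
   using AB by (subst ennreal_mult'[symmetric]) (auto simp: mult.commute)
  finally show ?thesis .
 qed
qed

section \<open>Fourier integrals on the line and a Bessel inequality\<close>

lemma cis_measurable [measurable]: "cis \<in> bmeas"
 by (intro borel_measurable_continuous_onI continuous_intros)

lemma cnj_measurable [measurable]: "cnj \<in> bmeas"
 by (intro borel_measurable_continuous_onI continuous_intros)

text \<open>No integrability is assumed: a non-integrable function has Bochner integral 0, which
  satisfies the bound. Later estimates can therefore be carried out in \<open>ennreal\<close> before
  integrability is known.\<close>

lemma norm_integral_le_nn_integral:
 fixes f :: "'a => 'b::{banach, second_countable_topology}"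
 shows "ennreal (norm (integral\<^sup>L M f)) <= (\<integral>\<^sup>+x. ennreal (norm (f x)) \<partial>M)"
 by (cases "integrable M f") (auto simp: integral_norm_bound_ennreal not_integrable_integral_eq)

lemma fst_borel_measurable [measurable]:
 "(fst :: 'a::euclidean_space \<times> 'b::euclidean_space => 'a) \<in> bmeas"
 by (intro borel_measurable_continuous_onI continuous_intros)

lemma snd_borel_measurable [measurable]:
 "(snd :: 'a::euclidean_space \<times> 'b::euclidean_space => 'b) \<in> bmeas"
 by (intro borel_measurable_continuous_onI continuous_intros)

lemma integrable_prod_dominated:
 fixes F :: "'a::euclidean_space \<times> 'b::euclidean_space => 'c::{banach, second_countable_topology}"
  and f :: "'a => 'd::{banach, second_countable_topology}" and h :: "'b => 'e::{banach, second_countable_topology}"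
 assumes f: "intble f" and h: "intble h" and [measurable]: "F \<in> bmeas"
  and le: "!!x y. norm (F (x, y)) <= norm (f x) * norm (h y)"
 shows "intble F"
proof -
 have [measurable]: "f \<in> bmeas" "h \<in> bmeas"
  using f h by auto
 have "(NINT z. ennreal (norm (F z))) <= (NINT z. ennreal (norm (f (fst z))) * ennreal (norm (h (snd z))))"
  using le by (intro nn_integral_mono) (auto simp flip: ennreal_mult' intro!: ennreal_leI)
 also have "... = (NINT x. NINT y. ennreal (norm (f x)) * ennreal (norm (h y)))"
  by (subst lborel_prod[symmetric], subst lborel.nn_integral_fst[symmetric]) (auto simp: case_prod_beta)
 also have "... = (NINT x. ennreal (norm (f x))) * (NINT y. ennreal (norm (h y)))"
  by (simp add: nn_integral_cmult nn_integral_multc)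
 also have "... < \<infinity>"
  using f h by (auto simp: integrable_iff_bounded ennreal_mult_less_top)
 finally show ?thesis by (simp add: integrable_iff_bounded)
qed

lemma fourier_swap:
 fixes f h :: "real => complex"
 assumes f: "intble f" and h: "intble h"
 shows "(LBINT x. f x * (LBINT ks. h ks * cis (x * ks))) = (LBINT ks. h ks * (LBINT x. f x * cis (x * ks)))"
proof -
 have [measurable]: "f \<in> bmeas" "h \<in> bmeas"
  using f h by auto
 have "intble (%(x, ks). f x * h ks * cis (x * ks))"
  by (rule integrable_prod_dominated[OF f h]) (auto simp: norm_mult split_beta')
 hence "integrable (lborel \<Otimes>\<^sub>M lborel) (%(x, ks). f x * h ks * cis (x * ks))"
  by (simp add: lborel_prod)
 from lborel_pair.Fubini_integral[OF this]
 have "(LBINT ks. LBINT x. h ks * (f x * cis (x * ks))) = (LBINT x. LBINT ks. f x * (h ks * cis (x * ks)))"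
  by (simp add: mult_ac)
 thus ?thesis by simp
qed

lemma integrable_cis_mult [simp]:
 fixes f :: "real => complex"
 assumes f: "intble f"
 shows "intble (%x. f x * cis (x * ks))"
 by (rule Bochner_Integration.integrable_bound[OF f]) (use f in \<open>auto simp: norm_mult\<close>)

text \<open>Parseval's identity in bilinear form: a double integral against the kernel of k becomes
  one integral over frequency. It results from \<open>fourier_swap\<close> used twice, the inner
  time after reflecting g because its phase has the opposite sign.\<close>

lemma fourier_bilinear:
 fixes f g k :: "real => complex"
 assumes f: "intble f" and g: "intble g" and k: "intble k"
 shows "(LBINT x. f x * (LBINT y. g y * (LBINT ks. k ks * cis ((x - y) * ks))))
  = (LBINT ks. k ks * (LBINT y. g y * cis (- y * ks)) * (LBINT x. f x * cis (x * ks)))"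
proof -
 have [measurable]: "f \<in> bmeas" "g \<in> bmeas" "k \<in> bmeas"
  using f g k by auto
 have g': "intble (%y. g (- y))"
  using lborel_integrable_real_affine[OF g, of "-1" 0] by simp
 let ?G = "%ks. (LBINT y. g y * cis (- y * ks))"
 have flip: "(LBINT y. g (- y) * h (- y)) = (LBINT y. g y * h y)" for h :: "real => complex"
  using lborel_integral_real_affine[of "-1" "%y. g y * h y" 0] by simp
 have kx: "intble (%ks. k ks * cis (x * ks))" for x
  using integrable_cis_mult[OF k, of x] by (simp add: mult.commute)
 have 1: "(LBINT y. g y * (LBINT ks. k ks * cis ((x - y) * ks))) = (LBINT ks. (k ks * ?G ks) * cis (x * ks))" for x
 proof -
  have "(LBINT y. g y * (LBINT ks. k ks * cis ((x - y) * ks)))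
   = (LBINT y. g (- y) * (LBINT ks. k ks * cis (x * ks) * cis (y * ks)))"
   by (subst flip[symmetric]) (simp add: cis_mult algebra_simps)
  also have "... = (LBINT ks. k ks * cis (x * ks) * (LBINT y. g (- y) * cis (y * ks)))"
   by (rule fourier_swap[OF g' kx])
  also have "... = (LBINT ks. (k ks * ?G ks) * cis (x * ks))"
  proof (intro Bochner_Integration.integral_cong refl)
   fix ks
   show "k ks * cis (x * ks) * (LBINT y. g (- y) * cis (y * ks)) = (k ks * ?G ks) * cis (x * ks)"
    using flip[of "%y. cis (- y * ks)"] by simp
  qed
  finally show ?thesis .
 qed
 have Gb: "norm (?G ks) <= (LBINT y. norm (g y))" for ks
  using integral_norm_bound[of lborel "%y. g y * cis (- y * ks)"] by (simp add: norm_mult)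
 have kG: "intble (%ks. k ks * ?G ks)"
 proof (rule Bochner_Integration.integrable_bound)
  show "intble (%ks. k ks * cor (LBINT y. norm (g y)))" using k by simp
  show "AE ks in lborel. norm (k ks * ?G ks) <= norm (k ks * cor (LBINT y. norm (g y)))"
   using Gb by (auto simp: norm_mult intro!: mult_left_mono order_trans[OF Gb])
 qed simp
 show ?thesis unfolding 1 by (rule fourier_swap[OF f kG])
qed

text \<open>The characteristic function of the standard normal distribution, rescaled by 1 / sqrt
  d.\<close>

lemma gaussian_fourier:
 fixes x d :: real
 assumes d: "d > 0"
 shows "intble (%ks. cor (exp (- d * ks\<^sup>2 / 2)))"
  and "(LBINT ks. cor (exp (- d * ks\<^sup>2 / 2)) * cis (x * ks)) = cor (sqrt (2 * pi / d) * exp (- x\<^sup>2 / (2 * d)))"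
proof -
 let ?s = "1 / sqrt d"
 have s: "?s ~= 0" "?s > 0" using d by auto
 have eq: "exp (- d * (0 + ?s * y)\<^sup>2 / 2) = sqrt (2 * pi) * std_normal_density y" for y
  using d by (simp add: std_normal_density_def power_mult_distrib power_divide)
 have "intble (%y. cor (sqrt (2 * pi) * std_normal_density y))"
  by (intro integrable_of_real) simp
 hence "intble (%y. cor (exp (- d * (0 + ?s * y)\<^sup>2 / 2)))"
  unfolding eq .
 thus "intble (%ks. cor (exp (- d * ks\<^sup>2 / 2)))"
  by (subst (asm) lborel_integrable_real_affine_iff[OF s(1), where f="%ks. cor (exp (- d * ks\<^sup>2 / 2))"])
 have char: "(LBINT y. cor (std_normal_density y) * cis (t * y)) = cor (exp (- t\<^sup>2 / 2))" for t
  using fun_cong[OF char_std_normal_distribution, of t] unfolding char_def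
  by (subst (asm) integral_density) (auto simp: normal_density_nonneg scaleR_conv_of_real cis_conv_exp)
 have "(LBINT ks. cor (exp (- d * ks\<^sup>2 / 2)) * cis (x * ks))
  = \<bar>?s\<bar> *\<^sub>R (LBINT y. cor (exp (- d * (0 + ?s * y)\<^sup>2 / 2)) * cis (x * (0 + ?s * y)))"
  by (rule lborel_integral_real_affine[OF s(1)])
 also have "... = cor (?s * sqrt (2 * pi)) * (LBINT y. cor (std_normal_density y) * cis (x * ?s * y))"
  unfolding eq using s by (simp add: scaleR_conv_of_real mult.assoc)
 also have "... = cor (sqrt (2 * pi / d) * exp (- x\<^sup>2 / (2 * d)))"
  unfolding char using d by (simp add: real_sqrt_divide power_divide)
 finally show "(LBINT ks. cor (exp (- d * ks\<^sup>2 / 2)) * cis (x * ks)) = cor (sqrt (2 * pi / d) * exp (- x\<^sup>2 / (2 * d)))" .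
qed

lemma nn_integral_gaussian:
 fixes d :: real assumes d: "d > 0"
 shows "(NINT x. ennreal (sqrt (2 * pi / d) * exp (- x\<^sup>2 / (2 * d)))) = ennreal (2 * pi)"
proof -
 have "(NINT x. ennreal (normal_density 0 (sqrt d) x)) = 1"
  using d integral_normal_density[of "sqrt d" 0] by (subst nn_integral_eq_integral) auto
 moreover have "ennreal (sqrt (2 * pi / d) * exp (- x\<^sup>2 / (2 * d))) = ennreal (2 * pi) * ennreal (normal_density 0 (sqrt d) x)" for x
 proof -
  have "sqrt (2 * pi / d) = 2 * pi * (1 / sqrt (2 * pi * d))"
   using d by (simp add: real_sqrt_divide real_sqrt_mult field_simps)
  thus ?thesis using d by (simp add: normal_density_def flip: ennreal_mult')
 qed
 ultimately show ?thesis by (simp add: nn_integral_cmult)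
qed

text \<open>Only this inequality of Plancherel's theorem is needed; it follows by inserting a Gaussian
  in frequency, which turns the left-hand side into a quadratic form with a kernel of mass 2 pi.\<close>
lemma bessel_inequality:
 fixes f :: "real => complex"
 assumes f: "intble f"
 shows "(NINT ks. ennreal ((norm (LBINT x. f x * cis (x * ks)))\<^sup>2)) <= ennreal (2 * pi) * (NINT x. ennreal ((norm (f x))\<^sup>2))"
proof -
 have [measurable]: "f \<in> bmeas" using f by auto
 define F where "F ks = (LBINT x. f x * cis (x * ks))" for ks
 have [measurable]: "F \<in> bmeas" unfolding F_def by measurable
 let ?S = "(NINT x. ennreal ((norm (f x))\<^sup>2))"
 have Fb: "norm (F ks) <= (LBINT y. norm (f y))" for ks
  using integral_norm_bound[of lborel "%y. f y * cis (y * ks)"] by (simp add: norm_mult F_def)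
 have main: "(NINT ks. ennreal ((norm (F ks))\<^sup>2 * exp (- d * ks\<^sup>2 / 2))) <= ennreal (2 * pi) * ?S" if d: "d > 0" for d :: real
 proof -
  let ?e = "%ks. exp (- d * ks\<^sup>2 / 2)"
  let ?g = "%x. sqrt (2 * pi / d) * exp (- x\<^sup>2 / (2 * d))"
  have cf: "intble (%x. cnj (f x))" using f by simp
  have cF: "(LBINT y. cnj (f y) * cis (- y * ks)) = cnj (F ks)" for ks
  proof -
   have "cnj (F ks) = (LBINT y. cnj (f y * cis (y * ks)))"
    unfolding F_def by (rule Bochner_Integration.integral_cnj[symmetric])
   thus ?thesis by (simp add: cis_cnj)
  qed
  have intb: "intble (%ks. (norm (F ks))\<^sup>2 * ?e ks)"
  proof (rule Bochner_Integration.integrable_bound)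
   show "intble (%ks. cor (?e ks) * cor ((LBINT y. norm (f y))\<^sup>2))"
    using gaussian_fourier(1)[OF d] by simp
   show "AE ks in lborel. norm ((norm (F ks))\<^sup>2 * ?e ks) <= norm (cor (?e ks) * cor ((LBINT y. norm (f y))\<^sup>2))"
    using Fb by (auto simp: norm_mult norm_power mult.commute intro!: mult_left_mono power_mono order_trans[OF Fb])
  qed simp
  have "cor (LBINT ks. (norm (F ks))\<^sup>2 * ?e ks) = (LBINT ks. cor (?e ks) * cnj (F ks) * F ks)"
   by (subst integral_complex_of_real[symmetric], intro Bochner_Integration.integral_cong)
    (simp_all del: of_real_power add: complex_norm_square mult_ac)
  also have "... = (LBINT x. f x * (LBINT y. cnj (f y) * (LBINT ks. cor (?e ks) * cis ((x - y) * ks))))"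
   unfolding fourier_bilinear[OF f cf gaussian_fourier(1)[OF d]] cF F_def ..
  also have "... = (LBINT x. f x * (LBINT y. cnj (f y) * cor (?g (x - y))))"
   unfolding gaussian_fourier(2)[OF d] ..
  finally have eq: "cor (LBINT ks. (norm (F ks))\<^sup>2 * ?e ks) = (LBINT x. f x * (LBINT y. cnj (f y) * cor (?g (x - y))))" .
  have "(NINT ks. ennreal ((norm (F ks))\<^sup>2 * ?e ks)) = ennreal (LBINT ks. (norm (F ks))\<^sup>2 * ?e ks)"
   by (rule nn_integral_eq_integral[OF intb]) auto
  also have "... <= ennreal (norm (LBINT x. f x * (LBINT y. cnj (f y) * cor (?g (x - y)))))"
   unfolding eq[symmetric] by (intro ennreal_leI) simp
  also have "... <= (NINT x. ennreal (norm (f x * (LBINT y. cnj (f y) * cor (?g (x - y))))))"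
   by (rule norm_integral_le_nn_integral)
  also have "... <= (NINT x. NINT y. ennreal (norm (f x)) * ennreal (norm (cnj (f y) * cor (?g (x - y)))))"
  proof (intro nn_integral_mono)
   fix x
   show "ennreal (norm (f x * (LBINT y. cnj (f y) * cor (?g (x - y)))))
    <= (NINT y. ennreal (norm (f x)) * ennreal (norm (cnj (f y) * cor (?g (x - y)))))"
    unfolding norm_mult[of "f x"] ennreal_mult'[OF norm_ge_zero]
    by (subst nn_integral_cmult) (auto intro!: mult_left_mono norm_integral_le_nn_integral)
  qed
  \<comment> \<open>Schur test: 2 |f(x)| |f(y)| <= |f(x)|^2 + |f(y)|^2, and the Gaussian kernel has
    mass 2 pi in either variable, so that both halves give the same multiple of
    \<open>?S\<close>.\<close>
  also have "... <= (NINT x. NINT y. ennreal (1/2) * (ennreal ((norm (f x))\<^sup>2) * ennreal (?g (x - y))) + ennreal (1/2) * (ennreal ((norm (f y))\<^sup>2) * ennreal (?g (x - y))))"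
  proof (intro nn_integral_mono)
   fix x y
   have g0: "?g (x - y) >= 0" using d by simp
   have "norm (f x) * norm (f y) <= 1/2 * (norm (f x))\<^sup>2 + 1/2 * (norm (f y))\<^sup>2"
    using sum_squares_bound[of "norm (f x)" "norm (f y)"] by simp
   hence *: "norm (f x) * norm (f y) * ?g (x - y) <= (1/2 * (norm (f x))\<^sup>2 + 1/2 * (norm (f y))\<^sup>2) * ?g (x - y)"
    using g0 by (rule mult_right_mono)
   have "ennreal (norm (f x)) * ennreal (norm (cnj (f y) * cor (?g (x - y)))) = ennreal (norm (f x) * norm (f y) * ?g (x - y))"
    using g0 d by (simp add: norm_mult abs_mult mult.assoc flip: ennreal_mult')
   also note ennreal_leI[OF *]
   also have "ennreal ((1/2 * (norm (f x))\<^sup>2 + 1/2 * (norm (f y))\<^sup>2) * ?g (x - y)) =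
    ennreal (1/2) * (ennreal ((norm (f x))\<^sup>2) * ennreal (?g (x - y))) + ennreal (1/2) * (ennreal ((norm (f y))\<^sup>2) * ennreal (?g (x - y)))"
    unfolding ennreal_mult'[OF zero_le_power2, symmetric]
    by (subst (1 2) ennreal_mult'[symmetric], simp, subst ennreal_plus[symmetric]) (use g0 in \<open>auto simp: algebra_simps\<close>)
   finally show "ennreal (norm (f x)) * ennreal (norm (cnj (f y) * cor (?g (x - y)))) <=
    ennreal (1/2) * (ennreal ((norm (f x))\<^sup>2) * ennreal (?g (x - y))) + ennreal (1/2) * (ennreal ((norm (f y))\<^sup>2) * ennreal (?g (x - y)))" .
  qed
  also have "... = (NINT x. NINT y. ennreal (1/2) * (ennreal ((norm (f x))\<^sup>2) * ennreal (?g (x - y))))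
    + (NINT x. NINT y. ennreal (1/2) * (ennreal ((norm (f y))\<^sup>2) * ennreal (?g (x - y))))"
   by (simp add: nn_integral_add)
  also have "(NINT x. NINT y. ennreal (1/2) * (ennreal ((norm (f y))\<^sup>2) * ennreal (?g (x - y))))
   = (NINT y. NINT x. ennreal (1/2) * (ennreal ((norm (f y))\<^sup>2) * ennreal (?g (x - y))))"
   by (rule lborel_pair.Fubini') simp
  also have "... = ennreal (1/2) * (?S * ennreal (2 * pi))"
   using nn_integral_shift_real[of "%x. ennreal (?g x)"] nn_integral_gaussian[OF d]
   by (simp add: nn_integral_cmult nn_integral_multc)
  also have "(NINT x. NINT y. ennreal (1/2) * (ennreal ((norm (f x))\<^sup>2) * ennreal (?g (x - y)))) = ennreal (1/2) * (?S * ennreal (2 * pi))"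
   using nn_integral_reflect_real[of "%x. ennreal (?g x)"] nn_integral_gaussian[OF d]
   by (simp add: nn_integral_cmult nn_integral_multc)
  also have "ennreal (1/2) * (?S * ennreal (2 * pi)) + ennreal (1/2) * (?S * ennreal (2 * pi)) = ennreal (2 * pi) * ?S"
   unfolding distrib_right[symmetric] by (subst ennreal_plus[symmetric]) (simp_all add: mult.commute)
  finally show ?thesis .
 qed
 \<comment> \<open>The Gaussian is removed by Fatou, which does not require the left-hand side to be
   finite in advance.\<close>
 let ?h = "%n ks. ennreal ((norm (F ks))\<^sup>2 * exp (- (1 / real (Suc n)) * ks\<^sup>2 / 2))"
 have lim: "(%n. ?h n ks) \<longlonglongrightarrow> ennreal ((norm (F ks))\<^sup>2)" for ks
 proof -
  have "(%n. (norm (F ks))\<^sup>2 * exp (- (1 / real (Suc n)) * ks\<^sup>2 / 2)) \<longlonglongrightarrow> (norm (F ks))\<^sup>2 * exp (- 0 * ks\<^sup>2 / 2)"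
   by (intro tendsto_intros LIMSEQ_Suc[OF lim_1_over_n]) auto
  thus ?thesis by (intro tendsto_ennrealI) simp
 qed
 have "(NINT ks. ennreal ((norm (F ks))\<^sup>2)) = (NINT ks. liminf (%n. ?h n ks))"
  by (intro nn_integral_cong lim_imp_Liminf[symmetric] lim) simp
 also have "... <= liminf (%n. NINT ks. ?h n ks)"
  by (rule nn_integral_liminf) simp
 also have "... <= ennreal (2 * pi) * ?S"
  by (intro Liminf_le always_eventually allI main) auto
 finally show ?thesis unfolding F_def .
qed

section \<open>Bilinear forms of Fourier multipliers and their interpolation\<close>

lemma nn_integral_R2:
 fixes F :: "'a::euclidean_space \<times> 'b::euclidean_space => ennreal"
 assumes [measurable]: "F \<in> bmeas"
 shows "(NINT z. F z) = (NINT x. NINT y. F (x, y))"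
proof -
 have "F \<in> borel_measurable (lborel \<Otimes>\<^sub>M lborel)" by (simp add: lborel_prod)
 from lborel.nn_integral_fst[OF this] show ?thesis by (simp add: lborel_prod)
qed

lemma integral_prod_mult:
 fixes f :: "'a::euclidean_space => complex" and h :: "'b::euclidean_space => complex"
 assumes f: "intble f" and h: "intble h"
 shows "(LBINT z. f (fst z) * h (snd z)) = (LBINT x. f x) * (LBINT y. h y)"
proof -
 have [measurable]: "f \<in> bmeas" "h \<in> bmeas" using f h by auto
 have "intble (%z. f (fst z) * h (snd z))"
  by (rule integrable_prod_dominated[OF f h]) (auto simp: norm_mult)
 hence "integrable (lborel \<Otimes>\<^sub>M lborel) (%z. f (fst z) * h (snd z))"
  by (simp add: lborel_prod)
 from lborel_pair.integral_fst'[OF this] show ?thesis by (simp add: lborel_prod)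
qed

text \<open>The pairing of f with the convolution of K and g; bilinear, without conjugation.\<close>

definition Bil :: "(real => complex) => (real => complex) => (real => complex) => complex" where
 "Bil K f g = (LBINT z. f (fst z) * K (fst z - snd z) * g (snd z))"

text \<open>Inverse Fourier transform of k, that is, the convolution kernel of the Fourier
  multiplier with symbol k.\<close>

definition fmult :: "(real => complex) => real => complex" where
 "fmult k x = cor (1 / (2 * pi)) * (LBINT ks. k ks * cis (x * ks))"

lemma fmult_measurable [measurable]:
 assumes [measurable]: "k \<in> bmeas"
 shows "fmult k \<in> bmeas"
 unfolding fmult_def[abs_def] by measurable

lemma Bil_L1:
 assumes [measurable]: "f \<in> bmeas" "g \<in> bmeas" "K \<in> bmeas"
  and K: "!!x. norm (K x) <= M"
 shows "ennreal (norm (Bil K f g)) <= ennreal M * ((NINT x. norm (f x)) * (NINT x. norm (g x)))"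
proof -
 have M: "M >= 0" using order_trans[OF norm_ge_zero K] .
 have "ennreal (norm (Bil K f g)) <= (NINT z. norm (f (fst z) * K (fst z - snd z) * g (snd z)))"
  unfolding Bil_def by (rule norm_integral_le_nn_integral)
 also have "... <= (NINT z. ennreal M * (ennreal (norm (f (fst z))) * ennreal (norm (g (snd z)))))"
 proof (rule nn_integral_mono)
  fix z :: "real \<times> real"
  have "norm (f (fst z) * K (fst z - snd z) * g (snd z)) <= M * (norm (f (fst z)) * norm (g (snd z)))"
   using mult_right_mono[OF K, of "norm (f (fst z)) * norm (g (snd z))" "fst z - snd z"] by (simp add: norm_mult mult_ac)
  thus "ennreal (norm (f (fst z) * K (fst z - snd z) * g (snd z))) <= ennreal M * (ennreal (norm (f (fst z))) * ennreal (norm (g (snd z))))"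
   using M by (simp add: ennreal_leI flip: ennreal_mult')
 qed
 also have "... = ennreal M * ((NINT x. norm (f x)) * (NINT x. norm (g x)))"
  by (simp add: nn_integral_R2 nn_integral_cmult nn_integral_multc)
 finally show ?thesis .
qed

lemma fmult_bounded:
 assumes "intble k"
 shows "norm (fmult k x) <= (LBINT ks. norm (k ks))"
proof -
 have "norm (LBINT ks. k ks * cis (x * ks)) <= (LBINT ks. norm (k ks))"
  using integral_norm_bound[of lborel "%ks. k ks * cis (x * ks)"] by (simp add: norm_mult)
 moreover have "(1 / (2 * pi)) * (LBINT ks. norm (k ks)) <= 1 * (LBINT ks. norm (k ks))"
  using pi_gt3 by (intro mult_right_mono) auto
 ultimately show ?thesis
  unfolding fmult_def norm_mult by (simp add: norm_divide field_simps)
qed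

lemma Bil_eq_iterated:
 assumes f: "intble f" and g: "intble g" and [measurable]: "K \<in> bmeas"
  and K: "!!x. norm (K x) <= M"
 shows "Bil K f g = (LBINT x. f x * (LBINT y. g y * K (x - y)))"
  and "intble (%z. f (fst z) * K (fst z - snd z) * g (snd z))"
proof -
 have [measurable]: "f \<in> bmeas" "g \<in> bmeas" using f g by auto
 have M: "M >= 0" using order_trans[OF norm_ge_zero K] .
 show *: "intble (%z. f (fst z) * K (fst z - snd z) * g (snd z))"
 proof (rule integrable_prod_dominated[of "%x. M *\<^sub>R f x" g])
  fix x y show "norm (f (fst (x, y)) * K (fst (x, y) - snd (x, y)) * g (snd (x, y))) <= norm (M *\<^sub>R f x) * norm (g y)"
   using mult_right_mono[OF K, of "norm (f x) * norm (g y)" "x - y"] M by (simp add: norm_mult mult_ac)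
 qed (use f g in auto)
 hence "integrable (lborel \<Otimes>\<^sub>M lborel) (%z. f (fst z) * K (fst z - snd z) * g (snd z))"
  by (simp add: lborel_prod)
 from lborel_pair.integral_fst'[OF this]
 have "Bil K f g = (LBINT x. LBINT y. f x * (g y * K (x - y)))"
  by (simp add: lborel_prod Bil_def mult_ac)
 thus "Bil K f g = (LBINT x. f x * (LBINT y. g y * K (x - y)))" by simp
qed

text \<open>Parseval and Bessel for a multiplier of modulus at most 1; the 2 pi of Bessel cancels
  the 1/(2 pi) in \<open>fmult\<close>. A weighted sum of squares replaces the product of norms: it
  makes sense for infinite norms in \<open>ennreal\<close>, and the weight c can be matched to a
  pair of level sets.\<close>

lemma Bil_L2:
 assumes f: "intble f" and g: "intble g" and k: "intble k"
  and k1: "!!ks. norm (k ks) <= 1" and c: "c > 0"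
 shows "ennreal (norm (Bil (fmult k) f g)) <= ennreal (c / 2) * (NINT x. (norm (f x))\<^sup>2) + ennreal (1 / (2 * c)) * (NINT x. (norm (g x))\<^sup>2)"
proof -
 have [measurable]: "f \<in> bmeas" "g \<in> bmeas" "k \<in> bmeas" using f g k by auto
 define F where "F ks = (LBINT x. f x * cis (x * ks))" for ks
 define G where "G ks = (LBINT x. g x * cis (x * ks))" for ks
 have [measurable]: "F \<in> bmeas" "G \<in> bmeas" unfolding F_def G_def by measurable
 have "Bil (fmult k) f g = (LBINT x. f x * (LBINT y. g y * fmult k (x - y)))"
  by (rule Bil_eq_iterated[OF f g _ fmult_bounded[OF k]]) simp
 also have "... = cor (1 / (2 * pi)) * (LBINT x. f x * (LBINT y. g y * (LBINT ks. k ks * cis ((x - y) * ks))))"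
  unfolding fmult_def by (simp add: mult.left_commute[of _ "cor _"] del: of_real_divide of_real_mult)
 also have "... = cor (1 / (2 * pi)) * (LBINT ks. k ks * G (- ks) * F ks)"
  unfolding fourier_bilinear[OF f g k] F_def G_def by simp
 finally have eq: "Bil (fmult k) f g = ..." .
 have "ennreal (norm (Bil (fmult k) f g)) = ennreal (1 / (2 * pi)) * ennreal (norm (LBINT ks. k ks * G (- ks) * F ks))"
  unfolding eq norm_mult by (subst ennreal_mult') (auto simp: norm_divide)
 also have "... <= ennreal (1 / (2 * pi)) * (NINT ks. norm (k ks * G (- ks) * F ks))"
  by (intro mult_left_mono norm_integral_le_nn_integral) auto
 also have "... <= ennreal (1 / (2 * pi)) * (NINT ks. ennreal (c / 2) * ennreal ((norm (F ks))\<^sup>2) + ennreal (1 / (2 * c)) * ennreal ((norm (G (- ks)))\<^sup>2))"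
 proof (intro mult_left_mono nn_integral_mono)
  fix ks
  have "norm (k ks * G (- ks) * F ks) <= norm (G (- ks)) * norm (F ks)"
   using mult_right_mono[OF k1, of "norm (G (- ks)) * norm (F ks)"] by (simp add: norm_mult mult_ac)
  also have "... <= c / 2 * (norm (F ks))\<^sup>2 + 1 / (2 * c) * (norm (G (- ks)))\<^sup>2"
  proof -
   have "0 <= (c * norm (F ks) - norm (G (- ks)))\<^sup>2" by simp
   thus ?thesis using c by (simp add: power2_eq_square field_simps)
  qed
  finally show "ennreal (norm (k ks * G (- ks) * F ks)) <= ennreal (c / 2) * ennreal ((norm (F ks))\<^sup>2) + ennreal (1 / (2 * c)) * ennreal ((norm (G (- ks)))\<^sup>2)"
   using c by (simp add: ennreal_leI flip: ennreal_mult' ennreal_plus)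
 qed auto
 also have "(NINT ks. ennreal (c / 2) * ennreal ((norm (F ks))\<^sup>2) + ennreal (1 / (2 * c)) * ennreal ((norm (G (- ks)))\<^sup>2))
   = ennreal (c / 2) * (NINT ks. ennreal ((norm (F ks))\<^sup>2)) + ennreal (1 / (2 * c)) * (NINT ks. ennreal ((norm (G ks))\<^sup>2))"
  using nn_integral_reflect_real[of "%ks. ennreal ((norm (G ks))\<^sup>2)" 0]
  by (simp add: nn_integral_add nn_integral_cmult)
 also have "... <= ennreal (c / 2) * (ennreal (2 * pi) * (NINT x. (norm (f x))\<^sup>2)) + ennreal (1 / (2 * c)) * (ennreal (2 * pi) * (NINT x. (norm (g x))\<^sup>2))"
  unfolding F_def G_def by (intro add_mono mult_left_mono bessel_inequality f g) auto
 also have "... = ennreal (2 * pi) * (ennreal (c / 2) * (NINT x. (norm (f x))\<^sup>2) + ennreal (1 / (2 * c)) * (NINT x. (norm (g x))\<^sup>2))"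
  by (simp only: distrib_left mult_ac)
 also have "ennreal (1 / (2 * pi)) * ... = ennreal (c / 2) * (NINT x. (norm (f x))\<^sup>2) + ennreal (1 / (2 * c)) * (NINT x. (norm (g x))\<^sup>2)"
  unfolding mult.assoc[symmetric, of "ennreal (1 / (2 * pi))" "ennreal (2 * pi)"] by (subst ennreal_mult'[symmetric]) auto
 finally show ?thesis by (simp add: mult_left_mono)
qed

text \<open>The layer of f at height a. f is the integral of its layers over a, and a layer has
  modulus 1 where |f| > a > 0 and is 0 elsewhere, so that its L1 norm and its squared L2 norm
  agree.\<close>

definition slice :: "('a => complex) => real => 'a => complex" where
 "slice f a x = indicator {0<..<norm (f x)} a *\<^sub>R sgn (f x)"

lemma slice_measurable [measurable]:
 fixes f :: "real => complex"
 assumes [measurable]: "f \<in> bmeas"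
 shows "(%z. slice f (fst z) (snd z)) \<in> borel_measurable (borel :: (real \<times> real) measure)"
proof -
 have "(%z. f z / of_real (norm (f z)) :: complex) \<in> bmeas" by measurable
 hence [measurable]: "(%x. sgn (f x)) \<in> bmeas" by (simp add: sgn_eq)
 have "(%z. slice f (fst z) (snd z)) = (%z. if 0 < fst z & fst z < norm (f (snd z)) then sgn (f (snd z)) else 0)"
  by (auto simp: slice_def indicator_def fun_eq_iff)
 thus ?thesis by simp
qed

lemma slice_integral:
 "intble (%a. slice f a x)" "(LBINT a. slice f a x) = f x"
 "(NINT a. norm (slice f a x)) = ennreal (norm (f x))"
proof -
 have 1: "intble (indicator {0<..<norm (f x)} :: real => real)" by simp
 thus "intble (%a. slice f a x)" by (simp add: slice_def)
 have "(LBINT a. slice f a x) = norm (f x) *\<^sub>R sgn (f x)"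
  using 1 by (simp add: slice_def)
 thus "(LBINT a. slice f a x) = f x" by (simp add: sgn_eq scaleR_conv_of_real)
 have "(NINT a. norm (slice f a x)) = (NINT a. indicator {0<..<norm (f x)} a)"
  by (intro nn_integral_cong) (auto simp: slice_def norm_sgn indicator_def)
 thus "(NINT a. norm (slice f a x)) = ennreal (norm (f x))" by simp
qed

text \<open>Reduces a bilinear bound to level sets. The boundedness of K together with f and g in L1
  justifies Fubini over the two points and the two heights.\<close>

lemma Bil_slices:
 assumes f: "intble f" and g: "intble g" and [measurable]: "K \<in> bmeas"
  and K: "!!x. norm (K x) <= M"
 shows "ennreal (norm (Bil K f g)) <= (NINT a. NINT b. norm (Bil K (slice f a) (slice g b)))"
proof -
 have [measurable]: "f \<in> bmeas" "g \<in> bmeas" using f g by auto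
 have M: "M >= 0" using order_trans[OF norm_ge_zero K] .
 have Mf[measurable]: "(%w :: (real \<times> real) \<times> (real \<times> real). slice h (P w) (Q w)) \<in> bmeas"
  if "h \<in> bmeas" "P \<in> bmeas" "Q \<in> bmeas" for h :: "real => complex" and P Q
  using measurable_compose[OF _ slice_measurable[OF that(1)], of "%w. (P w, Q w)"] that by simp
 have sl1[measurable]: "slice h a \<in> bmeas" if "h \<in> bmeas" for h :: "real => complex" and a
  using measurable_compose[OF _ slice_measurable[OF that], of "%w. (a, w)" borel] by simp
 have sl2[measurable]: "(%a. slice h a x) \<in> bmeas" if "h \<in> bmeas" for h :: "real => complex" and x
  using measurable_compose[OF _ slice_measurable[OF that], of "%w. (w, x)" borel] by simp
 define \<Phi> where "\<Phi> z w = slice f (fst w) (fst z) * K (fst z - snd z) * slice g (snd w) (snd z)" for z w :: "real \<times> real"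
 have meas[measurable]: "(%p. \<Phi> (fst p) (snd p)) \<in> bmeas" unfolding \<Phi>_def by measurable
 have inner: "(NINT w. norm (\<Phi> z w)) <= ennreal M * (ennreal (norm (f (fst z))) * ennreal (norm (g (snd z))))" for z
 proof -
  have "(NINT w. norm (\<Phi> z w)) <= (NINT w. ennreal M * (ennreal (norm (slice f (fst w) (fst z))) * ennreal (norm (slice g (snd w) (snd z)))))"
  proof (rule nn_integral_mono)
   fix w
   have "norm (\<Phi> z w) <= M * (norm (slice f (fst w) (fst z)) * norm (slice g (snd w) (snd z)))"
    using mult_right_mono[OF K, of "norm (slice f (fst w) (fst z)) * norm (slice g (snd w) (snd z))" "fst z - snd z"] by (simp add: \<Phi>_def norm_mult mult_ac)
   thus "ennreal (norm (\<Phi> z w)) <= ennreal M * (ennreal (norm (slice f (fst w) (fst z))) * ennreal (norm (slice g (snd w) (snd z))))"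
    using M by (simp add: ennreal_leI flip: ennreal_mult')
  qed
  also have "... = ennreal M * ((NINT a. norm (slice f a (fst z))) * (NINT b. norm (slice g b (snd z))))"
   by (simp add: nn_integral_R2 nn_integral_cmult nn_integral_multc)
  finally show ?thesis by (simp add: slice_integral)
 qed
 have "(NINT p. norm (\<Phi> (fst p) (snd p))) = (NINT z. NINT w. norm (\<Phi> z w))"
  by (subst nn_integral_R2) auto
 also have "... <= (NINT z. ennreal M * (ennreal (norm (f (fst z))) * ennreal (norm (g (snd z)))))"
  by (intro nn_integral_mono inner)
 also have "... = ennreal M * ((NINT x. norm (f x)) * (NINT x. norm (g x)))"
  by (simp add: nn_integral_R2 nn_integral_cmult nn_integral_multc)
 also have "... < \<infinity>" using f g by (auto simp: integrable_iff_bounded ennreal_mult_less_top)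
 finally have int: "integrable (lborel \<Otimes>\<^sub>M lborel) (%(z, w). \<Phi> z w)"
  by (simp add: integrable_iff_bounded lborel_prod split_beta')
 have "Bil K f g = (LBINT z. LBINT w. \<Phi> z w)"
 proof -
  have "(LBINT w. \<Phi> z w) = f (fst z) * K (fst z - snd z) * g (snd z)" for z
  proof -
   have "(LBINT w. \<Phi> z w) = (LBINT w. K (fst z - snd z) * (slice f (fst w) (fst z) * slice g (snd w) (snd z)))"
    by (simp add: \<Phi>_def mult_ac)
   also have "... = K (fst z - snd z) * (f (fst z) * g (snd z))"
    using integral_prod_mult[OF slice_integral(1)[of f "fst z"] slice_integral(1)[of g "snd z"]]
    by (simp add: slice_integral)
   finally show ?thesis by (simp add: mult_ac)
  qed
  thus ?thesis by (simp add: Bil_def)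
 qed
 also have "... = (LBINT w. LBINT z. \<Phi> z w)"
  by (rule lborel_pair.Fubini_integral[OF int, symmetric])
 also have "... = (LBINT w. Bil K (slice f (fst w)) (slice g (snd w)))"
  by (simp add: \<Phi>_def Bil_def)
 finally have eq: "Bil K f g = (LBINT w. Bil K (slice f (fst w)) (slice g (snd w)))" .
 have [measurable]: "(%w. Bil K (slice f (fst w)) (slice g (snd w))) \<in> bmeas"
 proof -
  have "(%w. LBINT z. \<Phi> z w) \<in> bmeas"
   by (rule lborel.borel_measurable_lebesgue_integral)
    (use measurable_compose[OF _ meas, of "%p. (snd p, fst p)" "borel \<Otimes>\<^sub>M lborel"] in \<open>simp add: split_beta'\<close>)
  thus ?thesis by (simp add: \<Phi>_def Bil_def)
 qed
 have "ennreal (norm (Bil K f g)) <= (NINT w. norm (Bil K (slice f (fst w)) (slice g (snd w))))"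
  unfolding eq by (rule norm_integral_le_nn_integral)
 also have "... = (NINT a. NINT b. norm (Bil K (slice f a) (slice g b)))"
  by (subst nn_integral_R2) auto
 finally show ?thesis .
qed

text \<open>Measure of the level set where |f| > a; the open interval makes it 0 for a <= 0.\<close>

definition dist_fun :: "(real => complex) => real => ennreal" where
 "dist_fun f a = (NINT x. indicator {0<..<norm (f x)} a)"

lemma dist_fun_measurable [measurable]:
 assumes [measurable]: "f \<in> bmeas"
 shows "dist_fun f \<in> bmeas"
proof -
 have "dist_fun f = (%a. NINT x. (if 0 < a & a < norm (f x) then 1 else 0))"
  by (auto simp: dist_fun_def fun_eq_iff indicator_def intro!: nn_integral_cong)
 also have "... \<in> bmeas" by measurable
 finally show ?thesis .
qed

lemma nn_integral_powr_greaterThanLessThan: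
 fixes e l :: real
 assumes e: "- 1 < e" and l: "l >= 0"
 shows "(NINT a. ennreal (a powr e) * indicator {0<..<l} a) = ennreal (l powr (e + 1) / (e + 1))"
proof -
 have "(NINT a. ennreal (a powr e) * indicator {0<..<l} a) = (NINT a. ennreal (a powr e) * indicator {0..l} a)"
  by (rule nn_integral_cong_AE, rule AE_I'[OF finite_imp_null_set_lborel[of "{0, l}"]]) (auto simp: indicator_def)
 also have "... = ennreal (l powr (e + 1) / (e + 1))"
  by (subst nn_integral_has_integral_lebesgue'[OF _ has_integral_powr_from_0[OF e l]]) auto
 finally show ?thesis .
qed

lemma ennreal_mult3:
 "0 <= x ==> 0 <= y ==> ennreal (x * (y * z)) = ennreal x * (ennreal y * ennreal z)"
 by (simp add: ennreal_mult')

lemma nn_integral_iterated_lincomb: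
 fixes F G H :: "real => real => ennreal"
 assumes [measurable]: "(%z. F (fst z) (snd z)) \<in> bmeas"
  "(%z. G (fst z) (snd z)) \<in> bmeas" "(%z. H (fst z) (snd z)) \<in> bmeas"
 shows "(NINT a. NINT b. c * F a b + (c * G a b + H a b)) =
  c * (NINT a. NINT b. F a b) + (c * (NINT a. NINT b. G a b) + (NINT a. NINT b. H a b))"
proof -
 have "(NINT a. NINT b. c * F a b + (c * G a b + H a b)) =
   (NINT z. c * F (fst z) (snd z) + (c * G (fst z) (snd z) + H (fst z) (snd z)))"
  by (subst nn_integral_R2) auto
 also have "... = c * (NINT z. F (fst z) (snd z)) + (c * (NINT z. G (fst z) (snd z)) + (NINT z. H (fst z) (snd z)))"
  by (simp add: nn_integral_add nn_integral_cmult)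
 finally show ?thesis by (simp add: nn_integral_R2)
qed

lemma layer_cake:
 assumes [measurable]: "f \<in> bmeas" and q: "q > 0"
 shows "(NINT a. ennreal (a powr (q - 1)) * dist_fun f a) = ennreal (1 / q) * (NINT x. norm (f x) powr q)"
proof -
 have "(NINT a. ennreal (a powr (q - 1)) * dist_fun f a) = (NINT a. NINT x. ennreal (a powr (q - 1)) * indicator {0<..<norm (f x)} a)"
  unfolding dist_fun_def by (simp add: nn_integral_cmult indicator_def)
 also have "... = (NINT x. NINT a. ennreal (a powr (q - 1)) * indicator {0<..<norm (f x)} a)"
  by (rule lborel_pair.Fubini') (simp add: indicator_def)
 also have "... = (NINT x. ennreal (1 / q) * ennreal (norm (f x) powr q))"
  using q by (intro nn_integral_cong) (simp add: nn_integral_powr_greaterThanLessThan flip: ennreal_mult')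
 also have "... = ennreal (1 / q) * (NINT x. norm (f x) powr q)"
  by (simp add: nn_integral_cmult)
 finally show ?thesis .
qed

lemma slice_norms:
 assumes "f \<in> bmeas"
 shows "(NINT x. norm (slice f a x)) = dist_fun f a"
  and "(NINT x. (norm (slice f a x))\<^sup>2) = dist_fun f a"
 unfolding dist_fun_def
 by (intro nn_integral_cong, auto simp: slice_def norm_sgn indicator_def)+

lemma slice_integrable:
 fixes f :: "real => complex"
 assumes f: "intble f"
 shows "intble (slice f a)"
proof (cases "a > 0")
 case True
 have [measurable]: "f \<in> bmeas" using f by auto
 have "slice f a \<in> bmeas"
  using measurable_compose[OF _ slice_measurable[OF \<open>f \<in> bmeas\<close>], of "%w. (a, w)" borel] by simp
 moreover have "norm (slice f a x) <= norm ((1 / a) *\<^sub>R f x)" for x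
 proof (cases "a < norm (f x)")
  case True
  hence "norm (slice f a x) <= 1" by (simp add: slice_def norm_sgn)
  also have "1 <= norm (f x) / a" using True \<open>a > 0\<close> by simp
  finally show ?thesis using \<open>a > 0\<close> by simp
 qed (simp add: slice_def)
 ultimately show ?thesis
  by (intro Bochner_Integration.integrable_bound[OF integrable_scaleR_right[OF f, of "1 / a"]] AE_I2) simp_all
next
 case False
 hence "slice f a = (%x. 0)" by (auto simp: slice_def fun_eq_iff)
 thus ?thesis by simp
qed

text \<open>Real interpolation replaces the Riesz--Thorin theorem: level sets a of f and b of g
  are paired by the L2 bound if ab is below the threshold M powr (2/q) and by the
  L1 bound above it.\<close>
lemma interpolation_normalised:
 fixes f g k :: "real => complex" and q M :: real
 assumes f: "intble f" and g: "intble g" and k: "intble k"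
  and k1: "!!ks. norm (k ks) <= 1" and M: "M > 0" "!!x. norm (fmult k x) <= M"
  and q: "1 < q" "q < 2"
  and fn: "(NINT x. norm (f x) powr q) <= 1"
  and gn: "(NINT x. norm (g x) powr q) <= 1"
 shows "norm (Bil (fmult k) f g) <= (1 / (1 - q / 2) + 1) * M powr (2 / q - 1)"
proof -
 have [measurable]: "f \<in> bmeas" "g \<in> bmeas" "k \<in> bmeas" using f g k by auto
 have [measurable]: "slice h a \<in> bmeas" if "h \<in> bmeas" for h :: "real => complex" and a
  using measurable_compose[OF _ slice_measurable[OF that], of "%w. (a, w)" borel] by simp
 define h where "h = M powr (2 / q)"
 have h: "h > 0" using M by (simp add: h_def)
 \<comment> \<open>Exponent of the weight (a/b)^p given to \<open>Bil_L2\<close>. Integrating b^(-p)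
   over b < h/a produces the power 2p - 1 = q - 1 of a, the one in the layer-cake formula;
   convergence at b = 0 needs p < 1, that is q < 2.\<close>
 define p where "p = q / 2"
 have p: "0 < p" "p < 1" using q by (auto simp: p_def)
 let ?U = "dist_fun f" and ?V = "dist_fun g"
 let ?ind = "%a. indicator {0<..} a :: ennreal"
 have Un: "(NINT a. ennreal (a powr (q - 1)) * ?U a) <= 1" and Vn: "(NINT a. ennreal (a powr (q - 1)) * ?V a) <= 1"
 proof -
  have "ennreal (1 / q) * X <= 1" if "X <= 1" for X
   using mult_mono[of "ennreal (1 / q)" 1 X 1] that q by simp
  thus "(NINT a. ennreal (a powr (q - 1)) * ?U a) <= 1" "(NINT a. ennreal (a powr (q - 1)) * ?V a) <= 1"
   using q fn gn by (simp_all add: layer_cake)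
 qed
 let ?T1 = "%a b. ennreal (a powr p) * ?U a * (ennreal (b powr - p) * indicator {0<..<h / a} b)"
 let ?T2 = "%a b. ennreal (b powr p) * ?V b * (ennreal (a powr - p) * indicator {0<..<h / b} a)"
 let ?T3 = "%a b. ennreal (M * h powr (1 - q)) * ((ennreal (a powr (q - 1)) * ?U a) * (ennreal (b powr (q - 1)) * ?V b))"
 have pt: "ennreal (norm (Bil (fmult k) (slice f a) (slice g b))) <= ennreal (1/2) * ?T1 a b + (ennreal (1/2) * ?T2 a b + ?T3 a b)" for a b
 proof (cases "a > 0 & b > 0")
  case False
  hence "slice f a = (%x. 0) \<or> slice g b = (%x. 0)" by (auto simp: slice_def fun_eq_iff)
  hence "Bil (fmult k) (slice f a) (slice g b) = 0" by (auto simp: Bil_def)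
  thus ?thesis by simp
 next
  case True
  hence ab: "a > 0" "b > 0" by auto
  show ?thesis
  proof (cases "a * b < h")
   case True
   have "ennreal (norm (Bil (fmult k) (slice f a) (slice g b)))
    <= ennreal ((a / b) powr p / 2) * ?U a + ennreal (1 / (2 * (a / b) powr p)) * ?V b"
    using Bil_L2[OF slice_integrable[OF f] slice_integrable[OF g] k k1, of "(a / b) powr p" a b] ab
    by (simp add: slice_norms)
   also have "ennreal ((a / b) powr p / 2) * ?U a = ennreal (1/2) * ?T1 a b"
   proof -
    have "(a / b) powr p / 2 = 1/2 * (a powr p * b powr - p)"
     using ab by (simp add: powr_divide powr_minus field_simps)
    hence "ennreal ((a / b) powr p / 2) = ennreal (1/2) * (ennreal (a powr p) * ennreal (b powr - p))"
     by (simp only: ennreal_mult3[of "1/2"] powr_ge_zero zero_le_divide_1_iff zero_le_numeral)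
    moreover have "indicator {0<..<h / a} b = (1::ennreal)" using True ab by (simp add: field_simps)
    ultimately show ?thesis by (simp only: mult_1_right mult_1_left mult_ac)
   qed
   also have "ennreal (1 / (2 * (a / b) powr p)) * ?V b = ennreal (1/2) * ?T2 a b"
   proof -
    have "1 / (2 * (a / b) powr p) = 1/2 * (b powr p * a powr - p)"
     using ab by (simp add: powr_divide powr_minus field_simps)
    hence "ennreal (1 / (2 * (a / b) powr p)) = ennreal (1/2) * (ennreal (b powr p) * ennreal (a powr - p))"
     by (simp only: ennreal_mult3[of "1/2"] powr_ge_zero zero_le_divide_1_iff zero_le_numeral)
    moreover have "indicator {0<..<h / b} a = (1::ennreal)" using True ab by (simp add: field_simps)
    ultimately show ?thesis by (simp only: mult_1_right mult_1_left mult_ac)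
   qed
   also have "ennreal (1/2) * ?T1 a b + ennreal (1/2) * ?T2 a b <= ennreal (1/2) * ?T1 a b + (ennreal (1/2) * ?T2 a b + ?T3 a b)"
    by (intro add_left_mono) simp
   finally show ?thesis .
  next
   case False
   have "ennreal (norm (Bil (fmult k) (slice f a) (slice g b))) <= ennreal M * (?U a * ?V b)"
    using Bil_L1[of "slice f a" "slice g b" "fmult k" M] M by (simp add: slice_norms)
   also have "... <= ennreal (M * (h powr (1 - q) * (a powr (q - 1) * b powr (q - 1)))) * (?U a * ?V b)"
   proof (intro mult_right_mono ennreal_leI)
    \<comment> \<open>Above the threshold this factor is at least 1. It supplies both layer-cake
      weights at the price of a power of h.\<close>
    have "1 <= (a * b / h) powr (q - 1)"
     using False h ab q by (intro ge_one_powr_ge_zero) (auto simp: field_simps)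
    also have "... = h powr (1 - q) * (a powr (q - 1) * b powr (q - 1))"
     using ab h powr_minus_divide[of h "q - 1"] by (simp add: powr_divide powr_mult)
    finally show "M <= M * (h powr (1 - q) * (a powr (q - 1) * b powr (q - 1)))"
     using M by simp
   qed simp
   also have "... = ?T3 a b"
   proof -
    have "M * (h powr (1 - q) * (a powr (q - 1) * b powr (q - 1))) = (M * h powr (1 - q)) * (a powr (q - 1) * b powr (q - 1))"
     by (simp only: mult.assoc)
    moreover have "0 <= M * h powr (1 - q)" using M by simp
    ultimately have "ennreal (M * (h powr (1 - q) * (a powr (q - 1) * b powr (q - 1)))) = ennreal (M * h powr (1 - q)) * (ennreal (a powr (q - 1)) * ennreal (b powr (q - 1)))"
     by (simp only: ennreal_mult3 powr_ge_zero)
    thus ?thesis by (simp only: mult_ac)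
   qed
   also have "... <= ennreal (1/2) * ?T1 a b + (ennreal (1/2) * ?T2 a b + ?T3 a b)"
    by (simp add: add_increasing)
   finally show ?thesis .
  qed
 qed
 have M0: "norm (fmult k x) <= M" for x by (rule M)
 have S1: "(NINT a. NINT b. ennreal (a powr p) * X a * (ennreal (b powr - p) * indicator {0<..<h / a} b)) <= ennreal (h powr (1 - p) / (1 - p))"
  if X: "X \<in> bmeas" and Xn: "(NINT a. ennreal (a powr (q - 1)) * X a) <= 1" and X0: "!!a. a <= 0 ==> X a = 0" for X
 proof -
  note [measurable] = X
  have "(NINT a. NINT b. ennreal (a powr p) * X a * (ennreal (b powr - p) * indicator {0<..<h / a} b)) = (NINT a. ennreal (h powr (1 - p) / (1 - p)) * (ennreal (a powr (q - 1)) * X a))"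
  proof (rule nn_integral_cong)
   fix a :: real
   show "(NINT b. ennreal (a powr p) * X a * (ennreal (b powr - p) * indicator {0<..<h / a} b)) = ennreal (h powr (1 - p) / (1 - p)) * (ennreal (a powr (q - 1)) * X a)"
   proof (cases "a > 0")
    case True
    have "(NINT b. ennreal (a powr p) * X a * (ennreal (b powr - p) * indicator {0<..<h / a} b)) = ennreal (a powr p) * X a * ennreal ((h / a) powr (1 - p) / (1 - p))"
     using nn_integral_powr_greaterThanLessThan[of "-p" "h / a"] p h True by (simp add: nn_integral_cmult)
    also have "... = ennreal (a powr p * ((h / a) powr (1 - p) / (1 - p))) * X a"
     by (simp only: ennreal_mult'[OF powr_ge_zero] mult_ac)
    also have "a powr p * ((h / a) powr (1 - p) / (1 - p)) = h powr (1 - p) / (1 - p) * a powr (q - 1)"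
    proof -
     have "a powr (q - 1) = a powr p * a powr (p - 1)" by (simp add: p_def flip: powr_add)
     also have "a powr (p - 1) = 1 / a powr (1 - p)" by (simp add: powr_minus_divide[symmetric])
     finally show ?thesis using True h by (simp add: powr_divide mult_ac)
    qed
    also have "ennreal (h powr (1 - p) / (1 - p) * a powr (q - 1)) * X a = ennreal (h powr (1 - p) / (1 - p)) * (ennreal (a powr (q - 1)) * X a)"
     using p by (subst ennreal_mult') (auto simp: mult.assoc)
    finally show ?thesis .
   qed (simp add: X0)
  qed
  also have "... = ennreal (h powr (1 - p) / (1 - p)) * (NINT a. ennreal (a powr (q - 1)) * X a)"
   by (simp add: nn_integral_cmult)
  also have "... <= ennreal (h powr (1 - p) / (1 - p)) * 1"
   using Xn by (intro mult_left_mono) auto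
  finally show ?thesis by simp
 qed
 have U0: "?U a = 0" "?V a = 0" if "a <= 0" for a using that by (auto simp: dist_fun_def)
 have S2: "(NINT a. NINT b. ?T2 a b) <= ennreal (h powr (1 - p) / (1 - p))"
 proof -
  have "(NINT a. NINT b. ?T2 a b) = (NINT b. NINT a. ?T2 a b)"
   by (rule lborel_pair.Fubini') (simp add: indicator_def)
  also have "... <= ennreal (h powr (1 - p) / (1 - p))"
   by (rule S1[of "?V"]) (use Vn U0 in auto)
  finally show ?thesis .
 qed
 have "ennreal (norm (Bil (fmult k) f g)) <= (NINT a. NINT b. norm (Bil (fmult k) (slice f a) (slice g b)))"
  by (rule Bil_slices[OF f g _ M0]) simp
 also have "... <= (NINT a. NINT b. ennreal (1/2) * ?T1 a b + (ennreal (1/2) * ?T2 a b + ?T3 a b))"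
  by (intro nn_integral_mono pt)
 also have "... = ennreal (1/2) * (NINT a. NINT b. ?T1 a b) + (ennreal (1/2) * (NINT a. NINT b. ?T2 a b) +
   (NINT a. NINT b. ?T3 a b))"
 proof -
  have [measurable]: "(%b. indicator {0<..<h / a} b :: ennreal) \<in> bmeas" for a by simp
  have [measurable]: "(%z. indicator {0<..<h / fst z} (snd z) :: ennreal) \<in> borel_measurable (borel :: (real \<times> real) measure)"
   "(%z. indicator {0<..<h / snd z} (fst z) :: ennreal) \<in> borel_measurable (borel :: (real \<times> real) measure)"
   unfolding indicator_def greaterThanLessThan_iff by measurable
  have [measurable]: "(%z. ?T1 (fst z) (snd z)) \<in> bmeas" "(%z. ?T2 (fst z) (snd z)) \<in> bmeas" "(%z. ?T3 (fst z) (snd z)) \<in> bmeas"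
   by measurable
  show ?thesis
   by (rule nn_integral_iterated_lincomb) measurable
 qed
 also have "... <= ennreal (1/2) * ennreal (h powr (1 - p) / (1 - p)) + (ennreal (1/2) * ennreal (h powr (1 - p) / (1 - p)) + ennreal (M * h powr (1 - q)) * (1 * 1))"
 proof (intro add_mono mult_left_mono)
  have "(NINT a. NINT b. ?T3 a b) = ennreal (M * h powr (1 - q)) * ((NINT a. ennreal (a powr (q - 1)) * ?U a) * (NINT b. ennreal (b powr (q - 1)) * ?V b))"
   by (simp add: nn_integral_cmult nn_integral_multc)
  also have "... <= ennreal (M * h powr (1 - q)) * (1 * 1)"
   by (intro mult_left_mono mult_mono Un Vn) auto
  finally show "(NINT a. NINT b. ?T3 a b) <= ennreal (M * h powr (1 - q)) * (1 * 1)" .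
  show "(NINT a. NINT b. ?T1 a b) <= ennreal (h powr (1 - p) / (1 - p))"
   by (rule S1) (use Un U0 in auto)
 qed (use S2 in auto)
 also have "... = ennreal (h powr (1 - p) / (1 - p) + M * h powr (1 - q))"
 proof -
  define X where "X = h powr (1 - p) / (1 - p)"
  have X: "X >= 0" using p by (simp add: X_def)
  have "ennreal (1/2) * ennreal X = ennreal (1/2 * X)"
   by (rule ennreal_mult'[symmetric]) simp
  moreover have "ennreal (1/2 * X) + (ennreal (1/2 * X) + ennreal (M * h powr (1 - q))) = ennreal (X + M * h powr (1 - q))"
   using X M by (simp flip: ennreal_plus)
  ultimately show ?thesis unfolding X_def[symmetric] by simp
 qed
 \<comment> \<open>The threshold is the value of h for which the contributions from below and from
   above carry the same power of M.\<close>
 also have "h powr (1 - p) = M powr (2 / q - 1)"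
  using q by (simp add: h_def p_def powr_powr algebra_simps)
 also have "M * h powr (1 - q) = M powr 1 * M powr (2 / q * (1 - q))"
  using M by (simp add: h_def powr_powr)
 also have "... = M powr (2 / q - 1)"
 proof -
  have "1 + 2 / q * (1 - q) = 2 / q - 1" using q by (simp add: field_simps)
  thus ?thesis by (simp only: powr_add[symmetric])
 qed
 finally have "ennreal (norm (Bil (fmult k) f g)) <= ennreal (M powr (2 / q - 1) / (1 - p) + M powr (2 / q - 1))" .
 hence "norm (Bil (fmult k) f g) <= M powr (2 / q - 1) / (1 - p) + M powr (2 / q - 1)"
  using p by (subst (asm) ennreal_le_iff) auto
 thus ?thesis unfolding p_def distrib_right by simp
qed

lemma interpolation:
 fixes f g k :: "real => complex" and q M A B :: real
 assumes f: "intble f" and g: "intble g" and k: "intble k"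
  and k1: "!!ks. norm (k ks) <= 1" and M: "M > 0" "!!x. norm (fmult k x) <= M"
  and q: "1 < q" "q < 2" and AB: "0 <= A" "0 <= B"
  and fn: "(NINT x. norm (f x) powr q) = ennreal A"
  and gn: "(NINT x. norm (g x) powr q) = ennreal B"
 shows "norm (Bil (fmult k) f g) <= (1 / (1 - q / 2) + 1) * M powr (2 / q - 1) * (A powr (1/q) * B powr (1/q))"
proof -
 have [measurable]: "f \<in> bmeas" "g \<in> bmeas" "k \<in> bmeas" using f g k by auto
 consider "A = 0" | "B = 0" | "A > 0" "B > 0" using AB by linarith
 thus ?thesis
 proof cases
  case 1
  hence "AE x in lborel. norm (f x) = 0"
   using nn_integral_eq_0_powr[of "%x. norm (f x)" lborel q] fn by simp
  hence "(NINT x. norm (f x)) = 0" by (subst nn_integral_0_iff_AE) auto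
  hence "norm (Bil (fmult k) f g) = 0" using Bil_L1[of f g "fmult k" M] M by simp
  thus ?thesis using 1 by simp
 next
  case 2
  hence "AE x in lborel. norm (g x) = 0"
   using nn_integral_eq_0_powr[of "%x. norm (g x)" lborel q] gn by simp
  hence "(NINT x. norm (g x)) = 0" by (subst nn_integral_0_iff_AE) auto
  hence "norm (Bil (fmult k) f g) = 0" using Bil_L1[of f g "fmult k" M] M by simp
  thus ?thesis using 2 by simp
 next
  case 3
  let ?A = "A powr (1/q)" let ?B = "B powr (1/q)"
  have nrm: "(NINT x. norm (h x /\<^sub>R c powr (1/q)) powr q) <= 1"
   if [measurable]: "h \<in> bmeas" and c: "c > 0"
    and "(NINT t. norm (h t) powr q) = ennreal c" for h :: "real => complex" and c
  proof -
   have "(NINT x. norm (h x /\<^sub>R c powr (1/q)) powr q) = (NINT t. ennreal (norm (h t) powr q) * ennreal (1 / c))"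
   proof (rule nn_integral_cong)
    fix x
    have "norm (h x /\<^sub>R c powr (1/q)) powr q = norm (h x) powr q * (1 / c)"
     using c q by (simp add: powr_mult powr_powr powr_minus inverse_eq_divide powr_divide)
    thus "ennreal (norm (h x /\<^sub>R c powr (1/q)) powr q) = ennreal (norm (h x) powr q) * ennreal (1 / c)"
     by (simp only: ennreal_mult'[OF powr_ge_zero])
   qed
   also have "... = ennreal c * ennreal (1 / c)"
    using that by (subst nn_integral_multc) auto
   also have "... = 1" using c by (simp flip: ennreal_mult')
   finally show ?thesis by simp
  qed
  have "Bil (fmult k) (%x. f x /\<^sub>R ?A) (%x. g x /\<^sub>R ?B) = Bil (fmult k) f g /\<^sub>R (?A * ?B)"
  proof -
   have "(f x /\<^sub>R ?A) * K * (g y /\<^sub>R ?B) = inverse (?A * ?B) *\<^sub>R (f x * K * g y)" for x y K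
    by simp
   thus ?thesis unfolding Bil_def by (simp only: integral_scaleR_right)
  qed
  moreover have "norm (Bil (fmult k) (%x. f x /\<^sub>R ?A) (%x. g x /\<^sub>R ?B)) <= (1 / (1 - q / 2) + 1) * M powr (2 / q - 1)"
  proof (rule interpolation_normalised[OF _ _ k k1 M q])
   show "(NINT x. norm (f x /\<^sub>R ?A) powr q) <= 1" by (rule nrm[OF _ 3(1) fn]) simp
   show "(NINT x. norm (g x /\<^sub>R ?B) powr q) <= 1" by (rule nrm[OF _ 3(2) gn]) simp
  qed (intro integrable_scaleR_right f g)+
  moreover have AB: "?A * ?B > 0" using 3 by simp
  moreover have "norm (z /\<^sub>R c) = norm z / c" if "c > 0" for z :: complex and c
   using that by (simp add: divide_inverse mult.commute)
  ultimately have "norm (Bil (fmult k) f g) / (?A * ?B) <= (1 / (1 - q / 2) + 1) * M powr (2 / q - 1)"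
   using AB by (simp only:)
  thus ?thesis unfolding pos_divide_le_eq[OF AB] .
 qed
qed

section \<open>Oscillatory integrals with polynomial phase and damping\<close>

lemma cis_poly_has_vector_derivative:
 fixes p :: "real poly"
 shows "((%x. cis (poly p x)) has_vector_derivative (poly (pderiv p) x *\<^sub>R (\<i> * cis (poly p x)))) (at x within S)"
proof -
 have 1: "((%x. poly p x) has_vector_derivative poly (pderiv p) x) (at x within S)"
  using poly_DERIV[of p x] has_field_derivative_at_within has_real_derivative_iff_has_vector_derivative by blast
 have 2: "(cis has_vector_derivative (\<i> * cis (poly p x))) (at (poly p x) within poly p ` S)"
 proof -
  have "((%z. exp (\<i> * z)) has_field_derivative (\<i> * exp (\<i> * cor (poly p x)))) (at (cor (poly p x)))"
   by (auto intro!: derivative_eq_intros)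
  from has_vector_derivative_real_field[OF this, of "poly p ` S"] show ?thesis
   by (simp add: cis_conv_exp[abs_def])
 qed
 from vector_diff_chain_within[OF 1 2] show ?thesis by (simp add: o_def)
qed

lemma continuous_on_cis_poly [continuous_intros]: "continuous_on S (%x. cis (poly (p :: real poly) x))"
 by (intro continuous_intros)

text \<open>Integration by parts against 1/p'. Since p'' has a fixed sign, 1/p' is monotone and the
  remaining integral telescopes to a difference of endpoint values; the boundary terms and the
  remainder are each at most 2/d.\<close>

lemma oscillatory_monotone_phase:
 fixes p :: "real poly"
 assumes ab: "a <= b" and d: "d > 0"
  and D1: "(\<forall>x\<in>{a..b}. poly (pderiv p) x >= d) \<or> (\<forall>x\<in>{a..b}. poly (pderiv p) x <= - d)"
  and D2: "(\<forall>x\<in>{a..b}. poly (pderiv (pderiv p)) x >= 0) \<or> (\<forall>x\<in>{a..b}. poly (pderiv (pderiv p)) x <= 0)"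
 shows "norm (integral {a..b} (%x. cis (poly p x))) <= 4 / d"
proof -
 let ?p1 = "%x. poly (pderiv p) x" and ?p2 = "%x. poly (pderiv (pderiv p)) x"
 have nz: "?p1 x ~= 0" and inv: "\<bar>1 / ?p1 x\<bar> <= 1 / d" if "x \<in> {a..b}" for x
 proof -
  have "?p1 x >= d \<or> ?p1 x <= - d" using D1 that by blast
  hence "\<bar>?p1 x\<bar> >= d" using d by linarith
  thus "?p1 x ~= 0" "\<bar>1 / ?p1 x\<bar> <= 1 / d" using d by (auto simp: abs_divide intro!: divide_left_mono)
 qed
 let ?h = "%x. - (1 / ?p1 x)" and ?h' = "%x. ?p2 x / (?p1 x)\<^sup>2"
 have h: "(?h has_vector_derivative ?h' x) (at x within {a..b})" if "x \<in> {a..b}" for x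
 proof -
  have "((%x. - (1 / ?p1 x)) has_field_derivative ?h' x) (at x within {a..b})"
   using nz[OF that] by (auto intro!: derivative_eq_intros simp: power2_eq_square)
  thus ?thesis by (simp add: has_real_derivative_iff_has_vector_derivative)
 qed
 have hint: "(?h' has_integral (?h b - ?h a)) {a..b}"
  by (rule fundamental_theorem_of_calculus[OF ab h])
 let ?e = "%x. cis (poly p x)"
 let ?F = "%x. ?h x *\<^sub>R (\<i> * ?e x)"
 have F: "(?F has_vector_derivative (?h x *\<^sub>R (\<i> * (?p1 x *\<^sub>R (\<i> * ?e x))) + ?h' x *\<^sub>R (\<i> * ?e x))) (at x within {a..b})" if "x \<in> {a..b}" for x
  by (rule bounded_bilinear.has_vector_derivative[OF bounded_bilinear_scaleR h[OF that]
    has_vector_derivative_mult_right[OF cis_poly_has_vector_derivative]])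
 have F': "(?F has_vector_derivative (?e x + ?h' x *\<^sub>R (\<i> * ?e x))) (at x within {a..b})" if "x \<in> {a..b}" for x
 proof -
  have "?h x *\<^sub>R (\<i> * (?p1 x *\<^sub>R (\<i> * ?e x))) = ?e x"
   using nz[OF that] by (simp add: scaleR_conv_of_real field_simps)
  thus ?thesis using F[OF that] by simp
 qed
 have tot: "((%x. ?e x + ?h' x *\<^sub>R (\<i> * ?e x)) has_integral (?F b - ?F a)) {a..b}"
  by (rule fundamental_theorem_of_calculus[OF ab F'])
 have cont: "continuous_on {a..b} (%x. ?h' x *\<^sub>R (\<i> * ?e x))"
  using nz by (intro continuous_intros) auto
 hence ci: "(%x. ?h' x *\<^sub>R (\<i> * ?e x)) integrable_on {a..b}" by (rule integrable_continuous_interval)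
 have ei: "?e integrable_on {a..b}" by (intro integrable_continuous_interval continuous_intros)
 have eq: "integral {a..b} ?e = (?F b - ?F a) - integral {a..b} (%x. ?h' x *\<^sub>R (\<i> * ?e x))"
  using integral_unique[OF tot] integral_add[OF ei ci] by (simp add: algebra_simps)
 have "norm (integral {a..b} (%x. ?h' x *\<^sub>R (\<i> * ?e x))) <= \<bar>?h b - ?h a\<bar>"
  using D2
 proof
  assume s: "\<forall>x\<in>{a..b}. ?p2 x >= 0"
  have "norm (integral {a..b} (%x. ?h' x *\<^sub>R (\<i> * ?e x))) <= integral {a..b} ?h'"
   using s by (intro integral_norm_bound_integral ci has_integral_integrable[OF hint]) (auto simp: norm_mult)
  thus ?thesis using integral_unique[OF hint] by simp
 next
  assume s: "\<forall>x\<in>{a..b}. ?p2 x <= 0"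
  have "norm (integral {a..b} (%x. ?h' x *\<^sub>R (\<i> * ?e x))) <= integral {a..b} (%x. - ?h' x)"
   using s by (intro integral_norm_bound_integral ci integrable_neg has_integral_integrable[OF hint]) (auto simp: norm_mult abs_if divide_nonpos_nonneg)
  thus ?thesis using integral_unique[OF has_integral_neg[OF hint]] by simp
 qed
 moreover have "norm (?F x) <= 1 / d" if "x \<in> {a..b}" for x
  using inv[OF that] by (simp add: norm_mult)
 moreover have "\<bar>?h b - ?h a\<bar> <= 1 / d + 1 / d"
  using inv[of a] inv[of b] ab abs_triangle_ineq4[of "?h b" "?h a"] by simp
 ultimately have "norm (integral {a..b} ?e) <= (1 / d + 1 / d) + (1 / d + 1 / d)"
  unfolding eq using ab
  by (intro order_trans[OF norm_triangle_ineq4] add_mono) (auto intro!: order_trans[OF norm_triangle_ineq4] add_mono)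
 thus ?thesis by simp
qed

text \<open>z is the zero of r or, if r keeps its sign, the endpoint where |r| is smallest. With
  slope at least mu, r moves away from 0 at least linearly on both sides of z.\<close>

lemma steep_function_zero:
 fixes r :: "real poly"
 assumes ab: "a <= b" and mu: "mu > 0" and D: "!!x. x \<in> {a..b} ==> poly (pderiv r) x >= mu"
 obtains z where "z \<in> {a..b}" "!!x. x \<in> {a..b} ==> x > z ==> poly r x >= mu * (x - z)"
  "!!x. x \<in> {a..b} ==> x < z ==> poly r x <= - mu * (z - x)"
proof -
 have inc: "poly r y - poly r x >= mu * (y - x)" if "a <= x" "x <= y" "y <= b" for x y
 proof (cases "x = y")
  case False
  with that have "x < y" by simp
  from poly_MVT[OF this, of r] obtain w where w: "w > x" "w < y" "poly r y - poly r x = (y - x) * poly (pderiv r) w" by auto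
  have "(y - x) * mu <= (y - x) * poly (pderiv r) w" using D[of w] w that by (intro mult_left_mono) auto
  thus ?thesis using w by (simp add: mult.commute)
 qed simp
 consider "poly r a > 0" | "poly r b < 0" | "poly r a <= 0" "0 <= poly r b" by linarith
 thus ?thesis
 proof cases
  case 1
  have "poly r x >= mu * (x - a)" if "x \<in> {a..b}" for x using inc[of a x] that 1 by auto
  thus ?thesis using that[of a] ab by auto
 next
  case 2
  have "poly r x <= - mu * (b - x)" if "x \<in> {a..b}" for x using inc[of x b] that 2 by auto
  thus ?thesis using that[of b] ab by auto
 next
  case 3
  obtain z where z: "a <= z" "z <= b" "poly r z = 0"
   using IVT'[of "poly r" a 0 b] 3 ab continuous_at_imp_continuous_on[of "{a..b}" "poly r"] by auto
  have "poly r x >= mu * (x - z)" if "x \<in> {a..b}" "x > z" for x using inc[of z x] that z by auto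
  moreover have "poly r x <= - mu * (z - x)" if "x \<in> {a..b}" "x < z" for x using inc[of x z] that z by auto
  ultimately show ?thesis using that[of z] z by auto
 qed
qed

text \<open>Values |r| < d are confined to an interval of length at most 2 d / mu, which is
  estimated trivially. At most two intervals with |r| >= d remain, and there \<open>sub\<close>
  gives E. With a derivative of the phase for r, this is the inductive step of van der Corput's
  lemma.\<close>

lemma oscillatory_split:
 fixes p r :: "real poly"
 assumes ab: "a <= b" and mu: "mu > 0" and d: "d > 0" and E: "E >= 0"
  and D: "(\<forall>x\<in>{a..b}. poly (pderiv r) x >= mu) \<or> (\<forall>x\<in>{a..b}. poly (pderiv r) x <= - mu)"
  and sub: "!!c e. a <= c ==> c <= e ==> e <= b ==>
   (\<forall>x\<in>{c..e}. poly r x >= d) \<or> (\<forall>x\<in>{c..e}. poly r x <= - d) ==>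
   norm (integral {c..e} (%x. cis (poly p x))) <= E"
 shows "norm (integral {a..b} (%x. cis (poly p x))) <= 2 * (d / mu) + 2 * E"
proof -
 obtain s where s: "s = r \<or> s = - r" and Ds: "!!x. x \<in> {a..b} ==> poly (pderiv s) x >= mu"
 proof (cases "\<forall>x\<in>{a..b}. poly (pderiv r) x >= mu")
  case True thus ?thesis using that[of r] by auto
 next
  case False thus ?thesis using D that[of "-r"] by (force simp: pderiv_minus)
 qed
 have sub': "norm (integral {c..e} (%x. cis (poly p x))) <= E"
  if "a <= c" "c <= e" "e <= b" "(\<forall>x\<in>{c..e}. poly s x >= d) \<or> (\<forall>x\<in>{c..e}. poly s x <= - d)" for c e
 proof (rule sub[OF that(1-3)])
  show "(\<forall>x\<in>{c..e}. poly r x >= d) \<or> (\<forall>x\<in>{c..e}. poly r x <= - d)"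
   using s that(4) by (elim disjE) force+
 qed
 obtain z where z: "z \<in> {a..b}" "!!x. x \<in> {a..b} ==> x > z ==> poly s x >= mu * (x - z)"
  "!!x. x \<in> {a..b} ==> x < z ==> poly s x <= - mu * (z - x)"
  using steep_function_zero[OF ab mu Ds] by blast
 define c where "c = max a (z - d / mu)"
 define e where "e = min b (z + d / mu)"
 have dm: "d / mu > 0" using d mu by simp
 have ord: "a <= c" "c <= e" "e <= b" "e - c <= 2 * (d / mu)" using z(1) dm by (auto simp: c_def e_def)
 let ?e = "%x. cis (poly p x)"
 have ei: "?e integrable_on {u..v}" for u v by (intro integrable_continuous_interval continuous_intros)
 have comb: "integral {a..b} ?e = integral {a..c} ?e + (integral {c..e} ?e + integral {e..b} ?e)"
  using Henstock_Kurzweil_Integration.integral_combine[of a c b ?e] Henstock_Kurzweil_Integration.integral_combine[of c e b ?e] ord ei by simp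
 have "norm (integral {a..c} ?e) <= E"
 proof (cases "a = c")
  case False
  hence c: "c = z - d / mu" by (simp add: c_def)
  have "poly s x <= - d" if "x \<in> {a..c}" for x
  proof -
   have "poly s x <= - mu * (z - x)" using z(3)[of x] that ord dm c by auto
   also have "... <= - mu * (d / mu)" using that c mu by (intro mult_left_mono_neg) auto
   finally show ?thesis using mu by simp
  qed
  thus ?thesis using ord by (intro sub') auto
 qed (use E in simp)
 moreover have "norm (integral {e..b} ?e) <= E"
 proof (cases "e = b")
  case False
  hence c: "e = z + d / mu" by (simp add: e_def min_def split: if_splits)
  have "poly s x >= d" if "x \<in> {e..b}" for x
  proof -
   have "mu * (d / mu) <= mu * (x - z)" using that c mu by (intro mult_left_mono) auto
   also have "... <= poly s x" using z(2)[of x] that ord dm c by auto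
   finally show ?thesis using mu by simp
  qed
  thus ?thesis using ord by (intro sub') auto
 qed (use E in simp)
 moreover have "norm (integral {c..e} ?e) <= 2 * (d / mu)"
  using integral_bound[OF ord(2) continuous_on_cis_poly, of p 1] ord by simp
 ultimately show ?thesis unfolding comb
  using norm_triangle_ineq[of "integral {a..c} ?e" "integral {c..e} ?e + integral {e..b} ?e"]
   norm_triangle_ineq[of "integral {c..e} ?e" "integral {e..b} ?e"] by linarith
qed

text \<open>Induction on the order of the derivative, one order per use of
  \<open>oscillatory_split\<close>. It starts at n = 2: for n = 1 monotonicity of the derivative
  would be needed in addition, and for n = 2 the sign of the second derivative provides it.
  Polynomial phases avoid all smoothness hypotheses.\<close>

lemma van_der_Corput:
 assumes "n >= 2"
 shows "EX C>0. ALL (p :: real poly) a b mu. a <= b --> mu > 0 -->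
  (\<forall>x\<in>{a..b}. poly ((pderiv ^^ n) p) x >= mu) \<or> (\<forall>x\<in>{a..b}. poly ((pderiv ^^ n) p) x <= - mu) -->
  norm (integral {a..b} (%x. cis (poly p x))) <= C * mu powr (- 1 / real n)"
 using assms
proof (induction n rule: dec_induct)
 case base
 show ?case
 proof (intro exI[of _ 10] conjI allI impI)
  fix p :: "real poly" and a b mu :: real
  assume ab: "a <= b" and mu: "mu > 0"
   and D: "(\<forall>x\<in>{a..b}. poly ((pderiv ^^ 2) p) x >= mu) \<or> (\<forall>x\<in>{a..b}. poly ((pderiv ^^ 2) p) x <= - mu)"
  have D': "(\<forall>x\<in>{a..b}. poly (pderiv (pderiv p)) x >= mu) \<or> (\<forall>x\<in>{a..b}. poly (pderiv (pderiv p)) x <= - mu)"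
   using D by (simp add: numeral_2_eq_2)
  \<comment> \<open>Balances the two terms: d / mu and 1 / d both become
    \<open>mu powr (- 1/2)\<close>.\<close>
  define d where "d = mu powr (1/2)"
  have d: "d > 0" using mu by (simp add: d_def)
  have "norm (integral {a..b} (%x. cis (poly p x))) <= 2 * (d / mu) + 2 * (4 / d)"
  proof (rule oscillatory_split[OF ab mu d _ D'])
   fix c e assume *: "a <= c" "c <= e" "e <= b" and r: "(\<forall>x\<in>{c..e}. poly (pderiv p) x >= d) \<or> (\<forall>x\<in>{c..e}. poly (pderiv p) x <= - d)"
   have "(\<forall>x\<in>{c..e}. poly (pderiv (pderiv p)) x >= 0) \<or> (\<forall>x\<in>{c..e}. poly (pderiv (pderiv p)) x <= 0)"
   proof -
    have "{c..e} \<subseteq> {a..b}" using * by auto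
    thus ?thesis using D' mu by (elim disjE) (fastforce dest: subsetD)+
   qed
   thus "norm (integral {c..e} (%x. cis (poly p x))) <= 4 / d"
    by (rule oscillatory_monotone_phase[OF *(2) d r])
  qed (use d in auto)
  also have "d / mu = mu powr (- 1/2)" using mu by (simp add: d_def powr_minus field_simps flip: powr_add)
  also have "4 / d = 4 * mu powr (- 1/2)" using mu by (simp add: d_def powr_minus field_simps)
  finally show "norm (integral {a..b} (%x. cis (poly p x))) <= 10 * mu powr (- 1 / real 2)" by simp
 qed simp
next
 case (step n)
 then obtain C where C: "C > 0" "!!(p :: real poly) a b mu. a <= b ==> mu > 0 ==>
  (\<forall>x\<in>{a..b}. poly ((pderiv ^^ n) p) x >= mu) \<or> (\<forall>x\<in>{a..b}. poly ((pderiv ^^ n) p) x <= - mu) ==>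
  norm (integral {a..b} (%x. cis (poly p x))) <= C * mu powr (- 1 / real n)" by blast
 show ?case
 proof (intro exI[of _ "2 + 2 * C"] conjI allI impI)
  fix p :: "real poly" and a b mu :: real
  assume ab: "a <= b" and mu: "mu > 0"
   and D: "(\<forall>x\<in>{a..b}. poly ((pderiv ^^ Suc n) p) x >= mu) \<or> (\<forall>x\<in>{a..b}. poly ((pderiv ^^ Suc n) p) x <= - mu)"
  have n: "real n > 0" using step by simp
  \<comment> \<open>Balances d / mu with \<open>d powr (- 1 / real n)\<close>: both become mu to the
    power -1/(n+1).\<close>
  define d where "d = mu powr (real n / (real n + 1))"
  have d: "d > 0" using mu by (simp add: d_def)
  have "norm (integral {a..b} (%x. cis (poly p x))) <= 2 * (d / mu) + 2 * (C * d powr (- 1 / real n))"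
  proof (rule oscillatory_split[OF ab mu d])
   show "(\<forall>x\<in>{a..b}. poly (pderiv ((pderiv ^^ n) p)) x >= mu) \<or> (\<forall>x\<in>{a..b}. poly (pderiv ((pderiv ^^ n) p)) x <= - mu)"
    using D by simp
   show "0 <= C * d powr (- 1 / real n)" using C(1) by simp
   fix c e assume "c <= e" "(\<forall>x\<in>{c..e}. poly ((pderiv ^^ n) p) x >= d) \<or> (\<forall>x\<in>{c..e}. poly ((pderiv ^^ n) p) x <= - d)"
   thus "norm (integral {c..e} (%x. cis (poly p x))) <= C * d powr (- 1 / real n)"
    by (intro C(2) d)
  qed
  also have "d / mu = mu powr (real n / (real n + 1) - 1)" using mu by (simp add: d_def powr_diff)
  also have "real n / (real n + 1) - 1 = - 1 / real (Suc n)" by (simp add: field_simps)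
  also have "d powr (- 1 / real n) = mu powr (- 1 / real (Suc n))" using n by (simp add: d_def powr_powr field_simps)
  finally show "norm (integral {a..b} (%x. cis (poly p x))) <= (2 + 2 * C) * mu powr (- 1 / real (Suc n))"
   by (simp add: algebra_simps)
 qed (use C(1) in simp)
qed

text \<open>Quantitative second mean value theorem: integration by parts against the primitive of h,
  where a monotone amplitude with values in [0, 1] has variation at most 1. The bound covers every
  upper limit x, so the result can serve as hypothesis for a second amplitude.\<close>

lemma monotone_amplitude:
 fixes h :: "real => complex" and A A' :: "real => real"
 assumes ch: "continuous_on {a..b} h" and B: "!!x. x \<in> {a..b} ==> norm (integral {a..x} h) <= B"
  and A: "!!x. x \<in> {a..b} ==> (A has_real_derivative A' x) (at x within {a..b})"
  and cA': "continuous_on {a..b} A'"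
  and A01: "!!x. x \<in> {a..b} ==> 0 <= A x & A x <= 1"
  and sgn: "(\<forall>x\<in>{a..b}. A' x >= 0) \<or> (\<forall>x\<in>{a..b}. A' x <= 0)"
  and x: "x \<in> {a..b}"
 shows "norm (integral {a..x} (%y. A y *\<^sub>R h y)) <= 2 * B"
proof -
 define H where "H y = integral {a..y} h" for y
 have ax: "a <= x" "{a..x} \<subseteq> {a..b}" using x by auto
 have B0: "B >= 0" using order_trans[OF norm_ge_zero B[OF x]] .
 have Hd: "(H has_vector_derivative h y) (at y within {a..x})" if "y \<in> {a..x}" for y
  unfolding H_def using integral_has_vector_derivative[of a x h y] continuous_on_subset[OF ch ax(2)] that by auto
 have Ad: "(A has_vector_derivative A' y) (at y within {a..x})" if "y \<in> {a..x}" for y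
  using A[of y] that ax has_real_derivative_iff_has_vector_derivative has_vector_derivative_within_subset by blast
 have cA: "continuous_on {a..x} A"
  using Ad by (meson continuous_on_eq_continuous_within has_vector_derivative_continuous)
 have cH: "continuous_on {a..x} H"
  using Hd by (meson continuous_on_eq_continuous_within has_vector_derivative_continuous)
 have AH: "((%y. A y *\<^sub>R h y + A' y *\<^sub>R H y) has_integral (A x *\<^sub>R H x - A a *\<^sub>R H a)) {a..x}"
  by (rule fundamental_theorem_of_calculus[OF ax(1)])
   (rule bounded_bilinear.has_vector_derivative[OF bounded_bilinear_scaleR Ad Hd])
 have cA'x: "continuous_on {a..x} A'" and chx: "continuous_on {a..x} h" using continuous_on_subset[OF cA' ax(2)] continuous_on_subset[OF ch ax(2)] by auto
 have i1: "(%y. A y *\<^sub>R h y) integrable_on {a..x}" and i2: "(%y. A' y *\<^sub>R H y) integrable_on {a..x}"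
  by (intro integrable_continuous_interval continuous_intros cA chx cA'x cH)+
 have H0: "H a = 0" by (simp add: H_def)
 have eq: "integral {a..x} (%y. A y *\<^sub>R h y) = A x *\<^sub>R H x - integral {a..x} (%y. A' y *\<^sub>R H y)"
  using integral_unique[OF AH] integral_add[OF i1 i2] H0 by (simp add: algebra_simps)
 have A'i: "(A' has_integral (A x - A a)) {a..x}"
  by (rule fundamental_theorem_of_calculus[OF ax(1) Ad])
 have HB: "norm (H y) <= B" if "y \<in> {a..x}" for y using B[of y] that ax by (auto simp: H_def)
 have "norm (integral {a..x} (%y. A' y *\<^sub>R H y)) <= B * \<bar>A x - A a\<bar>"
  using sgn
 proof
  assume s: "\<forall>x\<in>{a..b}. A' x >= 0"
  have "norm (integral {a..x} (%y. A' y *\<^sub>R H y)) <= integral {a..x} (%y. B * A' y)"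
  proof (intro integral_norm_bound_integral i2 integrable_on_mult_right has_integral_integrable[OF A'i])
   fix y assume y: "y \<in> {a..x}"
   have "A' y * norm (H y) <= A' y * B" using s y ax HB[OF y] by (intro mult_left_mono) auto
   thus "norm (A' y *\<^sub>R H y) <= B * A' y" using s y ax by (auto simp: mult.commute)
  qed
  also have "... = B * (A x - A a)" using integral_unique[OF has_integral_mult_right[OF A'i, of B]] .
  also have "... <= B * \<bar>A x - A a\<bar>" by (rule mult_left_mono[OF abs_ge_self B0])
  finally show ?thesis .
 next
  assume s: "\<forall>x\<in>{a..b}. A' x <= 0"
  have "norm (integral {a..x} (%y. A' y *\<^sub>R H y)) <= integral {a..x} (%y. - B * A' y)"
  proof (intro integral_norm_bound_integral i2 integrable_on_mult_right has_integral_integrable[OF A'i])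
   fix y assume y: "y \<in> {a..x}"
   have "- A' y * norm (H y) <= - A' y * B" using s y ax HB[OF y] by (intro mult_left_mono) auto
   thus "norm (A' y *\<^sub>R H y) <= - B * A' y" using s y ax by (auto simp: mult.commute)
  qed
  also have "... = - B * (A x - A a)" using integral_unique[OF has_integral_mult_right[OF A'i, of "-B"]] .
  also have "... <= B * \<bar>A x - A a\<bar>" using mult_left_mono[OF abs_ge_minus_self B0, of "A x - A a"] by (simp only: minus_mult_left[symmetric] minus_mult_right[symmetric])
  finally show ?thesis .
 qed
 also have "... <= B * 1" using A01[OF x] A01[of a] x B0 by (intro mult_left_mono) auto
 finally have 1: "norm (integral {a..x} (%y. A' y *\<^sub>R H y)) <= B" by simp
 have "norm (A x *\<^sub>R H x) <= 1 * B"
  unfolding norm_scaleR using A01[OF x] HB[of x] ax by (intro mult_mono) auto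
 thus ?thesis unfolding eq using 1 norm_triangle_ineq4[of "A x *\<^sub>R H x" "integral {a..x} (%y. A' y *\<^sub>R H y)"] by simp
qed

text \<open>Strong induction on the number of points of Z inside the interval: splitting at any one
  of them leaves fewer on both sides, and the number of pieces exceeds the number of points by
  one.\<close>

lemma integral_pieces:
 fixes f :: "real => complex"
 assumes Z: "finite Z" and fi: "!!c e. f integrable_on {c..e}"
  and piece: "!!c e. c <= e ==> {c<..<e} \<inter> Z = {} ==> norm (integral {c..e} f) <= E"
 shows "a <= b ==> norm (integral {a..b} f) <= real (card (Z \<inter> {a<..<b}) + 1) * E"
proof (induction "card (Z \<inter> {a<..<b})" arbitrary: a b rule: less_induct)
 case less
 show ?case
 proof (cases "Z \<inter> {a<..<b} = {}")
  case True thus ?thesis using piece[OF less.prems] by (auto simp: Int_commute)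
 next
  case False
  then obtain z where z: "z \<in> Z" "a < z" "z < b" by auto
  have eq: "Z \<inter> {a<..<b} = insert z ((Z \<inter> {a<..<z}) \<union> (Z \<inter> {z<..<b}))" using z by auto
  have c: "card (Z \<inter> {a<..<b}) = Suc (card (Z \<inter> {a<..<z}) + card (Z \<inter> {z<..<b}))"
  proof -
   have "card (Z \<inter> {a<..<z} \<union> Z \<inter> {z<..<b}) = card (Z \<inter> {a<..<z}) + card (Z \<inter> {z<..<b})"
    by (rule card_Un_disjoint) (use Z in auto)
   moreover have ni: "z \<notin> Z \<inter> {a<..<z} \<union> Z \<inter> {z<..<b}" and fin: "finite (Z \<inter> {a<..<z} \<union> Z \<inter> {z<..<b})" using Z by auto
   ultimately show ?thesis unfolding eq card_insert_disjoint[OF fin ni] by simp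
  qed
  have "norm (integral {a..b} f) <= norm (integral {a..z} f) + norm (integral {z..b} f)"
  proof -
   have "integral {a..b} f = integral {a..z} f + integral {z..b} f"
    using Henstock_Kurzweil_Integration.integral_combine[of a z b f] z fi by simp
   thus ?thesis by (simp only: norm_triangle_ineq)
  qed
  also have "... <= real (card (Z \<inter> {a<..<z}) + 1) * E + real (card (Z \<inter> {z<..<b}) + 1) * E"
  proof (rule add_mono)
   show "norm (integral {a..z} f) <= real (card (Z \<inter> {a<..<z}) + 1) * E"
    by (rule less.hyps) (use z c in linarith)+
   show "norm (integral {z..b} f) <= real (card (Z \<inter> {z<..<b}) + 1) * E"
    by (rule less.hyps) (use z c in linarith)+
  qed
  also have "... = real (card (Z \<inter> {a<..<b}) + 1) * E" unfolding c by (simp add: algebra_simps)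
  finally show ?thesis .
 qed
qed

text \<open>Values of both signs would force a zero strictly between them, by the intermediate value
  theorem. The hypothesis is conditional so that the zero polynomial is covered too.\<close>

lemma poly_weak_sign:
 fixes r :: "real poly"
 assumes "r ~= 0 ==> \<forall>x\<in>{c<..<e}. poly r x ~= 0"
 shows "(\<forall>x\<in>{c..e}. poly r x >= 0) \<or> (\<forall>x\<in>{c..e}. poly r x <= 0)"
proof (rule ccontr)
 assume "\<not> ?thesis"
 then obtain x y where xy: "x \<in> {c..e}" "y \<in> {c..e}" "poly r x < 0" "poly r y > 0" by (auto simp: not_le)
 hence "r ~= 0" "x ~= y" by auto
 have "\<exists>z\<in>{c<..<e}. poly r z = 0"
 proof (cases "x < y")
  case True
  from poly_IVT_pos[OF this xy(3,4)] obtain z where "x < z" "z < y" "poly r z = 0" by auto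
  thus ?thesis using xy(1,2) by (intro bexI[of _ z]) auto
 next
  case False
  hence "y < x" using \<open>x ~= y\<close> by simp
  from poly_IVT_neg[OF this xy(4,3)] obtain z where "y < z" "z < x" "poly r z = 0" by auto
  thus ?thesis using xy(1,2) by (intro bexI[of _ z]) auto
 qed
 with assms \<open>r ~= 0\<close> show False by blast
qed

text \<open>Both damping factors are monotone with values in [0, 1] on the piece, so
  \<open>monotone_amplitude\<close> applies twice and doubles the bound each time. The Gaussian is
  monotone because the piece lies on one side of 0.\<close>

lemma oscillatory_damped_piece:
 fixes ap bp :: "real poly"
 assumes ce: "c <= e" and eps: "eps >= 0"
  and B: "!!x. x \<in> {c..e} ==> norm (integral {c..x} (%x. cis (poly ap x))) <= B"
  and b0: "\<forall>x\<in>{c..e}. poly bp x >= 0"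
  and b': "(\<forall>x\<in>{c..e}. poly (pderiv bp) x >= 0) \<or> (\<forall>x\<in>{c..e}. poly (pderiv bp) x <= 0)"
  and z: "(\<forall>x\<in>{c..e}. x >= 0) \<or> (\<forall>x\<in>{c..e}. x <= 0)"
 shows "norm (integral {c..e} (%x. exp (- poly bp x) *\<^sub>R exp (- eps * x\<^sup>2 / 2) *\<^sub>R cis (poly ap x))) <= 4 * B"
proof -
 have 1: "norm (integral {c..x} (%x. exp (- eps * x\<^sup>2 / 2) *\<^sub>R cis (poly ap x))) <= 2 * B" if "x \<in> {c..e}" for x
 proof (rule monotone_amplitude[OF continuous_on_cis_poly B _ _ _ _ that])
  show "((%x. exp (- eps * x\<^sup>2 / 2)) has_real_derivative (- eps * x * exp (- eps * x\<^sup>2 / 2))) (at x within {c..e})" for x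
   by (auto intro!: derivative_eq_intros)
  show "continuous_on {c..e} (%x. - eps * x * exp (- eps * x\<^sup>2 / 2))" by (intro continuous_intros) simp
  show "(\<forall>x\<in>{c..e}. 0 <= - eps * x * exp (- eps * x\<^sup>2 / 2)) \<or> (\<forall>x\<in>{c..e}. - eps * x * exp (- eps * x\<^sup>2 / 2) <= 0)"
   using z eps by (auto simp: mult_le_0_iff zero_le_mult_iff)
 qed (use eps in auto)
 have "norm (integral {c..e} (%x. exp (- poly bp x) *\<^sub>R exp (- eps * x\<^sup>2 / 2) *\<^sub>R cis (poly ap x))) <= 2 * (2 * B)"
 proof (rule monotone_amplitude[where A="%x. exp (- poly bp x)" and A'="%x. - poly (pderiv bp) x * exp (- poly bp x)"
    and h="%x. exp (- eps * x\<^sup>2 / 2) *\<^sub>R cis (poly ap x)" and B="2 * B" and x=e and a=c and b=e, OF _ 1])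
  show "continuous_on {c..e} (%x. exp (- eps * x\<^sup>2 / 2) *\<^sub>R cis (poly ap x))" by (intro continuous_intros) simp
  show "((%x. exp (- poly bp x)) has_real_derivative (- poly (pderiv bp) x * exp (- poly bp x))) (at x within {c..e})" for x
   by (auto intro!: derivative_eq_intros DERIV_subset[OF poly_DERIV])
  show "continuous_on {c..e} (%x. - poly (pderiv bp) x * exp (- poly bp x))" by (intro continuous_intros)
  show "(\<forall>x\<in>{c..e}. 0 <= - poly (pderiv bp) x * exp (- poly bp x)) \<or> (\<forall>x\<in>{c..e}. - poly (pderiv bp) x * exp (- poly bp x) <= 0)"
   using b' by (auto simp: mult_le_0_iff zero_le_mult_iff)
 qed (use ce b0 in auto)
 thus ?thesis by simp
qed

text \<open>Cuts are placed at 0 and at the zeros of bp and its derivative: on each piece the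
  damping exponent keeps its sign and its monotonicity. There are at most 2n + 1 cuts, hence 2n + 2
  pieces, a number that depends on the degree alone. This makes the bound uniform in the
  coefficients of bp and in eps.\<close>

lemma oscillatory_damped:
 fixes ap bp :: "real poly" and S :: "real set"
 assumes eps: "eps >= 0" and l: "l >= 0"
  and B: "!!c e. c <= e ==> norm (integral {c..e} (%x. cis (poly ap x))) <= B"
  and deg: "degree bp <= n"
  and S: "S = {x. poly bp x > 0} \<or> S = {x. poly bp x >= 0}"
  and f: "f = (%x. if x \<in> S then exp (- poly bp x) *\<^sub>R exp (- eps * x\<^sup>2 / 2) *\<^sub>R cis (poly ap x) else 0)"
  and fi: "!!c e. f integrable_on {c..e}"
 shows "norm (integral {-l..l} f) <= real (2 * n + 2) * (4 * B)"
proof -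
 \<comment> \<open>The zero polynomial vanishes everywhere; it has constant sign and calls for no
   cuts.\<close>
 let ?R = "%r :: real poly. if r = 0 then {} else {x. poly r x = 0}"
 define Z where "Z = ?R bp \<union> ?R (pderiv bp) \<union> {0}"
 have finR: "finite (?R r)" for r using poly_roots_finite[of r] by auto
 have cardR: "card (?R r) <= degree r" for r
  using card_poly_roots_bound[of r] by (cases "r = 0") auto
 have finZ: "finite Z" using finR by (auto simp: Z_def)
 have "card Z <= card (?R bp) + card (?R (pderiv bp)) + card {0::real}"
  unfolding Z_def by (intro order_trans[OF card_Un_le] add_mono card_Un_le order_refl)
 also have "... <= n + n + 1"
  using cardR[of bp] cardR[of "pderiv bp"] deg degree_pderiv[of bp] by (intro add_mono) (auto intro: order_trans)
 finally have cardZ: "card Z <= 2 * n + 1" by simp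
 have B0: "B >= 0" using B[of 0 0] by simp
 have piece: "norm (integral {c..e} f) <= 4 * B" if ce: "c <= e" and Zce: "{c<..<e} \<inter> Z = {}" for c e
 proof -
  have nb: "\<forall>x\<in>{c<..<e}. poly bp x ~= 0" if "bp ~= 0" using Zce that by (auto simp: Z_def)
  have nb': "\<forall>x\<in>{c<..<e}. poly (pderiv bp) x ~= 0" if "pderiv bp ~= 0" using Zce that by (auto simp: Z_def)
  have z: "(\<forall>x\<in>{c..e}. x >= 0) \<or> (\<forall>x\<in>{c..e}. x <= 0)"
  proof -
   have "\<not> (c < 0 & 0 < e)" using Zce by (auto simp: Z_def)
   thus ?thesis by auto
  qed
  let ?g = "%x. exp (- poly bp x) *\<^sub>R exp (- eps * x\<^sup>2 / 2) *\<^sub>R cis (poly ap x)"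
  have "(\<forall>x\<in>{c<..<e}. f x = 0) \<or> ((\<forall>x\<in>{c..e}. poly bp x >= 0) & (\<forall>x\<in>{c<..<e}. f x = ?g x))"
  proof (cases "bp = 0")
   case True
   thus ?thesis using S by (auto simp: f)
  next
   case False
   from poly_weak_sign[of bp c e, OF nb] show ?thesis
   proof
    assume p: "\<forall>x\<in>{c..e}. poly bp x >= 0"
    have "x \<in> S" if "x \<in> {c<..<e}" for x
    proof -
     have "poly bp x > 0" using p nb[OF False] that by (simp add: order_less_le)
     thus ?thesis using S by auto
    qed
    thus ?thesis using p by (simp add: f)
   next
    assume p: "\<forall>x\<in>{c..e}. poly bp x <= 0"
    have "x \<notin> S" if "x \<in> {c<..<e}" for x
    proof -
     have "poly bp x < 0" using p nb[OF False] that by (simp add: order_less_le)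
     thus ?thesis using S by auto
    qed
    thus ?thesis by (simp add: f)
   qed
  qed
  thus ?thesis
  proof
   assume "\<forall>x\<in>{c<..<e}. f x = 0"
   hence "integral {c..e} f = integral {c..e} (%x. 0)"
    by (intro integral_spike[of "{c, e}"]) (auto simp: less_le)
   thus ?thesis using B0 by simp
  next
   assume *: "(\<forall>x\<in>{c..e}. poly bp x >= 0) & (\<forall>x\<in>{c<..<e}. f x = ?g x)"
   hence "integral {c..e} f = integral {c..e} ?g"
    by (intro integral_spike[of "{c, e}"]) (auto simp: less_le)
   moreover have "norm (integral {c..e} ?g) <= 4 * B"
    using * by (intro oscillatory_damped_piece ce eps B poly_weak_sign nb' z) auto
   ultimately show ?thesis by simp
  qed
 qed
 have "norm (integral {-l..l} f) <= real (card (Z \<inter> {-l<..<l}) + 1) * (4 * B)"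
  using l by (intro integral_pieces finZ fi piece) auto
 also have "... <= real (2 * n + 2) * (4 * B)"
 proof -
  have "card (Z \<inter> {-l<..<l}) <= card Z" by (intro card_mono finZ) auto
  thus ?thesis using cardZ B0 by (intro mult_right_mono) auto
 qed
 finally show ?thesis .
qed

lemma lebesgue_integral_bound_from_intervals:
 fixes f :: "real => complex"
 assumes f: "intble f" and B: "!!l. l >= 0 ==> norm (integral {-l..l} f) <= B"
 shows "norm (LBINT x. f x) <= B"
proof -
 have "(%n. LBINT x. indicator {- real n..real n} x *\<^sub>R f x) \<longlonglongrightarrow> (LBINT x. f x)"
 proof (rule integral_dominated_convergence[where w="%x. norm (f x)"])
  show "AE x in lborel. (%n. indicator {- real n..real n} x *\<^sub>R f x) \<longlonglongrightarrow> f x"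
  proof (rule AE_I2)
   fix x :: real
   obtain N where N: "\<bar>x\<bar> <= real N" using real_arch_simple by blast
   have "eventually (%n. indicator {- real n..real n} x *\<^sub>R f x = f x) sequentially"
    using eventually_ge_at_top[of N] by eventually_elim (use N in \<open>auto simp: indicator_def\<close>)
   thus "(%n. indicator {- real n..real n} x *\<^sub>R f x) \<longlonglongrightarrow> f x" by (rule tendsto_eventually)
  qed
 qed (use f in \<open>auto simp: indicator_def\<close>)
 hence lim: "(%n. norm (LBINT x. indicator {- real n..real n} x *\<^sub>R f x)) \<longlonglongrightarrow> norm (LBINT x. f x)"
  by (rule tendsto_norm)
 have eq: "(LBINT x. indicator {- real n..real n} x *\<^sub>R f x) = integral {- real n..real n} f" for n
  using set_borel_integral_eq_integral(2)[of "{- real n..real n}" f] integrable_mult_indicator[OF _ f, of "{- real n..real n}"]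
  by (simp add: set_lebesgue_integral_def set_integrable_def)
 show ?thesis
  by (rule Lim_bounded[OF lim, of 0]) (simp add: eq B)
qed

section \<open>Dispersive estimate for the conjugated propagator\<close>

lemma higher_pderiv_const:
 fixes p :: "real poly"
 shows "degree p <= n ==> (pderiv ^^ n) p = [:fact n * coeff p n:]"
proof (induction n arbitrary: p)
 case 0
 thus ?case by (auto elim: degree_eq_zeroE)
next
 case (Suc n)
 hence "degree (pderiv p) <= n" by (simp add: degree_pderiv)
 from Suc.IH[OF this] show ?case by (simp add: funpow_Suc_right coeff_pderiv mult_ac del: funpow.simps)
qed

text \<open>On the real line, taking real and imaginary parts of the coefficients separates damping
  and phase into real polynomials of no larger degree.\<close>

lemma poly_Re_Im:
 fixes p :: "complex poly"
 shows "poly (map_poly Re p) x = Re (poly p (cor x))"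
  and "poly (map_poly Im p) x = Im (poly p (cor x))"
  and "degree (map_poly Re p) <= degree p" and "degree (map_poly Im p) <= degree p"
proof -
 show "poly (map_poly Re p) x = Re (poly p (cor x))"
  by (induction p) (auto simp: map_poly_pCons)
 show "poly (map_poly Im p) x = Im (poly p (cor x))"
  by (induction p) (auto simp: map_poly_pCons)
 show "degree (map_poly Re p) <= degree p" "degree (map_poly Im p) <= degree p"
  by (auto intro!: degree_le simp: coeff_map_poly coeff_eq_0)
qed

text \<open>\<open>csym\<close> is the symbol of the equation conjugated with \<open>exp (al t + be x)\<close>; \<open>propag\<close> is its fundamental solution in time, chosen to decay
  forwards or backwards according to the sign of \<open>Re csym\<close>.\<close>
definition csym :: "nat => real => real => real => complex" where
 "csym m al be ks = \<i> * (cor ks - \<i> * cor be) ^ (2 * m) - cor al"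

definition propag :: "nat => real => real => real => real => complex" where
 "propag m al be r ks = (if r > 0 then (if Re (csym m al be ks) < 0 then exp (cor r * csym m al be ks) else 0)
  else (if Re (csym m al be ks) < 0 then 0 else - exp (cor r * csym m al be ks)))"

lemma propag_bounded: "norm (propag m al be r ks) <= 1"
 by (auto simp: propag_def mult_nonneg_nonpos mult_nonpos_nonneg)

lemma csym_measurable [measurable]: "csym m al be \<in> bmeas"
 unfolding csym_def[abs_def] by (intro borel_measurable_continuous_onI continuous_intros)

lemma propag_measurable [measurable]:
 assumes [measurable]: "f \<in> borel_measurable M" "g \<in> borel_measurable M"
 shows "(%z. propag m al be (f z) (g z)) \<in> borel_measurable M"
 unfolding propag_def by measurable

text \<open>As a function of the frequency, r * csym is a polynomial of degree n = 2m with leading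
  coefficient i r, whatever al and be are. Its imaginary part is the phase, with constant n-th
  derivative n! r, which the linear term x ks does not affect because n >= 2. Its real part is the
  damping treated in \<open>oscillatory_damped\<close>. Hence D depends on m only, neither on the
  weight nor on eps.\<close>

lemma dispersive_estimate:
 assumes m: "m >= 1"
 shows "EX D>0. ALL al be r eps x. r ~= 0 --> eps > 0 -->
  norm (fmult (%ks. propag m al be r ks * cor (exp (- eps * ks\<^sup>2 / 2))) x) <= D * \<bar>r\<bar> powr (- 1 / (2 * real m))"
proof -
 define n where "n = 2 * m"
 have n: "n >= 2" "n ~= 1" using m by (auto simp: n_def)
 obtain C where C: "C > 0" "!!(p :: real poly) a b mu. a <= b ==> mu > 0 ==>
  (\<forall>x\<in>{a..b}. poly ((pderiv ^^ n) p) x >= mu) \<or> (\<forall>x\<in>{a..b}. poly ((pderiv ^^ n) p) x <= - mu) ==>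
  norm (integral {a..b} (%x. cis (poly p x))) <= C * mu powr (- 1 / real n)"
  using van_der_Corput[OF n(1)] by blast
 define D where "D = real (2 * n + 2) * (4 * C)"
 have D: "D > 0" using C by (simp add: D_def)
 have main: "norm (fmult (%ks. propag m al be r ks * cor (exp (- eps * ks\<^sup>2 / 2))) x) <= D * \<bar>r\<bar> powr (- 1 / real n)"
  if r: "r ~= 0" and eps: "eps > 0" for al be r eps x :: real
 proof -
  define P where "P = smult \<i> ([:- \<i> * cor be, 1:] ^ n) - [:cor al:]"
  have Pc: "poly P (cor ks) = csym m al be ks" for ks
   by (simp add: P_def csym_def n_def poly_power algebra_simps)
  have degq: "degree ([:- \<i> * cor be, 1:] ^ n) = n" by (simp add: degree_power_eq)
  hence degP: "degree P <= n" unfolding P_def by (intro degree_diff_le) auto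
  have lead: "coeff ([:- \<i> * cor be, 1:] ^ n) n = 1"
   using degq lead_coeff_power[of "[:- \<i> * cor be, 1:]" n] by simp
  have Pn: "coeff P n = \<i>" using n lead by (simp add: P_def coeff_pCons split: nat.split)
  define bp where "bp = smult (- r) (map_poly Re P)"
  define ap where "ap = smult r (map_poly Im P) + [:0, x:]"
  have degb: "degree bp <= n" using poly_Re_Im(3)[of P] degP by (auto simp: bp_def)
  have dega: "degree ap <= n" unfolding ap_def
   using poly_Re_Im(4)[of P] degP n by (intro degree_add_le) (auto intro: order_trans[OF degree_smult_le] order_trans[OF degree_pCons_le])
  have "coeff ap n = r" using n Pn by (simp add: ap_def coeff_map_poly coeff_pCons split: nat.split)
  hence apn: "(pderiv ^^ n) ap = [:fact n * r:]" using higher_pderiv_const[OF dega] by simp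
  have fr: "fact n * \<bar>r\<bar> >= \<bar>r\<bar>" using fact_ge_1[of n, where 'a=real] mult_right_mono[of 1 "fact n" "\<bar>r\<bar>"] by simp
  have B: "norm (integral {c..e} (%x. cis (poly ap x))) <= C * \<bar>r\<bar> powr (- 1 / real n)" if "c <= e" for c e
  proof (rule C(2)[OF that])
   show "\<bar>r\<bar> > 0" using r by simp
   show "(\<forall>x\<in>{c..e}. poly ((pderiv ^^ n) ap) x >= \<bar>r\<bar>) \<or> (\<forall>x\<in>{c..e}. poly ((pderiv ^^ n) ap) x <= - \<bar>r\<bar>)"
    unfolding apn using fr by (cases "r > 0") auto
  qed
  define S where "S = (if r > 0 then {ks. poly bp ks > 0} else {ks. poly bp ks >= 0})"
  define f where "f = (%x. if x \<in> S then exp (- poly bp x) *\<^sub>R exp (- eps * x\<^sup>2 / 2) *\<^sub>R cis (poly ap x) else 0)"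
  let ?k = "%ks. propag m al be r ks * cor (exp (- eps * ks\<^sup>2 / 2))"
  define \<sigma> :: complex where "\<sigma> = (if r > 0 then 1 else - 1)"
  have fk: "?k ks * cis (x * ks) = \<sigma> * f ks" for ks
  proof -
   have e: "exp (cor r * csym m al be ks) * cis (x * ks) = exp (- poly bp ks) *\<^sub>R cis (poly ap ks)"
   proof -
    have "exp (cor r * csym m al be ks) = exp (r * Re (csym m al be ks)) *\<^sub>R cis (r * Im (csym m al be ks))"
     by (simp add: exp_eq_polar scaleR_conv_of_real exp_of_real)
    moreover have "- poly bp ks = r * Re (csym m al be ks)" "poly ap ks = r * Im (csym m al be ks) + x * ks"
     by (simp_all add: bp_def ap_def poly_Re_Im Pc)
    ultimately show ?thesis by (simp add: cis_mult)
   qed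
   have S': "ks \<in> S \<longleftrightarrow> (if r > 0 then Re (csym m al be ks) < 0 else \<not> Re (csym m al be ks) < 0)"
    using r by (auto simp: S_def bp_def poly_Re_Im Pc mult_less_0_iff mult_le_0_iff zero_le_mult_iff)
   have "?k ks * cis (x * ks) = (if ks \<in> S then \<sigma> * (exp (cor r * csym m al be ks) * cis (x * ks)) * cor (exp (- eps * ks\<^sup>2 / 2)) else 0)"
    unfolding propag_def S' \<sigma>_def by simp
   also have "... = \<sigma> * f ks" unfolding e f_def by (simp add: scaleR_conv_of_real mult_ac)
   finally show ?thesis .
  qed
  have ki: "intble ?k"
   by (rule Bochner_Integration.integrable_bound[OF gaussian_fourier(1)[OF eps]])
    (auto simp: norm_mult mult_left_le_one_le propag_bounded)
  have "intble (%ks. \<sigma> * (?k ks * cis (x * ks)))"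
   using integrable_cis_mult[OF ki, of x] by (simp add: mult.commute)
  moreover have "\<sigma> * (\<sigma> * z) = z" for z by (simp add: \<sigma>_def)
  ultimately have fint: "intble f" unfolding fk by simp
  have fi: "f integrable_on {c..e}" for c e
   using set_borel_integral_eq_integral(1)[of "{c..e}" f] integrable_mult_indicator[OF _ fint, of "{c..e}"]
   by (simp add: set_integrable_def)
  have "norm (LBINT ks. f ks) <= D * \<bar>r\<bar> powr (- 1 / real n)"
  proof (rule lebesgue_integral_bound_from_intervals[OF fint])
   fix l :: real assume l: "l >= 0"
   have "norm (integral {-l..l} f) <= real (2 * n + 2) * (4 * (C * \<bar>r\<bar> powr (- 1 / real n)))"
    by (rule oscillatory_damped[OF less_imp_le[OF eps] l B degb _ f_def fi]) (auto simp: S_def)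
   thus "norm (integral {-l..l} f) <= D * \<bar>r\<bar> powr (- 1 / real n)" by (simp only: D_def mult.assoc)
  qed
  moreover have "norm (fmult ?k x) <= norm (LBINT ks. f ks)"
  proof -
   have "norm (fmult ?k x) = 1 / (2 * pi) * norm (LBINT ks. f ks)"
    unfolding fmult_def fk by (simp add: norm_mult norm_divide \<sigma>_def)
   also have "... <= 1 * norm (LBINT ks. f ks)" using pi_gt3 by (intro mult_right_mono) auto
   finally show ?thesis by simp
  qed
  ultimately show ?thesis by linarith
 qed
 show ?thesis
  by (intro exI[of _ D] conjI allI impI D order_trans[OF main]) (simp_all add: n_def)
qed

section \<open>Uniform space-time estimate of Strichartz type\<close>

text \<open>Regroups a pair of times and a pair of positions into two space-time points, so that
  Fubini can integrate the positions for fixed times.\<close>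

definition swap_mid :: "(real \<times> real) \<times> (real \<times> real) => (real \<times> real) \<times> (real \<times> real)" where
 "swap_mid w = ((fst (fst w), fst (snd w)), (snd (fst w), snd (snd w)))"

lemma swap_mid_measurable [measurable]: "swap_mid \<in> bmeas"
 unfolding swap_mid_def[abs_def] by (intro borel_measurable_continuous_onI continuous_intros)

lemma nn_integral_swap_mid:
 assumes [measurable]: "F \<in> bmeas"
 shows "(NINT w. F (swap_mid w)) = (NINT w. F w)"
proof -
 have "(NINT w. F (swap_mid w)) = (NINT a. NINT b. NINT c. NINT d. F ((a, c), (b, d)))"
  by (simp add: nn_integral_R2 swap_mid_def)
 also have "... = (NINT a. NINT c. NINT b. NINT d. F ((a, c), (b, d)))"
  by (intro nn_integral_cong lborel_pair.Fubini') simp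
 also have "... = (NINT w. F w)"
  by (simp add: nn_integral_R2)
 finally show ?thesis .
qed

lemma integral_swap_mid:
 fixes F :: "(real \<times> real) \<times> (real \<times> real) => complex"
 assumes [measurable]: "F \<in> bmeas"
 shows "(LBINT w. F (swap_mid w)) = (LBINT w. F w)"
  and "intble F ==> intble (%w. F (swap_mid w))"
proof -
 have eq: "distr lborel borel swap_mid = lborel"
 proof (rule measure_eqI)
  fix A assume "A \<in> sets (distr lborel borel swap_mid)"
  hence [measurable]: "A \<in> sets borel" by simp
  have "emeasure (distr lborel borel swap_mid) A = (\<integral>\<^sup>+w. indicator A w \<partial>distr lborel borel swap_mid)" by simp
  also have "... = (NINT w. indicator A (swap_mid w))"
   by (rule nn_integral_distr) auto
  also have "... = emeasure lborel A" by (simp add: nn_integral_swap_mid)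
  finally show "emeasure (distr lborel borel swap_mid) A = emeasure lborel A" .
 qed simp
 have "(\<integral>w. F w \<partial>distr lborel borel swap_mid) = (LBINT w. F (swap_mid w))"
  by (rule integral_distr) auto
 thus "(LBINT w. F (swap_mid w)) = (LBINT w. F w)" by (simp add: eq)
 assume "intble F"
 hence "integrable (distr lborel borel swap_mid) F" by (simp add: eq)
 thus "intble (%w. F (swap_mid w))"
  by (subst (asm) integrable_distr_eq) auto
qed

text \<open>The Gaussian makes the multiplier integrable, which a propagator of modulus 1 is not.
  The decisive bounds are uniform in eps; only qualitative facts such as boundedness of the kernel
  depend on it.\<close>

definition kern :: "nat => real => real => real => real => real => complex" where
 "kern m al be eps r x = fmult (%ks. propag m al be r ks * cor (exp (- eps * ks\<^sup>2 / 2))) x"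

lemma kern_measurable [measurable]:
 assumes [measurable]: "f \<in> borel_measurable M" "g \<in> borel_measurable M"
 shows "(%z. kern m al be eps (f z) (g z)) \<in> borel_measurable M"
 unfolding kern_def fmult_def by measurable

lemma propag_gauss_integrable:
 assumes eps: "eps > 0"
 shows "intble (%ks. propag m al be r ks * cor (exp (- eps * ks\<^sup>2 / 2)))"
 by (rule Bochner_Integration.integrable_bound[OF gaussian_fourier(1)[OF eps]])
  (auto simp: norm_mult mult_left_le_one_le propag_bounded)

lemma propag_gauss_bounded:
 assumes eps: "eps > 0"
 shows "norm (propag m al be r ks * cor (exp (- eps * ks\<^sup>2 / 2))) <= 1"
proof -
 have "norm (propag m al be r ks) * exp (- eps * ks\<^sup>2 / 2) <= 1 * 1"
  using eps by (intro mult_mono propag_bounded) auto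
 thus ?thesis by (simp add: norm_mult)
qed

lemma kern_bounded:
 assumes eps: "eps > 0"
 shows "norm (kern m al be eps r x) <= sqrt (2 * pi / eps)"
proof -
 have "norm (kern m al be eps r x) <= (LBINT ks. norm (propag m al be r ks * cor (exp (- eps * ks\<^sup>2 / 2))))"
  unfolding kern_def by (rule fmult_bounded[OF propag_gauss_integrable[OF eps]])
 also have "... <= (LBINT ks. exp (- eps * ks\<^sup>2 / 2))"
  using propag_gauss_integrable[OF eps] gaussian_fourier(1)[OF eps]
  by (intro integral_mono integrable_norm) (auto simp: norm_mult mult_left_le_one_le propag_bounded complex_of_real_integrable_eq)
 also have "cor (LBINT ks. exp (- eps * ks\<^sup>2 / 2)) = cor (sqrt (2 * pi / eps))"
  using gaussian_fourier(2)[OF eps, of 0] by (simp add: integral_complex_of_real[symmetric] del: integral_complex_of_real)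
 hence "(LBINT ks. exp (- eps * ks\<^sup>2 / 2)) = sqrt (2 * pi / eps)" by (simp only: of_real_eq_iff)
 finally show ?thesis .
qed

definition Bil2 :: "(real \<times> real => complex) => (real \<times> real => complex) => (real \<times> real => complex) => complex" where
 "Bil2 K h g = (LBINT w. h (fst w) * K (fst w - snd w) * g (snd w))"

lemma Bil2_integrable:
 fixes h g K :: "real \<times> real => complex"
 assumes h: "intble h" and g: "intble g" and [measurable]: "K \<in> bmeas"
  and K: "!!x. norm (K x) <= M"
 shows "intble (%z. h (fst z) * K (fst z - snd z) * g (snd z))"
proof (rule integrable_prod_dominated[of "%x. M *\<^sub>R h x" g])
 have [measurable]: "h \<in> bmeas" "g \<in> bmeas" using h g by auto
 show "(%z. h (fst z) * K (fst z - snd z) * g (snd z)) \<in> bmeas" by measurable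
 have M: "M >= 0" using order_trans[OF norm_ge_zero K] .
 fix x y show "norm (h (fst (x, y)) * K (fst (x, y) - snd (x, y)) * g (snd (x, y))) <= norm (M *\<^sub>R h x) * norm (g y)"
  using mult_right_mono[OF K, of "norm (h x) * norm (g y)" "x - y"] M by (simp add: norm_mult mult_ac)
qed (use h g in auto)

lemma Bil2_time_slices:
 assumes h: "intble h" and g: "intble g"
  and [measurable]: "(%z. K (fst z) (snd z)) \<in> borel_measurable (borel :: (real \<times> real) measure)"
  and K: "!!r x. norm (K r x) <= M"
 shows "ennreal (norm (Bil2 (%z. K (fst z) (snd z)) h g)) <=
  (NINT t. NINT s. norm (Bil (K (t - s)) (%x. h (t, x)) (%y. g (s, y))))"
proof -
 have [measurable]: "h \<in> bmeas" "g \<in> bmeas" using h g by auto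
 define F where "F w = h (fst w) * K (fst (fst w) - fst (snd w)) (snd (fst w) - snd (snd w)) * g (snd w)" for w
 have mK[measurable]: "(%w :: (real \<times> real) \<times> (real \<times> real). K (P w) (Q w)) \<in> bmeas"
  if "P \<in> bmeas" "Q \<in> bmeas" for P Q
  using measurable_compose[OF _ assms(3), of "%w. (P w, Q w)" borel] that by simp
 have [measurable]: "F \<in> bmeas" unfolding F_def by measurable
 have Feq: "Bil2 (%z. K (fst z) (snd z)) h g = (LBINT w. F w)"
  by (simp add: Bil2_def F_def)
 have "intble F"
  using Bil2_integrable[OF h g assms(3) K] by (simp add: F_def[abs_def])
 hence Fi: "intble (%w. F (swap_mid w))" by (intro integral_swap_mid(2)) simp_all
 hence Fi': "integrable (lborel \<Otimes>\<^sub>M lborel) (%w. F (swap_mid w))" by (simp add: lborel_prod)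
 have inner: "(LBINT y. F (swap_mid (p, y))) = Bil (K (fst p - snd p)) (%x. h (fst p, x)) (%y. g (snd p, y))" for p
  by (simp add: F_def swap_mid_def Bil_def)
 have eq: "Bil2 (%z. K (fst z) (snd z)) h g = (LBINT p. Bil (K (fst p - snd p)) (%x. h (fst p, x)) (%y. g (snd p, y)))"
  unfolding Feq integral_swap_mid(1)[OF \<open>F \<in> bmeas\<close>, symmetric]
  using lborel_pair.integral_fst'[OF Fi'] by (simp add: lborel_prod inner)
 have [measurable]: "(%p. Bil (K (fst p - snd p)) (%x. h (fst p, x)) (%y. g (snd p, y))) \<in> bmeas"
 proof -
  have "(%p. LBINT y. F (swap_mid (p, y))) \<in> bmeas" by measurable
  thus ?thesis unfolding inner .
 qed
 have "ennreal (norm (Bil2 (%z. K (fst z) (snd z)) h g)) <= (NINT p. norm (Bil (K (fst p - snd p)) (%x. h (fst p, x)) (%y. g (snd p, y))))"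
  unfolding eq by (rule norm_integral_le_nn_integral)
 thus ?thesis by (simp add: nn_integral_R2)
qed

text \<open>\<open>enn2real\<close> turns an infinite slice norm into 0. This happens only on a null
  set of times, so the slice norms still control h.\<close>

lemma AE_slice_norms:
 fixes h :: "real \<times> real => complex"
 assumes h: "intble h" and hn: "(NINT z. norm (h z) powr q) <= 1"
 shows "AE t in lborel. intble (%x. h (t, x)) & (NINT x. norm (h (t, x)) powr q) < \<infinity>"
  and "(NINT t. ennreal (enn2real (NINT x. norm (h (t, x)) powr q))) <= 1"
proof -
 have [measurable]: "h \<in> bmeas" using h by auto
 have 1: "AE t in lborel. intble (%x. h (t, x))"
  using lborel_pair.AE_integrable_fst'[of h] h by (simp add: lborel_prod)
 have le: "(NINT t. NINT x. norm (h (t, x)) powr q) <= 1"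
  using hn by (simp add: nn_integral_R2)
 hence "AE t in lborel. (NINT x. norm (h (t, x)) powr q) ~= \<infinity>"
  by (intro nn_integral_PInf_AE) (auto simp: top_unique dest: order_trans)
 with 1 show "AE t in lborel. intble (%x. h (t, x)) & (NINT x. norm (h (t, x)) powr q) < \<infinity>"
  by eventually_elim (auto simp: less_top)
 have "(NINT t. ennreal (enn2real (NINT x. norm (h (t, x)) powr q))) <= (NINT t. NINT x. norm (h (t, x)) powr q)"
  by (intro nn_integral_mono) (simp add: ennreal_enn2real_if)
 with le show "(NINT t. ennreal (enn2real (NINT x. norm (h (t, x)) powr q))) <= 1" by (rule order_trans[rotated])
qed

text \<open>The constant is quantified before the weight, the regularisation and the functions.
  \<open>C1\<close> collects interpolation in x and the dispersive constant; the other factor is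
  Hardy-Littlewood-Sobolev in t, applied to the L^q norms of the time slices.\<close>

lemma strichartz:
 assumes m: "m >= 1" and k: "ka = 1 / (2 * real m + 1)" and q: "q = 2 / (2 - ka)"
 shows "EX C>0. ALL al be eps h g. eps > 0 --> intble h --> intble g -->
  (NINT z. norm (h z) powr q) <= 1 --> (NINT z. norm (g z) powr q) <= 1 -->
  norm (Bil2 (%z. kern m al be eps (fst z) (snd z)) h g) <= C"
proof -
 have k01: "0 < ka" "ka < 1" using m by (auto simp: k)
 have q12: "1 < q" "q < 2" using k01 by (auto simp: q field_simps)
 obtain D where D: "D > 0" and disp: "!!al be r eps x. r ~= 0 ==> eps > 0 ==>
  norm (kern m al be eps r x) <= D * \<bar>r\<bar> powr (- 1 / (2 * real m))"
  using dispersive_estimate[OF m] unfolding kern_def by blast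
 define C1 where "C1 = (1 / (1 - q / 2) + 1) * D powr (2 / q - 1)"
 have C1: "C1 > 0" using q12 D by (simp add: C1_def add_pos_pos)
 define C where "C = C1 * (4 / (1 - ka) + 6)"
 have C: "C > 0" using C1 k01 by (simp add: C_def add_pos_pos)
 have ex: "2 / q - 1 = 1 - ka" using k01 by (simp add: q field_simps)
 \<comment> \<open>The identity that determines ka: the interpolated dispersive power has to be the
   power for which Hardy-Littlewood-Sobolev holds with the same q.\<close>
 have ex2: "- 1 / (2 * real m) * (1 - ka) = - ka" using m by (simp add: k field_simps)
 have main: "norm (Bil2 (%z. kern m al be eps (fst z) (snd z)) h g) <= C"
  if eps: "eps > 0" and h: "intble h" and g: "intble g"
   and hn: "(NINT z. norm (h z) powr q) <= 1" and gn: "(NINT z. norm (g z) powr q) <= 1"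
  for al be eps h g
 proof -
  have [measurable]: "h \<in> bmeas" "g \<in> bmeas" using h g by auto
  define a where "a t = enn2real (NINT x. norm (h (t, x)) powr q)" for t
  define b where "b t = enn2real (NINT x. norm (g (t, x)) powr q)" for t
  have [measurable]: "a \<in> bmeas" "b \<in> bmeas" unfolding a_def b_def by measurable
  have slice: "norm (Bil (kern m al be eps (t - s)) (%x. h (t, x)) (%y. g (s, y))) <= C1 * (a t powr (1/q) * b s powr (1/q) * \<bar>t - s\<bar> powr - ka)"
   if ht: "intble (%x. h (t, x)) & (NINT x. norm (h (t, x)) powr q) < \<infinity>"
    and gs: "intble (%x. g (s, x)) & (NINT x. norm (g (s, x)) powr q) < \<infinity>"
    and ts: "t ~= s" for t s
  proof -
   let ?M = "D * \<bar>t - s\<bar> powr (- 1 / (2 * real m))"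
   have M: "?M > 0" using D ts by simp
   have "norm (Bil (kern m al be eps (t - s)) (%x. h (t, x)) (%y. g (s, y)))
    <= (1 / (1 - q / 2) + 1) * ?M powr (2 / q - 1) * (a t powr (1/q) * b s powr (1/q))"
    unfolding kern_def
   proof (rule interpolation[OF _ _ propag_gauss_integrable[OF eps] propag_gauss_bounded[OF eps] M _ q12])
    show "norm (fmult (%ks. propag m al be (t - s) ks * cor (exp (- eps * ks\<^sup>2 / 2))) x) <= ?M" for x
     using disp[of "t - s" eps al be x] ts eps by (simp add: kern_def)
   qed (use ht gs in \<open>simp_all add: a_def b_def\<close>)
   also have "?M powr (2 / q - 1) = D powr (2 / q - 1) * \<bar>t - s\<bar> powr - ka"
    using D ex2 by (simp add: powr_mult powr_powr ex)
   finally show ?thesis by (simp add: C1_def mult_ac)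
  qed
  have A: "AE t in lborel. intble (%x. h (t, x)) & (NINT x. norm (h (t, x)) powr q) < \<infinity>"
   by (rule AE_slice_norms(1)[OF h hn])
  have B: "AE t in lborel. intble (%x. g (t, x)) & (NINT x. norm (g (t, x)) powr q) < \<infinity>"
   by (rule AE_slice_norms(1)[OF g gn])
  have "ennreal (norm (Bil2 (%z. kern m al be eps (fst z) (snd z)) h g))
   <= (NINT t. NINT s. norm (Bil (kern m al be eps (t - s)) (%x. h (t, x)) (%y. g (s, y))))"
   by (rule Bil2_time_slices[OF h g _ kern_bounded[OF eps]]) measurable
  also have "... <= (NINT t. NINT s. ennreal C1 * ennreal (a t powr (1/q) * b s powr (1/q) * \<bar>t - s\<bar> powr - ka))"
   using A
  proof (intro nn_integral_mono_AE, eventually_elim)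
   case (elim t)
   note ht = elim(2)
   have "AE s in lborel. ennreal (norm (Bil (kern m al be eps (t - s)) (%x. h (t, x)) (%y. g (s, y))))
    <= ennreal C1 * ennreal (a t powr (1/q) * b s powr (1/q) * \<bar>t - s\<bar> powr - ka)"
    using B AE_lborel_singleton[of t]
   proof eventually_elim
    case (elim s)
    have "norm (Bil (kern m al be eps (t - s)) (%x. h (t, x)) (%y. g (s, y))) <= C1 * (a t powr (1/q) * b s powr (1/q) * \<bar>t - s\<bar> powr - ka)"
     by (rule slice[OF ht elim(1)]) (use elim(2) in simp)
    from ennreal_leI[OF this] show ?case using C1 by (simp add: ennreal_mult')
   qed
   thus ?case by (rule nn_integral_mono_AE)
  qed
  also have "... = ennreal C1 * (NINT t. NINT s. ennreal (a t powr (1/q) * b s powr (1/q) * \<bar>t - s\<bar> powr - ka))"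
   by (simp add: nn_integral_cmult)
  also have "... <= ennreal C1 * ennreal (4 / (1 - ka) + 6)"
  proof (intro mult_left_mono HLS_normalised[OF _ _ _ _ k01 q])
   have pw: "(a t powr (1/q)) powr q = a t" "(b t powr (1/q)) powr q = b t" for t
    using q12 by (simp_all add: powr_powr a_def b_def)
   show "(NINT t. ennreal ((a t powr (1/q)) powr q)) <= 1"
    unfolding pw unfolding a_def by (rule AE_slice_norms(2)[OF h hn])
   show "(NINT t. ennreal ((b t powr (1/q)) powr q)) <= 1"
    unfolding pw unfolding b_def by (rule AE_slice_norms(2)[OF g gn])
  qed auto
  also have "... = ennreal C" using C1 by (simp add: C_def ennreal_mult')
  finally show ?thesis using C by (subst (asm) ennreal_le_iff) auto
 qed
 show ?thesis by (intro exI[of _ C] conjI allI impI C main)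
qed

section \<open>Duality and Hoelder's inequality\<close>

text \<open>Converse Hoelder inequality. As only bounded test functions of bounded support are
  available, W is truncated to the set where both z and W z are bounded by n, the extremal function
  of the truncation is tested, and Fatou removes the truncation. Finiteness of the norm is part of
  the conclusion.\<close>

lemma Lp_duality:
 fixes W :: "'a::euclidean_space => complex" and p q N :: real
 assumes [measurable]: "W \<in> bmeas" and p: "p > 1" and q: "q = p / (p - 1)" and N: "N >= 0"
  and dual: "!!g M R. g \<in> bmeas ==> (!!z. norm (g z) <= M) ==> (!!z. norm z > R ==> g z = 0) ==>
   (NINT z. norm (g z) powr q) <= 1 ==> norm (LBINT z. W z * g z) <= N"
 shows "(NINT z. norm (W z) powr p) <= ennreal (N powr p)"
proof -
 have q1: "q > 1" using p by (simp add: q field_simps)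
 define E where "E n = {z :: 'a. norm z <= real n & norm (W z) <= real n}" for n :: nat
 have [measurable]: "E n \<in> sets borel" for n unfolding E_def by measurable
 let ?f = "%n z. norm (W z) powr p * indicator (E n) z"
 have fin: "intble (?f n)" for n
 proof (rule integrableI_bounded_set[where A="cball 0 (real n)" and B="real n powr p"])
  show "emeasure lborel (cball (0::'a) (real n)) < \<infinity>" by (rule emeasure_lborel_cball_finite)
  show "AE z in lborel. z \<in> cball 0 (real n) --> norm (?f n z) <= real n powr p"
   using p by (auto simp: indicator_def E_def intro!: powr_mono2)
  show "AE z in lborel. z \<notin> cball 0 (real n) --> ?f n z = 0"
   by (auto simp: indicator_def E_def)
 qed auto
 have bound: "(NINT z. ?f n z) <= ennreal (N powr p)" for n
 proof -
  define A where "A = (LBINT z. ?f n z)"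
  have A0: "A >= 0" unfolding A_def by (intro Bochner_Integration.integral_nonneg) auto
  have Aeq: "(NINT z. ?f n z) = ennreal A"
   unfolding A_def by (intro nn_integral_eq_integral fin) auto
  have "A <= N powr p"
  proof (cases "A = 0")
   case False
   with A0 have A: "A > 0" by simp
   \<comment> \<open>The extremal function of Hoelder's inequality, normalised in L^q; its phase
     makes W * g real and nonnegative.\<close>
   define g where "g z = (A powr (- 1 / q) * norm (W z) powr (p - 1) * indicator (E n) z) *\<^sub>R cnj (sgn (W z))" for z
   have [measurable]: "(%z. cnj (sgn (W z))) \<in> bmeas"
    unfolding sgn_eq by measurable
   have [measurable]: "g \<in> bmeas" unfolding g_def by measurable
   have ng: "norm (g z) = A powr (- 1 / q) * norm (W z) powr (p - 1) * indicator (E n) z" for z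
    by (cases "W z = 0") (auto simp: g_def norm_sgn)
   have Wg: "W z * g z = cor (A powr (- 1 / q) * ?f n z)" for z
   proof (cases "W z = 0")
    case False
    have "W z * cnj (sgn (W z)) = cor (norm (W z))"
     using False complex_norm_square[of "W z"] by (simp add: sgn_eq power2_eq_square field_simps)
    moreover have "W z * g z = (W z * cnj (sgn (W z))) * cor (A powr (- 1 / q) * norm (W z) powr (p - 1) * indicator (E n) z)"
     unfolding g_def scaleR_conv_of_real by (simp only: mult_ac)
    ultimately have "W z * g z = cor (norm (W z) * (A powr (- 1 / q) * norm (W z) powr (p - 1) * indicator (E n) z))"
     by (simp only: of_real_mult)
    also have "norm (W z) * (A powr (- 1 / q) * norm (W z) powr (p - 1) * indicator (E n) z) = A powr (- 1 / q) * ?f n z"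
     using False by (simp add: powr_diff)
    finally show ?thesis .
   qed (simp add: g_def)
   have "norm (LBINT z. W z * g z) <= N"
   proof (rule dual)
    show "norm (g z) <= A powr (- 1 / q) * real n powr (p - 1)" for z
     unfolding ng using p by (auto simp: indicator_def E_def intro!: mult_left_mono powr_mono2)
    show "g z = 0" if "norm z > real n" for z using that by (auto simp: g_def E_def)
    have "norm (g z) powr q = (1 / A) * ?f n z" for z
    proof -
     have "norm (g z) powr q = A powr (- 1 / q * q) * norm (W z) powr ((p - 1) * q) * indicator (E n) z"
      unfolding ng using A by (auto simp: indicator_def powr_mult powr_powr)
     moreover have "(p - 1) * q = p" using p by (simp add: q)
     moreover have "- 1 / q * q = - 1" using q1 by simp
     ultimately show ?thesis using A by (simp add: powr_minus divide_inverse)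
    qed
    hence "(NINT z. norm (g z) powr q) = (NINT z. ennreal (1 / A) * ennreal (?f n z))"
     using A by (intro nn_integral_cong) (simp only: ennreal_mult' zero_le_divide_1_iff less_imp_le)
    also have "... = ennreal (1 / A) * ennreal A" by (subst nn_integral_cmult) (auto simp: Aeq)
    also have "... = 1" using A by (simp flip: ennreal_mult')
    finally show "(NINT z. norm (g z) powr q) <= 1" by simp
   qed simp
   also have "(LBINT z. W z * g z) = cor (A powr (- 1 / q) * A)"
    unfolding Wg A_def integral_complex_of_real by simp
   also have "A powr (- 1 / q) * A = A powr (1 / p)"
   proof -
    have "A powr (- 1 / q) * A = A powr (- 1 / q + 1)" using A by (simp only: powr_add) simp
    also have "- 1 / q + 1 = 1 / p" using p by (simp add: q field_simps)
    finally show ?thesis .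
   qed
   finally have "A powr (1 / p) <= N" by simp
   hence "(A powr (1 / p)) powr p <= N powr p" using p by (intro powr_mono2) auto
   thus ?thesis using A p by (simp add: powr_powr)
  qed simp
  thus ?thesis unfolding Aeq by (rule ennreal_leI)
 qed
 have "(NINT z. norm (W z) powr p) = (NINT z. liminf (%n. ennreal (?f n z)))"
 proof (intro nn_integral_cong lim_imp_Liminf[symmetric])
  fix z
  obtain k where k: "max (norm z) (norm (W z)) <= real k" using real_arch_simple by blast
  have "eventually (%n. ennreal (?f n z) = ennreal (norm (W z) powr p)) sequentially"
   using eventually_ge_at_top[of k] by eventually_elim (use k in \<open>auto simp: E_def indicator_def\<close>)
  thus "(%n. ennreal (?f n z)) \<longlonglongrightarrow> ennreal (norm (W z) powr p)" by (rule tendsto_eventually)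
 qed simp
 also have "... <= liminf (%n. NINT z. ?f n z)" by (rule nn_integral_liminf) simp
 also have "... <= ennreal (N powr p)" by (intro Liminf_le always_eventually allI bound) simp
 finally show ?thesis .
qed

text \<open>Young's inequality applied to W / N and g; after integration the coefficients 1/p and
  1/q add up to 1.\<close>

lemma Holder_normalised:
 fixes W g :: "'a => complex"
 assumes [measurable]: "W \<in> borel_measurable M" "g \<in> borel_measurable M"
  and p: "p > 1" and q: "q = p / (p - 1)" and N: "N > 0"
  and W: "(\<integral>\<^sup>+z. norm (W z) powr p \<partial>M) <= ennreal (N powr p)" and g: "(\<integral>\<^sup>+z. norm (g z) powr q \<partial>M) <= 1"
 shows "(\<integral>\<^sup>+z. norm (W z * g z) \<partial>M) <= ennreal N"
proof -
 have q1: "q > 1" using p by (simp add: q field_simps)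
 have conj: "1 / p + 1 / q = 1" using p by (simp add: q field_simps)
 have pt: "ennreal (norm (W z * g z)) <= ennreal (N / (p * N powr p)) * ennreal (norm (W z) powr p) + ennreal (N / q) * ennreal (norm (g z) powr q)" for z
 proof -
  have "(norm (W z) / N) * norm (g z) <= (norm (W z) / N) powr p / p + norm (g z) powr q / q"
   using N by (intro Youngs_inequality p q1 conj) auto
  hence "N * ((norm (W z) / N) * norm (g z)) <= N * ((norm (W z) / N) powr p / p + norm (g z) powr q / q)"
   using N by (intro mult_left_mono) auto
  hence "norm (W z * g z) <= N / (p * N powr p) * norm (W z) powr p + N / q * norm (g z) powr q"
   using N by (simp add: norm_mult powr_divide algebra_simps)
  thus ?thesis using N p q1 by (simp add: ennreal_leI flip: ennreal_mult' ennreal_plus)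
 qed
 have "(\<integral>\<^sup>+z. norm (W z * g z) \<partial>M) <= (\<integral>\<^sup>+z. ennreal (N / (p * N powr p)) * ennreal (norm (W z) powr p) + ennreal (N / q) * ennreal (norm (g z) powr q) \<partial>M)"
  by (intro nn_integral_mono pt)
 also have "... = ennreal (N / (p * N powr p)) * (\<integral>\<^sup>+z. norm (W z) powr p \<partial>M) + ennreal (N / q) * (\<integral>\<^sup>+z. norm (g z) powr q \<partial>M)"
  by (simp add: nn_integral_add nn_integral_cmult)
 also have "... <= ennreal (N / (p * N powr p)) * ennreal (N powr p) + ennreal (N / q) * 1"
  using W g by (intro add_mono mult_left_mono) auto
 also have "... = ennreal (N / (p * N powr p) * N powr p + N / q)"
  using N p q1 by (simp add: ennreal_plus flip: ennreal_mult')
 also have "N / (p * N powr p) * N powr p + N / q = N * (1 / p + 1 / q)" using N by (simp add: algebra_simps)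
 finally show ?thesis by (simp add: conj)
qed

section \<open>Differentiation and continuity of parameter integrals\<close>

lemma has_vector_derivative_at_iff_tendsto_quotient:
 fixes f :: "real => 'a::real_normed_vector"
 shows "(f has_vector_derivative D) (at s0) \<longleftrightarrow> ((%s. (f s - f s0) /\<^sub>R (s - s0)) \<longlongrightarrow> D) (at s0)"
proof -
 have eq: "norm (f y - f s0 - (y - s0) *\<^sub>R D) / norm (y - s0) = norm ((f y - f s0) /\<^sub>R (y - s0) - D)" if "y ~= s0" for y
 proof -
  have "(f y - f s0) /\<^sub>R (y - s0) - D = (f y - f s0 - (y - s0) *\<^sub>R D) /\<^sub>R (y - s0)"
   using that by (simp add: scaleR_diff_right)
  thus ?thesis by (simp add: divide_inverse mult.commute)
 qed
 have "(f has_vector_derivative D) (at s0) \<longleftrightarrow> ((%y. norm (f y - f s0 - (y - s0) *\<^sub>R D) / norm (y - s0)) \<longlongrightarrow> 0) (at s0)"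
  unfolding has_vector_derivative_def has_derivative_iff_norm by (simp add: bounded_linear_scaleR_left)
 also have "... \<longleftrightarrow> ((%y. norm ((f y - f s0) /\<^sub>R (y - s0) - D)) \<longlongrightarrow> 0) (at s0)"
  by (intro filterlim_cong refl) (use eq in \<open>auto simp: eventually_at_filter intro!: always_eventually\<close>)
 also have "... \<longleftrightarrow> ((%s. (f s - f s0) /\<^sub>R (s - s0)) \<longlongrightarrow> D) (at s0)"
  by (simp add: tendsto_norm_zero_iff LIM_zero_iff)
 finally show ?thesis .
qed

text \<open>Dominated convergence for difference quotients; the mean value inequality turns the
  bound on F' into a Lipschitz bound. Domination is asked only within distance 1 of s0, so the
  majorant may depend on the point.\<close>

lemma has_vector_derivative_integral:
 fixes F F' :: "real => 'b => complex"
 assumes D: "!!s y. ((%s. F s y) has_vector_derivative F' s y) (at s)"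
  and int: "!!s. integrable M (F s)" and meas: "F' s0 \<in> borel_measurable M"
  and w: "integrable M w" and dom: "!!s y. \<bar>s - s0\<bar> <= 1 ==> norm (F' s y) <= w y"
 shows "integrable M (F' s0)" and "((%s. \<integral>y. F s y \<partial>M) has_vector_derivative (\<integral>y. F' s0 y \<partial>M)) (at s0)"
proof -
 have nn: "0 <= w y" for y using order_trans[OF norm_ge_zero dom[of s0 y]] by simp
 show "integrable M (F' s0)"
 proof (rule Bochner_Integration.integrable_bound[OF w meas AE_I2])
  show "norm (F' s0 y) <= norm (w y)" for y using dom[of s0 y] nn[of y] by simp
 qed
 have lip: "norm (F s y - F s0 y) <= w y * \<bar>s - s0\<bar>" if s: "\<bar>s - s0\<bar> <= 1" for s y
 proof -
  let ?S = "{s. \<bar>s - s0\<bar> <= 1}"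
  have S: "?S = {s0 - 1..s0 + 1}" by auto
  have "norm (F s y - F s0 y) <= w y * norm (s - s0)"
  proof (rule differentiable_bound[where S="?S" and f'="%s h. h *\<^sub>R F' s y"])
   show "convex ?S" unfolding S by simp
   show "((%s. F s y) has_derivative (%h. h *\<^sub>R F' x y)) (at x within ?S)" for x
    using D[of y x] has_derivative_at_withinI unfolding has_vector_derivative_def by blast
   show "onorm (%h. h *\<^sub>R F' x y) <= w y" if "x \<in> ?S" for x
   proof (rule onorm_le)
    fix h :: real
    have "norm (F' x y) <= w y" using that by (intro dom) simp
    from mult_right_mono[OF this, of "\<bar>h\<bar>"] show "norm (h *\<^sub>R F' x y) <= w y * norm h"
     by (simp add: mult.commute)
   qed
  qed (use s in auto)
  thus ?thesis by simp
 qed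
 have "((%s. ((\<integral>y. F s y \<partial>M) - (\<integral>y. F s0 y \<partial>M)) /\<^sub>R (s - s0)) \<longlongrightarrow> (\<integral>y. F' s0 y \<partial>M)) (at s0)"
  unfolding tendsto_at_iff_sequentially
 proof (intro allI impI)
  fix X :: "nat => real" assume X: "ALL i. X i \<in> UNIV - {s0}" "X \<longlonglongrightarrow> s0"
  have "eventually (%n. \<bar>X n - s0\<bar> <= 1) sequentially"
   using X(2)[THEN tendstoD, of 1] by (auto simp: dist_real_def elim!: eventually_mono)
  then obtain N where N: "!!n. n >= N ==> \<bar>X n - s0\<bar> <= 1" by (auto simp: eventually_sequentially)
  define Y where "Y n = X (n + N)" for n
  have Y: "!!n. Y n ~= s0" "Y \<longlonglongrightarrow> s0" "!!n. \<bar>Y n - s0\<bar> <= 1"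
   using X(1) N LIMSEQ_ignore_initial_segment[OF X(2), of N] unfolding Y_def[abs_def] by auto
  let ?q = "%n y. (F (Y n) y - F s0 y) /\<^sub>R (Y n - s0)"
  have "(%n. \<integral>y. ?q n y \<partial>M) \<longlonglongrightarrow> (\<integral>y. F' s0 y \<partial>M)"
  proof (rule integral_dominated_convergence[where w=w])
   show "AE y in M. (%n. ?q n y) \<longlonglongrightarrow> F' s0 y"
   proof (rule AE_I2)
    fix y
    have "((%s. (F s y - F s0 y) /\<^sub>R (s - s0)) \<longlongrightarrow> F' s0 y) (at s0)"
     using D[of y s0] by (simp add: has_vector_derivative_at_iff_tendsto_quotient)
    thus "(%n. ?q n y) \<longlonglongrightarrow> F' s0 y"
     unfolding tendsto_at_iff_sequentially using Y(1,2) by (auto simp: o_def)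
   qed
   show "AE y in M. norm (?q n y) <= w y" for n
   proof (rule AE_I2)
    fix y
    have "norm (?q n y) = norm (F (Y n) y - F s0 y) / \<bar>Y n - s0\<bar>" by (simp add: divide_inverse mult.commute)
    also have "... <= (w y * \<bar>Y n - s0\<bar>) / \<bar>Y n - s0\<bar>" using lip[OF Y(3)] by (intro divide_right_mono) auto
    finally show "norm (?q n y) <= w y" using Y(1)[of n] by simp
   qed
  next
   show "(%y. ?q n y) \<in> borel_measurable M" for n
    using int[of "Y n"] int[of s0] by simp
  qed (use meas w in simp_all)
  hence "(%n. ((\<integral>y. F (Y n) y \<partial>M) - (\<integral>y. F s0 y \<partial>M)) /\<^sub>R (Y n - s0)) \<longlonglongrightarrow> (\<integral>y. F' s0 y \<partial>M)"
   using int by (simp add: Bochner_Integration.integral_diff)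
  hence "(%n. ((%s. ((\<integral>y. F s y \<partial>M) - (\<integral>y. F s0 y \<partial>M)) /\<^sub>R (s - s0)) \<circ> X) (n + N)) \<longlonglongrightarrow> (\<integral>y. F' s0 y \<partial>M)"
   by (simp add: Y_def o_def)
  thus "((%s. ((\<integral>y. F s y \<partial>M) - (\<integral>y. F s0 y \<partial>M)) /\<^sub>R (s - s0)) \<circ> X) \<longlonglongrightarrow> (\<integral>y. F' s0 y \<partial>M)"
   by (rule LIMSEQ_offset)
 qed
 thus "((%s. \<integral>y. F s y \<partial>M) has_vector_derivative (\<integral>y. F' s0 y \<partial>M)) (at s0)"
  by (simp add: has_vector_derivative_at_iff_tendsto_quotient)
qed

lemma continuous_on_integral:
 fixes F :: "'a::metric_space => 'b => complex"
 assumes c: "!!y. continuous_on UNIV (%z. F z y)" and meas: "!!z. F z \<in> borel_measurable M"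
  and dom: "!!z0. EX w. integrable M w & (ALL z y. dist z z0 <= 1 --> norm (F z y) <= w y)"
 shows "continuous_on UNIV (%z. \<integral>y. F z y \<partial>M)"
 unfolding continuous_on_sequentially
proof (intro allI ballI impI)
 fix X :: "nat => 'a" and z0 assume "(ALL n. X n \<in> UNIV) & X \<longlonglongrightarrow> z0"
 hence X: "X \<longlonglongrightarrow> z0" by simp
 from dom[of z0] obtain w where "integrable M w & (ALL z y. dist z z0 <= 1 --> norm (F z y) <= w y)" ..
 hence w: "integrable M w" "!!z y. dist z z0 <= 1 ==> norm (F z y) <= w y" by simp_all
 have "eventually (%n. dist (X n) z0 <= 1) sequentially"
  using X[THEN tendstoD, of 1] by (auto elim!: eventually_mono)
 then obtain N where N: "!!n. n >= N ==> dist (X n) z0 <= 1" by (auto simp: eventually_sequentially)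
 have "(%n. \<integral>y. F (X (n + N)) y \<partial>M) \<longlonglongrightarrow> (\<integral>y. F z0 y \<partial>M)"
 proof (rule integral_dominated_convergence[where w=w])
  show "AE y in M. (%n. F (X (n + N)) y) \<longlonglongrightarrow> F z0 y"
  proof (rule AE_I2)
   fix y
   have "(%n. F (X n) y) \<longlonglongrightarrow> F z0 y"
    by (rule continuous_on_tendsto_compose[OF c X]) simp_all
   thus "(%n. F (X (n + N)) y) \<longlonglongrightarrow> F z0 y" by (rule LIMSEQ_ignore_initial_segment)
  qed
  show "AE y in M. norm (F (X (n + N)) y) <= w y" for n by (rule AE_I2, rule w(2), rule N) simp
 qed (use meas w(1) in simp_all)
 thus "((%z. \<integral>y. F z y \<partial>M) \<circ> X) \<longlonglongrightarrow> (\<integral>y. F z0 y \<partial>M)"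
  by - (rule LIMSEQ_offset[of _ N], simp add: o_def)
qed

section \<open>Smoothness through families closed under differentiation, and a bump function\<close>

definition has_partials :: "(R2 => complex) => (R2 => complex) => (R2 => complex) => bool" where
 "has_partials f ft fx \<longleftrightarrow> continuous_on UNIV f &
  (ALL t x. ((%s. f (s, x)) has_vector_derivative ft (t, x)) (at t)) &
  (ALL t x. ((%y. f (t, y)) has_vector_derivative fx (t, x)) (at x))"

lemma has_partialsD:
 assumes "has_partials f ft fx"
 shows "dT f = ft" "dX f = fx" "continuous_on UNIV f"
  "((%s. f (s, x)) has_vector_derivative ft (t, x)) (at t)" "((%y. f (t, y)) has_vector_derivative fx (t, x)) (at x)"
 using assms by (auto simp: has_partials_def dT_def dX_def fun_eq_iff intro!: vector_derivative_at)

text \<open>If every member of a set has both partials in the same set, all iterated derivatives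
  stay in it. A proof of smoothness then amounts to naming such a set, without computing higher
  derivatives.\<close>

lemma smooth2_coinduct:
 assumes f: "f \<in> \<S>" and S: "!!f. f \<in> \<S> ==> \<exists>ft\<in>\<S>. \<exists>fx\<in>\<S>. has_partials f ft fx"
 shows "smooth2 f"
proof -
 have w: "pd w f \<in> \<S>" for w
 proof (induction w)
  case (Cons b w)
  then obtain ft fx where "ft \<in> \<S>" "fx \<in> \<S>" "has_partials (pd w f) ft fx" using S by blast
  thus ?case by (auto dest: has_partialsD(1,2))
 qed (use f in simp)
 show ?thesis unfolding smooth2_def
 proof (intro allI conjI)
  fix w t x
  obtain ft fx where *: "has_partials (pd w f) ft fx" using S[OF w] by blast
  show "continuous_on UNIV (pd w f)" using has_partialsD(3)[OF *] .
  show "(%s. pd w f (s, x)) differentiable at t" using has_partialsD(4)[OF *] by (rule differentiableI_vector)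
  show "(%y. pd w f (t, y)) differentiable at x" using has_partialsD(5)[OF *] by (rule differentiableI_vector)
 qed
qed

lemma smooth2_has_partials:
 assumes "smooth2 f" shows "has_partials f (dT f) (dX f)" "smooth2 (dT f)" "smooth2 (dX f)"
proof -
 have d: "(%s. f (s, x)) differentiable at t" "(%y. f (t, y)) differentiable at x" "continuous_on UNIV f" for t x
  using assms[unfolded smooth2_def, rule_format, of "[]"] by auto
 thus "has_partials f (dT f) (dX f)"
  by (auto simp: has_partials_def dT_def dX_def vector_derivative_works[symmetric])
 have app: "pd w (pd v f) = pd (w @ v) f" for w v by (induction w) auto
 have s: "smooth2 (pd v f)" for v unfolding smooth2_def app using assms unfolding smooth2_def by blast
 from s[of "[True]"] s[of "[False]"] show "smooth2 (dT f)" "smooth2 (dX f)" by simp_all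
qed

lemma has_partials_mult:
 assumes f: "has_partials f ft fx" and g: "has_partials g gt gx"
 shows "has_partials (%z. f z * g z) (%z. f z * gt z + ft z * g z) (%z. f z * gx z + fx z * g z)"
 unfolding has_partials_def
 using has_partialsD(3-5)[OF f] has_partialsD(3-5)[OF g]
 by (auto intro!: continuous_intros has_vector_derivative_mult)

lemma has_partials_add:
 assumes f: "has_partials f ft fx" and g: "has_partials g gt gx"
 shows "has_partials (%z. f z + g z) (%z. ft z + gt z) (%z. fx z + gx z)"
 unfolding has_partials_def
 using has_partialsD(3-5)[OF f] has_partialsD(3-5)[OF g]
 by (auto intro!: continuous_intros has_vector_derivative_add)

text \<open>The product rule leads from products to sums of products of smooth functions; this
  family is closed under it and serves for \<open>smooth2_mult\<close>.\<close>

inductive_set prodsums :: "(R2 => complex) set" where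
 prod: "smooth2 f ==> smooth2 g ==> (%z. f z * g z) \<in> prodsums"
| add: "f \<in> prodsums ==> g \<in> prodsums ==> (%z. f z + g z) \<in> prodsums"

lemma smooth2_mult:
 assumes "smooth2 f" "smooth2 g"
 shows "smooth2 (%z. f z * g z)"
proof (rule smooth2_coinduct[OF prodsums.prod[OF assms]])
 fix h assume "h \<in> prodsums"
 thus "\<exists>ht\<in>prodsums. \<exists>hx\<in>prodsums. has_partials h ht hx"
 proof induction
  case (prod f g)
  note f = smooth2_has_partials[OF prod(1)] and g = smooth2_has_partials[OF prod(2)]
  show ?case
   by (rule bexI, rule bexI, rule has_partials_mult[OF f(1) g(1)])
    (intro prodsums.add prodsums.prod prod f(2,3) g(2,3))+
 next
  case (add f g)
  from add.IH obtain ft fx gt gx where "ft \<in> prodsums" "fx \<in> prodsums" "gt \<in> prodsums" "gx \<in> prodsums"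
   and fg: "has_partials f ft fx" "has_partials g gt gx" by blast
  thus ?case
   by - (rule bexI, rule bexI, rule has_partials_add[OF fg], (intro prodsums.add; assumption)+)
 qed
qed

lemma fun_eq_pairI: "(!!t x. f (t, x) = g (t, x)) ==> f = g"
 by (auto simp: fun_eq_iff)

text \<open>The index k counts derivatives on the first factor. This factor will be the cutoff, so k
  = 0 isolates the one term without a commutator.\<close>

lemma dX_leibniz:
 assumes f: "smooth2 f" and g: "smooth2 g"
 shows "(dX ^^ n) (%z. f z * g z) = (%z. \<Sum>k\<le>n. of_nat (n choose k) * (dX ^^ k) f z * (dX ^^ (n - k)) g z)"
proof (induction n)
 case (Suc n)
 have sm: "smooth2 ((dX ^^ k) h)" if "smooth2 h" for h k by (induction k) (auto simp: that smooth2_has_partials)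
 have D: "((%y. (dX ^^ k) h (t, y)) has_vector_derivative (dX ^^ Suc k) h (t, x)) (at x)" if "smooth2 h" for h k t x
  using has_partialsD(5)[OF smooth2_has_partials(1)[OF sm[OF that]]] by simp
 have "dX (%z. \<Sum>k\<le>n. of_nat (n choose k) * (dX ^^ k) f z * (dX ^^ (n - k)) g z) (t, x) =
   (\<Sum>k\<le>Suc n. of_nat (Suc n choose k) * (dX ^^ k) f (t, x) * (dX ^^ (Suc n - k)) g (t, x))" for t x
 proof -
  let ?F = "%k. (dX ^^ k) f (t, x)" and ?G = "%k. (dX ^^ k) g (t, x)"
  have "((%y. \<Sum>k\<le>n. of_nat (n choose k) * ((dX ^^ k) f (t, y) * (dX ^^ (n - k)) g (t, y))) has_vector_derivative
    (\<Sum>k\<le>n. of_nat (n choose k) * (?F k * ?G (Suc (n - k)) + ?F (Suc k) * ?G (n - k)))) (at x)"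
   by (intro has_vector_derivative_sum has_vector_derivative_mult_right has_vector_derivative_mult D f g)
  hence "dX (%z. \<Sum>k\<le>n. of_nat (n choose k) * (dX ^^ k) f z * (dX ^^ (n - k)) g z) (t, x) =
    (\<Sum>k\<le>n. of_nat (n choose k) * (?F k * ?G (Suc (n - k)) + ?F (Suc k) * ?G (n - k)))"
   unfolding dX_def by (simp add: vector_derivative_at mult.assoc)
  also have "... = (\<Sum>k\<le>n. of_nat (n choose k) * (?F k * ?G (Suc n - k))) + (\<Sum>k\<le>n. of_nat (n choose k) * (?F (Suc k) * ?G (n - k)))"
   by (simp add: sum.distrib distrib_left Suc_diff_le)
  also have "(\<Sum>k\<le>n. of_nat (n choose k) * (?F k * ?G (Suc n - k))) = ?F 0 * ?G (Suc n) + (\<Sum>k\<le>n. of_nat (n choose Suc k) * (?F (Suc k) * ?G (n - k)))"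
  proof -
   have "(\<Sum>k\<le>n. of_nat (n choose k) * (?F k * ?G (Suc n - k))) = (\<Sum>k\<le>Suc n. of_nat (n choose k) * (?F k * ?G (Suc n - k)))" by simp
   also have "... = ?F 0 * ?G (Suc n) + (\<Sum>k\<le>n. of_nat (n choose Suc k) * (?F (Suc k) * ?G (n - k)))"
    by (subst sum.atMost_Suc_shift) simp
   finally show ?thesis .
  qed
  also have "... + (\<Sum>k\<le>n. of_nat (n choose k) * (?F (Suc k) * ?G (n - k))) = ?F 0 * ?G (Suc n) + (\<Sum>k\<le>n. of_nat (Suc n choose Suc k) * (?F (Suc k) * ?G (n - k)))"
   by (simp add: sum.distrib distrib_right)
  also have "... = (\<Sum>k\<le>Suc n. of_nat (Suc n choose k) * (?F k * ?G (Suc n - k)))"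
   by (subst sum.atMost_Suc_shift) simp
  finally show ?thesis by (simp only: mult.assoc)
 qed
 hence "dX (%z. \<Sum>k\<le>n. of_nat (n choose k) * (dX ^^ k) f z * (dX ^^ (n - k)) g z) =
   (%z. \<Sum>k\<le>Suc n. of_nat (Suc n choose k) * (dX ^^ k) f z * (dX ^^ (Suc n - k)) g z)"
  by (rule fun_eq_pairI)
 thus ?case by (simp only: funpow.simps o_apply Suc.IH)
qed simp

text \<open>The factor \<open>poly p (1 / x)\<close> makes this family closed under differentiation.\<close>
definition expinv :: "real poly => real => real" where
 "expinv p x = (if x > 0 then poly p (1 / x) * exp (- 1 / x) else 0)"

lemma expinv_tendsto_0: "((expinv p) \<longlongrightarrow> 0) (at 0)"
proof -
 have "((%y. poly p y * exp (- y)) \<longlongrightarrow> 0) at_top"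
 proof -
  have "((%y. y ^ i * exp (- y)) \<longlongrightarrow> (0::real)) at_top" for i
   using tendsto_power_div_exp_0[of i] by (simp add: exp_minus divide_inverse)
  hence "((%y. \<Sum>i\<le>degree p. coeff p i * (y ^ i * exp (- y))) \<longlongrightarrow> (\<Sum>i\<le>degree p. coeff p i * 0)) at_top"
   by (intro tendsto_intros)
  thus ?thesis by (simp add: poly_altdef sum_distrib_right mult.assoc)
 qed
 hence "((%x. poly p (inverse x) * exp (- inverse x)) \<longlongrightarrow> 0) (at_right 0)"
  by (rule filterlim_compose[OF _ filterlim_inverse_at_top_right])
 hence r: "((expinv p) \<longlongrightarrow> 0) (at_right 0)"
  by (rule Lim_transform_eventually) (auto simp: expinv_def eventually_at_filter divide_inverse intro!: always_eventually)
 have l: "((expinv p) \<longlongrightarrow> 0) (at_left 0)"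
  by (rule tendsto_eventually) (auto simp: expinv_def eventually_at_filter)
 from l r show ?thesis by (simp add: filterlim_split_at)
qed

text \<open>In the variable y = 1/x differentiation acts on p as y^2 (p - p'). At 0 the difference
  quotient is again in the family, with p multiplied by y, and tends to 0.\<close>

lemma expinv_deriv:
 "((expinv p) has_real_derivative expinv ([:0, 0, 1:] * (p - pderiv p)) x) (at x)"
proof -
 consider "x > 0" | "x < 0" | "x = 0" by linarith
 thus ?thesis
 proof cases
  case 1
  have "((%x. poly p (1 / x) * exp (- 1 / x)) has_real_derivative expinv ([:0, 0, 1:] * (p - pderiv p)) x) (at x)"
   using 1 by (auto intro!: derivative_eq_intros DERIV_chain2[OF poly_DERIV] simp: expinv_def field_simps power2_eq_square)
  thus ?thesis
   by (rule has_field_derivative_transform_within_open[where S="{0<..}"]) (use 1 in \<open>auto simp: expinv_def\<close>)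
 next
  case 2
  have "((%x. 0) has_real_derivative expinv ([:0, 0, 1:] * (p - pderiv p)) x) (at x)"
   using 2 by (auto simp: expinv_def)
  thus ?thesis
   by (rule has_field_derivative_transform_within_open[where S="{..<0}"]) (use 2 in \<open>auto simp: expinv_def\<close>)
 next
  case 3
  have "((%y. (expinv p y - expinv p 0) / (y - 0)) \<longlongrightarrow> 0) (at 0)"
  proof -
   have "(%y. (expinv p y - expinv p 0) / (y - 0)) = expinv (pCons 0 p)"
    by (auto simp: expinv_def fun_eq_iff)
   thus ?thesis using expinv_tendsto_0 by simp
  qed
  thus ?thesis using 3 by (simp add: has_field_derivative_iff expinv_def)
 qed
qed

text \<open>The whole sequence of derivatives is carried along, each with its own bound: the bounds
  are what the commutators with a scaled cutoff need.\<close>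

definition is_bump :: "(nat => real => real) => bool" where
 "is_bump b \<longleftrightarrow> (ALL k x. (b k has_real_derivative b (Suc k) x) (at x)) & (ALL k x. \<bar>x\<bar> > 1 --> b k x = 0) &
  b 0 0 = 1 & (ALL x. \<bar>b 0 x\<bar> <= 1) & (ALL k. EX C. ALL x. \<bar>b k x\<bar> <= C)"

lemma is_bump_exists: "EX b. is_bump b"
proof -
 \<comment> \<open>A product of two one-sided flat functions, vanishing outside (-1, 1). Derivatives
   are sums of products of this kind, represented by lists of polynomial pairs on which
   \<open>step\<close> differentiates formally.\<close>
 define T :: "(real poly \<times> real poly) => real => real" where
  "T pq x = expinv (fst pq) (1 - x) * expinv (snd pq) (1 + x)" for pq x
 let ?D = "%p :: real poly. [:0, 0, 1:] * (p - pderiv p)"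
 define step where "step L = concat (map (%pq. [(- ?D (fst pq), snd pq), (fst pq, ?D (snd pq))]) L)" for L
 define e where "e = expinv 1 1 * expinv 1 1"
 have e: "e > 0" by (simp add: e_def expinv_def)
 define b where "b k x = (\<Sum>pq\<leftarrow>(step ^^ k) [(1, 1)]. T pq x) / e" for k x
 have neg: "expinv (- p) x = - expinv p x" for p x by (simp add: expinv_def)
 have dT: "(T pq has_real_derivative (T (- ?D (fst pq), snd pq) x + T (fst pq, ?D (snd pq)) x)) (at x)" for pq x
 proof -
  have 1: "((%x. expinv (fst pq) (1 - x)) has_real_derivative (expinv (?D (fst pq)) (1 - x) * - 1)) (at x)"
   by (rule DERIV_chain2[OF expinv_deriv]) (auto intro!: derivative_eq_intros)
  have 2: "((%x. expinv (snd pq) (1 + x)) has_real_derivative (expinv (?D (snd pq)) (1 + x) * 1)) (at x)"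
   by (rule DERIV_chain2[OF expinv_deriv]) (auto intro!: derivative_eq_intros)
  have eq: "T pq = (%x. expinv (fst pq) (1 - x) * expinv (snd pq) (1 + x))" by (simp add: T_def fun_eq_iff)
  show ?thesis unfolding eq
   by (rule DERIV_cong[OF DERIV_mult[OF 1 2]]) (simp add: T_def neg del: mult_pCons_left)
 qed
 have dL: "((%x. \<Sum>pq\<leftarrow>L. T pq x) has_real_derivative (\<Sum>pq\<leftarrow>step L. T pq x)) (at x)" for L x
 proof (induction L)
  case (Cons pq L)
  have "((%x. T pq x + (\<Sum>pq\<leftarrow>L. T pq x)) has_real_derivative ((T (- ?D (fst pq), snd pq) x + T (fst pq, ?D (snd pq)) x) + (\<Sum>pq\<leftarrow>step L. T pq x))) (at x)"
   by (rule DERIV_add[OF dT Cons])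
  thus ?case by (simp add: step_def add.assoc del: mult_pCons_left)
 qed (simp add: step_def)
 have D: "(b k has_real_derivative b (Suc k) x) (at x)" for k x
  unfolding b_def[abs_def] using DERIV_cdivide[OF dL[of "(step ^^ k) [(1, 1)]" x], of e] by simp
 moreover have Z: "b k x = 0" if "\<bar>x\<bar> > 1" for k x
 proof -
  have "T pq x = 0" for pq using that by (auto simp: T_def expinv_def)
  thus ?thesis by (simp add: b_def)
 qed
 moreover have "b 0 0 = 1" by (simp add: b_def T_def e_def expinv_def)
 moreover have "EX C. ALL x. \<bar>b k x\<bar> <= C" for k
 proof -
  have "continuous_on {-1..1} (b k)" by (intro continuous_at_imp_continuous_on ballI DERIV_isCont[OF D])
  hence "bounded (b k ` {-1..1})" by (intro compact_imp_bounded compact_continuous_image) auto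
  then obtain C where C: "\<forall>x\<in>{-1..1}. \<bar>b k x\<bar> <= C" by (auto simp: bounded_iff)
  have "\<bar>b k x\<bar> <= max C 0" for x
  proof (cases "x \<in> {-1..1}")
   case True
   hence "\<bar>b k x\<bar> <= C" using C by blast
   thus ?thesis by simp
  next
   case False
   hence "\<bar>x\<bar> > 1" by auto
   thus ?thesis using Z[of x k] by simp
  qed
  thus ?thesis by blast
 qed
 moreover have "\<bar>b 0 x\<bar> <= 1" for x
 proof (cases "\<bar>x\<bar> < 1")
  case True
  hence x: "1 - x > 0" "1 + x > 0" by auto
  \<comment> \<open>The tangent line of 1/a at a = 1. Applied to 1 - x and 1 + x, it shows that the
    exponent of the bump is largest at x = 0, where the normalisation gives the value 1.\<close>
  have inv: "2 - a <= 1 / a" if "a > 0" for a :: real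
  proof -
   have "(2 - a) * a <= 1" using zero_le_power2[of "a - 1"] by (simp add: power2_eq_square algebra_simps)
   thus ?thesis by (subst pos_le_divide_eq[OF that])
  qed
  have "- 1 / (1 - x) + - 1 / (1 + x) <= - 1 + - 1" using inv[OF x(1)] inv[OF x(2)] by simp
  hence "exp (- 1 / (1 - x)) * exp (- 1 / (1 + x)) <= exp (- 1) * exp (- 1 :: real)"
   by (simp flip: exp_add)
  thus ?thesis using x by (simp add: b_def T_def e_def expinv_def)
 next
  case False
  hence "T pq x = 0" for pq by (auto simp: T_def expinv_def)
  thus ?thesis by (simp add: b_def)
 qed
 ultimately have "is_bump b" unfolding is_bump_def by blast
 thus ?thesis by (intro exI)
qed

definition bump :: "nat => real => real" where "bump = (SOME b. is_bump b)"

lemma bump: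
 "(bump k has_real_derivative bump (Suc k) x) (at x)" "\<bar>x\<bar> > 1 ==> bump k x = 0"
 "bump 0 0 = 1" "\<bar>bump 0 x\<bar> <= 1" "EX C. ALL x. \<bar>bump k x\<bar> <= C"
proof -
 have "is_bump bump" unfolding bump_def by (rule someI_ex[OF is_bump_exists])
 thus "(bump k has_real_derivative bump (Suc k) x) (at x)" "\<bar>x\<bar> > 1 ==> bump k x = 0"
  "bump 0 0 = 1" "\<bar>bump 0 x\<bar> <= 1" "EX C. ALL x. \<bar>bump k x\<bar> <= C"
  unfolding is_bump_def by blast+
qed

section \<open>Polynomials times Gaussians\<close>

lemma integrable_exp_neg_abs: "intble (%t::real. exp (- \<bar>t\<bar>))"
proof -
 have "((%x. exp (- 1 * x)) has_integral exp (- 1 * 0) / 1) {0::real..}"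
  by (rule has_integral_exp_minus_to_infinity) simp
 hence "(NINT x. ennreal (exp (- 1 * x)) * indicator {0::real..} x) = ennreal (exp (- 1 * 0) / 1)"
  by (intro nn_integral_has_integral_lebesgue') simp_all
 moreover have "(NINT x. ennreal (exp (- \<bar>x\<bar>))) = 2 * (NINT x. ennreal (exp (- 1 * x)) * indicator {0::real..} x)"
  by (subst nn_integral_even_cong_2) (auto simp: indicator_def intro!: arg_cong[where f="%x. 2 * x"] nn_integral_cong)
 ultimately show ?thesis by (intro integrableI_nonneg) (auto simp: ennreal_mult_less_top)
qed

text \<open>Polynomial times a Gaussian of variance e. Differentiation stays in this family and acts
  on the polynomial through \<open>gpD\<close>, which makes all later derivatives algebraic.\<close>

definition gp :: "real => complex poly => real => complex" where
 "gp e p t = poly p (cor t) * cor (exp (- t\<^sup>2 / (2 * e)))"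

definition gpD :: "real => complex poly => complex poly" where
 "gpD e p = pderiv p - smult (cor (1 / e)) (pCons 0 p)"

lemma gp_continuous [continuous_intros]: "continuous_on S f ==> continuous_on S (%x. gp e p (f x))"
 unfolding gp_def divide_inverse by (intro continuous_intros)

lemma gp_measurable [measurable]: "gp e p \<in> bmeas"
 by (intro borel_measurable_continuous_onI continuous_intros)

lemma gp_bound:
 assumes e: "e > 0"
 shows "EX C>=0. ALL t. norm (gp e p t) <= C * exp (- \<bar>t\<bar>)"
proof -
 define d where "d = real (degree p)"
 define A where "A = (\<Sum>i\<le>degree p. norm (coeff p i))"
 have A: "A >= 0" by (simp add: A_def sum_nonneg)
 show ?thesis
 proof (intro exI[of _ "A * exp ((d + 1)\<^sup>2 * e / 2)"] conjI allI)
  fix t :: real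
  have "norm (poly p (cor t)) <= (\<Sum>i\<le>degree p. norm (coeff p i * cor t ^ i))"
   unfolding poly_altdef by (rule norm_sum)
  also have "... <= (\<Sum>i\<le>degree p. norm (coeff p i) * exp (d * \<bar>t\<bar>))"
  proof (rule sum_mono)
   fix i assume i: "i \<in> {..degree p}"
   have "\<bar>t\<bar> <= exp \<bar>t\<bar>" using exp_ge_add_one_self[of "\<bar>t\<bar>"] by linarith
   hence "\<bar>t\<bar> ^ i <= exp \<bar>t\<bar> ^ i" by (intro power_mono) auto
   also have "... = exp (real i * \<bar>t\<bar>)" by (simp add: exp_of_nat_mult)
   also have "... <= exp (d * \<bar>t\<bar>)" using i by (auto simp: d_def intro!: mult_right_mono)
   finally show "norm (coeff p i * cor t ^ i) <= norm (coeff p i) * exp (d * \<bar>t\<bar>)"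
    by (simp add: norm_mult norm_power mult_left_mono)
  qed
  also have "... = A * exp (d * \<bar>t\<bar>)" by (simp add: A_def sum_distrib_right)
  finally have 1: "norm (poly p (cor t)) <= A * exp (d * \<bar>t\<bar>)" .
  have "d * \<bar>t\<bar> - t\<^sup>2 / (2 * e) <= (d + 1)\<^sup>2 * e / 2 - \<bar>t\<bar>"
  proof -
   \<comment> \<open>Completing the square with slope d + 1: d pays for the growth of the polynomial
     and 1 for the exponential decay in the claim.\<close>
   have "0 <= (\<bar>t\<bar> - (d + 1) * e)\<^sup>2 / (2 * e)" using e by simp
   also have "... = t\<^sup>2 / (2 * e) - (d + 1) * \<bar>t\<bar> + (d + 1)\<^sup>2 * e / 2"
    using e by (simp add: power2_eq_square field_simps)
   finally show ?thesis by (simp add: algebra_simps)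
  qed
  hence 2: "exp (d * \<bar>t\<bar>) * exp (- t\<^sup>2 / (2 * e)) <= exp ((d + 1)\<^sup>2 * e / 2) * exp (- \<bar>t\<bar>)"
   by (simp flip: exp_add)
  have "norm (gp e p t) = norm (poly p (cor t)) * exp (- t\<^sup>2 / (2 * e))" by (simp add: gp_def norm_mult)
  also have "... <= A * exp (d * \<bar>t\<bar>) * exp (- t\<^sup>2 / (2 * e))" using 1 by (intro mult_right_mono) auto
  also have "... <= A * (exp ((d + 1)\<^sup>2 * e / 2) * exp (- \<bar>t\<bar>))"
   using mult_left_mono[OF 2 A] by (simp only: mult.assoc)
  finally show "norm (gp e p t) <= A * exp ((d + 1)\<^sup>2 * e / 2) * exp (- \<bar>t\<bar>)" by (simp only: mult.assoc)
 qed (use A in simp)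
qed

lemma gp_deriv:
 assumes "e > 0"
 shows "(gp e p has_vector_derivative gp e (gpD e p) t) (at t)"
proof -
 have "((%z. poly p z * exp (- z\<^sup>2 / (2 * cor e))) has_field_derivative
  (poly (pderiv p) (cor t) * exp (- (cor t)\<^sup>2 / (2 * cor e)) +
   poly p (cor t) * (exp (- (cor t)\<^sup>2 / (2 * cor e)) * (- cor t / cor e)))) (at (cor t))"
  using assms by (auto intro!: derivative_eq_intros simp: field_simps)
 from has_vector_derivative_real_field[OF this, of UNIV]
 show ?thesis
  by (rule has_vector_derivative_eq_rhs[OF has_vector_derivative_transform[of _ UNIV, rotated 2]])
   (auto simp: gp_def gpD_def exp_of_real[symmetric] algebra_simps)
qed

lemma gp_integrable:
 assumes e: "e > 0" shows "intble (gp e p)"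
proof -
 obtain C where C: "C >= 0" "ALL t. norm (gp e p t) <= C * exp (- \<bar>t\<bar>)" using gp_bound[OF e] by blast
 show ?thesis
 proof (rule Bochner_Integration.integrable_bound[OF integrable_mult_right[OF integrable_exp_neg_abs, of C] _ AE_I2])
  show "norm (gp e p t) <= norm (C * exp (- \<bar>t\<bar>))" for t using C(1) C(2)[rule_format, of t] by simp
 qed simp
qed

lemma gp_shift_integrable:
 assumes e: "e > 0" shows "intble (%r. gp e p (c - r))"
 using lborel_integrable_real_affine[OF gp_integrable[OF e, of p], of "-1" c] by simp

lemma gp_linear:
 "gp e (p + q) t = gp e p t + gp e q t" "gp e (smult c p) t = c * gp e p t" "gp e ([:a, b:] * p) t = (a + b * cor t) * gp e p t"
 by (simp_all add: gp_def algebra_simps)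

section \<open>The smoothed parametrix and its equation\<close>

text \<open>(t1, x1) is the point at which the weighted solution will be represented; e is the
  common variance of the smoothing Gaussians in time and space.\<close>

locale parametrix =
 fixes m :: nat and al be e t1 x1 :: real
 assumes e: "e > 0"
begin

text \<open>The variable y holds the propagation time r and the frequency. A Gaussian of variance
  1/e in frequency, hence e in space, and one of variance e in time smooth the propagator. Space
  derivatives multiply Q by i ks and time derivatives fall on the time Gaussian through R, so the
  propagator, which jumps at r = 0, is never differentiated.\<close>

definition phi :: "complex poly => complex poly => R2 => R2 => complex" where
 "phi Q R z y = propag m al be (fst y) (snd y) * gp (1 / e) Q (snd y) * gp e R (fst z - t1 - fst y) * cis ((snd z - x1) * snd y)"

definition I :: "complex poly => complex poly => R2 => complex" where
 "I Q R z = (LBINT y. phi Q R z y)"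

lemma phi_measurable [measurable]: "phi Q R z \<in> bmeas"
 unfolding phi_def[abs_def] by measurable

lemma phi_norm: "norm (phi Q R z y) <= norm (gp e R (fst z - t1 - fst y)) * norm (gp (1 / e) Q (snd y))"
proof -
 have "norm (phi Q R z y) = norm (propag m al be (fst y) (snd y)) * (norm (gp (1 / e) Q (snd y)) * norm (gp e R (fst z - t1 - fst y)))"
  by (simp add: phi_def norm_mult)
 also have "... <= 1 * (norm (gp (1 / e) Q (snd y)) * norm (gp e R (fst z - t1 - fst y)))"
  by (intro mult_right_mono propag_bounded) auto
 finally show ?thesis by (simp add: mult.commute)
qed

lemma phi_integrable: "intble (phi Q R z)"
proof (rule integrable_prod_dominated[OF gp_shift_integrable[OF e, of R "fst z - t1"] gp_integrable[of "1 / e" Q]])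
 show "norm (phi Q R z (a, b)) <= norm (gp e R (fst z - t1 - a)) * norm (gp (1 / e) Q b)" for a b
  using phi_norm[of Q R z "(a, b)"] by simp
qed (use e in simp_all)

lemma I_linear:
 "I (P + Q) R z = I P R z + I Q R z" "I (smult c Q) R z = c * I Q R z"
 "I Q (R + S) z = I Q R z + I Q S z" "I Q (smult c R) z = c * I Q R z"
proof -
 have 1: "phi (P + Q) R z y = phi P R z y + phi Q R z y" "phi (smult c Q) R z y = c * phi Q R z y"
  "phi Q (R + S) z y = phi Q R z y + phi Q S z y" "phi Q (smult c R) z y = c * phi Q R z y" for y
  by (simp_all add: phi_def gp_linear algebra_simps)
 show "I (P + Q) R z = I P R z + I Q R z" "I (smult c Q) R z = c * I Q R z"
  "I Q (R + S) z = I Q R z + I Q S z" "I Q (smult c R) z = c * I Q R z"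
  unfolding I_def 1 by (simp_all add: phi_integrable)
qed

lemma phi_dominated:
 "EX w. intble w & (ALL z y. \<bar>fst z - t0\<bar> <= 1 --> norm (phi Q R z y) <= w y)"
proof -
 obtain C where C: "C >= 0" "!!t. norm (gp e R t) <= C * exp (- \<bar>t\<bar>)" using gp_bound[OF e] by blast
 let ?f = "%r. C * exp 1 * exp (- \<bar>t0 - t1 - r\<bar>)"
 let ?w = "%y. ?f (fst y) * norm (gp (1 / e) Q (snd y))"
 have f: "intble ?f"
  using lborel_integrable_real_affine[OF integrable_exp_neg_abs, of "-1" "t0 - t1"] by simp
 have gi: "intble (gp (1 / e) Q)" using e by (intro gp_integrable) simp
 have "intble ?w"
  by (rule integrable_prod_dominated[OF f gi]) (use C(1) in \<open>simp_all\<close>)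
 moreover have "norm (phi Q R z y) <= ?w y" if z: "\<bar>fst z - t0\<bar> <= 1" for z y
 proof -
  have "norm (gp e R (fst z - t1 - fst y)) <= C * exp (- \<bar>fst z - t1 - fst y\<bar>)" by (rule C)
  also have "... <= C * exp (1 - \<bar>t0 - t1 - fst y\<bar>)" using z C(1) by (intro mult_left_mono) auto
  also have "... = ?f (fst y)" by (simp add: exp_diff exp_minus divide_inverse)
  finally have "norm (gp e R (fst z - t1 - fst y)) * norm (gp (1 / e) Q (snd y)) <= ?w y"
   by (rule mult_right_mono) simp
  thus ?thesis using phi_norm[of Q R z y] by linarith
 qed
 ultimately show ?thesis by blast
qed

lemma I_continuous: "continuous_on UNIV (I Q R)"
proof -
 have "continuous_on UNIV (%z. LBINT y. phi Q R z y)"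
 proof (rule continuous_on_integral)
  show "continuous_on UNIV (%z. phi Q R z y)" for y
   unfolding phi_def by (intro continuous_intros)
  fix z0 :: R2
  obtain w where w: "intble w" "ALL z y. \<bar>fst z - fst z0\<bar> <= 1 --> norm (phi Q R z y) <= w y"
   using phi_dominated[of "fst z0" Q R] by blast
  have "norm (phi Q R z y) <= w y" if "dist z z0 <= 1" for z y
  proof -
   have "\<bar>fst z - fst z0\<bar> <= 1" using dist_fst_le[of z z0] that by (simp add: dist_real_def)
   thus ?thesis using w(2) by blast
  qed
  thus "EX w. intble w & (ALL z y. dist z z0 <= 1 --> norm (phi Q R z y) <= w y)" using w(1) by blast
 qed simp
 thus ?thesis by (simp add: I_def[abs_def])
qed

lemma cis_affine_deriv: "((%x. cis ((x - x1) * ks)) has_vector_derivative (\<i> * cor ks * cis ((x - x1) * ks))) (at x)"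
proof -
 have "((%z. exp (\<i> * ((z - cor x1) * cor ks))) has_field_derivative
   (exp (\<i> * ((cor x - cor x1) * cor ks)) * (\<i> * cor ks))) (at (cor x))"
  by (auto intro!: derivative_eq_intros)
 from has_vector_derivative_real_field[OF this, of UNIV] show ?thesis
  by (simp add: cis_conv_exp mult.commute)
qed

lemma I_dx: "((%x. I Q R (t, x)) has_vector_derivative I ([:0, \<i>:] * Q) R (t, x)) (at x)"
proof -
 obtain w where w: "intble w" "ALL z y. \<bar>fst z - t\<bar> <= 1 --> norm (phi ([:0, \<i>:] * Q) R z y) <= w y"
  using phi_dominated[of t "[:0, \<i>:] * Q" R] by blast
 show ?thesis unfolding I_def
 proof (rule has_vector_derivative_integral(2)[OF _ phi_integrable _ w(1)])
  fix s y
  have "((%s. phi Q R (t, s) y) has_vector_derivative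
    (propag m al be (fst y) (snd y) * gp (1 / e) Q (snd y) * gp e R (t - t1 - fst y)) * (\<i> * cor (snd y) * cis ((s - x1) * snd y))) (at s)"
   unfolding phi_def fst_conv snd_conv by (intro has_vector_derivative_mult_right cis_affine_deriv)
  thus "((%s. phi Q R (t, s) y) has_vector_derivative phi ([:0, \<i>:] * Q) R (t, s) y) (at s)"
   unfolding phi_def gp_linear by (simp add: mult_ac)
 next
  show "norm (phi ([:0, \<i>:] * Q) R (t, s) y) <= w y" for s y using w(2)[rule_format, of "(t, s)" y] by simp
 qed simp
qed

lemma I_dt: "((%t. I Q R (t, x)) has_vector_derivative I Q (gpD e R) (t, x)) (at t)"
proof -
 obtain w where w: "intble w" "ALL z y. \<bar>fst z - t\<bar> <= 1 --> norm (phi Q (gpD e R) z y) <= w y"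
  using phi_dominated[of t Q "gpD e R"] by blast
 show ?thesis unfolding I_def
 proof (rule has_vector_derivative_integral(2)[OF _ phi_integrable _ w(1)])
  fix s :: real and y :: R2
  have 1: "((%s. gp e R (s - t1 - fst y)) has_vector_derivative gp e (gpD e R) (s - t1 - fst y)) (at s)"
  proof -
   have a: "((%s. s - t1 - fst y) has_vector_derivative 1) (at s)"
    by (auto intro!: derivative_eq_intros simp: has_vector_derivative_def)
   have "((gp e R \<circ> (%s. s - t1 - fst y)) has_vector_derivative (1 *\<^sub>R gp e (gpD e R) (s - t1 - fst y))) (at s)"
    by (rule vector_diff_chain_at[OF a gp_deriv[OF e]])
   thus ?thesis by (simp add: o_def)
  qed
  show "((%s. phi Q R (s, x) y) has_vector_derivative phi Q (gpD e R) (s, x) y) (at s)"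
   unfolding phi_def fst_conv snd_conv by (intro has_vector_derivative_mult_left has_vector_derivative_mult_right 1)
 next
  show "norm (phi Q (gpD e R) (s, x) y) <= w y" if "\<bar>s - t\<bar> <= 1" for s y using w(2)[rule_format, of "(s, x)" y] that by simp
 qed simp
qed

definition ex :: "R2 => complex" where "ex z = cor (exp (al * fst z + be * snd z))"

text \<open>The factor \<open>ex\<close> reverses the conjugation with the weight: derivatives of J
  produce the symbols shifted by al and be, while u is effectively tested with its weighted
  version.\<close>

definition J :: "complex poly => complex poly => R2 => complex" where
 "J Q R z = ex z * I Q R z"

lemma ex_dx: "((%x. ex (t, x)) has_vector_derivative cor be * ex (t, x)) (at x)"
 unfolding ex_def fst_conv snd_conv of_real_mult[symmetric]
 by (intro has_vector_derivative_of_real has_vector_derivative_eq_rhs[OF iffD1[OF has_real_derivative_iff_has_vector_derivative]])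
  (auto intro!: derivative_eq_intros)

lemma ex_dt: "((%t. ex (t, x)) has_vector_derivative cor al * ex (t, x)) (at t)"
 unfolding ex_def fst_conv snd_conv of_real_mult[symmetric]
 by (intro has_vector_derivative_of_real has_vector_derivative_eq_rhs[OF iffD1[OF has_real_derivative_iff_has_vector_derivative]])
  (auto intro!: derivative_eq_intros)

lemma J_partials: "has_partials (J Q R) (J Q (smult (cor al) R + gpD e R)) (J ([:cor be, \<i>:] * Q) R)"
 unfolding has_partials_def
proof (intro conjI allI)
 have "continuous_on UNIV ex" unfolding ex_def by (intro continuous_intros)
 thus "continuous_on UNIV (J Q R)" unfolding J_def by (intro continuous_intros I_continuous)
 fix t x
 have "((%s. ex (s, x) * I Q R (s, x)) has_vector_derivative (ex (t, x) * I Q (gpD e R) (t, x) + (cor al * ex (t, x)) * I Q R (t, x))) (at t)"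
  by (rule has_vector_derivative_mult[OF ex_dt I_dt])
 thus "((%s. J Q R (s, x)) has_vector_derivative J Q (smult (cor al) R + gpD e R) (t, x)) (at t)"
  unfolding J_def I_linear by (simp add: algebra_simps)
 have "((%y. ex (t, y) * I Q R (t, y)) has_vector_derivative (ex (t, x) * I ([:0, \<i>:] * Q) R (t, x) + (cor be * ex (t, x)) * I Q R (t, x))) (at x)"
  by (rule has_vector_derivative_mult[OF ex_dx I_dx])
 moreover have "[:cor be, \<i>:] * Q = smult (cor be) Q + [:0, \<i>:] * Q" by simp
 ultimately show "((%y. J Q R (t, y)) has_vector_derivative J ([:cor be, \<i>:] * Q) R (t, x)) (at x)"
  unfolding J_def by (simp only: I_linear) (simp add: algebra_simps)
qed

lemma J_smooth: "smooth2 (J Q R)"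
proof (rule smooth2_coinduct[where \<S>="{J Q R | Q R. True}"])
 fix f assume "f \<in> {J Q R | Q R. True}"
 then obtain Q R where f: "f = J Q R" by blast
 show "\<exists>ft\<in>{J Q R | Q R. True}. \<exists>fx\<in>{J Q R | Q R. True}. has_partials f ft fx"
  unfolding f by (rule bexI, rule bexI, rule J_partials) blast+
qed blast

lemma J_dX: "(dX ^^ n) (J Q R) = J ([:cor be, \<i>:] ^ n * Q) R"
proof (induction n)
 case (Suc n)
 thus ?case using has_partialsD(2)[OF J_partials[of "[:cor be, \<i>:] ^ n * Q" R]] by (simp only: funpow.simps o_apply power_Suc mult.assoc)
qed simp

end

lemma integral_derivative_atLeast:
 fixes G G' :: "real => complex"
 assumes G: "!!r. (G has_vector_derivative G' r) (at r)" and cont: "continuous_on UNIV G'"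
  and int: "intble (%r. indicator {0..} r *\<^sub>R G' r)" and lim: "(%n. G (real n)) \<longlonglongrightarrow> 0"
 shows "(LBINT r. indicator {0..} r *\<^sub>R G' r) = - G 0"
proof (rule LIMSEQ_unique)
 show "(%n. LBINT r. indicator {0..real n} r *\<^sub>R G' r) \<longlonglongrightarrow> (LBINT r. indicator {0..} r *\<^sub>R G' r)"
 proof (rule integral_dominated_convergence[where w="%r. norm (indicator {0..} r *\<^sub>R G' r)"])
  have [measurable]: "G' \<in> bmeas" by (intro borel_measurable_continuous_onI cont)
  show "(%r. indicator {0..} r *\<^sub>R G' r) \<in> borel_measurable lborel" by simp
  show "(%r. indicator {0..real n} r *\<^sub>R G' r) \<in> borel_measurable lborel" for n by simp
  show "intble (%r. norm (indicator {0..} r *\<^sub>R G' r))" by (rule integrable_norm[OF int])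
  show "AE r in lborel. (%n. indicator {0..real n} r *\<^sub>R G' r) \<longlonglongrightarrow> indicator {0..} r *\<^sub>R G' r"
  proof (rule AE_I2)
   fix r :: real
   obtain N where N: "r <= real N" using real_arch_simple by blast
   have "eventually (%n. indicator {0..real n} r *\<^sub>R G' r = indicator {0..} r *\<^sub>R G' r) sequentially"
    using eventually_ge_at_top[of N] by eventually_elim (use N in \<open>auto simp: indicator_def\<close>)
   thus "(%n. indicator {0..real n} r *\<^sub>R G' r) \<longlonglongrightarrow> indicator {0..} r *\<^sub>R G' r" by (rule tendsto_eventually)
  qed
  show "AE r in lborel. norm (indicator {0..real n} r *\<^sub>R G' r) <= norm (indicator {0..} r *\<^sub>R G' r)" for n
   by (rule AE_I2) (simp add: indicator_def)
 qed
 have "(LBINT r. indicator {0..real n} r *\<^sub>R G' r) = G (real n) - G 0" for n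
  by (rule integral_FTC_Icc) (use G cont in \<open>auto intro: has_vector_derivative_at_within continuous_on_subset\<close>)
 thus "(%n. LBINT r. indicator {0..real n} r *\<^sub>R G' r) \<longlonglongrightarrow> - G 0"
  using tendsto_diff[OF lim tendsto_const[of "G 0"]] by simp
qed

lemma integral_derivative_atMost:
 fixes G G' :: "real => complex"
 assumes G: "!!r. (G has_vector_derivative G' r) (at r)" and cont: "continuous_on UNIV G'"
  and int: "intble (%r. indicator {..0} r *\<^sub>R G' r)" and lim: "(%n. G (- real n)) \<longlonglongrightarrow> 0"
 shows "(LBINT r. indicator {..0} r *\<^sub>R G' r) = G 0"
proof -
 have flip: "indicator {..0} (- r) = (indicator {0..} r :: real)" for r :: real by (simp add: indicator_def)
 have i: "intble (%r. indicator {0..} r *\<^sub>R (- G' (- r)))"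
  using lborel_integrable_real_affine[OF int, of "-1" 0] by (simp add: flip)
 have "(LBINT r. indicator {0..} r *\<^sub>R (- G' (- r))) = - G (- 0)"
 proof (rule integral_derivative_atLeast[where G="%r. G (- r)", OF _ _ i lim])
  fix r
  have a: "((%r. - r) has_vector_derivative - 1) (at r)"
   by (auto intro!: derivative_eq_intros simp: has_vector_derivative_def)
  have "((G \<circ> (%r. - r)) has_vector_derivative (- 1 *\<^sub>R G' (- r))) (at r)"
   by (rule vector_diff_chain_at[OF a G])
  thus "((%r. G (- r)) has_vector_derivative - G' (- r)) (at r)" by (simp add: o_def)
  show "continuous_on UNIV (%r. - G' (- r))"
   by (intro continuous_intros continuous_on_compose2[OF cont]) auto
 qed
 thus ?thesis
  using lborel_integral_real_affine[of "-1" "%r. indicator {..0} r *\<^sub>R G' r" 0] by (simp add: flip)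
qed

lemma gp_tendsto_0:
 assumes e: "e > 0"
 shows "(%n. gp e R (c - real n)) \<longlonglongrightarrow> 0" "(%n. gp e R (c + real n)) \<longlonglongrightarrow> 0"
proof -
 obtain C where C: "C >= 0" "!!t. norm (gp e R t) <= C * exp (- \<bar>t\<bar>)" using gp_bound[OF e] by blast
 have lim: "(%n. C * exp \<bar>c\<bar> * exp (- real n)) \<longlonglongrightarrow> 0"
 proof -
  have "(%n. exp (- real n)) \<longlonglongrightarrow> 0"
   by (rule filterlim_compose[OF exp_at_bot]) (simp add: filterlim_uminus_at_top[symmetric] filterlim_real_sequentially)
  from tendsto_mult_right_zero[OF this, of "C * exp \<bar>c\<bar>"] show ?thesis .
 qed
 have b: "norm (gp e R t) <= C * exp \<bar>c\<bar> * exp (- real n)" if "\<bar>t\<bar> >= real n - \<bar>c\<bar>" for t n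
 proof -
  have "C * exp (- \<bar>t\<bar>) <= C * exp (\<bar>c\<bar> - real n)" using C(1) that by (intro mult_left_mono) auto
  thus ?thesis using C(2)[of t] by (simp add: exp_diff exp_minus divide_inverse)
 qed
 show "(%n. gp e R (c - real n)) \<longlonglongrightarrow> 0" "(%n. gp e R (c + real n)) \<longlonglongrightarrow> 0"
  by (rule Lim_null_comparison[OF always_eventually lim], rule allI, rule b, linarith)+
qed

context parametrix
begin

text \<open>In r the propagator solves the first-order equation with coefficient csym and jumps by 1
  at r = 0 in either case, from 0 to 1 or from -1 to 0. Tested with the time Gaussian it reproduces
  the Gaussian. The sign of Re csym decides on which half-line the exponential is bounded.\<close>

lemma propag_ode:
 "(LBINT r. propag m al be r ks * (gp e (gpD e R) (ta - r) - csym m al be ks * gp e R (ta - r))) = gp e R ta"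
proof -
 define c where "c = csym m al be ks"
 define G where "G r = exp (cor r * c) * gp e R (ta - r)" for r
 define D where "D r = exp (cor r * c) * (gp e (gpD e R) (ta - r) - c * gp e R (ta - r))" for r
 have dG: "(G has_vector_derivative - D r) (at r)" for r
 proof -
  have 1: "((%r. exp (cor r * c)) has_vector_derivative (c * exp (cor r * c))) (at r)"
  proof -
   have "((%z. exp (z * c)) has_field_derivative (exp (cor r * c) * c)) (at (cor r))"
    by (auto intro!: derivative_eq_intros)
   from has_vector_derivative_real_field[OF this, of UNIV] show ?thesis by (simp add: mult.commute)
  qed
  have a: "((%r. ta - r) has_vector_derivative - 1) (at r)"
   by (auto intro!: derivative_eq_intros simp: has_vector_derivative_def)
  have "((gp e R \<circ> (%r. ta - r)) has_vector_derivative (- 1 *\<^sub>R gp e (gpD e R) (ta - r))) (at r)"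
   by (rule vector_diff_chain_at[OF a gp_deriv[OF e]])
  hence 2: "((%r. gp e R (ta - r)) has_vector_derivative - gp e (gpD e R) (ta - r)) (at r)" by (simp add: o_def)
  from has_vector_derivative_mult[OF 1 2] show ?thesis
   unfolding G_def[abs_def] D_def by (rule has_vector_derivative_eq_rhs) (simp add: algebra_simps)
 qed
 have cD: "continuous_on UNIV D" unfolding D_def[abs_def] by (intro continuous_intros)
 have [measurable]: "D \<in> bmeas" by (intro borel_measurable_continuous_onI cD)
 let ?h = "%r. gp e (gpD e R) (ta - r) - c * gp e R (ta - r)"
 have hi: "intble ?h"
  by (intro Bochner_Integration.integrable_diff integrable_mult_right gp_shift_integrable e)
 have Dn: "norm (D r) <= norm (?h r)" and Gn: "norm (G r) <= norm (gp e R (ta - r))" if "r * Re c <= 0" for r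
 proof -
  have x: "norm (exp (cor r * c)) <= 1" using that by simp
  show "norm (D r) <= norm (?h r)" unfolding D_def norm_mult[of "exp _"] using mult_right_mono[OF x, of "norm (?h r)"] by simp
  show "norm (G r) <= norm (gp e R (ta - r))" unfolding G_def norm_mult using mult_right_mono[OF x, of "norm (gp e R (ta - r))"] by simp
 qed
 show ?thesis
 proof (cases "Re c < 0")
  case True
  have int: "intble (%r. indicator {0..} r *\<^sub>R - D r)"
  proof (rule Bochner_Integration.integrable_bound[OF hi _ AE_I2])
   show "norm (indicator {0..} r *\<^sub>R - D r) <= norm (?h r)" for r
    using Dn[of r] True by (cases "r >= 0") (auto simp: mult_nonneg_nonpos)
  qed simp
  have lim: "(%n. G (real n)) \<longlonglongrightarrow> 0"
   by (rule Lim_null_comparison[OF always_eventually tendsto_norm_zero[OF gp_tendsto_0(1)[OF e, of R ta]]], rule allI, rule Gn)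
    (use True in \<open>simp add: mult_nonneg_nonpos\<close>)
  have "(LBINT r. propag m al be r ks * ?h r) = (LBINT r. - (indicator {0..} r *\<^sub>R - D r))"
  proof (rule integral_cong_AE)
   \<comment> \<open>At r = 0 \<open>propag\<close> takes its second branch and is 0 here, while the
     indicator of {0..} includes the point; equality holds almost everywhere only.\<close>
   show "AE r in lborel. propag m al be r ks * ?h r = - (indicator {0..} r *\<^sub>R - D r)"
    using AE_lborel_singleton[of "0::real"]
    by eventually_elim (use True in \<open>auto simp: propag_def D_def c_def indicator_def\<close>)
  qed simp_all
  also have "... = - (LBINT r. indicator {0..} r *\<^sub>R - D r)" by (rule Bochner_Integration.integral_minus)
  also have "... = - (- G 0)"
   by (subst integral_derivative_atLeast[OF dG continuous_on_minus[OF cD] int lim]) simp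
  finally show ?thesis by (simp add: G_def c_def)
 next
  case False
  have int: "intble (%r. indicator {..0} r *\<^sub>R - D r)"
  proof (rule Bochner_Integration.integrable_bound[OF hi _ AE_I2])
   show "norm (indicator {..0} r *\<^sub>R - D r) <= norm (?h r)" for r
    using Dn[of r] False by (cases "r <= 0") (auto simp: mult_nonpos_nonneg)
  qed simp
  have lim: "(%n. G (- real n)) \<longlonglongrightarrow> 0"
  proof (rule Lim_null_comparison[OF always_eventually])
   show "(%n. norm (gp e R (ta + real n))) \<longlonglongrightarrow> 0" by (rule tendsto_norm_zero[OF gp_tendsto_0(2)[OF e]])
   show "ALL n. norm (G (- real n)) <= norm (gp e R (ta + real n))"
    using Gn[of "- real _"] False by (simp add: mult_nonpos_nonneg)
  qed
  have "(LBINT r. propag m al be r ks * ?h r) = (LBINT r. indicator {..0} r *\<^sub>R - D r)"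
   using False by (intro Bochner_Integration.integral_cong) (auto simp: propag_def D_def c_def indicator_def)
  also have "... = G 0"
   by (rule integral_derivative_atMost[OF dG continuous_on_minus[OF cD] int lim])
  finally show ?thesis by (simp add: G_def c_def)
 qed
qed

text \<open>The operator is the transpose of the one in \<open>solves\<close>. At each frequency the
  r-integral is that of \<open>propag_ode\<close>, so what remains is the time Gaussian times the
  Fourier integral of the frequency Gaussian, multiplied by the weight.\<close>

lemma J_pde:
 "- \<i> * J Q (smult (cor al) R + gpD e R) z - (-1) ^ m * J ([:cor be, \<i>:] ^ (2 * m) * Q) R z
  = - \<i> * ex z * (LBINT ks. gp (1 / e) Q ks * cis ((snd z - x1) * ks)) * gp e R (fst z - t1)"
proof -
 define ta where "ta = fst z - t1"
 define \<Phi> where "\<Phi> y = propag m al be (fst y) (snd y) * (gp e (gpD e R) (ta - fst y) - csym m al be (snd y) * gp e R (ta - fst y))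
  * (gp (1 / e) Q (snd y) * cis ((snd z - x1) * snd y))" for y
 have gpow: "gp (1 / e) ([:cor be, \<i>:] ^ n * Q) ks = (cor be + \<i> * cor ks) ^ n * gp (1 / e) Q ks" for n ks
  by (simp add: gp_def poly_power algebra_simps)
 \<comment> \<open>i^(2m) = (-1)^m turns the symbol be + i ks of the weighted derivative into ks - i
   be, the form used in \<open>csym\<close>.\<close>
 have pw: "(-1) ^ m * (cor be + \<i> * cor ks) ^ (2 * m) = (cor ks - \<i> * cor be) ^ (2 * m)" for ks
 proof -
  have "cor be + \<i> * cor ks = \<i> * (cor ks - \<i> * cor be)" by (simp add: algebra_simps)
  hence "(cor be + \<i> * cor ks) ^ (2 * m) = (-1) ^ m * (cor ks - \<i> * cor be) ^ (2 * m)"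
   by (simp only: power_mult_distrib power_mult[of \<i>] power2_i)
  thus ?thesis by (simp flip: mult.assoc power_mult_distrib)
 qed
 have pt: "- \<i> * phi Q (smult (cor al) R + gpD e R) z y - (-1) ^ m * phi ([:cor be, \<i>:] ^ (2 * m) * Q) R z y = - \<i> * \<Phi> y" for y
 proof -
  let ?A = "propag m al be (fst y) (snd y) * gp (1 / e) Q (snd y) * cis ((snd z - x1) * snd y)"
  let ?tht = "(cor (snd y) - \<i> * cor be) ^ (2 * m)"
  have "- \<i> * phi Q (smult (cor al) R + gpD e R) z y - (-1) ^ m * phi ([:cor be, \<i>:] ^ (2 * m) * Q) R z y
   = - \<i> * (?A * (cor al * gp e R (ta - fst y) + gp e (gpD e R) (ta - fst y)))
    - ((-1) ^ m * (cor be + \<i> * cor (snd y)) ^ (2 * m)) * (?A * gp e R (ta - fst y))"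
   unfolding phi_def gpow gp_linear ta_def by (simp add: mult_ac)
  also have "... = - \<i> * (?A * (cor al * gp e R (ta - fst y) + gp e (gpD e R) (ta - fst y))) - ?tht * (?A * gp e R (ta - fst y))"
   unfolding pw ..
  also have "... = - \<i> * \<Phi> y" unfolding \<Phi>_def csym_def by (simp add: algebra_simps)
  finally show ?thesis .
 qed
 have i1: "intble (%y. - \<i> * phi Q (smult (cor al) R + gpD e R) z y)"
  and i2: "intble (%y. (-1) ^ m * phi ([:cor be, \<i>:] ^ (2 * m) * Q) R z y)"
  by (intro integrable_mult_right phi_integrable)+
 have \<Phi>i: "intble \<Phi>"
 proof -
  have "intble (%y. \<i> * (- \<i> * \<Phi> y))"
   unfolding pt[symmetric] by (intro integrable_mult_right Bochner_Integration.integrable_diff i1 i2)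
  thus ?thesis by simp
 qed
 hence \<Phi>i': "integrable (lborel \<Otimes>\<^sub>M lborel) (%(r, ks). \<Phi> (r, ks))" by (simp add: lborel_prod)
 have "(LBINT y. \<Phi> y) = (LBINT ks. LBINT r. \<Phi> (r, ks))"
  using lborel_pair.integral_snd[OF \<Phi>i'] by (simp add: lborel_prod)
 also have "... = (LBINT ks. gp e R ta * (gp (1 / e) Q ks * cis ((snd z - x1) * ks)))"
  unfolding \<Phi>_def fst_conv snd_conv by (simp only: integral_mult_left_zero propag_ode)
 also have "... = gp e R ta * (LBINT ks. gp (1 / e) Q ks * cis ((snd z - x1) * ks))" by simp
 finally have \<Phi>eq: "(LBINT y. \<Phi> y) = gp e R ta * (LBINT ks. gp (1 / e) Q ks * cis ((snd z - x1) * ks))" .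
 have "- \<i> * J Q (smult (cor al) R + gpD e R) z - (-1) ^ m * J ([:cor be, \<i>:] ^ (2 * m) * Q) R z
  = ex z * ((LBINT y. - \<i> * phi Q (smult (cor al) R + gpD e R) z y) - (LBINT y. (-1) ^ m * phi ([:cor be, \<i>:] ^ (2 * m) * Q) R z y))"
  unfolding J_def I_def by (simp add: algebra_simps)
 also have "... = ex z * (LBINT y. - \<i> * \<Phi> y)"
  unfolding Bochner_Integration.integral_diff[OF i1 i2, symmetric] pt ..
 also have "... = - \<i> * ex z * (LBINT ks. gp (1 / e) Q ks * cis ((snd z - x1) * ks)) * gp e R (fst z - t1)"
  using \<Phi>eq by (simp add: ta_def mult_ac)
 finally show ?thesis .
qed

text \<open>At fixed time I is the Fourier transform of a function bounded by A times the frequency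
  Gaussian, and Bessel's inequality applies. The bound is uniform in t, with no decay claimed; this
  is all that the cutoff argument uses.\<close>

lemma I_L2: "EX B>=0. ALL t. (NINT x. ennreal ((norm (I Q R (t, x)))\<^sup>2)) <= ennreal B"
proof -
 define A where "A = (LBINT r. norm (gp e R r))"
 have A0: "A >= 0" by (simp add: A_def)
 obtain C where C: "C >= 0" "!!t. norm (gp (1 / e) Q t) <= C * exp (- \<bar>t\<bar>)" using gp_bound[of "1 / e" Q] e by auto
 have gi: "intble (gp (1 / e) Q)" using e by (intro gp_integrable) simp
 define B where "B = 2 * pi * (A\<^sup>2 * (C * (LBINT x. norm (gp (1 / e) Q x))))"
 have B0: "B >= 0" using C(1) by (simp add: B_def)
 have "(NINT x. ennreal ((norm (I Q R (t, x)))\<^sup>2)) <= ennreal B" for t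
 proof -
  define N where "N ks = gp (1 / e) Q ks * (LBINT r. propag m al be r ks * gp e R (t - t1 - r))" for ks
  have [measurable]: "N \<in> bmeas" unfolding N_def by measurable
  have sh: "(LBINT r. norm (gp e R (t - t1 - r))) = A"
   unfolding A_def using lborel_integral_real_affine[of "-1" "%r. norm (gp e R r)" "t - t1"] by simp
  have Nb: "norm (N ks) <= A * norm (gp (1 / e) Q ks)" for ks
  proof -
   have "norm (LBINT r. propag m al be r ks * gp e R (t - t1 - r)) <= (LBINT r. norm (gp e R (t - t1 - r)))"
   proof (rule Bochner_Integration.integral_norm_bound[THEN order_trans], rule integral_mono')
    show "intble (%r. norm (gp e R (t - t1 - r)))" by (intro integrable_norm gp_shift_integrable e)
    show "norm (propag m al be r ks * gp e R (t - t1 - r)) <= norm (gp e R (t - t1 - r))" for r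
     using mult_right_mono[OF propag_bounded[of m al be r ks], of "norm (gp e R (t - t1 - r))"] by (simp add: norm_mult)
   qed simp
   hence "norm (gp (1 / e) Q ks) * norm (LBINT r. propag m al be r ks * gp e R (t - t1 - r)) <= norm (gp (1 / e) Q ks) * A"
    unfolding sh by (intro mult_left_mono) auto
   thus ?thesis by (simp add: N_def norm_mult mult.commute)
  qed
  have Ni: "intble N"
  proof (rule Bochner_Integration.integrable_bound[OF integrable_mult_right[OF integrable_norm[OF gi], of A] _ AE_I2])
   show "norm (N ks) <= norm (A * norm (gp (1 / e) Q ks))" for ks using Nb[of ks] A0 by simp
  qed simp
  have IN: "I Q R (t, x) = (LBINT ks. N ks * cis (ks * (x - x1)))" for x
  proof -
   have "integrable (lborel \<Otimes>\<^sub>M lborel) (%(r, ks). phi Q R (t, x) (r, ks))"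
    using phi_integrable[of Q R "(t, x)"] by (simp add: lborel_prod)
   from lborel_pair.integral_snd[OF this]
   have "I Q R (t, x) = (LBINT ks. LBINT r. phi Q R (t, x) (r, ks))" by (simp add: lborel_prod I_def)
   also have "... = (LBINT ks. LBINT r. (gp (1 / e) Q ks * cis (ks * (x - x1))) * (propag m al be r ks * gp e R (t - t1 - r)))"
    unfolding phi_def fst_conv snd_conv by (simp only: mult_ac)
   also have "... = (LBINT ks. N ks * cis (ks * (x - x1)))" unfolding integral_mult_right_zero N_def by (simp only: mult_ac)
   finally show ?thesis .
  qed
  have [measurable]: "(%x. LBINT ks. N ks * cis (ks * x)) \<in> bmeas" by measurable
  have "(NINT x. ennreal ((norm (I Q R (t, x)))\<^sup>2)) = (NINT x. ennreal ((norm (LBINT ks. N ks * cis (ks * x)))\<^sup>2))"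
   unfolding IN by (rule nn_integral_shift_real[of "%x. ennreal ((norm (LBINT ks. N ks * cis (ks * x)))\<^sup>2)"]) simp
  also have "... <= ennreal (2 * pi) * (NINT ks. ennreal ((norm (N ks))\<^sup>2))" by (rule bessel_inequality[OF Ni])
  also have "... <= ennreal (2 * pi) * (NINT ks. ennreal (A\<^sup>2 * (C * norm (gp (1 / e) Q ks))))"
  proof (intro mult_left_mono nn_integral_mono ennreal_leI)
   fix ks
   have g: "norm (gp (1 / e) Q ks) <= C"
   proof -
    have "C * exp (- \<bar>ks\<bar>) <= C * 1" using C(1) by (intro mult_left_mono) auto
    thus ?thesis using C(2)[of ks] by simp
   qed
   have "(norm (N ks))\<^sup>2 <= (A * norm (gp (1 / e) Q ks))\<^sup>2" using Nb by (intro power_mono) auto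
   also have "... = A\<^sup>2 * (norm (gp (1 / e) Q ks) * norm (gp (1 / e) Q ks))" by (simp add: power2_eq_square mult_ac)
   also have "... <= A\<^sup>2 * (C * norm (gp (1 / e) Q ks))" using g by (intro mult_left_mono mult_right_mono) auto
   finally show "(norm (N ks))\<^sup>2 <= A\<^sup>2 * (C * norm (gp (1 / e) Q ks))" .
  qed simp
  also have "(NINT ks. ennreal (A\<^sup>2 * (C * norm (gp (1 / e) Q ks)))) = ennreal (A\<^sup>2 * (C * (LBINT x. norm (gp (1 / e) Q x))))"
  proof -
   have "intble (%ks. A\<^sup>2 * (C * norm (gp (1 / e) Q ks)))" by (intro integrable_mult_right integrable_norm gi)
   thus ?thesis using C(1) by (subst nn_integral_eq_integral) simp_all
  qed
  also have "ennreal (2 * pi) * ... = ennreal B" unfolding B_def by (rule ennreal_mult'[symmetric]) simp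
  finally show ?thesis .
 qed
 thus ?thesis using B0 by blast
qed

end

section \<open>Cutoffs and the vanishing of their commutators\<close>

definition gau :: "real => real => real" where
 "gau e x = exp (- x\<^sup>2 / (2 * e)) / sqrt (2 * pi * e)"

definition cutoff :: "nat => R2 => complex" where
 "cutoff n z = cor (bump 0 (fst z / real (Suc n)) * bump 0 (snd z / real (Suc n)))"

text \<open>Derivatives of the cutoff as a family of their own: differentiation divides c by n + 1
  and raises one of the orders j and k.\<close>

definition cut :: "nat => complex => nat => nat => R2 => complex" where
 "cut n c j k z = c * cor (bump j (fst z / real (Suc n)) * bump k (snd z / real (Suc n)))"

lemma bump_continuous [continuous_intros]: "continuous_on S f ==> continuous_on S (%x. bump k (f x))"
proof -
 have "continuous_on UNIV (bump k)"
  by (intro continuous_at_imp_continuous_on ballI DERIV_isCont[OF bump(1)])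
 thus "continuous_on S f ==> continuous_on S (%x. bump k (f x))"
  by (rule continuous_on_compose2) auto
qed

lemma bump_scaled_deriv:
 "((%s. cor (bump j (s / r))) has_vector_derivative cor (bump (Suc j) (t / r) / r)) (at t)"
proof -
 have "((%s. bump j (s / r)) has_real_derivative (bump (Suc j) (t / r) * (1 / r))) (at t)"
  by (rule DERIV_chain2[OF bump(1)]) (auto intro!: derivative_eq_intros simp: divide_inverse)
 hence "((%s. bump j (s / r)) has_vector_derivative (bump (Suc j) (t / r) / r)) (at t)"
  by (simp add: has_real_derivative_iff_has_vector_derivative)
 thus ?thesis by (rule bounded_linear.has_vector_derivative[OF bounded_linear_of_real])
qed

lemma cut_partials: "has_partials (cut n c j k) (cut n (c / of_nat (Suc n)) (Suc j) k) (cut n (c / of_nat (Suc n)) j (Suc k))"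
 unfolding has_partials_def
proof (intro conjI allI)
 show "continuous_on UNIV (cut n c j k)" unfolding cut_def divide_inverse by (intro continuous_intros)
 fix t x
 have "((%s. (c * cor (bump k (x / real (Suc n)))) * cor (bump j (s / real (Suc n)))) has_vector_derivative
   ((c * cor (bump k (x / real (Suc n)))) * cor (bump (Suc j) (t / real (Suc n)) / real (Suc n)))) (at t)"
  by (intro has_vector_derivative_mult_right bump_scaled_deriv)
 thus "((%s. cut n c j k (s, x)) has_vector_derivative cut n (c / of_nat (Suc n)) (Suc j) k (t, x)) (at t)"
  unfolding cut_def fst_conv snd_conv of_real_mult of_real_divide of_real_of_nat_eq
  by (simp only: mult_ac times_divide_eq_right times_divide_eq_left)
 have "((%s. (c * cor (bump j (t / real (Suc n)))) * cor (bump k (s / real (Suc n)))) has_vector_derivative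
   ((c * cor (bump j (t / real (Suc n)))) * cor (bump (Suc k) (x / real (Suc n)) / real (Suc n)))) (at x)"
  by (intro has_vector_derivative_mult_right bump_scaled_deriv)
 thus "((%y. cut n c j k (t, y)) has_vector_derivative cut n (c / of_nat (Suc n)) j (Suc k) (t, x)) (at x)"
  unfolding cut_def fst_conv snd_conv of_real_mult of_real_divide of_real_of_nat_eq
  by (simp only: mult_ac times_divide_eq_right times_divide_eq_left)
qed

lemma cutoff_eq_cut: "cutoff n = cut n 1 0 0"
 by (simp add: cutoff_def cut_def fun_eq_iff)

lemma cut_smooth: "smooth2 (cut n c j k)"
proof (rule smooth2_coinduct[where \<S>="{cut n c j k | c j k. True}"])
 fix f assume "f \<in> {cut n c j k | c j k. True}"
 then obtain c j k where f: "f = cut n c j k" by blast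
 show "\<exists>ft\<in>{cut n c j k | c j k. True}. \<exists>fx\<in>{cut n c j k | c j k. True}. has_partials f ft fx"
  unfolding f by (rule bexI, rule bexI, rule cut_partials) blast+
qed blast

lemma cut_dX: "(dX ^^ i) (cut n c j k) = cut n (c / of_nat (Suc n) ^ i) j (k + i)"
proof (induction i)
 case (Suc i)
 have "dX (cut n (c / of_nat (Suc n) ^ i) j (k + i)) = cut n (c / of_nat (Suc n) ^ i / of_nat (Suc n)) j (Suc (k + i))"
  by (rule has_partialsD(2)[OF cut_partials])
 thus ?case using Suc by (simp add: mult.commute)
qed simp

lemma cut_support: "real (Suc n) < \<bar>fst z\<bar> \<or> real (Suc n) < \<bar>snd z\<bar> ==> cut n c j k z = 0"
proof -
 have "bump i (x / real (Suc n)) = 0" if "real (Suc n) < \<bar>x\<bar>" for i x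
  using that by (intro bump(2)) (simp add: abs_divide)
 thus "real (Suc n) < \<bar>fst z\<bar> \<or> real (Suc n) < \<bar>snd z\<bar> ==> cut n c j k z = 0" by (auto simp: cut_def)
qed

lemma cut_bound: "EX C>=0. ALL n c z. norm (cut n c j k z) <= norm c * C * indicator {z. \<bar>fst z\<bar> <= real (Suc n)} z"
proof -
 obtain A B where A: "ALL x. \<bar>bump j x\<bar> <= A" and B: "ALL x. \<bar>bump k x\<bar> <= B" using bump(5) by blast
 have A0: "A >= 0" "B >= 0" using A[rule_format, of 0] B[rule_format, of 0] by linarith+
 have "norm (cut n c j k z) <= norm c * (A * B) * indicator {z. \<bar>fst z\<bar> <= real (Suc n)} z" for n c z
 proof (cases "\<bar>fst z\<bar> <= real (Suc n)")
  case True
  have "norm (cut n c j k z) = norm c * (\<bar>bump j (fst z / real (Suc n))\<bar> * \<bar>bump k (snd z / real (Suc n))\<bar>)"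
   by (simp add: cut_def norm_mult)
  also have "... <= norm c * (A * B)" using A B A0 by (intro mult_left_mono mult_mono) auto
  finally show ?thesis using True by simp
 next
  case False thus ?thesis using cut_support[of n z c j k] by simp
 qed
 thus ?thesis using A0 by (intro exI[of _ "A * B"]) simp
qed

lemma cutoff_le: "norm (cutoff n z) <= 1"
proof -
 have "\<bar>bump 0 (fst z / real (Suc n))\<bar> * \<bar>bump 0 (snd z / real (Suc n))\<bar> <= 1 * 1"
  by (intro mult_mono bump(4)) auto
 thus ?thesis by (simp add: cutoff_def norm_mult)
qed

lemma cutoff_tendsto: "(%n. cutoff n z) \<longlonglongrightarrow> 1"
proof -
 have b: "(%n. bump 0 (x / real (Suc n))) \<longlonglongrightarrow> 1" for x
 proof -
  have "(%n. x / real (Suc n)) \<longlonglongrightarrow> 0"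
   using LIMSEQ_Suc[OF lim_const_over_n[of x]] by simp
  from isCont_tendsto_compose[OF DERIV_isCont[OF bump(1)] this, of 0] show ?thesis by (simp add: bump(3))
 qed
 have "(%n. cutoff n z) \<longlonglongrightarrow> cor (1 * 1)"
  unfolding cutoff_def by (intro tendsto_of_real tendsto_mult b)
 thus ?thesis by simp
qed

lemma cutoff_measurable [measurable]: "cutoff n \<in> bmeas"
 using has_partialsD(3)[OF cut_partials[of n 1 0 0]] unfolding cutoff_eq_cut by (rule borel_measurable_continuous_onI)

text \<open>Cauchy-Schwarz as a weighted sum; the free weight c balances factors whose L2 norms grow
  at different rates.\<close>

lemma nn_integral_mult_L2:
 fixes W g :: "'a => complex"
 assumes [measurable]: "W \<in> borel_measurable M" "g \<in> borel_measurable M" and c: "c > 0"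
 shows "(\<integral>\<^sup>+z. norm (W z * g z) \<partial>M) <= ennreal c * (\<integral>\<^sup>+z. (norm (W z))\<^sup>2 \<partial>M) + ennreal (1 / c) * (\<integral>\<^sup>+z. (norm (g z))\<^sup>2 \<partial>M)"
proof -
 have "(\<integral>\<^sup>+z. norm (W z * g z) \<partial>M) <= (\<integral>\<^sup>+z. ennreal c * ennreal ((norm (W z))\<^sup>2) + ennreal (1 / c) * ennreal ((norm (g z))\<^sup>2) \<partial>M)"
 proof (rule nn_integral_mono)
  fix z
  have "0 <= (c * norm (W z) - norm (g z))\<^sup>2" by simp
  hence "2 * c * (norm (W z) * norm (g z)) <= c * (c * (norm (W z))\<^sup>2) + (norm (g z))\<^sup>2"
   by (simp add: power2_eq_square algebra_simps)
  moreover have "c * (norm (W z) * norm (g z)) <= 2 * c * (norm (W z) * norm (g z))" using c by simp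
  ultimately have "c * (norm (W z) * norm (g z)) <= c * (c * (norm (W z))\<^sup>2) + (norm (g z))\<^sup>2" by linarith
  also have "... = c * (c * (norm (W z))\<^sup>2 + 1 / c * (norm (g z))\<^sup>2)" using c by (simp add: distrib_left)
  finally have "c * (norm (W z) * norm (g z)) <= c * (c * (norm (W z))\<^sup>2 + 1 / c * (norm (g z))\<^sup>2)" .
  hence "norm (W z * g z) <= c * (norm (W z))\<^sup>2 + 1 / c * (norm (g z))\<^sup>2" using c by (simp only: norm_mult mult_le_cancel_left_pos)
  from ennreal_leI[OF this] show "ennreal (norm (W z * g z)) <= ennreal c * ennreal ((norm (W z))\<^sup>2) + ennreal (1 / c) * ennreal ((norm (g z))\<^sup>2)"
   using c by (simp add: ennreal_plus ennreal_mult' del: times_divide_eq_left)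
 qed
 also have "... = ennreal c * (\<integral>\<^sup>+z. (norm (W z))\<^sup>2 \<partial>M) + ennreal (1 / c) * (\<integral>\<^sup>+z. (norm (g z))\<^sup>2 \<partial>M)"
  by (simp add: nn_integral_add nn_integral_cmult)
 finally show ?thesis .
qed

lemma integrable_mult_L2:
 fixes W g :: "'a => complex"
 assumes [measurable]: "W \<in> borel_measurable M" "g \<in> borel_measurable M"
  and "(\<integral>\<^sup>+z. (norm (W z))\<^sup>2 \<partial>M) < \<infinity>" "(\<integral>\<^sup>+z. (norm (g z))\<^sup>2 \<partial>M) < \<infinity>"
 shows "integrable M (%z. W z * g z)"
 using order_le_less_trans[OF nn_integral_mult_L2[of W M g 1]] assms(3,4)
 by (auto simp: integrable_iff_bounded)

context parametrix
begin

text \<open>Over a time interval of length 2(n+1) the uniform bound of \<open>I_L2\<close> adds up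
  linearly.\<close>

lemma I_L2_strip:
 "EX B>=0. ALL n. (NINT z. ennreal ((norm (indicator {z. \<bar>fst z\<bar> <= real (Suc n)} z *\<^sub>R I Q R z))\<^sup>2)) <= ennreal (B * real (Suc n))"
proof -
 obtain B where B: "B >= 0" "!!t. (NINT x. ennreal ((norm (I Q R (t, x)))\<^sup>2)) <= ennreal B" using I_L2 by blast
 have [measurable]: "I Q R \<in> bmeas" by (intro borel_measurable_continuous_onI I_continuous)
 have [measurable]: "{z :: R2. \<bar>fst z\<bar> <= real (Suc n)} \<in> sets borel" for n by measurable
 have "(NINT z. ennreal ((norm (indicator {z. \<bar>fst z\<bar> <= real (Suc n)} z *\<^sub>R I Q R z))\<^sup>2)) <= ennreal (2 * B * real (Suc n))" for n
 proof -
  have "(NINT z. ennreal ((norm (indicator {z. \<bar>fst z\<bar> <= real (Suc n)} z *\<^sub>R I Q R z))\<^sup>2))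
   = (NINT t. NINT x. ennreal ((norm (indicator {z. \<bar>fst z\<bar> <= real (Suc n)} (t, x) *\<^sub>R I Q R (t, x)))\<^sup>2))"
   by (rule nn_integral_R2) measurable
  also have "... <= (NINT t. ennreal B * indicator {- real (Suc n)..real (Suc n)} t)"
  proof (rule nn_integral_mono)
   fix t
   show "(NINT x. ennreal ((norm (indicator {z. \<bar>fst z\<bar> <= real (Suc n)} (t, x) *\<^sub>R I Q R (t, x)))\<^sup>2)) <= ennreal B * indicator {- real (Suc n)..real (Suc n)} t"
   proof (cases "\<bar>t\<bar> <= real (Suc n)")
    case True
    hence "t \<in> {- real (Suc n)..real (Suc n)}" by auto
    thus ?thesis using B(2)[of t] True by simp
   qed simp
  qed
  also have "... = ennreal B * ennreal (2 * real (Suc n))"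
   by (subst nn_integral_cmult_indicator) simp_all
  also have "... = ennreal (2 * B * real (Suc n))" unfolding ennreal_mult'[OF B(1), symmetric] by (simp only: mult_ac)
  finally show ?thesis .
 qed
 thus ?thesis using B(1) by (intro exI[of _ "2 * B"]) simp
qed

text \<open>A derivative of the cutoff has size 1/n, while the squared L2 norm of I on the strip
  that carries it is O(n). Cauchy-Schwarz against W gives the order n^(-1/2). This is the place
  where square integrability of the weighted solution enters.\<close>

lemma commutator_tendsto_0:
 fixes W :: "R2 => complex" and D :: "nat => R2 => complex"
 assumes [measurable]: "W \<in> bmeas" "!!n. D n \<in> bmeas"
  and W2: "(NINT z. (norm (W z))\<^sup>2) < \<infinity>"
  and D: "!!n z. norm (D n z) <= C / real (Suc n) * indicator {z. \<bar>fst z\<bar> <= real (Suc n)} z"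
 shows "intble (%z. W z * (D n z * I Q R z))" and "(%n. LBINT z. W z * (D n z * I Q R z)) \<longlonglongrightarrow> 0"
proof -
 have [measurable]: "I Q R \<in> bmeas" by (intro borel_measurable_continuous_onI I_continuous)
 have [measurable]: "{z :: R2. \<bar>fst z\<bar> <= real (Suc n)} \<in> sets borel" for n by measurable
 have C0: "C >= 0" using order_trans[OF norm_ge_zero D[of 0 "(0,0)"]] by simp
 obtain B where B: "B >= 0" "!!n. (NINT z. ennreal ((norm (indicator {z. \<bar>fst z\<bar> <= real (Suc n)} z *\<^sub>R I Q R z))\<^sup>2)) <= ennreal (B * real (Suc n))"
  using I_L2_strip[of Q R] by blast
 obtain S where S: "S >= 0" "(NINT z. (norm (W z))\<^sup>2) = ennreal S"
  using W2 by (cases "(NINT z. (norm (W z))\<^sup>2)") auto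
 have bnd: "(NINT z. norm (W z * (D n z * I Q R z))) <= ennreal (C * (S + B) / sqrt (real (Suc n)))" for n
 proof -
  define r where "r = real (Suc n)"
  have r: "r > 0" by (simp add: r_def)
  let ?g = "%z. indicator {z. \<bar>fst z\<bar> <= real (Suc n)} z *\<^sub>R I Q R z"
  have "(NINT z. norm (W z * (D n z * I Q R z))) <= (NINT z. ennreal (C / r) * ennreal (norm (W z * ?g z)))"
  proof (rule nn_integral_mono)
   fix z
   have "norm (D n z) * (norm (W z) * norm (I Q R z)) <= C / r * indicator {z. \<bar>fst z\<bar> <= real (Suc n)} z * (norm (W z) * norm (I Q R z))"
    unfolding r_def by (intro mult_right_mono D) auto
   hence "norm (W z * (D n z * I Q R z)) <= C / r * norm (W z * ?g z)" by (simp add: norm_mult mult_ac)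
   from ennreal_leI[OF this] show "ennreal (norm (W z * (D n z * I Q R z))) <= ennreal (C / r) * ennreal (norm (W z * ?g z))"
    unfolding ennreal_mult'[OF divide_nonneg_pos[OF C0 r]] .
  qed
  also have "... = ennreal (C / r) * (NINT z. norm (W z * ?g z))" by (rule nn_integral_cmult) measurable
  \<comment> \<open>The weight sqrt r gives both terms the order sqrt r, so that C / r leaves 1 /
    sqrt r.\<close>
  also have "... <= ennreal (C / r) * (ennreal (sqrt r) * ennreal S + ennreal (1 / sqrt r) * ennreal (B * r))"
  proof (rule mult_left_mono)
   have "(NINT z. norm (W z * ?g z)) <= ennreal (sqrt r) * (NINT z. (norm (W z))\<^sup>2) + ennreal (1 / sqrt r) * (NINT z. (norm (?g z))\<^sup>2)"
    by (rule nn_integral_mult_L2) (use r in simp_all)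
   also have "... <= ennreal (sqrt r) * ennreal S + ennreal (1 / sqrt r) * ennreal (B * r)"
    unfolding S(2) r_def by (intro add_mono mult_left_mono B(2) order_refl) simp_all
   finally show "(NINT z. norm (W z * ?g z)) <= ennreal (sqrt r) * ennreal S + ennreal (1 / sqrt r) * ennreal (B * r)" .
  qed simp
  also have "... = ennreal (C / r * (sqrt r * S + 1 / sqrt r * (B * r)))"
   using r S(1) B(1) C0 by (simp add: ennreal_mult' ennreal_plus del: times_divide_eq_left times_divide_eq_right)
  also have "C / r * (sqrt r * S + 1 / sqrt r * (B * r)) = C * (S + B) / sqrt r"
  proof -
   have "1 / sqrt r * (B * r) = sqrt r * B" using r by (simp add: field_simps)
   hence "C / r * (sqrt r * S + 1 / sqrt r * (B * r)) = C / r * sqrt r * (S + B)" by (simp only: distrib_left mult.assoc)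
   also have "C / r * sqrt r = C / sqrt r" using r by (simp add: field_simps)
   finally show ?thesis by simp
  qed
  finally show ?thesis unfolding r_def .
 qed
 show "intble (%z. W z * (D n z * I Q R z))"
  using order_le_less_trans[OF bnd[of n]] by (simp add: integrable_iff_bounded)
 have lim: "(%n. C * (S + B) / sqrt (real (Suc n))) \<longlonglongrightarrow> 0"
 proof -
  have "filterlim (%n. sqrt (real (Suc n))) at_top sequentially"
   by (intro filterlim_compose[OF sqrt_at_top] filterlim_compose[OF filterlim_real_sequentially filterlim_Suc])
  thus ?thesis by (rule real_tendsto_divide_at_top[OF tendsto_const])
 qed
 show "(%n. LBINT z. W z * (D n z * I Q R z)) \<longlonglongrightarrow> 0"
 proof (rule Lim_null_comparison[OF always_eventually lim], rule allI)
  fix n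
  have "ennreal (norm (LBINT z. W z * (D n z * I Q R z))) <= ennreal (C * (S + B) / sqrt (real (Suc n)))"
   by (rule order_trans[OF norm_integral_le_nn_integral bnd])
  thus "norm (LBINT z. W z * (D n z * I Q R z)) <= C * (S + B) / sqrt (real (Suc n))"
   using C0 S(1) B(1) by (subst (asm) ennreal_le_iff) simp_all
 qed
qed

text \<open>Normalised so that the transpose equation for J has the weighted unit-mass Gaussian on
  the right: the factor i cancels -i, and 2 pi comes from Fourier inversion.\<close>

definition Q0 :: "complex poly" where "Q0 = [:\<i> / cor (2 * pi):]"
definition R0 :: "complex poly" where "R0 = [:cor (1 / sqrt (2 * pi * e)):]"

lemma gp_R0: "gp e R0 t = cor (gau e t)"
 by (simp add: gp_def R0_def gau_def)

lemma gp_Q0: "gp (1 / e) Q0 ks = \<i> * (cor (1 / (2 * pi)) * cor (exp (- e * ks\<^sup>2 / 2)))"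
 by (simp add: gp_def Q0_def mult.commute)

lemma fourier_Q0: "(LBINT ks. gp (1 / e) Q0 ks * cis (x * ks)) = \<i> * cor (gau e x)"
proof -
 have "(LBINT ks. gp (1 / e) Q0 ks * cis (x * ks)) = \<i> * (cor (1 / (2 * pi)) * (LBINT ks. cor (exp (- e * ks\<^sup>2 / 2)) * cis (x * ks)))"
  unfolding gp_Q0 by (simp only: mult.assoc integral_mult_right_zero)
 also have "... = \<i> * cor (1 / (2 * pi) * (sqrt (2 * pi / e) * exp (- x\<^sup>2 / (2 * e))))"
  unfolding gaussian_fourier(2)[OF e] by (simp only: of_real_mult)
 also have "1 / (2 * pi) * (sqrt (2 * pi / e) * exp (- x\<^sup>2 / (2 * e))) = gau e x"
 proof -
  have "sqrt (2 * pi / e) = 2 * pi * (1 / sqrt (2 * pi * e))"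
   using e by (simp add: real_sqrt_divide real_sqrt_mult field_simps)
  thus ?thesis by (simp add: gau_def)
 qed
 finally show ?thesis .
qed

text \<open>The frequency integral is \<open>kern\<close>, so up to the factor i the parametrix is
  the propagator kernel mollified in time. This links it to \<open>strichartz\<close>.\<close>

lemma I_Q0_R0: "I Q0 R0 z = \<i> * (LBINT r. cor (gau e (fst z - t1 - r)) * kern m al be e r (snd z - x1))"
proof -
 have "integrable (lborel \<Otimes>\<^sub>M lborel) (%y. phi Q0 R0 z y)"
  using phi_integrable[of Q0 R0 z] by (simp add: lborel_prod)
 from lborel_pair.integral_fst'[OF this]
 have "I Q0 R0 z = (LBINT r. LBINT ks. phi Q0 R0 z (r, ks))" by (simp add: lborel_prod I_def)
 also have "... = (LBINT r. LBINT ks. (\<i> * cor (gau e (fst z - t1 - r)) * cor (1 / (2 * pi))) *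
   (propag m al be r ks * cor (exp (- e * ks\<^sup>2 / 2)) * cis ((snd z - x1) * ks)))"
  unfolding phi_def fst_conv snd_conv gp_Q0 gp_R0 by (simp only: mult_ac)
 also have "... = \<i> * (LBINT r. cor (gau e (fst z - t1 - r)) * kern m al be e r (snd z - x1))"
  by (simp only: kern_def fmult_def integral_mult_right_zero mult.assoc)
 finally show ?thesis .
qed

lemma test_fun_cutoff_J: "test_fun (%z. cutoff n z * J Q R z)"
 unfolding test_fun_def cutoff_eq_cut
proof (intro conjI exI[of _ "2 * real (Suc n)"] allI impI)
 show "smooth2 (%z. cut n 1 0 0 z * J Q R z)" by (intro smooth2_mult cut_smooth J_smooth)
 fix z :: R2 assume "norm z > 2 * real (Suc n)"
 moreover have "norm z <= \<bar>fst z\<bar> + \<bar>snd z\<bar>" using norm_Pair_le[of "fst z" "snd z"] by simp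
 moreover have "r < a \<or> r < b" if "2 * r < c" "c <= a + b" for a b c r :: real using that by linarith
 ultimately have "real (Suc n) < \<bar>fst z\<bar> \<or> real (Suc n) < \<bar>snd z\<bar>" by blast
 thus "cut n 1 0 0 z * J Q R z = 0" using cut_support by simp
qed

text \<open>Leibniz rule. The term in which no derivative falls on the cutoff is the Gaussian by
  \<open>J_pde\<close>; every other term carries a negative power of n + 1.\<close>

lemma cut_J_equation:
 "- \<i> * dT (%z. cutoff n z * J Q0 R0 z) z - (-1) ^ m * (dX ^^ (2 * m)) (%z. cutoff n z * J Q0 R0 z) z =
  cutoff n z * (ex z * cor (gau e (fst z - t1) * gau e (snd z - x1)))
  + ex z * (cut n (- \<i> / of_nat (Suc n)) 1 0 z * I Q0 R0 z)
  + ex z * (\<Sum>k=1..2*m. cut n (- ((-1) ^ m * of_nat (2 * m choose k) / of_nat (Suc n) ^ k)) 0 k z * I ([:cor be, \<i>:] ^ (2 * m - k) * Q0) R0 z)"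
proof -
 have T: "dT (%z. cutoff n z * J Q0 R0 z) z = cut n 1 0 0 z * J Q0 (smult (cor al) R0 + gpD e R0) z + cut n (1 / of_nat (Suc n)) 1 0 z * J Q0 R0 z"
  unfolding cutoff_eq_cut using has_partialsD(1)[OF has_partials_mult[OF cut_partials[of n 1 0 0] J_partials[of Q0 R0]]]
  by simp
 have "(dX ^^ (2 * m)) (%z. cutoff n z * J Q0 R0 z) z =
  (\<Sum>k\<le>2*m. of_nat (2 * m choose k) * cut n (1 / of_nat (Suc n) ^ k) 0 k z * J ([:cor be, \<i>:] ^ (2 * m - k) * Q0) R0 z)"
  unfolding cutoff_eq_cut dX_leibniz[OF cut_smooth J_smooth] cut_dX J_dX by simp
 also have "... = cut n 1 0 0 z * J ([:cor be, \<i>:] ^ (2 * m) * Q0) R0 z +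
  (\<Sum>k=1..2*m. of_nat (2 * m choose k) * cut n (1 / of_nat (Suc n) ^ k) 0 k z * J ([:cor be, \<i>:] ^ (2 * m - k) * Q0) R0 z)"
 proof -
  have "{..2 * m} = insert 0 {1..2 * m}" by auto
  thus ?thesis by simp
 qed
 finally have X: "(dX ^^ (2 * m)) (%z. cutoff n z * J Q0 R0 z) z = ..." .
 have P: "- \<i> * J Q0 (smult (cor al) R0 + gpD e R0) z - (-1) ^ m * J ([:cor be, \<i>:] ^ (2 * m) * Q0) R0 z
   = ex z * cor (gau e (fst z - t1) * gau e (snd z - x1))"
 proof -
  have "- \<i> * a * (\<i> * b) * c = a * (c * b)" for a b c by (simp add: algebra_simps)
  thus ?thesis unfolding J_pde fourier_Q0 gp_R0 by (simp only: of_real_mult)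
 qed
 have S: "(-1) ^ m * (\<Sum>k=1..2*m. of_nat (2 * m choose k) * cut n (1 / of_nat (Suc n) ^ k) 0 k z * J ([:cor be, \<i>:] ^ (2 * m - k) * Q0) R0 z)
  = - (ex z * (\<Sum>k=1..2*m. cut n (- ((-1) ^ m * of_nat (2 * m choose k) / of_nat (Suc n) ^ k)) 0 k z * I ([:cor be, \<i>:] ^ (2 * m - k) * Q0) R0 z))"
  unfolding sum_distrib_left sum_negf[symmetric] by (intro sum.cong refl) (simp add: cut_def J_def)
 have T': "- \<i> * (cut n (1 / of_nat (Suc n)) 1 0 z * J Q0 R0 z) = ex z * (cut n (- \<i> / of_nat (Suc n)) 1 0 z * I Q0 R0 z)"
  by (simp add: cut_def J_def)
 have "- \<i> * dT (%z. cutoff n z * J Q0 R0 z) z - (-1) ^ m * (dX ^^ (2 * m)) (%z. cutoff n z * J Q0 R0 z) z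
  = cut n 1 0 0 z * (- \<i> * J Q0 (smult (cor al) R0 + gpD e R0) z - (-1) ^ m * J ([:cor be, \<i>:] ^ (2 * m) * Q0) R0 z)
   + - \<i> * (cut n (1 / of_nat (Suc n)) 1 0 z * J Q0 R0 z)
   - (-1) ^ m * (\<Sum>k=1..2*m. of_nat (2 * m choose k) * cut n (1 / of_nat (Suc n) ^ k) 0 k z * J ([:cor be, \<i>:] ^ (2 * m - k) * Q0) R0 z)"
  unfolding T X by (simp only: distrib_left right_diff_distrib mult_ac diff_conv_add_uminus minus_add_distrib add_ac mult_minus_right mult_minus_left)
 thus ?thesis unfolding P S T' cutoff_eq_cut by simp
qed

end

section \<open>Affine substitution, continuous test functions and mollification\<close>

lemma nn_integral_lborel_affine:
 fixes f :: "'a::euclidean_space => ennreal"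
 assumes [measurable]: "f \<in> bmeas" and c: "c ~= 0"
 shows "(NINT x. f x) = ennreal (\<bar>c\<bar> ^ DIM('a)) * (NINT x. f (t + c *\<^sub>R x))"
 by (subst lborel_affine[OF c, of t]) (simp add: nn_integral_density nn_integral_distr nn_integral_cmult)

lemma integrable_lborel_affine:
 fixes f :: "'a::euclidean_space => complex"
 assumes f: "intble f" and c: "c ~= 0"
 shows "intble (%x. f (t + c *\<^sub>R x))"
proof -
 have [measurable]: "f \<in> bmeas" using f by simp
 have "(NINT x. norm (f x)) < \<infinity>" using f by (simp add: integrable_iff_bounded)
 hence "(NINT x. norm (f (t + c *\<^sub>R x))) < \<infinity>"
  by (subst (asm) nn_integral_lborel_affine[OF _ c, of _ t]) (use c in \<open>auto simp: ennreal_mult_less_top\<close>)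
 thus ?thesis by (simp add: integrable_iff_bounded)
qed

lemma integral_lborel_affine:
 fixes f :: "'a::euclidean_space => complex"
 assumes [measurable]: "f \<in> bmeas" and c: "c ~= 0"
 shows "(LBINT x. f x) = (\<bar>c\<bar> ^ DIM('a)) *\<^sub>R (LBINT x. f (t + c *\<^sub>R x))"
 by (subst lborel_affine[OF c, of t]) (simp add: integral_density integral_distr)

text \<open>Continuous test functions suffice for duality: a bounded measurable function with bounded
  support is an a.e. limit of continuous ones that obey the same bounds.\<close>
lemma dual_extend:
 fixes W g :: "R2 => complex"
 assumes [measurable]: "W \<in> bmeas" and Wloc: "!!R. intble (%z. indicator (cball 0 R) z *\<^sub>R W z)"
  and q: "q > 0" and N: "N >= 0"
  and dual: "!!f R. continuous_on UNIV f ==> (!!z. norm z > R ==> f z = 0) ==>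
   norm (LBINT z. W z * f z) <= N * (LBINT z. norm (f z) powr q) powr (1 / q)"
  and [measurable]: "g \<in> bmeas" and gM: "!!z. norm (g z) <= M" and gR: "!!z. norm z > R ==> g z = 0"
  and gn: "(NINT z. norm (g z) powr q) <= 1"
 shows "norm (LBINT z. W z * g z) <= N"
proof -
 define M1 where "M1 = max M 1"
 have M1: "M1 > 0" "norm (g z) <= M1" for z using gM[of z] by (simp_all add: M1_def le_max_iff_disj)
 have "g \<in> borel_measurable lebesgue" by (simp add: measurable_completion)
 hence "g measurable_on UNIV" by (simp add: lebesgue_measurable_imp_measurable_on)
 then obtain Z f where Z: "negligible Z" and f: "!!n. continuous_on UNIV (f n)"
  and lim: "!!x. x \<notin> Z ==> (%n. f n x) \<longlonglongrightarrow> g x"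
  unfolding measurable_on_def by auto
 \<comment> \<open>Radial truncation to modulus M1: continuous, and the identity on the values of g.
   Together with \<open>ch\<close> it gives the continuous approximants of g a uniform bound and
   bounded support.\<close>
 define tr where "tr y = y /\<^sub>R max 1 (norm y / M1)" for y :: complex
 have tr_cont: "continuous_on UNIV tr" unfolding tr_def using M1(1) by (intro continuous_intros) auto
 have tr_le: "norm (tr y) <= M1" for y
 proof -
  have "norm y <= M1 * max 1 (norm y / M1)"
  proof -
   have "norm y = M1 * (norm y / M1)" using M1(1) by simp
   also have "... <= M1 * max 1 (norm y / M1)" using M1(1) by (intro mult_left_mono) auto
   finally show ?thesis .
  qed
  hence "norm y / max 1 (norm y / M1) <= M1" by (subst pos_divide_le_eq) auto
  moreover have "norm (tr y) = norm y / max 1 (norm y / M1)" by (simp add: tr_def divide_inverse mult.commute)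
  ultimately show ?thesis by simp
 qed
 have tr_g: "tr (g z) = g z" for z
 proof -
  have "norm (g z) / M1 <= 1" using M1 by (simp add: pos_divide_le_eq)
  thus ?thesis by (simp add: tr_def max_def)
 qed
 define ch where "ch z = max 0 (min 1 (R + 1 - norm z))" for z :: R2
 have ch_cont: "continuous_on UNIV ch" unfolding ch_def by (intro continuous_intros)
 define h where "h n z = ch z *\<^sub>R tr (f n z)" for n z
 have h_cont: "continuous_on UNIV (h n)" for n
  unfolding h_def by (intro continuous_intros ch_cont continuous_on_compose2[OF tr_cont f]) auto
 have [measurable]: "h n \<in> bmeas" for n by (intro borel_measurable_continuous_onI h_cont)
 have h_supp: "h n z = 0" if "norm z > R + 1" for n z using that by (simp add: h_def ch_def)
 have h_le: "norm (h n z) <= M1 * indicator (cball 0 (R + 1)) z" for n z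
 proof (cases "norm z <= R + 1")
  case True
  have "\<bar>ch z\<bar> * norm (tr (f n z)) <= 1 * M1" by (intro mult_mono tr_le) (auto simp: ch_def)
  thus ?thesis using True by (simp add: h_def)
 next
  case False thus ?thesis using h_supp[of z n] by simp
 qed
 have h_lim: "AE z in lborel. (%n. h n z) \<longlonglongrightarrow> g z"
 proof -
  have "AE z in lebesgue. z \<notin> Z" using Z by (simp add: AE_not_in negligible_iff_null_sets)
  hence "AE z in lborel. z \<notin> Z" using AE_completion_iff by blast
  thus ?thesis
  proof eventually_elim
   case (elim z)
   have "(%n. tr (f n z)) \<longlonglongrightarrow> tr (g z)"
    by (rule continuous_on_tendsto_compose[OF tr_cont lim[OF elim]]) simp_all
   hence "(%n. h n z) \<longlonglongrightarrow> ch z *\<^sub>R g z" unfolding h_def tr_g by (intro tendsto_intros)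
   moreover have "ch z *\<^sub>R g z = g z"
    using gR[of z] by (cases "norm z <= R") (auto simp: ch_def)
   ultimately show ?case by simp
  qed
 qed
 have dW: "intble (%z. M1 * norm (indicator (cball 0 (R + 1)) z *\<^sub>R W z))"
  by (intro integrable_mult_right integrable_norm Wloc)
 have l1: "(%n. LBINT z. W z * h n z) \<longlonglongrightarrow> (LBINT z. W z * g z)"
 proof (rule integral_dominated_convergence[OF _ _ dW])
  show "AE z in lborel. (%n. W z * h n z) \<longlonglongrightarrow> W z * g z" using h_lim by eventually_elim (intro tendsto_intros)
  show "AE z in lborel. norm (W z * h n z) <= M1 * norm (indicator (cball 0 (R + 1)) z *\<^sub>R W z)" for n
  proof (rule AE_I2)
   fix z
   have "norm (W z) * norm (h n z) <= norm (W z) * (M1 * indicator (cball 0 (R + 1)) z)" by (intro mult_left_mono h_le) simp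
   thus "norm (W z * h n z) <= M1 * norm (indicator (cball 0 (R + 1)) z *\<^sub>R W z)" by (simp add: norm_mult mult_ac)
  qed
 qed simp_all
 have indi: "intble (%z. M1 powr q * indicator (cball (0::R2) (R + 1)) z)"
  using emeasure_lborel_cball_finite[of "0::R2" "R + 1"] by (intro integrable_mult_right integrable_real_indicator) simp_all
 have l2: "(%n. LBINT z. norm (h n z) powr q) \<longlonglongrightarrow> (LBINT z. norm (g z) powr q)"
 proof (rule integral_dominated_convergence[OF _ _ indi])
  show "AE z in lborel. (%n. norm (h n z) powr q) \<longlonglongrightarrow> norm (g z) powr q"
   using h_lim by eventually_elim (use q in \<open>auto intro!: tendsto_intros\<close>)
  show "AE z in lborel. norm (norm (h n z) powr q) <= M1 powr q * indicator (cball 0 (R + 1)) z" for n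
  proof (rule AE_I2)
   fix z
   have "norm (h n z) powr q <= (M1 * indicator (cball 0 (R + 1)) z) powr q" using q by (intro powr_mono2 h_le) auto
   thus "norm (norm (h n z) powr q) <= M1 powr q * indicator (cball 0 (R + 1)) z" by (cases "norm z <= R + 1") simp_all
  qed
 qed simp_all
 have le1: "(LBINT z. norm (g z) powr q) <= 1"
 proof -
  have "(LBINT z. norm (g z) powr q) = enn2real (NINT z. norm (g z) powr q)"
   by (rule integral_eq_nn_integral) auto
  also have "... <= 1" using enn2real_mono[OF gn] by simp
  finally show ?thesis .
 qed
 have "norm (LBINT z. W z * g z) <= N * (LBINT z. norm (g z) powr q) powr (1 / q)"
 proof (rule tendsto_le[OF trivial_limit_sequentially])
  show "(%n. norm (LBINT z. W z * h n z)) \<longlonglongrightarrow> norm (LBINT z. W z * g z)" by (intro tendsto_norm l1)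
  show "(%n. N * (LBINT z. norm (h n z) powr q) powr (1 / q)) \<longlonglongrightarrow> N * (LBINT z. norm (g z) powr q) powr (1 / q)"
   using q by (intro tendsto_mult tendsto_const tendsto_powr' l2) auto
  show "\<forall>\<^sub>F n in sequentially. norm (LBINT z. W z * h n z) <= N * (LBINT z. norm (h n z) powr q) powr (1 / q)"
   by (intro always_eventually allI dual[of _ "R + 1"] h_cont h_supp)
 qed
 also have "... <= N * 1"
 proof (rule mult_left_mono[OF _ N])
  show "(LBINT z. norm (g z) powr q) powr (1 / q) <= 1"
   using powr_mono2[of "1 / q" "(LBINT z. norm (g z) powr q)" 1] le1 q by simp
 qed
 finally show ?thesis by simp
qed

lemma gau_properties:
 assumes e: "e > 0"
 shows "gau e x >= 0" "intble (gau e)" "(LBINT x. gau e x) = 1" "gau e x <= 1 / sqrt (2 * pi * e)" "gau e (- x) = gau e x"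
proof -
 have eq: "gau e = normal_density 0 (sqrt e)"
  using e by (simp add: gau_def normal_density_def fun_eq_iff)
 show "intble (gau e)" "(LBINT x. gau e x) = 1"
  unfolding eq using e by simp_all
 show "gau e x >= 0" "gau e (- x) = gau e x" using e by (simp_all add: gau_def)
 have "exp (- x\<^sup>2 / (2 * e)) <= 1" using e by simp
 thus "gau e x <= 1 / sqrt (2 * pi * e)" unfolding gau_def using e by (intro divide_right_mono) auto
qed

lemma gau_measurable [measurable]: "gau e \<in> bmeas"
 unfolding gau_def[abs_def] by measurable

definition gau2 :: "real => R2 => real" where "gau2 e z = gau e (fst z) * gau e (snd z)"

lemma gau2_measurable [measurable]: "gau2 e \<in> bmeas"
 unfolding gau2_def[abs_def] by measurable

lemma gau2_properties:
 assumes e: "e > 0"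
 shows "gau2 e z >= 0" "intble (%z. cor (gau2 e z))" "(LBINT z. cor (gau2 e z)) = 1"
  "gau2 e z <= 1 / (2 * pi * e)" "gau2 e (- z) = gau2 e z"
proof -
 have i: "intble (%x. cor (gau e x))" by (intro integrable_of_real gau_properties e)
 show "intble (%z. cor (gau2 e z))"
  by (rule integrable_prod_dominated[OF i i]) (simp_all add: gau2_def norm_mult)
 have "(LBINT z. cor (gau2 e z)) = (LBINT z. cor (gau e (fst z)) * cor (gau e (snd z)))"
  by (simp add: gau2_def)
 also have "... = 1" unfolding integral_prod_mult[OF i i] integral_complex_of_real gau_properties(3)[OF e] by simp
 finally show "(LBINT z. cor (gau2 e z)) = 1" .
 show "gau2 e z >= 0" "gau2 e (- z) = gau2 e z" using gau_properties(1,5)[OF e] by (simp_all add: gau2_def)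
 have "gau2 e z <= 1 / sqrt (2 * pi * e) * (1 / sqrt (2 * pi * e))"
  unfolding gau2_def using e
  by (intro mult_mono gau_properties(4)[OF e] gau_properties(1)[OF e]) simp
 thus "gau2 e z <= 1 / (2 * pi * e)" using e by simp
qed

context parametrix
begin

lemma gau2_shift_L2:
 assumes [measurable]: "D \<in> bmeas" and D: "!!z. norm (D z) <= 1"
 shows "(NINT z. (norm (D z * cor (gau2 e (z - (t1, x1)))))\<^sup>2) < \<infinity>"
proof -
 let ?c = "1 / (2 * pi * e)"
 have c: "?c >= 0" using e by simp
 have "(NINT z. (norm (D z * cor (gau2 e (z - (t1, x1)))))\<^sup>2) <= (NINT z. ennreal ?c * ennreal (gau2 e (- (t1, x1) + 1 *\<^sub>R z)))"
 proof (rule nn_integral_mono)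
  fix z
  have "(norm (D z * cor (gau2 e (z - (t1, x1)))))\<^sup>2 = (norm (D z))\<^sup>2 * (gau2 e (z - (t1, x1)) * gau2 e (z - (t1, x1)))"
   using gau2_properties(1)[OF e] by (simp add: norm_mult power_mult_distrib power2_eq_square)
  also have "... <= 1 * (?c * gau2 e (z - (t1, x1)))"
  proof (rule mult_mono)
   show "(norm (D z))\<^sup>2 <= 1" using D[of z] by (simp add: power_le_one)
   show "gau2 e (z - (t1, x1)) * gau2 e (z - (t1, x1)) <= ?c * gau2 e (z - (t1, x1))"
    by (rule mult_right_mono[OF gau2_properties(4)[OF e] gau2_properties(1)[OF e]])
  qed (simp_all add: gau2_properties(1)[OF e])
  finally have "(norm (D z * cor (gau2 e (z - (t1, x1)))))\<^sup>2 <= ?c * gau2 e (z - (t1, x1))" by simp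
  from ennreal_leI[OF this] show "ennreal ((norm (D z * cor (gau2 e (z - (t1, x1)))))\<^sup>2) <= ennreal ?c * ennreal (gau2 e (- (t1, x1) + 1 *\<^sub>R z))"
   unfolding ennreal_mult'[OF c, symmetric] by (simp only: scaleR_one uminus_add_conv_diff)
 qed
 also have "... = ennreal ?c * (NINT z. ennreal (gau2 e (- (t1, x1) + 1 *\<^sub>R z)))" by (rule nn_integral_cmult) simp
 also have "(NINT z. ennreal (gau2 e (- (t1, x1) + 1 *\<^sub>R z))) = (NINT z. ennreal (gau2 e z))"
  by (subst (2) nn_integral_lborel_affine[where c=1 and t="- (t1, x1)"]) simp_all
 also have "ennreal ?c * ... < \<infinity>"
  using gau2_properties(1,2)[OF e] by (auto simp: ennreal_mult_less_top integrable_iff_bounded)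
 finally show ?thesis .
qed

text \<open>The equation is tested with the truncated parametrix. The commutators disappear and the
  Gaussian term becomes the mollified weighted solution at (t1, x1). Convergence of the integrals
  with V u is a consequence of the equation and needs no decay of V u.\<close>

lemma parametrix_limit:
 assumes sol: "solves m V u" and [measurable]: "u \<in> bmeas" and W2: "(NINT z. (norm (ex z * u z))\<^sup>2) < \<infinity>"
 shows "(%n. LBINT z. V z * u z * (cutoff n z * J Q0 R0 z)) \<longlonglongrightarrow> (LBINT z. ex z * u z * cor (gau2 e (z - (t1, x1))))"
proof -
 have [measurable]: "ex \<in> bmeas" unfolding ex_def by (intro borel_measurable_continuous_onI continuous_intros)
 define W where "W z = ex z * u z" for z
 have [measurable]: "W \<in> bmeas" unfolding W_def by measurable
 have W2': "(NINT z. (norm (W z))\<^sup>2) < \<infinity>" using W2 by (simp add: W_def)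
 define G where "G z = cor (gau2 e (z - (t1, x1)))" for z
 have [measurable]: "G \<in> bmeas" unfolding G_def by measurable
 \<comment> \<open>Index 0 stands for the time-derivative term, index k >= 1 for the k-th Leibniz
   term in x; all commutators become one finite sum.\<close>
 define D where "D k n = (if k = 0 then cut n (- \<i> / of_nat (Suc n)) 1 0 else cut n (- ((-1) ^ m * of_nat (2 * m choose k) / of_nat (Suc n) ^ k)) 0 k)" for k n
 define P where "P k = (if k = 0 then Q0 else [:cor be, \<i>:] ^ (2 * m - k) * Q0)" for k
 have [measurable]: "D k n \<in> bmeas" for k n
  unfolding D_def using has_partialsD(3)[OF cut_partials] by (auto intro!: borel_measurable_continuous_onI)
 have Db: "EX C. ALL n z. norm (D k n z) <= C / real (Suc n) * indicator {z. \<bar>fst z\<bar> <= real (Suc n)} z" for k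
 proof (cases "k = 0")
  case True
  obtain C where C: "C >= 0" "ALL n c z. norm (cut n c 1 0 z) <= norm c * C * indicator {z. \<bar>fst z\<bar> <= real (Suc n)} z" using cut_bound by blast
  have "norm (D k n z) <= C / real (Suc n) * indicator {z. \<bar>fst z\<bar> <= real (Suc n)} z" for n z
   using C(2)[rule_format, of n "- \<i> / of_nat (Suc n)" z] True by (simp add: D_def norm_divide del: of_nat_Suc)
  thus ?thesis by blast
 next
  case False
  obtain C where C: "C >= 0" "ALL n c z. norm (cut n c 0 k z) <= norm c * C * indicator {z. \<bar>fst z\<bar> <= real (Suc n)} z" using cut_bound by blast
  have "norm (D k n z) <= (real (2 * m choose k) * C) / real (Suc n) * indicator {z. \<bar>fst z\<bar> <= real (Suc n)} z" for n z
  proof -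
   let ?c = "- ((-1) ^ m * of_nat (2 * m choose k) / of_nat (Suc n) ^ k) :: complex"
   have "norm ?c = real (2 * m choose k) / real (Suc n) ^ k" by (simp add: norm_divide norm_mult norm_power del: of_nat_Suc)
   also have "... <= real (2 * m choose k) / real (Suc n)"
   proof (rule divide_left_mono)
    show "real (Suc n) <= real (Suc n) ^ k" using power_increasing[of 1 k "real (Suc n)"] False by simp
   qed simp_all
   finally have c: "norm ?c <= real (2 * m choose k) / real (Suc n)" .
   have "norm (D k n z) <= norm ?c * (C * indicator {z. \<bar>fst z\<bar> <= real (Suc n)} z)"
    using C(2)[rule_format, of n ?c z] False by (simp only: D_def if_False mult.assoc)
   also have "... <= real (2 * m choose k) / real (Suc n) * (C * indicator {z. \<bar>fst z\<bar> <= real (Suc n)} z)"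
    using C(1) by (intro mult_right_mono c) simp
   finally show ?thesis by (simp add: mult_ac del: of_nat_Suc)
  qed
  thus ?thesis by blast
 qed
 have int: "intble (%z. W z * (D k n z * I (P k) R0 z))" and lim: "(%n. LBINT z. W z * (D k n z * I (P k) R0 z)) \<longlonglongrightarrow> 0" for k n
 proof -
  obtain C where C: "ALL n z. norm (D k n z) <= C / real (Suc n) * indicator {z. \<bar>fst z\<bar> <= real (Suc n)} z" using Db by blast
  show "intble (%z. W z * (D k n z * I (P k) R0 z))" "(%n. LBINT z. W z * (D k n z * I (P k) R0 z)) \<longlonglongrightarrow> 0"
   by (rule commutator_tendsto_0[OF _ _ W2' C[rule_format]]; simp)+
 qed
 have int0: "intble (%z. W z * (cutoff n z * G z))" for n
  unfolding G_def by (rule integrable_mult_L2[OF _ _ W2' gau2_shift_L2[OF _ cutoff_le]]) simp_all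
 have int1: "intble (%z. W z * G z)"
  unfolding G_def using integrable_mult_L2[OF _ _ W2' gau2_shift_L2[of "%z. 1"]] by simp
 have eq: "(LBINT z. V z * u z * (cutoff n z * J Q0 R0 z)) = (LBINT z. W z * (cutoff n z * G z)) + (\<Sum>k\<le>2*m. LBINT z. W z * (D k n z * I (P k) R0 z))" for n
 proof -
  have split: "{..2 * m} = insert 0 {1..2 * m}" by auto
  have "(LBINT z. V z * u z * (cutoff n z * J Q0 R0 z)) =
   (LBINT z. u z * (- \<i> * dT (%z. cutoff n z * J Q0 R0 z) z - (-1) ^ m * (dX ^^ (2 * m)) (%z. cutoff n z * J Q0 R0 z) z))"
   using sol[unfolded solves_def, rule_format, OF test_fun_cutoff_J[of n Q0 R0]] by simp
  also have "... = (LBINT z. W z * (cutoff n z * G z) + (\<Sum>k\<le>2*m. W z * (D k n z * I (P k) R0 z)))"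
  proof (rule Bochner_Integration.integral_cong[OF refl])
   fix z
   have S: "(\<Sum>k\<le>2*m. D k n z * I (P k) R0 z) = cut n (- \<i> / of_nat (Suc n)) 1 0 z * I Q0 R0 z +
     (\<Sum>k=1..2*m. cut n (- ((-1) ^ m * of_nat (2 * m choose k) / of_nat (Suc n) ^ k)) 0 k z * I ([:cor be, \<i>:] ^ (2 * m - k) * Q0) R0 z)"
   proof -
    have "(\<Sum>k\<le>2*m. D k n z * I (P k) R0 z) = D 0 n z * I (P 0) R0 z + (\<Sum>k=1..2*m. D k n z * I (P k) R0 z)"
     unfolding split by (subst sum.insert) auto
    also have "(\<Sum>k=1..2*m. D k n z * I (P k) R0 z) = (\<Sum>k=1..2*m. cut n (- ((-1) ^ m * of_nat (2 * m choose k) / of_nat (Suc n) ^ k)) 0 k z * I ([:cor be, \<i>:] ^ (2 * m - k) * Q0) R0 z)"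
     by (intro sum.cong refl) (simp add: D_def P_def)
    finally show ?thesis by (simp add: D_def P_def)
   qed
   show "u z * (- \<i> * dT (%z. cutoff n z * J Q0 R0 z) z - (-1) ^ m * (dX ^^ (2 * m)) (%z. cutoff n z * J Q0 R0 z) z)
    = W z * (cutoff n z * G z) + (\<Sum>k\<le>2*m. W z * (D k n z * I (P k) R0 z))"
    unfolding cut_J_equation sum_distrib_left[symmetric] S W_def G_def gau2_def
    by (simp only: fst_diff snd_diff fst_conv snd_conv distrib_left mult_ac add.assoc)
  qed
  also have "... = (LBINT z. W z * (cutoff n z * G z)) + (\<Sum>k\<le>2*m. LBINT z. W z * (D k n z * I (P k) R0 z))"
   by (subst Bochner_Integration.integral_add[OF int0 Bochner_Integration.integrable_sum[OF int]], subst Bochner_Integration.integral_sum[OF int], rule refl)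
  finally show ?thesis .
 qed
 have "(%n. LBINT z. W z * (cutoff n z * G z)) \<longlonglongrightarrow> (LBINT z. W z * G z)"
 proof (rule integral_dominated_convergence[OF _ _ integrable_norm[OF int1]])
  show "AE z in lborel. (%n. W z * (cutoff n z * G z)) \<longlonglongrightarrow> W z * G z"
  proof (rule AE_I2)
   fix z
   have "(%n. W z * (cutoff n z * G z)) \<longlonglongrightarrow> W z * (1 * G z)" by (intro tendsto_intros cutoff_tendsto)
   thus "(%n. W z * (cutoff n z * G z)) \<longlonglongrightarrow> W z * G z" by simp
  qed
  show "AE z in lborel. norm (W z * (cutoff n z * G z)) <= norm (W z * G z)" for n
  proof (rule AE_I2)
   fix z
   have "norm (cutoff n z) * (norm (W z) * norm (G z)) <= 1 * (norm (W z) * norm (G z))" by (intro mult_right_mono cutoff_le) simp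
   thus "norm (W z * (cutoff n z * G z)) <= norm (W z * G z)" by (simp add: norm_mult mult_ac)
  qed
 qed simp_all
 moreover have "(%n. \<Sum>k\<le>2*m. LBINT z. W z * (D k n z * I (P k) R0 z)) \<longlonglongrightarrow> (\<Sum>k\<le>2*m. 0)"
  by (intro tendsto_sum lim)
 ultimately have "(%n. (LBINT z. W z * (cutoff n z * G z)) + (\<Sum>k\<le>2*m. LBINT z. W z * (D k n z * I (P k) R0 z))) \<longlonglongrightarrow> (LBINT z. W z * G z) + (\<Sum>k\<le>2*m. 0)"
  by (rule tendsto_add)
 thus ?thesis unfolding eq W_def G_def by simp
qed

end

text \<open>The Gaussian absorbs polynomial growth; this is the dominating function for mollifying
  functions that grow polynomially in the mean.\<close>

lemma integrable_gau2_weighted: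
 "intble (%y. gau2 1 y * (C * (1 + R + norm y) ^ N))" if R: "R >= 0" and C: "C >= 0"
proof -
 define g where "g t = gau 1 t * (1 + \<bar>t\<bar>) ^ N" for t
 have g: "intble g"
 proof (rule Bochner_Integration.integrable_bound[OF integrable_mult_right[OF integrable_exp_neg_abs, of "exp ((real N + 1)\<^sup>2 / 2)"] _ AE_I2])
  show "g \<in> borel_measurable lborel" unfolding g_def by measurable
  fix t :: real
  have "(1 + \<bar>t\<bar>) ^ N <= exp \<bar>t\<bar> ^ N" by (intro power_mono exp_ge_add_one_self) simp
  also have "... = exp (real N * \<bar>t\<bar>)" by (simp add: exp_of_nat_mult)
  finally have p: "(1 + \<bar>t\<bar>) ^ N <= exp (real N * \<bar>t\<bar>)" .
  have s: "gau 1 t <= exp (- t\<^sup>2 / 2)"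
  proof -
   have "1 <= sqrt (2 * pi * 1)" using pi_gt3 by simp
   hence "exp (- t\<^sup>2 / 2) / sqrt (2 * pi * 1) <= exp (- t\<^sup>2 / 2) / 1" by (intro divide_left_mono) auto
   thus ?thesis by (simp add: gau_def)
  qed
  have "0 <= (\<bar>t\<bar> - (real N + 1))\<^sup>2 / 2" by simp
  also have "... = t\<^sup>2 / 2 - (real N + 1) * \<bar>t\<bar> + (real N + 1)\<^sup>2 / 2" by (simp add: power2_eq_square field_simps)
  finally have ex: "- t\<^sup>2 / 2 + real N * \<bar>t\<bar> <= (real N + 1)\<^sup>2 / 2 + - \<bar>t\<bar>" by (simp add: algebra_simps)
  have "g t <= exp (- t\<^sup>2 / 2) * exp (real N * \<bar>t\<bar>)"
   unfolding g_def by (intro mult_mono s p) simp_all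
  also have "... <= exp ((real N + 1)\<^sup>2 / 2) * exp (- \<bar>t\<bar>)" unfolding exp_add[symmetric] using ex by simp
  finally show "norm (g t) <= norm (exp ((real N + 1)\<^sup>2 / 2) * exp (- \<bar>t\<bar>))"
   using gau_properties(1)[of 1 t] by (simp add: g_def abs_mult)
 qed
 let ?c = "C * (1 + R) ^ N"
 show ?thesis
 proof (rule integrable_prod_dominated[OF integrable_mult_right[OF g, of ?c] g])
  fix t x :: real
  have g0: "g s >= 0" for s using gau_properties(1)[of 1 s] by (simp add: g_def)
  have "norm (t, x) <= \<bar>t\<bar> + \<bar>x\<bar>" using norm_Pair_le[of t x] by simp
  hence "1 + R + norm (t, x) <= 1 + R + (\<bar>t\<bar> + \<bar>x\<bar>)" by simp
  also have "... <= (1 + R) * ((1 + \<bar>t\<bar>) * (1 + \<bar>x\<bar>))"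
  proof -
   have "0 <= \<bar>t\<bar> * \<bar>x\<bar> + R * (\<bar>t\<bar> + \<bar>x\<bar> + \<bar>t\<bar> * \<bar>x\<bar>)" using R by simp
   thus ?thesis by (simp add: algebra_simps)
  qed
  finally have "(1 + R + norm (t, x)) ^ N <= ((1 + R) * ((1 + \<bar>t\<bar>) * (1 + \<bar>x\<bar>))) ^ N" using R by (intro power_mono) auto
  hence "gau2 1 (t, x) * (C * (1 + R + norm (t, x)) ^ N) <= gau2 1 (t, x) * (C * ((1 + R) * ((1 + \<bar>t\<bar>) * (1 + \<bar>x\<bar>))) ^ N)"
   using C by (intro mult_left_mono gau2_properties) auto
  also have "... = ?c * g t * g x" by (simp add: gau2_def g_def power_mult_distrib)
  finally have "gau2 1 (t, x) * (C * (1 + R + norm (t, x)) ^ N) <= ?c * g t * g x" .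
  moreover have "0 <= gau2 1 (t, x) * (C * (1 + R + norm (t, x)) ^ N)" using R C gau2_properties(1)[of 1 "(t, x)"] by simp
  ultimately show "norm (gau2 1 (t, x) * (C * (1 + R + norm (t, x)) ^ N)) <= norm (?c * g t) * norm (g x)"
   using R C g0[of t] g0[of x] by (simp add: abs_mult)
 qed simp
qed

lemma gau2_scale: "e > 0 ==> gau2 e (sqrt e *\<^sub>R y) = gau2 1 y / e"
 by (simp add: gau2_def gau_def power_mult_distrib real_sqrt_mult)

text \<open>Fubini moves the mollifier from W to f, after scaling to the fixed Gaussian
  \<open>gau2 1\<close>. Because W is controlled only in a weighted L1 norm, a shift by s costs the
  factor (1 + R1 + |s|)^N, which the Gaussian absorbs.\<close>

lemma mollify_limit:
 fixes W f :: "R2 => complex"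
 assumes [measurable]: "W \<in> bmeas" and Wt: "intble (%z. norm (W z) / (1 + norm z) ^ N)"
  and f: "continuous_on UNIV f" and fR: "!!z. norm z > R ==> f z = 0"
 shows "(%n. LBINT z. (LBINT y. W y * cor (gau2 (1 / real (Suc n)) (y - z))) * f z) \<longlonglongrightarrow> (LBINT z. W z * f z)"
proof -
 have [measurable]: "f \<in> bmeas" by (intro borel_measurable_continuous_onI f)
 define R1 where "R1 = max R 0"
 have R1: "R1 >= 0" "!!z. norm z > R1 ==> f z = 0" using fR by (auto simp: R1_def)
 have "bounded (f ` cball 0 R1)"
  by (intro compact_imp_bounded compact_continuous_image continuous_on_subset[OF f]) auto
 then obtain M where M: "\<forall>z\<in>cball 0 R1. norm (f z) <= M" by (auto simp: bounded_iff)
 have M0: "M >= 0" using order_trans[OF norm_ge_zero M[rule_format, of 0]] R1(1) by simp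
 have fM: "norm (f z) <= M * indicator (cball 0 R1) z" for z
  using M R1(2)[of z] by (cases "norm z <= R1") auto
 define S where "S = (LBINT z. norm (W z) / (1 + norm z) ^ N)"
 have S0: "S >= 0" by (simp add: S_def)
 have Snn: "(NINT z. ennreal (norm (W z) / (1 + norm z) ^ N)) = ennreal S"
  unfolding S_def by (intro nn_integral_eq_integral Wt) auto
 have loc: "(NINT z. norm (W (z + s) * f z)) <= ennreal (M * S * (1 + R1 + norm s) ^ N)" for s
 proof -
  let ?P = "(1 + R1 + norm s) ^ N"
  have "(NINT z. norm (W (z + s) * f z)) <= (NINT z. ennreal (M * ?P) * ennreal (norm (W (s + 1 *\<^sub>R z)) / (1 + norm (s + 1 *\<^sub>R z)) ^ N))"
  proof (rule nn_integral_mono)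
   fix z
   have "norm (W (z + s) * f z) <= M * ?P * (norm (W (z + s)) / (1 + norm (z + s)) ^ N)"
   proof (cases "norm z <= R1")
    case True
    have "norm (z + s) <= norm z + norm s" by (rule norm_triangle_ineq)
    hence "(1 + norm (z + s)) ^ N <= ?P" using True by (intro power_mono) auto
    hence "1 <= ?P / (1 + norm (z + s)) ^ N" by (simp add: add_pos_nonneg)
    hence "norm (W (z + s)) * M * 1 <= norm (W (z + s)) * M * (?P / (1 + norm (z + s)) ^ N)"
     using M0 by (intro mult_left_mono) auto
    moreover have "norm (W (z + s)) * norm (f z) <= norm (W (z + s)) * M" using fM[of z] True by (intro mult_left_mono) auto
    ultimately show ?thesis by (simp add: norm_mult mult_ac)
   next
    case False thus ?thesis using R1(2)[of z] M0 R1(1) by simp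
   qed
   from ennreal_leI[OF this] show "ennreal (norm (W (z + s) * f z)) <= ennreal (M * ?P) * ennreal (norm (W (s + 1 *\<^sub>R z)) / (1 + norm (s + 1 *\<^sub>R z)) ^ N)"
    using M0 R1(1) by (subst ennreal_mult'[symmetric]) (simp_all add: add.commute)
  qed
  also have "... = ennreal (M * ?P) * (NINT z. ennreal (norm (W (s + 1 *\<^sub>R z)) / (1 + norm (s + 1 *\<^sub>R z)) ^ N))"
   by (rule nn_integral_cmult) measurable
  also have "(NINT z. ennreal (norm (W (s + 1 *\<^sub>R z)) / (1 + norm (s + 1 *\<^sub>R z)) ^ N)) = ennreal S"
   unfolding Snn[symmetric] by (subst (2) nn_integral_lborel_affine[where c=1 and t=s]) simp_all
  also have "ennreal (M * ?P) * ennreal S = ennreal (M * S * ?P)" using M0 R1(1) by (subst ennreal_mult'[symmetric]) (simp_all add: mult_ac)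
  finally show ?thesis .
 qed
 define F where "F s = (LBINT z. W (z + s) * f z)" for s
 have [measurable]: "F \<in> bmeas" unfolding F_def by measurable
 have Fb: "norm (F s) <= M * S * (1 + R1 + norm s) ^ N" for s
 proof -
  have "ennreal (norm (F s)) <= ennreal (M * S * (1 + R1 + norm s) ^ N)"
   unfolding F_def by (rule order_trans[OF norm_integral_le_nn_integral loc])
  thus ?thesis using M0 S0 R1(1) by (subst (asm) ennreal_le_iff) simp_all
 qed
 have dom: "intble (%y. gau2 1 y * (M * S * (1 + R1 + norm y) ^ N))"
  using M0 S0 by (intro integrable_gau2_weighted R1) simp
 have conv: "(LBINT z. (LBINT y. W y * cor (gau2 e (y - z))) * f z) = (LBINT y. cor (gau2 1 y) * F (sqrt e *\<^sub>R y))"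
  if e: "e > 0" "e <= 1" for e
 proof -
  have inner: "(LBINT y. W y * cor (gau2 e (y - z))) = (LBINT y. cor (gau2 1 y) * W (z + sqrt e *\<^sub>R y))" for z
  proof -
   have "(LBINT y. W y * cor (gau2 e (y - z))) = (\<bar>sqrt e\<bar> ^ DIM(R2)) *\<^sub>R (LBINT y. W (z + sqrt e *\<^sub>R y) * cor (gau2 e (z + sqrt e *\<^sub>R y - z)))"
    by (rule integral_lborel_affine) (use e in simp_all)
   also have "... = cor e * (LBINT y. W (z + sqrt e *\<^sub>R y) * cor (gau2 1 y / e))"
    using e by (simp add: gau2_scale scaleR_conv_of_real power2_eq_square flip: of_real_mult)
   also have "... = (LBINT y. cor e * (W (z + sqrt e *\<^sub>R y) * cor (gau2 1 y / e)))" by simp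
   also have "... = (LBINT y. cor (gau2 1 y) * W (z + sqrt e *\<^sub>R y))"
    using e by (intro Bochner_Integration.integral_cong refl) simp
   finally show ?thesis .
  qed
  let ?H = "%z y. cor (gau2 1 y) * W (z + sqrt e *\<^sub>R y) * f z"
  have "(NINT p. norm (?H (snd p) (fst p))) = (NINT y. NINT z. norm (?H z y))"
   by (subst nn_integral_R2) simp_all
  also have "... <= (NINT y. ennreal (gau2 1 y * (M * S * (1 + R1 + norm y) ^ N)))"
  proof (rule nn_integral_mono)
   fix y
   have g0: "gau2 1 y >= 0" by (rule gau2_properties) simp
   have "(NINT z. norm (?H z y)) = (NINT z. ennreal (gau2 1 y) * ennreal (norm (W (z + sqrt e *\<^sub>R y) * f z)))"
    using g0 by (intro nn_integral_cong) (simp add: norm_mult mult.assoc flip: ennreal_mult')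
   also have "... = ennreal (gau2 1 y) * (NINT z. norm (W (z + sqrt e *\<^sub>R y) * f z))" by (rule nn_integral_cmult) measurable
   also have "... <= ennreal (gau2 1 y) * ennreal (M * S * (1 + R1 + norm (sqrt e *\<^sub>R y)) ^ N)" by (intro mult_left_mono loc) simp
   also have "... = ennreal (gau2 1 y * (M * S * (1 + R1 + norm (sqrt e *\<^sub>R y)) ^ N))" using g0 by (simp only: ennreal_mult')
   also have "... <= ennreal (gau2 1 y * (M * S * (1 + R1 + norm y) ^ N))"
   proof (intro ennreal_leI mult_left_mono power_mono add_left_mono)
    show "norm (sqrt e *\<^sub>R y) <= norm y" using e mult_right_mono[of "sqrt e" 1 "norm y"] by simp
   qed (use g0 M0 S0 R1(1) in simp_all)
   finally show "(NINT z. norm (?H z y)) <= ennreal (gau2 1 y * (M * S * (1 + R1 + norm y) ^ N))" .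
  qed
  also have "... < \<infinity>"
   using integrableD(2)[OF dom] M0 S0 R1(1) gau2_properties(1)[of 1] by (simp add: abs_mult less_top)
  finally have "integrable (lborel \<Otimes>\<^sub>M lborel) (%(y, z). ?H z y)"
   by (simp add: integrable_iff_bounded lborel_prod split_beta')
  from lborel_pair.Fubini_integral[OF this]
  have "(LBINT z. LBINT y. ?H z y) = (LBINT y. LBINT z. ?H z y)" .
  moreover have "(LBINT y. ?H z y) = (LBINT y. cor (gau2 1 y) * W (z + sqrt e *\<^sub>R y)) * f z" for z by (rule integral_mult_left_zero)
  moreover have "(LBINT z. ?H z y) = cor (gau2 1 y) * F (sqrt e *\<^sub>R y)" for y
   unfolding F_def mult.assoc by (rule integral_mult_right_zero)
  ultimately show ?thesis unfolding inner by simp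
 qed
 \<comment> \<open>Continuity at 0 along bounded sequences. The shift is put on f, which is
   continuous, since W is merely measurable.\<close>
 have F0: "(%n. F (s n)) \<longlonglongrightarrow> F 0" if s: "s \<longlonglongrightarrow> 0" "!!n. norm (s n) <= B" for s :: "nat => R2" and B
 proof -
  have B0: "B >= 0" using order_trans[OF norm_ge_zero s(2)] .
  have Fs: "F s = (LBINT z. W z * f (z - s))" for s
   unfolding F_def using integral_lborel_affine[of "%z. W z * f (z - s)" 1 s] by (simp add: add.commute)
  let ?w = "%z. M * (1 + R1 + B) ^ N * (norm (W z) / (1 + norm z) ^ N)"
  have "(%n. LBINT z. W z * f (z - s n)) \<longlonglongrightarrow> (LBINT z. W z * f (z - 0))"
  proof (rule integral_dominated_convergence[where w="?w"])
   show "intble ?w" by (intro integrable_mult_right Wt)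
   show "AE z in lborel. (%n. W z * f (z - s n)) \<longlonglongrightarrow> W z * f (z - 0)"
   proof (rule AE_I2)
    fix z
    have "(%n. z - s n) \<longlonglongrightarrow> z - 0" by (intro tendsto_intros s)
    from continuous_on_tendsto_compose[OF f this] show "(%n. W z * f (z - s n)) \<longlonglongrightarrow> W z * f (z - 0)"
     by (intro tendsto_intros) simp_all
   qed
   show "AE z in lborel. norm (W z * f (z - s n)) <= ?w z" for n
   proof (rule AE_I2)
    fix z
    show "norm (W z * f (z - s n)) <= ?w z"
    proof (cases "norm (z - s n) <= R1")
     case True
     have "norm z <= norm (z - s n) + norm (s n)" using norm_triangle_sub[of z "s n"] by simp
     hence "(1 + norm z) ^ N <= (1 + R1 + B) ^ N" using True s(2)[of n] by (intro power_mono) auto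
     hence "1 <= (1 + R1 + B) ^ N / (1 + norm z) ^ N" by (simp add: add_pos_nonneg)
     hence "norm (W z) * M * 1 <= norm (W z) * M * ((1 + R1 + B) ^ N / (1 + norm z) ^ N)"
      using M0 by (intro mult_left_mono) auto
     moreover have "norm (W z) * norm (f (z - s n)) <= norm (W z) * M" using fM[of "z - s n"] True by (intro mult_left_mono) auto
     ultimately show ?thesis by (simp add: norm_mult mult_ac)
    next
     case False thus ?thesis using R1(2)[of "z - s n"] M0 R1(1) B0 by simp
    qed
   qed
  qed simp_all
  thus ?thesis unfolding Fs by simp
 qed
 have "(%n. LBINT y. cor (gau2 1 y) * F (sqrt (1 / real (Suc n)) *\<^sub>R y)) \<longlonglongrightarrow> (LBINT y. cor (gau2 1 y) * F 0)"
 proof (rule integral_dominated_convergence[OF _ _ dom])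
  have le1: "sqrt (1 / real (Suc n)) <= 1" "0 <= sqrt (1 / real (Suc n))" for n by simp_all
  show "AE y in lborel. (%n. cor (gau2 1 y) * F (sqrt (1 / real (Suc n)) *\<^sub>R y)) \<longlonglongrightarrow> cor (gau2 1 y) * F 0"
  proof (rule AE_I2)
   fix y :: R2
   have "(%n. 1 / real (Suc n)) \<longlonglongrightarrow> 0" by (rule LIMSEQ_Suc[OF lim_1_over_n])
   from tendsto_real_sqrt[OF this] have "(%n. sqrt (1 / real (Suc n)) *\<^sub>R y) \<longlonglongrightarrow> sqrt 0 *\<^sub>R y" by (rule tendsto_scaleR[OF _ tendsto_const])
   hence "(%n. sqrt (1 / real (Suc n)) *\<^sub>R y) \<longlonglongrightarrow> 0" by simp
   moreover have "norm (sqrt (1 / real (Suc n)) *\<^sub>R y) <= norm y" for n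
    using mult_right_mono[OF le1(1)[of n] norm_ge_zero[of y]] le1(2)[of n] by simp
   ultimately have "(%n. F (sqrt (1 / real (Suc n)) *\<^sub>R y)) \<longlonglongrightarrow> F 0" by (rule F0)
   thus "(%n. cor (gau2 1 y) * F (sqrt (1 / real (Suc n)) *\<^sub>R y)) \<longlonglongrightarrow> cor (gau2 1 y) * F 0"
    by (intro tendsto_intros)
  qed
  show "AE y in lborel. norm (cor (gau2 1 y) * F (sqrt (1 / real (Suc n)) *\<^sub>R y)) <= gau2 1 y * (M * S * (1 + R1 + norm y) ^ N)" for n
  proof (rule AE_I2)
   fix y
   have g0: "gau2 1 y >= 0" by (rule gau2_properties) simp
   have "norm (sqrt (1 / real (Suc n)) *\<^sub>R y) <= norm y"
    using mult_right_mono[OF le1(1)[of n] norm_ge_zero[of y]] le1(2)[of n] by simp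
   hence "M * S * (1 + R1 + norm (sqrt (1 / real (Suc n)) *\<^sub>R y)) ^ N <= M * S * (1 + R1 + norm y) ^ N"
    using M0 S0 R1(1) by (intro mult_left_mono power_mono) auto
   hence "norm (F (sqrt (1 / real (Suc n)) *\<^sub>R y)) <= M * S * (1 + R1 + norm y) ^ N"
    using Fb[of "sqrt (1 / real (Suc n)) *\<^sub>R y"] by linarith
   hence "gau2 1 y * norm (F (sqrt (1 / real (Suc n)) *\<^sub>R y)) <= gau2 1 y * (M * S * (1 + R1 + norm y) ^ N)"
    using g0 by (rule mult_left_mono)
   thus "norm (cor (gau2 1 y) * F (sqrt (1 / real (Suc n)) *\<^sub>R y)) <= gau2 1 y * (M * S * (1 + R1 + norm y) ^ N)"
    using g0 by (simp only: norm_mult norm_of_real abs_of_nonneg)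
  qed
 qed measurable
 moreover have "(LBINT y. cor (gau2 1 y) * F 0) = (LBINT z. W z * f z)"
  using gau2_properties(3)[of 1] by (simp add: F_def)
 moreover have "(LBINT z. (LBINT y. W y * cor (gau2 (1 / real (Suc n)) (y - z))) * f z) =
   (LBINT y. cor (gau2 1 y) * F (sqrt (1 / real (Suc n)) *\<^sub>R y))" for n
  by (rule conv) simp_all
 ultimately show ?thesis by simp
qed

section \<open>The Carleman estimate with uniform constant\<close>

text \<open>The propagator kernel averaged in time with \<open>gau e\<close>: the kernel of the
  parametrix up to the factor i.\<close>

definition kern2 :: "nat => real => real => real => R2 => complex" where
 "kern2 m al be e s = (LBINT r. cor (gau e (fst s - r)) * kern m al be e r (snd s))"

lemma kern2_measurable [measurable]: "kern2 m al be e \<in> bmeas"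
 unfolding kern2_def[abs_def] by measurable

lemma kern2_eq: "kern2 m al be e s = (LBINT \<sigma>. cor (gau e \<sigma>) * kern m al be e (fst s - \<sigma>) (snd s))"
 unfolding kern2_def using lborel_integral_real_affine[of "-1" "%r. cor (gau e (fst s - r)) * kern m al be e r (snd s)" "fst s"] by simp

lemma kern2_bounded:
 assumes e: "e > 0"
 shows "norm (kern2 m al be e s) <= sqrt (2 * pi / e)"
proof -
 have "norm (kern2 m al be e s) <= (LBINT \<sigma>. norm (cor (gau e \<sigma>) * kern m al be e (fst s - \<sigma>) (snd s)))"
  unfolding kern2_eq by (rule integral_norm_bound)
 also have "... <= (LBINT \<sigma>. gau e \<sigma> * sqrt (2 * pi / e))"
 proof (rule integral_mono')
  show "intble (%\<sigma>. gau e \<sigma> * sqrt (2 * pi / e))" by (intro integrable_mult_left gau_properties e)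
  show "norm (cor (gau e \<sigma>) * kern m al be e (fst s - \<sigma>) (snd s)) <= gau e \<sigma> * sqrt (2 * pi / e)" for \<sigma>
   using mult_left_mono[OF kern_bounded[OF e] gau_properties(1)[OF e]] gau_properties(1)[OF e] by (simp add: norm_mult)
  show "0 <= gau e \<sigma> * sqrt (2 * pi / e)" for \<sigma> using gau_properties(1)[OF e] e by simp
 qed
 also have "... = sqrt (2 * pi / e)" using gau_properties(3)[OF e] by simp
 finally show ?thesis .
qed

text \<open>\<open>kern2\<close> averages time translates of \<open>kern\<close> with a probability
  weight. Translating the kernel amounts to translating h, which leaves its norm unchanged, so the
  constant is inherited.\<close>

lemma Bil2_kern2:
 assumes e: "e > 0" and h: "intble h" and g: "intble g"
  and str: "!!h. intble h ==> (NINT z. norm (h z) powr q) <= 1 ==>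
   norm (Bil2 (%z. kern m al be e (fst z) (snd z)) h g) <= C"
  and hn: "(NINT z. norm (h z) powr q) <= 1"
 shows "norm (Bil2 (kern2 m al be e) h g) <= C"
proof -
 have [measurable]: "h \<in> bmeas" "g \<in> bmeas" using h g by auto
 let ?B = "sqrt (2 * pi / e)"
 let ?k = "%\<sigma> z. kern m al be e (fst z - \<sigma>) (snd z)"
 have shift: "Bil2 (?k \<sigma>) h g = Bil2 (%z. kern m al be e (fst z) (snd z)) (%z. h ((\<sigma>, 0) + 1 *\<^sub>R z)) g" for \<sigma>
 proof -
  have "Bil2 (?k \<sigma>) h g = (LBINT w. h (fst (((\<sigma>, 0), 0) + 1 *\<^sub>R w)) * ?k \<sigma> (fst (((\<sigma>, 0), 0) + 1 *\<^sub>R w) - snd (((\<sigma>, 0), 0) + 1 *\<^sub>R w)) * g (snd (((\<sigma>, 0), 0) + 1 *\<^sub>R w)))"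
   unfolding Bil2_def by (subst integral_lborel_affine[where c=1 and t="((\<sigma>, 0), 0)"]) simp_all
  also have "... = Bil2 (%z. kern m al be e (fst z) (snd z)) (%z. h ((\<sigma>, 0) + 1 *\<^sub>R z)) g"
   unfolding Bil2_def by (simp add: algebra_simps)
  finally show ?thesis .
 qed
 have bnd: "norm (Bil2 (?k \<sigma>) h g) <= C" for \<sigma>
  unfolding shift
 proof (rule str)
  show "intble (%z. h ((\<sigma>, 0) + 1 *\<^sub>R z))" by (rule integrable_lborel_affine[OF h]) simp
  show "(NINT z. norm (h ((\<sigma>, 0) + 1 *\<^sub>R z)) powr q) <= 1"
   using hn by (subst (asm) nn_integral_lborel_affine[where c=1 and t="(\<sigma>, 0)"]) simp_all
 qed
 let ?F = "%w \<sigma>. cor (gau e \<sigma>) * (h (fst w) * ?k \<sigma> (fst w - snd w) * g (snd w))"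
 have hg: "intble (%w. h (fst w) * cor ?B * g (snd w))"
  by (rule Bil2_integrable[OF h g, of "%_. cor ?B" ?B]) (use e in simp_all)
 have gi: "intble (gau e)" by (rule gau_properties[OF e])
 have "intble (%p. ?F (fst p) (snd p))"
 proof (rule integrable_prod_dominated[OF hg gi])
  fix w \<sigma>
  have "norm (?k \<sigma> (fst w - snd w)) * (gau e \<sigma> * (norm (h (fst w)) * norm (g (snd w)))) <= ?B * (gau e \<sigma> * (norm (h (fst w)) * norm (g (snd w))))"
   using gau_properties(1)[OF e] by (intro mult_right_mono kern_bounded e) auto
  thus "norm (?F (fst (w, \<sigma>)) (snd (w, \<sigma>))) <= norm (h (fst w) * cor ?B * g (snd w)) * norm (gau e \<sigma>)"
   using gau_properties(1)[OF e, of \<sigma>] e by (simp add: norm_mult mult_ac)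
 qed measurable
 hence "integrable (lborel \<Otimes>\<^sub>M lborel) (%(w, \<sigma>). ?F w \<sigma>)" by (simp add: lborel_prod split_beta')
 from lborel_pair.Fubini_integral[OF this]
 have F: "(LBINT \<sigma>. LBINT w. ?F w \<sigma>) = (LBINT w. LBINT \<sigma>. ?F w \<sigma>)" .
 have "Bil2 (kern2 m al be e) h g = (LBINT w. LBINT \<sigma>. ?F w \<sigma>)"
 proof -
  have "(LBINT \<sigma>. ?F w \<sigma>) = h (fst w) * kern2 m al be e (fst w - snd w) * g (snd w)" for w
  proof -
   have "(LBINT \<sigma>. ?F w \<sigma>) = (LBINT \<sigma>. (h (fst w) * g (snd w)) * (cor (gau e \<sigma>) * ?k \<sigma> (fst w - snd w)))"
    by (simp only: mult_ac)
   also have "... = (h (fst w) * g (snd w)) * kern2 m al be e (fst w - snd w)" unfolding kern2_eq by (rule integral_mult_right_zero)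
   finally show ?thesis by (simp only: mult_ac)
  qed
  thus ?thesis unfolding Bil2_def by simp
 qed
 also have "... = (LBINT \<sigma>. cor (gau e \<sigma>) * Bil2 (?k \<sigma>) h g)"
  unfolding F[symmetric] Bil2_def integral_mult_right_zero ..
 finally have eq: "Bil2 (kern2 m al be e) h g = (LBINT \<sigma>. cor (gau e \<sigma>) * Bil2 (?k \<sigma>) h g)" .
 have "norm (Bil2 (kern2 m al be e) h g) <= (LBINT \<sigma>. norm (cor (gau e \<sigma>) * Bil2 (?k \<sigma>) h g))"
  unfolding eq by (rule integral_norm_bound)
 also have "... <= (LBINT \<sigma>. gau e \<sigma> * C)"
 proof (rule integral_mono')
  show "intble (%\<sigma>. gau e \<sigma> * C)" by (intro integrable_mult_left gi)
  show "norm (cor (gau e \<sigma>) * Bil2 (?k \<sigma>) h g) <= gau e \<sigma> * C" for \<sigma>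
   using mult_left_mono[OF bnd gau_properties(1)[OF e]] gau_properties(1)[OF e] by (simp add: norm_mult)
  show "0 <= gau e \<sigma> * C" for \<sigma> using gau_properties(1)[OF e] order_trans[OF norm_ge_zero bnd] by simp
 qed
 also have "... = C" using gau_properties(3)[OF e] by simp
 finally show ?thesis .
qed

lemma integrable_bounded_support:
 fixes g :: "R2 => complex"
 assumes [measurable]: "g \<in> bmeas" and M: "!!z. norm (g z) <= M" and R: "!!z. norm z > R ==> g z = 0"
 shows "intble g"
proof (rule integrableI_bounded_set[where A="cball 0 R" and B=M])
 show "emeasure lborel (cball (0::R2) R) < \<infinity>" by (rule emeasure_lborel_cball_finite)
 show "AE z in lborel. z \<in> cball 0 R --> norm (g z) <= M" using M by simp
 show "AE z in lborel. z \<notin> cball 0 R --> g z = 0" using R by (intro AE_I2) (simp add: not_le)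
qed simp_all

lemma weighted_locally_integrable:
 fixes W :: "R2 => complex"
 assumes [measurable]: "W \<in> bmeas" and Wt: "intble (%z. norm (W z) / (1 + norm z) ^ L)"
 shows "intble (%z. indicator (cball 0 R) z *\<^sub>R W z)"
proof (rule Bochner_Integration.integrable_bound[OF integrable_mult_right[OF Wt, of "(1 + \<bar>R\<bar>) ^ L"] _ AE_I2])
 fix z
 show "norm (indicator (cball 0 R) z *\<^sub>R W z) <= norm ((1 + \<bar>R\<bar>) ^ L * (norm (W z) / (1 + norm z) ^ L))"
 proof (cases "norm z <= R")
  case True
  hence "(1 + norm z) ^ L <= (1 + \<bar>R\<bar>) ^ L" by (intro power_mono) auto
  hence "1 <= (1 + \<bar>R\<bar>) ^ L / (1 + norm z) ^ L" by (simp add: add_pos_nonneg)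
  hence "norm (W z) * 1 <= norm (W z) * ((1 + \<bar>R\<bar>) ^ L / (1 + norm z) ^ L)" by (intro mult_left_mono) auto
  thus ?thesis using True by (simp add: abs_mult mult_ac)
 qed simp
next
 have [measurable]: "cball (0::R2) R \<in> sets borel" by (intro borel_closed closed_cball)
 show "(%z. indicator (cball 0 R) z *\<^sub>R W z) \<in> borel_measurable lborel" by measurable
qed

text \<open>Uniformity in the weight parameters is the point: it allows them to tend to infinity.\<close>
lemma carleman:
 assumes m: "m >= 1" and k: "ka = 1 / (2 * real m + 1)" and q: "q = 2 / (2 - ka)" and p: "p = 2 / ka"
 shows "EX C>0. ALL al be V u N L. solves m V u --> u \<in> bmeas --> V \<in> bmeas -->
  (NINT z. (exp (al * fst z + be * snd z) * norm (u z))\<^sup>2) < \<infinity> -->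
  intble (%z. exp (al * fst z + be * snd z) * norm (u z) / (1 + norm z) ^ L) --> N > 0 -->
  (NINT z. (exp (al * fst z + be * snd z) * norm (V z * u z)) powr q) <= ennreal (N powr q) -->
  (NINT z. (exp (al * fst z + be * snd z) * norm (u z)) powr p) <= ennreal ((C * N) powr p)"
proof -
 have k01: "0 < ka" "ka < 1" using m by (auto simp: k)
 have q12: "1 < q" "q < 2" using k01 by (auto simp: q field_simps)
 have p1: "p > 1" using k01 by (simp add: p field_simps)
 have qp: "q = p / (p - 1)" using k01 by (simp add: p q field_simps)
 obtain C where C: "C > 0" and str: "!!al be eps h g. eps > 0 ==> intble h ==> intble g ==>
  (NINT z. norm (h z) powr q) <= 1 ==> (NINT z. norm (g z) powr q) <= 1 ==>
  norm (Bil2 (%z. kern m al be eps (fst z) (snd z)) h g) <= C"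
  using strichartz[OF m k q] by blast
 have main: "(NINT z. (exp (al * fst z + be * snd z) * norm (u z)) powr p) <= ennreal ((C * N) powr p)"
  if sol: "solves m V u" and um[measurable]: "u \<in> bmeas" and [measurable]: "V \<in> bmeas"
   and W2: "(NINT z. (exp (al * fst z + be * snd z) * norm (u z))\<^sup>2) < \<infinity>"
   and Wt: "intble (%z. exp (al * fst z + be * snd z) * norm (u z) / (1 + norm z) ^ L)" and N: "N > 0"
   and gN: "(NINT z. (exp (al * fst z + be * snd z) * norm (V z * u z)) powr q) <= ennreal (N powr q)"
  for al be V u N L
 proof -
  define E where "E z = cor (exp (al * fst z + be * snd z))" for z :: R2
  have [measurable]: "E \<in> bmeas" unfolding E_def by measurable
  have nE: "norm (E z * y) = exp (al * fst z + be * snd z) * norm y" for z y by (simp add: E_def norm_mult)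
  define W where "W z = E z * u z" for z
  define G where "G z = E z * (V z * u z)" for z
  have [measurable]: "W \<in> bmeas" "G \<in> bmeas" unfolding W_def G_def by measurable
  define w where "w e z = (LBINT y. W y * cor (gau2 e (y - z)))" for e z
  have [measurable]: "w e \<in> bmeas" for e unfolding w_def by measurable
  \<comment> \<open>The cutoff puts the right-hand side into L1, as the bilinear estimates require,
    while its L^q norm stays below that of G for all n.\<close>
  define h where "h n z = G z * cutoff n z" for n z
  have [measurable]: "h n \<in> bmeas" for n unfolding h_def by measurable
  have hG: "norm (h n z) <= norm (G z)" for n z
   using mult_left_mono[OF cutoff_le[of n z] norm_ge_zero[of "G z"]] by (simp add: h_def norm_mult)
  have hN: "(NINT z. norm (h n z) powr q) <= ennreal (N powr q)" for n
  proof (rule order_trans[OF nn_integral_mono])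
   show "ennreal (norm (h n z) powr q) <= ennreal ((exp (al * fst z + be * snd z) * norm (V z * u z)) powr q)" for z
    using hG[of n z] q12 by (intro ennreal_leI powr_mono2) (simp_all add: G_def nE)
  qed (rule gN)
  have hi: "intble (h n)" for n
  proof -
   have supp: "h n z = 0" if "norm z > 2 * real (Suc n)" for z
   proof -
    have "norm z <= \<bar>fst z\<bar> + \<bar>snd z\<bar>" using norm_Pair_le[of "fst z" "snd z"] by simp
    moreover have "r < a \<or> r < b" if "2 * r < c" "c <= a + b" for a b c r :: real using that by linarith
    ultimately have "real (Suc n) < \<bar>fst z\<bar> \<or> real (Suc n) < \<bar>snd z\<bar>" using that by blast
    thus ?thesis using cut_support[of n z 1 0 0] by (simp add: h_def cutoff_eq_cut)
   qed
   have "(NINT z. norm (h n z)) <= (NINT z. indicator (cball 0 (2 * real (Suc n))) z + ennreal (norm (h n z) powr q))"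
   proof (rule nn_integral_mono)
    fix z
    show "ennreal (norm (h n z)) <= indicator (cball 0 (2 * real (Suc n))) z + ennreal (norm (h n z) powr q)"
    proof (cases "norm z > 2 * real (Suc n)")
     case True thus ?thesis using supp by simp
    next
     case False
     have "norm (h n z) <= 1 + norm (h n z) powr q"
     proof (cases "norm (h n z) <= 1")
      case False
      hence "norm (h n z) powr 1 <= norm (h n z) powr q" using q12 by (intro powr_mono) auto
      thus ?thesis by simp
     qed (simp add: add_increasing2)
     from ennreal_leI[OF this] show ?thesis using False by (simp add: not_less ennreal_plus)
    qed
   qed
   also have "... = emeasure lborel (cball (0::R2) (2 * real (Suc n))) + (NINT z. norm (h n z) powr q)"
    by (subst nn_integral_add) (simp_all add: borel_measurable_indicator del: of_nat_Suc)
   also have "... < \<infinity>"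
    using emeasure_lborel_cball_finite[of "0::R2" "2 * real (Suc n)"] order_le_less_trans[OF hN[of n] ennreal_less_top] by simp
   finally show ?thesis by (simp add: integrable_iff_bounded)
  qed
  \<comment> \<open>The parametrix applied to the truncated right-hand side; by
    \<open>parametrix_limit\<close> it converges pointwise to the mollified W.\<close>
  define T where "T e n z1 = (LBINT z. h n z * (\<i> * kern2 m al be e (z - z1)))" for e n z1
  have [measurable]: "T e n \<in> bmeas" for e n unfolding T_def by measurable
  have Tlim: "(%n. T e n z1) \<longlonglongrightarrow> w e z1" if e: "e > 0" for e z1
  proof -
   interpret parametrix m al be e "fst z1" "snd z1" by unfold_locales (rule e)
   have exE: "ex = E" by (simp add: fun_eq_iff ex_def E_def)
   have "(%n. LBINT z. V z * u z * (cutoff n z * J Q0 R0 z)) \<longlonglongrightarrow> (LBINT z. ex z * u z * cor (gau2 e (z - (fst z1, snd z1))))"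
    by (rule parametrix_limit[OF sol um]) (use W2 in \<open>simp add: exE nE\<close>)
   moreover have "V z * u z * (cutoff n z * J Q0 R0 z) = h n z * (\<i> * kern2 m al be e (z - z1))" for n z
    unfolding J_def I_Q0_R0 exE h_def G_def kern2_def by (simp add: mult_ac)
   ultimately show ?thesis unfolding T_def w_def W_def exE by simp
  qed
  have TN: "(NINT z. norm (T e n z) powr p) <= ennreal ((C * N) powr p)" if e: "e > 0" for e n
  proof (rule Lp_duality[OF _ p1 qp])
   fix g :: "R2 => complex" and M R
   assume [measurable]: "g \<in> bmeas" and gM: "!!z. norm (g z) <= M" and gR: "!!z. R < norm z ==> g z = 0"
    and gn: "(NINT z. norm (g z) powr q) <= 1"
   have gi: "intble g" by (rule integrable_bounded_support[OF _ gM gR]) simp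
   let ?h = "%z. h n z /\<^sub>R N"
   have "intble ?h" using hi by simp
   moreover have "(NINT z. norm (?h z) powr q) <= 1"
   proof -
    have "norm (?h z) powr q = norm (h n z) powr q * (1 / N powr q)" for z
    proof -
     have "norm (?h z) = norm (h n z) / N" using N by (simp add: divide_inverse mult.commute)
     thus ?thesis using N by (simp add: powr_divide)
    qed
    hence "(NINT z. norm (?h z) powr q) = (NINT z. ennreal (norm (h n z) powr q) * ennreal (1 / N powr q))"
     by (simp only: ennreal_mult'[OF powr_ge_zero])
    also have "... = (NINT z. norm (h n z) powr q) * ennreal (1 / N powr q)" by (rule nn_integral_multc) simp
    also have "... <= ennreal (N powr q) * ennreal (1 / N powr q)" by (intro mult_right_mono hN) simp
    also have "... = 1" using N by (simp flip: ennreal_mult')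
    finally show ?thesis .
   qed
   ultimately have "norm (Bil2 (kern2 m al be e) ?h g) <= C"
    by (intro Bil2_kern2[OF e _ gi str[OF e _ gi _ gn]])
   moreover have "Bil2 (kern2 m al be e) ?h g = Bil2 (kern2 m al be e) (h n) g /\<^sub>R N" by (simp add: Bil2_def)
   ultimately have "norm (Bil2 (kern2 m al be e) (h n) g) / N <= C" using N by (simp add: divide_inverse mult.commute)
   hence B: "norm (Bil2 (kern2 m al be e) (h n) g) <= C * N" unfolding pos_divide_le_eq[OF N] .
   have "integrable (lborel \<Otimes>\<^sub>M lborel) (%(z, z1). h n z * kern2 m al be e (z - z1) * g z1)"
    using Bil2_integrable[OF hi[of n] gi kern2_measurable[of m al be e] kern2_bounded[OF e]] by (simp add: lborel_prod split_beta')
   from lborel_pair.integral_snd[OF this]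
   have "(LBINT z1. LBINT z. h n z * kern2 m al be e (z - z1) * g z1) = Bil2 (kern2 m al be e) (h n) g"
    by (simp add: lborel_prod Bil2_def split_beta')
   moreover have "T e n z1 * g z1 = \<i> * (LBINT z. h n z * kern2 m al be e (z - z1) * g z1)" for z1
   proof -
    have "T e n z1 * g z1 = (LBINT z. h n z * (\<i> * kern2 m al be e (z - z1)) * g z1)"
     unfolding T_def by (rule integral_mult_left_zero[symmetric])
    also have "... = (LBINT z. \<i> * (h n z * kern2 m al be e (z - z1) * g z1))" by (simp only: mult_ac)
    also have "... = \<i> * (LBINT z. h n z * kern2 m al be e (z - z1) * g z1)" by (rule integral_mult_right_zero)
    finally show ?thesis .
   qed
   ultimately have "(LBINT z1. T e n z1 * g z1) = \<i> * Bil2 (kern2 m al be e) (h n) g" by (simp only: integral_mult_right_zero)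
   thus "norm (LBINT z1. T e n z1 * g z1) <= C * N" using B by (simp add: norm_mult)
  qed (use C N in simp_all)
  \<comment> \<open>Fatou passes the bound to the limit in n; it depends neither on n nor on
    e.\<close>
  have wN: "(NINT z. norm (w e z) powr p) <= ennreal ((C * N) powr p)" if e: "e > 0" for e
  proof -
   have "(NINT z. norm (w e z) powr p) = (NINT z. liminf (%n. ennreal (norm (T e n z) powr p)))"
   proof (intro nn_integral_cong lim_imp_Liminf[symmetric] tendsto_ennrealI)
    show "(%n. norm (T e n z) powr p) \<longlonglongrightarrow> norm (w e z) powr p" for z
     using p1 by (intro tendsto_powr' tendsto_norm Tlim e tendsto_const) auto
   qed simp
   also have "... <= liminf (%n. NINT z. norm (T e n z) powr p)" by (rule nn_integral_liminf) simp
   also have "... <= ennreal ((C * N) powr p)" by (intro Liminf_le always_eventually allI TN e) simp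
   finally show ?thesis .
  qed
  have Wt': "intble (%z. norm (W z) / (1 + norm z) ^ L)" using Wt by (simp add: W_def nE)
  have Wloc: "intble (%z. indicator (cball 0 R) z *\<^sub>R W z)" for R
   by (rule weighted_locally_integrable[OF _ Wt']) measurable
  \<comment> \<open>The mollification is removed after pairing with a continuous f, where
    \<open>mollify_limit\<close> is available; \<open>dual_extend\<close> and
    \<open>Lp_duality\<close> then recover the L^p norm of W.\<close>
  have cont: "norm (LBINT z. W z * f z) <= C * N * (LBINT z. norm (f z) powr q) powr (1 / q)"
   if f: "continuous_on UNIV f" and fR: "!!z. norm z > R ==> f z = 0" for f :: "R2 => complex" and R
  proof -
   have [measurable]: "f \<in> bmeas" by (intro borel_measurable_continuous_onI f)
   define A where "A = (LBINT z. norm (f z) powr q)"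
   have "bounded (f ` cball 0 R)"
    by (intro compact_imp_bounded compact_continuous_image continuous_on_subset[OF f]) auto
   then obtain M where M: "\<forall>z\<in>cball 0 R. norm (f z) <= M" by (auto simp: bounded_iff)
   have "intble (%z. cor (norm (f z) powr q))"
   proof (rule integrable_bounded_support[where M="\<bar>M\<bar> powr q" and R=R])
    fix z
    show "norm (cor (norm (f z) powr q)) <= \<bar>M\<bar> powr q"
    proof (cases "norm z <= R")
     case True
     hence "norm (f z) <= M" using M[rule_format, of z] by simp
     hence "norm (f z) <= \<bar>M\<bar>" by simp
     thus ?thesis using q12 by (simp add: powr_mono2)
    next
     case False thus ?thesis using fR[of z] by simp
    qed
   qed (use fR in simp_all)
   hence fi: "intble (%z. norm (f z) powr q)" by (simp only: complex_of_real_integrable_eq)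
   have A0: "A >= 0" by (simp add: A_def)
   have Ann: "(NINT z. norm (f z) powr q) = ennreal A" unfolding A_def by (intro nn_integral_eq_integral fi) simp
   show ?thesis
   proof (cases "A = 0")
    case True
    hence "AE z in lborel. norm (f z) = 0" using nn_integral_eq_0_powr[of "%z. norm (f z)" lborel q] Ann by simp
    hence "AE z in lborel. W z * f z = 0" by eventually_elim simp
    hence "(LBINT z. W z * f z) = 0" by (rule integral_eq_zero_AE)
    thus ?thesis using C N by simp
   next
    case False
    with A0 have A: "A > 0" by simp
    let ?a = "A powr (1 / q)"
    have a: "?a > 0" using A by simp
    let ?f = "%z. f z /\<^sub>R ?a"
    have fn: "(NINT z. norm (?f z) powr q) <= 1"
    proof -
     have "norm (?f z) powr q = norm (f z) powr q * (1 / A)" for z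
     proof -
      have "norm (?f z) = norm (f z) / ?a" using a by (simp add: divide_inverse mult.commute)
      thus ?thesis using a A q12 by (simp add: powr_divide powr_powr)
     qed
     hence "(NINT z. norm (?f z) powr q) = (NINT z. ennreal (norm (f z) powr q) * ennreal (1 / A))"
      by (simp only: ennreal_mult'[OF powr_ge_zero])
     also have "... = ennreal A * ennreal (1 / A)" by (subst nn_integral_multc) (simp_all add: Ann)
     also have "... = 1" using A by (simp flip: ennreal_mult')
     finally show ?thesis by simp
    qed
    have wf: "norm (LBINT z. w e z * f z) <= C * N * ?a" if e: "e > 0" for e
    proof -
     have "ennreal (norm (LBINT z. w e z * ?f z)) <= (NINT z. norm (w e z * ?f z))" by (rule norm_integral_le_nn_integral)
     also have "... <= ennreal (C * N)" by (rule Holder_normalised[OF _ _ p1 qp _ wN[OF e] fn]) (use C N in simp_all)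
     finally have "norm (LBINT z. w e z * ?f z) <= C * N" using C N by (subst (asm) ennreal_le_iff) simp_all
     moreover have "(LBINT z. w e z * ?f z) = (LBINT z. w e z * f z) /\<^sub>R ?a" by simp
     ultimately have "norm (LBINT z. w e z * f z) / ?a <= C * N" using a by (simp add: divide_inverse mult.commute)
     thus ?thesis unfolding pos_divide_le_eq[OF a] .
    qed
    have "(%n. LBINT z. w (1 / real (Suc n)) z * f z) \<longlonglongrightarrow> (LBINT z. W z * f z)"
     unfolding w_def by (rule mollify_limit[OF _ Wt' f fR]) simp
    from tendsto_norm[OF this] have "norm (LBINT z. W z * f z) <= C * N * ?a"
     by (rule Lim_bounded[of _ _ 0]) (simp add: wf)
    thus ?thesis by (simp add: A_def)
   qed
  qed
  have "(NINT z. norm (W z) powr p) <= ennreal ((C * N) powr p)"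
  proof (rule Lp_duality[OF _ p1 qp])
   fix g :: "R2 => complex" and M R
   assume "g \<in> bmeas" and gM: "!!z. norm (g z) <= M" and gR: "!!z. R < norm z ==> g z = 0"
    and gn: "(NINT z. norm (g z) powr q) <= 1"
   thus "norm (LBINT z. W z * g z) <= C * N"
    by (intro dual_extend[where q=q and N="C * N", OF _ Wloc _ _ cont _ gM gR gn]) (use q12 C N in simp_all)
  qed (use C N in simp_all)
  thus ?thesis by (simp add: W_def nE)
 qed
 show ?thesis by (rule exI[of _ C], intro conjI C allI impI, rule main)
qed

section \<open>Schwartz functions adapted to the symbol of W^q\<close>

definition ee :: "R2 => real" where "ee z = exp (- \<bar>fst z\<bar>) * exp (- \<bar>snd z\<bar>)"

lemma ee_measurable [measurable]: "ee \<in> bmeas"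
 unfolding ee_def[abs_def] by measurable

lemma ee_integrable: "intble ee"
 by (rule integrable_prod_dominated[OF integrable_exp_neg_abs integrable_exp_neg_abs]) (simp_all add: ee_def)

lemma integral_derivative_UNIV:
 fixes G G' :: "real => complex"
 assumes G: "!!r. (G has_vector_derivative G' r) (at r)" and cont: "continuous_on UNIV G'"
  and int: "intble G'" and lim: "(%n. G (real n)) \<longlonglongrightarrow> 0" "(%n. G (- real n)) \<longlonglongrightarrow> 0"
 shows "(LBINT r. G' r) = 0"
proof -
 have i1: "intble (%r. indicator {0..} r *\<^sub>R G' r)" and i2: "intble (%r. indicator {..0} r *\<^sub>R G' r)"
  by (intro integrable_mult_indicator int; simp)+
 have "(LBINT r. G' r) = (LBINT r. indicator {0..} r *\<^sub>R G' r + indicator {..0} r *\<^sub>R G' r)"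
 proof (rule integral_cong_AE)
  show "AE r in lborel. G' r = indicator {0..} r *\<^sub>R G' r + indicator {..0} r *\<^sub>R G' r"
   using AE_lborel_singleton[of "0::real"] by eventually_elim (auto simp: indicator_def)
 qed (use int i1 i2 in simp_all)
 also have "... = - G 0 + G 0"
  by (simp only: Bochner_Integration.integral_add[OF i1 i2] integral_derivative_atLeast[OF G cont i1 lim(1)] integral_derivative_atMost[OF G cont i2 lim(2)])
 finally show ?thesis by simp
qed

lemma exp_neg_tendsto_0: "(%n. C * exp (- real n)) \<longlonglongrightarrow> 0"
proof -
 have "(%n. exp (- real n)) \<longlonglongrightarrow> 0"
  by (rule filterlim_compose[OF exp_at_bot]) (simp add: filterlim_uminus_at_top[symmetric] filterlim_real_sequentially)
 from tendsto_mult_right_zero[OF this, of C] show ?thesis .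
qed

lemma tendsto_0_of_exp_bound:
 fixes G :: "real => complex"
 assumes "!!r. norm (G r) <= C * exp (- \<bar>r\<bar>)"
 shows "(%n. G (real n)) \<longlonglongrightarrow> 0" "(%n. G (- real n)) \<longlonglongrightarrow> 0"
 using assms[of "real _"] assms[of "- real _"]
 by (auto intro!: Lim_null_comparison[OF always_eventually exp_neg_tendsto_0[of C]])

lemma cis_line_derivative: "((%s. cis (s * a + b)) has_vector_derivative (\<i> * cor a * cis (t * a + b))) (at t)"
proof -
 have "((%z. exp (\<i> * (z * cor a + cor b))) has_field_derivative
   (\<i> * cor a * exp (\<i> * (cor t * cor a + cor b)))) (at (cor t))"
  by (auto intro!: derivative_eq_intros)
 from has_vector_derivative_real_field[OF this, of UNIV] show ?thesis by (simp add: cis_conv_exp)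
qed

lemma inner_R2: "z \<bullet> ze = fst z * fst ze + snd z * snd ze" for z ze :: R2
 by (simp add: inner_prod_def)

lemma integrable_ee_bound:
 fixes g :: "R2 => complex"
 assumes [measurable]: "g \<in> bmeas" and b: "!!z. norm (g z) <= C * ee z"
 shows "intble g"
proof (rule Bochner_Integration.integrable_bound[OF integrable_mult_right[OF ee_integrable, of C] _ AE_I2])
 show "norm (g z) <= norm (C * ee z)" for z using b[of z] by simp
qed simp

lemma integrable_exp_bound:
 fixes g :: "real => complex"
 assumes [measurable]: "g \<in> bmeas" and b: "!!z. norm (g z) <= C * exp (- \<bar>z\<bar>)"
 shows "intble g"
proof (rule Bochner_Integration.integrable_bound[OF integrable_mult_right[OF integrable_exp_neg_abs, of C] _ AE_I2])
 show "norm (g z) <= norm (C * exp (- \<bar>z\<bar>))" for z using b[of z] by simp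
qed simp

lemma integral_partial_derivative_fst:
 fixes G G' :: "R2 => complex"
 assumes D: "!!t x. ((%s. G (s, x)) has_vector_derivative G' (t, x)) (at t)" and c: "continuous_on UNIV G'"
  and b: "!!z. norm (G z) <= C * ee z" "!!z. norm (G' z) <= C' * ee z"
 shows "(LBINT z. G' z) = 0"
proof -
 have [measurable]: "G' \<in> bmeas" by (intro borel_measurable_continuous_onI c)
 have int: "intble G'" by (rule integrable_ee_bound[OF _ b(2)]) simp
 have "(LBINT t. G' (t, x)) = 0" for x
 proof (rule integral_derivative_UNIV[OF D])
  show "continuous_on UNIV (%t. G' (t, x))"
   by (rule continuous_on_compose2[OF c]) (auto intro!: continuous_intros)
  show "intble (%t. G' (t, x))"
  proof (rule integrable_exp_bound)
   show "norm (G' (t, x)) <= (C' * exp (- \<bar>x\<bar>)) * exp (- \<bar>t\<bar>)" for t using b(2)[of "(t, x)"] by (simp add: ee_def mult_ac)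
  qed simp
  have B: "norm (G (t, x)) <= (C * exp (- \<bar>x\<bar>)) * exp (- \<bar>t\<bar>)" for t using b(1)[of "(t, x)"] by (simp add: ee_def mult_ac)
  show "(%n. G (real n, x)) \<longlonglongrightarrow> 0" "(%n. G (- real n, x)) \<longlonglongrightarrow> 0" by (rule tendsto_0_of_exp_bound[OF B])+
 qed
 moreover have "integrable (lborel \<Otimes>\<^sub>M lborel) (%(t, x). G' (t, x))" using int by (simp add: lborel_prod)
 from lborel_pair.integral_snd[OF this] have "(LBINT x. LBINT t. G' (t, x)) = (LBINT z. G' z)" by (simp add: lborel_prod)
 ultimately show ?thesis by simp
qed

lemma integral_partial_derivative_snd:
 fixes G G' :: "R2 => complex"
 assumes D: "!!t x. ((%y. G (t, y)) has_vector_derivative G' (t, x)) (at x)" and c: "continuous_on UNIV G'"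
  and b: "!!z. norm (G z) <= C * ee z" "!!z. norm (G' z) <= C' * ee z"
 shows "(LBINT z. G' z) = 0"
proof -
 have [measurable]: "G' \<in> bmeas" by (intro borel_measurable_continuous_onI c)
 have int: "intble G'" by (rule integrable_ee_bound[OF _ b(2)]) simp
 have "(LBINT x. G' (t, x)) = 0" for t
 proof (rule integral_derivative_UNIV[OF D])
  show "continuous_on UNIV (%x. G' (t, x))"
   by (rule continuous_on_compose2[OF c]) (auto intro!: continuous_intros)
  show "intble (%x. G' (t, x))"
  proof (rule integrable_exp_bound)
   show "norm (G' (t, x)) <= (C' * exp (- \<bar>t\<bar>)) * exp (- \<bar>x\<bar>)" for x using b(2)[of "(t, x)"] by (simp add: ee_def mult_ac)
  qed simp
  have B: "norm (G (t, x)) <= (C * exp (- \<bar>t\<bar>)) * exp (- \<bar>x\<bar>)" for x using b(1)[of "(t, x)"] by (simp add: ee_def mult_ac)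
  show "(%n. G (t, real n)) \<longlonglongrightarrow> 0" "(%n. G (t, - real n)) \<longlonglongrightarrow> 0" by (rule tendsto_0_of_exp_bound[OF B])+
 qed
 moreover have "integrable (lborel \<Otimes>\<^sub>M lborel) G'" using int by (simp add: lborel_prod)
 from lborel_pair.integral_fst'[OF this] have "(LBINT t. LBINT x. G' (t, x)) = (LBINT z. G' z)" by (simp add: lborel_prod)
 ultimately show ?thesis by simp
qed

lemma integrable_inverse_square: "intble (%x::real. 1 / (1 + x\<^sup>2))"
 using integrable_inverse_1_plus_square by (simp add: set_integrable_def einterval_def inverse_eq_divide)

lemma gaussian_fourier2:
 assumes d: "d > 0"
 shows "(LBINT z. cis (z \<bullet> et) * (cor (exp (- d * (fst z)\<^sup>2 / 2)) * cor (exp (- d * (snd z)\<^sup>2 / 2))))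
  = cor ((2 * pi)\<^sup>2 * gau2 d et)" (is "?L = _")
  and "intble (%z::R2. cor (exp (- d * (fst z)\<^sup>2 / 2)) * cor (exp (- d * (snd z)\<^sup>2 / 2)))"
proof -
 let ?g = "%a t. cor (exp (- d * t\<^sup>2 / 2)) * cis (a * t)"
 have i: "intble (?g a)" for a using integrable_cis_mult[OF gaussian_fourier(1)[OF d], of a] by (simp only: mult.commute)
 have "?L = (LBINT z. ?g (fst et) (fst z) * ?g (snd et) (snd z))"
  by (rule Bochner_Integration.integral_cong) (simp_all add: inner_R2 cis_mult[symmetric] mult_ac)
 also have "... = cor (sqrt (2 * pi / d) * exp (- (fst et)\<^sup>2 / (2 * d))) * cor (sqrt (2 * pi / d) * exp (- (snd et)\<^sup>2 / (2 * d)))"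
  by (simp only: integral_prod_mult[OF i i] gaussian_fourier(2)[OF d])
 also have "... = cor ((2 * pi)\<^sup>2 * gau2 d et)"
 proof -
  have "sqrt (2 * pi / d) * sqrt (2 * pi / d) = 2 * pi / d" using d by simp
  moreover have "sqrt (2 * pi * d) * sqrt (2 * pi * d) = 2 * pi * d" using d by simp
  ultimately have "sqrt (2 * pi / d) * a * (sqrt (2 * pi / d) * b) = (2 * pi)\<^sup>2 * (a / sqrt (2 * pi * d) * (b / sqrt (2 * pi * d)))" for a b :: real
   using d by (simp add: power2_eq_square field_simps)
  thus ?thesis by (simp only: gau2_def gau_def of_real_mult[symmetric])
 qed
 finally show "?L = cor ((2 * pi)\<^sup>2 * gau2 d et)" .
 show "intble (%z::R2. cor (exp (- d * (fst z)\<^sup>2 / 2)) * cor (exp (- d * (snd z)\<^sup>2 / 2)))"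
  by (rule integrable_prod_dominated[OF gaussian_fourier(1)[OF d] gaussian_fourier(1)[OF d]]) (simp_all add: norm_mult)
qed

lemma gau2_approximate_identity:
 fixes g :: "R2 => complex"
 assumes c: "continuous_on UNIV g" and B: "!!z. norm (g z) <= B"
 shows "(%n. LBINT y. g y * cor (gau2 (1 / real (Suc n)) (y - z))) \<longlonglongrightarrow> g z"
proof -
 have [measurable]: "g \<in> bmeas" by (intro borel_measurable_continuous_onI c)
 define r where "r n = sqrt (1 / real (Suc n))" for n
 have r: "r n > 0" "r n ^ 2 = 1 / real (Suc n)" for n by (simp_all add: r_def)
 have eq: "(LBINT y. g y * cor (gau2 (1 / real (Suc n)) (y - z))) = (LBINT y. cor (gau2 1 y) * g (z + r n *\<^sub>R y))" for n
 proof -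
  have "(LBINT y. g y * cor (gau2 (1 / real (Suc n)) (y - z)))
   = (\<bar>r n\<bar> ^ DIM(R2)) *\<^sub>R (LBINT y. g (z + r n *\<^sub>R y) * cor (gau2 (1 / real (Suc n)) (z + r n *\<^sub>R y - z)))"
   by (rule integral_lborel_affine) (use r(1)[of n] in simp_all)
  also have "... = (\<bar>r n\<bar> ^ DIM(R2)) *\<^sub>R (LBINT y. cor (1 / r n ^ 2) * (cor (gau2 1 y) * g (z + r n *\<^sub>R y)))"
  proof -
   have "gau2 (1 / real (Suc n)) (z + r n *\<^sub>R y - z) = 1 / r n ^ 2 * gau2 1 y" for y
    using gau2_scale[of "1 / real (Suc n)" y] by (simp add: r_def)
   hence "g (z + r n *\<^sub>R y) * cor (gau2 (1 / real (Suc n)) (z + r n *\<^sub>R y - z)) = cor (1 / r n ^ 2) * (cor (gau2 1 y) * g (z + r n *\<^sub>R y))" for y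
    by (simp only: of_real_mult mult_ac)
   thus ?thesis by (simp only:)
  qed
  also have "... = (LBINT y. cor (gau2 1 y) * g (z + r n *\<^sub>R y))"
   using r(1)[of n] by (simp add: scaleR_conv_of_real power2_eq_square)
  finally show ?thesis .
 qed
 have "(%n. LBINT y. cor (gau2 1 y) * g (z + r n *\<^sub>R y)) \<longlonglongrightarrow> (LBINT y. cor (gau2 1 y) * g z)"
 proof (rule integral_dominated_convergence[where w="%y. B * norm (cor (gau2 1 y))"])
  show "intble (%y. B * norm (cor (gau2 1 y)))" by (intro integrable_mult_right integrable_norm gau2_properties) simp
  show "AE y in lborel. (%n. cor (gau2 1 y) * g (z + r n *\<^sub>R y)) \<longlonglongrightarrow> cor (gau2 1 y) * g z"
  proof (intro AE_I2 tendsto_mult tendsto_const)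
   fix y
   have "(%n. 1 / real (Suc n)) \<longlonglongrightarrow> 0" by (rule lim_1_over_n[THEN LIMSEQ_Suc])
   hence "r \<longlonglongrightarrow> sqrt 0" unfolding r_def by (intro tendsto_real_sqrt)
   hence "(%n. z + r n *\<^sub>R y) \<longlonglongrightarrow> z + 0 *\<^sub>R y" by (intro tendsto_intros) simp
   hence l: "(%n. z + r n *\<^sub>R y) \<longlonglongrightarrow> z" by simp
   show "(%n. g (z + r n *\<^sub>R y)) \<longlonglongrightarrow> g z" using continuous_on_tendsto_compose[OF c l] by simp
  qed
  show "AE y in lborel. norm (cor (gau2 1 y) * g (z + r n *\<^sub>R y)) <= B * norm (cor (gau2 1 y))" for n
  proof (intro AE_I2)
   fix y
   show "norm (cor (gau2 1 y) * g (z + r n *\<^sub>R y)) <= B * norm (cor (gau2 1 y))"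
    unfolding norm_mult mult.commute[of B] by (rule mult_left_mono[OF B]) simp
  qed
 qed simp_all
 moreover have "(LBINT y. cor (gau2 1 y) * g z) = g z"
  using integral_mult_left_zero[of lborel "%y. cor (gau2 1 y)" "g z"] by (simp only: gau2_properties(3)[OF zero_less_one] mult_1_left)
 ultimately show ?thesis by (simp only: eq)
qed

lemma IFT_cis: "IFT g z = cor (1 / (2 * pi) ^ 2) * (LBINT ze. cis (z \<bullet> ze) * g ze)"
 by (simp add: IFT_def cis_conv_exp)

text \<open>Convolution kernel of the inverse symbol, regularised by a Gaussian in
  frequency.\<close>

definition Phi :: "nat => real => R2 => complex" where
 "Phi m e = IFT (%ze. cor (1 / symb m ze) * (cor (exp (- e * (fst ze)\<^sup>2 / 2)) * cor (exp (- e * (snd ze)\<^sup>2 / 2))))"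

context
 fixes m :: nat and e :: real and z0 :: R2
 assumes m: "m >= 1" and e: "e > 0"
begin

text \<open>The inverse Japanese bracket in tau: the derivative of sqrt(1 + tau^2) is tau times
  it.\<close>

definition jap :: "R2 => complex" where "jap ze = cor (1 / sqrt (1 + (fst ze)\<^sup>2))"
definition isy :: "R2 => complex" where "isy ze = cor (1 / symb m ze)"
definition cf :: "R2 => complex" where "cf ze = cor (fst ze)"
definition cs :: "R2 => complex" where "cs ze = cor (snd ze)"

text \<open>Differentiating 1 / symb brings in the coordinates and \<open>jap\<close>. The algebra
  generated by all of these is closed under both partials, and its members grow at most
  polynomially, so a Gaussian factor makes them rapidly decreasing.\<close>

inductive_set mults :: "(R2 => complex) set" where
 const: "(%_. c) \<in> mults"
| cf: "cf \<in> mults"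
| cs: "cs \<in> mults"
| jap: "jap \<in> mults"
| isy: "isy \<in> mults"
| add: "f \<in> mults ==> g \<in> mults ==> (%z. f z + g z) \<in> mults"
| mult: "f \<in> mults ==> g \<in> mults ==> (%z. f z * g z) \<in> mults"

lemma mults_power: "f \<in> mults ==> (%z. f z ^ n) \<in> mults"
 by (induction n) (auto intro: mults.intros)

lemma symb_ge_1: "symb m ze >= 1"
proof -
 have "1 <= sqrt (1 + (fst ze)\<^sup>2)" by simp
 moreover have "0 <= (snd ze) ^ (2 * m)" by (simp add: zero_le_even_power)
 ultimately show ?thesis unfolding symb_def split_beta by linarith
qed

lemma mults_partials: "f \<in> mults ==> \<exists>ft\<in>mults. \<exists>fx\<in>mults. has_partials f ft fx"
proof (induction rule: mults.induct)
 case (const c)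
 have "has_partials (%_. c) (%_. 0) (%_. 0)" by (auto simp: has_partials_def intro!: derivative_eq_intros)
 thus ?case using mults.const by blast
next
 case cf
 have "has_partials cf (%_. 1) (%_. 0)"
  unfolding has_partials_def cf_def
  by (auto intro!: continuous_intros derivative_eq_intros bounded_linear.has_vector_derivative[OF bounded_linear_of_real, of _ 1, simplified])
 thus ?case using mults.const by blast
next
 case cs
 have "has_partials cs (%_. 0) (%_. 1)"
  unfolding has_partials_def cs_def
  by (auto intro!: continuous_intros derivative_eq_intros bounded_linear.has_vector_derivative[OF bounded_linear_of_real, of _ 1, simplified])
 thus ?case using mults.const by blast
next
 case jap
 have pos: "1 + t\<^sup>2 > 0" for t :: real by (simp add: add_pos_nonneg)
 have "((%s. 1 / sqrt (1 + s\<^sup>2)) has_real_derivative (- t * (1 / sqrt (1 + t\<^sup>2)) ^ 3)) (at t)" for t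
  using pos[of t] by (auto intro!: derivative_eq_intros simp: power3_eq_cube field_simps)
 hence d: "((%s. cor (1 / sqrt (1 + s\<^sup>2))) has_vector_derivative cor (- t * (1 / sqrt (1 + t\<^sup>2)) ^ 3)) (at t)" for t
  by (intro bounded_linear.has_vector_derivative[OF bounded_linear_of_real]) (simp add: has_real_derivative_iff_has_vector_derivative)
 have "sqrt (1 + (fst z)\<^sup>2) ~= 0" for z :: R2 using pos[of "fst z"] by simp
 hence "continuous_on UNIV jap" unfolding jap_def by (intro continuous_intros) auto
 hence "has_partials jap (%z. (-1) * cf z * jap z ^ 3) (%_. 0)"
  unfolding has_partials_def using d by (auto simp: jap_def cf_def)
 moreover have "(%z. (-1) * cf z * jap z ^ 3) \<in> mults" by (intro mults.mult mults_power mults.const mults.cf mults.jap)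
 ultimately show ?case using mults.const by blast
next
 case isy
 have s0: "symb m z ~= 0" for z using symb_ge_1[of z] by simp
 have st: "((%s. 1 / symb m (s, x)) has_real_derivative (- (t * (1 / sqrt (1 + t\<^sup>2))) * (1 / symb m (t, x)) ^ 2)) (at t)" for t x
 proof -
  have "1 + t\<^sup>2 > 0" by (simp add: add_pos_nonneg)
  hence "((%s. symb m (s, x)) has_real_derivative (t * (1 / sqrt (1 + t\<^sup>2)))) (at t)"
   unfolding symb_def by (auto intro!: derivative_eq_intros simp: field_simps)
  from DERIV_inverse_fun[OF this s0] show ?thesis by (simp add: divide_inverse power2_eq_square mult_ac)
 qed
 have sx: "((%s. 1 / symb m (t, s)) has_real_derivative (- (real (2 * m) * x ^ (2 * m - 1)) * (1 / symb m (t, x)) ^ 2)) (at x)" for t x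
 proof -
  have "((%s. symb m (t, s)) has_real_derivative (real (2 * m) * x ^ (2 * m - 1))) (at x)"
   unfolding symb_def by (auto intro!: derivative_eq_intros)
  from DERIV_inverse_fun[OF this s0] show ?thesis by (simp add: divide_inverse power2_eq_square mult_ac)
 qed
 have c: "continuous_on UNIV isy" unfolding isy_def
  using s0 by (intro continuous_intros) (auto simp: symb_def split_beta intro!: continuous_intros)
 have dt: "((%s. isy (s, x)) has_vector_derivative cor (- (t * (1 / sqrt (1 + t\<^sup>2))) * (1 / symb m (t, x)) ^ 2)) (at t)" for t x
  unfolding isy_def by (intro bounded_linear.has_vector_derivative[OF bounded_linear_of_real]) (use st in \<open>simp add: has_real_derivative_iff_has_vector_derivative\<close>)
 have dx: "((%s. isy (t, s)) has_vector_derivative cor (- (real (2 * m) * x ^ (2 * m - 1)) * (1 / symb m (t, x)) ^ 2)) (at x)" for t x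
  unfolding isy_def by (intro bounded_linear.has_vector_derivative[OF bounded_linear_of_real]) (use sx in \<open>simp add: has_real_derivative_iff_has_vector_derivative\<close>)
 have "has_partials isy (%z. (-1) * (cf z * jap z) * isy z ^ 2) (%z. (- of_nat (2 * m)) * cs z ^ (2 * m - 1) * isy z ^ 2)"
  unfolding has_partials_def using c dt dx by (auto simp: jap_def cf_def cs_def isy_def)
 moreover have "(%z. (-1) * (cf z * jap z) * isy z ^ 2) \<in> mults" "(%z. (- of_nat (2 * m)) * cs z ^ (2 * m - 1) * isy z ^ 2) \<in> mults"
  by (intro mults.mult mults_power mults.const mults.cf mults.cs mults.jap mults.isy)+
 ultimately show ?case by blast
next
 case (add f g)
 then obtain ft fx gt gx where p: "ft \<in> mults" "fx \<in> mults" "gt \<in> mults" "gx \<in> mults" and fg: "has_partials f ft fx" "has_partials g gt gx" by blast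
 show ?case by (rule bexI, rule bexI, rule has_partials_add[OF fg]) (intro mults.add p)+
next
 case (mult f g)
 then obtain ft fx gt gx where p: "ft \<in> mults" "fx \<in> mults" "gt \<in> mults" "gx \<in> mults" and fg: "has_partials f ft fx" "has_partials g gt gx" by blast
 show ?case by (rule bexI, rule bexI, rule has_partials_mult[OF fg]) (intro mults.add mults.mult p mult.hyps)+
qed

lemma mults_bound: "f \<in> mults ==> EX C>=0. EX k. ALL z. norm (f z) <= C * ((1 + \<bar>fst z\<bar>) * (1 + \<bar>snd z\<bar>)) ^ k"
proof (induction rule: mults.induct)
 case (const c)
 show ?case by (intro exI[of _ "norm c"] conjI exI[of _ 0]) simp_all
next
 case cf
 have "\<bar>fst z\<bar> <= 1 * ((1 + \<bar>fst z\<bar>) * (1 + \<bar>snd z\<bar>)) ^ 1" for z :: R2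
  using mult_mono[of "\<bar>fst z\<bar>" "1 + \<bar>fst z\<bar>" 1 "1 + \<bar>snd z\<bar>"] by simp
 thus ?case by (intro exI[of _ 1] conjI exI[of _ "1::nat"]) (simp_all add: cf_def)
next
 case cs
 have "\<bar>snd z\<bar> <= 1 * ((1 + \<bar>fst z\<bar>) * (1 + \<bar>snd z\<bar>)) ^ 1" for z :: R2
  using mult_mono[of 1 "1 + \<bar>fst z\<bar>" "\<bar>snd z\<bar>" "1 + \<bar>snd z\<bar>"] by simp
 thus ?case by (intro exI[of _ 1] conjI exI[of _ "1::nat"]) (simp_all add: cs_def)
next
 case jap
 have "norm (jap z) <= 1" for z
 proof -
  have "1 <= sqrt (1 + (fst z)\<^sup>2)" by simp
  moreover have "0 < 1 + (fst z)\<^sup>2" by (simp add: add_pos_nonneg)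
  ultimately show ?thesis unfolding jap_def norm_of_real by (simp add: divide_le_eq)
 qed
 thus ?case by (intro exI[of _ 1] conjI exI[of _ 0]) simp_all
next
 case isy
 have "norm (isy z) <= 1" for z using symb_ge_1[of z] by (simp add: isy_def norm_divide)
 thus ?case by (intro exI[of _ 1] conjI exI[of _ 0]) simp_all
next
 case (add f g)
 then obtain C k D l where C: "C >= 0" "ALL z. norm (f z) <= C * ((1 + \<bar>fst z\<bar>) * (1 + \<bar>snd z\<bar>)) ^ k"
  and D: "D >= 0" "ALL z. norm (g z) <= D * ((1 + \<bar>fst z\<bar>) * (1 + \<bar>snd z\<bar>)) ^ l" by blast
 have "norm (f z + g z) <= (C + D) * ((1 + \<bar>fst z\<bar>) * (1 + \<bar>snd z\<bar>)) ^ (k + l)" for z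
 proof -
  let ?x = "(1 + \<bar>fst z\<bar>) * (1 + \<bar>snd z\<bar>)"
  have x: "?x >= 1" using mult_mono[of 1 "1 + \<bar>fst z\<bar>" 1 "1 + \<bar>snd z\<bar>"] by simp
  have "norm (f z + g z) <= norm (f z) + norm (g z)" by (rule norm_triangle_ineq)
  also have "... <= C * ?x ^ k + D * ?x ^ l" by (rule add_mono[OF C(2)[rule_format] D(2)[rule_format]])
  also have "... <= C * ?x ^ (k + l) + D * ?x ^ (k + l)"
   using x C(1) D(1) by (intro add_mono mult_left_mono power_increasing) auto
  finally show ?thesis by (simp only: distrib_right)
 qed
 thus ?case using C(1) D(1) by (intro exI[of _ "C + D"] conjI exI[of _ "k + l"]) simp_all
next
 case (mult f g)
 then obtain C k D l where C: "C >= 0" "ALL z. norm (f z) <= C * ((1 + \<bar>fst z\<bar>) * (1 + \<bar>snd z\<bar>)) ^ k"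
  and D: "D >= 0" "ALL z. norm (g z) <= D * ((1 + \<bar>fst z\<bar>) * (1 + \<bar>snd z\<bar>)) ^ l" by blast
 have "norm (f z * g z) <= (C * D) * ((1 + \<bar>fst z\<bar>) * (1 + \<bar>snd z\<bar>)) ^ (k + l)" for z
 proof -
  let ?x = "(1 + \<bar>fst z\<bar>) * (1 + \<bar>snd z\<bar>)"
  have "norm (f z) * norm (g z) <= (C * ?x ^ k) * (D * ?x ^ l)" by (rule mult_mono[OF C(2)[rule_format] D(2)[rule_format]]) (use C(1) in simp_all)
  thus ?thesis by (simp only: norm_mult power_add mult_ac)
 qed
 thus ?case using C(1) D(1) by (intro exI[of _ "C * D"] conjI exI[of _ "k + l"]) simp_all
qed

text \<open>Frequency Gaussian with the phase that translates its inverse transform to z0. As one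
  exponential of a complex polynomial it has partials that follow from a complex derivative.\<close>

definition Eg :: "R2 => complex" where
 "Eg ze = exp (- (cor e / 2) * (cf ze ^ 2 + cs ze ^ 2) - \<i> * (cor (fst z0) * cf ze + cor (snd z0) * cs ze))"

lemma Eg_eq: "Eg ze = cor (exp (- e * (fst ze)\<^sup>2 / 2)) * cor (exp (- e * (snd ze)\<^sup>2 / 2)) * cis (- (z0 \<bullet> ze))"
proof -
 have "Eg ze = exp (cor (- e * (fst ze)\<^sup>2 / 2) + cor (- e * (snd ze)\<^sup>2 / 2) + \<i> * cor (- (z0 \<bullet> ze)))"
  unfolding Eg_def cf_def cs_def by (intro arg_cong[where f=exp]) (simp add: inner_prod_def field_simps)
 thus ?thesis by (simp only: exp_add cis_conv_exp exp_of_real)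
qed

lemma Eg_partials: "has_partials Eg (%z. (- cor e * cf z + - \<i> * cor (fst z0)) * Eg z) (%z. (- cor e * cs z + - \<i> * cor (snd z0)) * Eg z)"
 unfolding has_partials_def
proof (intro conjI allI)
 show "continuous_on UNIV Eg" unfolding Eg_def cf_def cs_def by (intro continuous_intros)
 fix t x
 have "((%z. exp (- (cor e / 2) * (z ^ 2 + cor x ^ 2) - \<i> * (cor (fst z0) * z + cor (snd z0) * cor x))) has_field_derivative
  ((- cor e * cor t + - \<i> * cor (fst z0)) * exp (- (cor e / 2) * (cor t ^ 2 + cor x ^ 2) - \<i> * (cor (fst z0) * cor t + cor (snd z0) * cor x)))) (at (cor t))"
  by (rule derivative_eq_intros refl | simp add: algebra_simps)+
 from has_vector_derivative_real_field[OF this, of UNIV]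
 show "((%s. Eg (s, x)) has_vector_derivative (- cor e * cf (t, x) + - \<i> * cor (fst z0)) * Eg (t, x)) (at t)"
  by (simp add: Eg_def cf_def cs_def)
 have "((%z. exp (- (cor e / 2) * (cor t ^ 2 + z ^ 2) - \<i> * (cor (fst z0) * cor t + cor (snd z0) * z))) has_field_derivative
  ((- cor e * cor x + - \<i> * cor (snd z0)) * exp (- (cor e / 2) * (cor t ^ 2 + cor x ^ 2) - \<i> * (cor (fst z0) * cor t + cor (snd z0) * cor x)))) (at (cor x))"
  by (rule derivative_eq_intros refl | simp add: algebra_simps)+
 from has_vector_derivative_real_field[OF this, of UNIV]
 show "((%y. Eg (t, y)) has_vector_derivative (- cor e * cs (t, x) + - \<i> * cor (snd z0)) * Eg (t, x)) (at x)"
  by (simp add: Eg_def cf_def cs_def)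
qed

text \<open>Closed under partials and under multiplication by \<open>mults\<close>, and dominated by
  multiples of \<open>ee\<close>. Under the inverse Fourier transform these become closure under
  multiplication by coordinates, closure under differentiation, and boundedness, which together are
  the Schwartz property.\<close>

definition freq :: "(R2 => complex) set" where "freq = {%z. a z * Eg z | a. a \<in> mults}"

lemma freqI: "a \<in> mults ==> (%z. a z * Eg z) \<in> freq"
 by (auto simp: freq_def)

lemma freq_partials:
 assumes "g \<in> freq" shows "\<exists>gt\<in>freq. \<exists>gx\<in>freq. has_partials g gt gx"
proof -
 obtain a where a: "a \<in> mults" "g = (%z. a z * Eg z)" using assms by (auto simp: freq_def)
 obtain aT ax where p: "aT \<in> mults" "ax \<in> mults" "has_partials a aT ax" using mults_partials[OF a(1)] by blast
 let ?bt = "%z. a z * (- cor e * cf z + - \<i> * cor (fst z0)) + aT z"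
 let ?bx = "%z. a z * (- cor e * cs z + - \<i> * cor (snd z0)) + ax z"
 have b: "?bt \<in> mults" "?bx \<in> mults" by (intro mults.intros a p)+
 have "(%z. ?bt z * Eg z) \<in> freq" "(%z. ?bx z * Eg z) \<in> freq" by (rule freqI[OF b(1)], rule freqI[OF b(2)])
 moreover have "has_partials g (%z. ?bt z * Eg z) (%z. ?bx z * Eg z)"
 proof -
  have "a z * (b * Eg z) + d * Eg z = (a z * b + d) * Eg z" for z b d by (simp only: distrib_right mult.assoc)
  thus ?thesis using has_partials_mult[OF p(3) Eg_partials] unfolding a(2) by (simp only:)
 qed
 ultimately show ?thesis by (intro bexI)
qed

lemma freq_mult: "g \<in> freq ==> a \<in> mults ==> (%z. a z * g z) \<in> freq"
proof -
 assume "g \<in> freq" "a \<in> mults"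
 then obtain b where "b \<in> mults" "g = (%z. b z * Eg z)" by (auto simp: freq_def)
 moreover from this have "(%z. a z * b z) \<in> mults" using \<open>a \<in> mults\<close> by (intro mults.mult)
 moreover have "(%z. a z * (b z * Eg z)) = (%z. (a z * b z) * Eg z)" by (simp only: mult.assoc)
 ultimately show "(%z. a z * g z) \<in> freq" unfolding freq_def by (intro CollectI exI[of _ "%z. a z * b z"]) (simp only:)
qed

lemma freq_bound:
 assumes "g \<in> freq" shows "EX C>=0. ALL z. norm (g z) <= C * ee z"
proof -
 obtain a where a: "a \<in> mults" "g = (%z. a z * Eg z)" using assms by (auto simp: freq_def)
 obtain C k where C: "C >= 0" "ALL z. norm (a z) <= C * ((1 + \<bar>fst z\<bar>) * (1 + \<bar>snd z\<bar>)) ^ k" using mults_bound[OF a(1)] by blast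
 define D where "D = exp ((real k + 1)\<^sup>2 / (2 * e))"
 have one: "(1 + \<bar>t\<bar>) ^ k * exp (- e * t\<^sup>2 / 2) <= D * exp (- \<bar>t\<bar>)" for t :: real
 proof -
  have "(1 + \<bar>t\<bar>) ^ k <= exp \<bar>t\<bar> ^ k" by (intro power_mono exp_ge_add_one_self) simp
  also have "... = exp (real k * \<bar>t\<bar>)" by (simp add: exp_of_nat_mult)
  finally have p: "(1 + \<bar>t\<bar>) ^ k <= exp (real k * \<bar>t\<bar>)" .
  have "0 <= (e * \<bar>t\<bar> - (real k + 1))\<^sup>2 / (2 * e)" using e by simp
  also have "... = e * t\<^sup>2 / 2 - (real k + 1) * \<bar>t\<bar> + (real k + 1)\<^sup>2 / (2 * e)" using e by (simp add: power2_eq_square field_simps)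
  finally have ex: "real k * \<bar>t\<bar> + - e * t\<^sup>2 / 2 <= (real k + 1)\<^sup>2 / (2 * e) + - \<bar>t\<bar>" by (simp add: algebra_simps)
  have "(1 + \<bar>t\<bar>) ^ k * exp (- e * t\<^sup>2 / 2) <= exp (real k * \<bar>t\<bar>) * exp (- e * t\<^sup>2 / 2)" by (intro mult_right_mono p) simp
  also have "... <= D * exp (- \<bar>t\<bar>)" unfolding D_def exp_add[symmetric] using ex by simp
  finally show ?thesis .
 qed
 have "norm (g z) <= (C * D * D) * ee z" for z
 proof -
  have "norm (g z) = norm (a z) * (exp (- e * (fst z)\<^sup>2 / 2) * exp (- e * (snd z)\<^sup>2 / 2))"
   unfolding a(2) Eg_eq by (simp add: norm_mult)
  also have "... <= (C * ((1 + \<bar>fst z\<bar>) * (1 + \<bar>snd z\<bar>)) ^ k) * (exp (- e * (fst z)\<^sup>2 / 2) * exp (- e * (snd z)\<^sup>2 / 2))"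
   by (rule mult_right_mono[OF C(2)[rule_format]]) simp
  also have "... = C * (((1 + \<bar>fst z\<bar>) ^ k * exp (- e * (fst z)\<^sup>2 / 2)) * ((1 + \<bar>snd z\<bar>) ^ k * exp (- e * (snd z)\<^sup>2 / 2)))"
   by (simp only: power_mult_distrib mult_ac)
  also have "... <= C * ((D * exp (- \<bar>fst z\<bar>)) * (D * exp (- \<bar>snd z\<bar>)))"
   using C(1) by (intro mult_left_mono mult_mono one) (auto simp: D_def)
  finally show ?thesis by (simp only: ee_def mult_ac)
 qed
 thus ?thesis using C(1) by (intro exI[of _ "C * D * D"]) (simp add: D_def)
qed

lemma freq_regular:
 assumes g: "g \<in> freq" shows "continuous_on UNIV g" "g \<in> bmeas" "intble g"
proof -
 obtain gt gx where "has_partials g gt gx" using freq_partials[OF g] by blast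
 thus c: "continuous_on UNIV g" by (rule has_partialsD)
 thus meas: "g \<in> bmeas" by (rule borel_measurable_continuous_onI)
 obtain C where C: "C >= 0" "ALL z. norm (g z) <= C * ee z" using freq_bound[OF g] by blast
 show "intble g" by (rule integrable_ee_bound[OF meas C(2)[rule_format]])
qed

lemma freq_const_mult: "g \<in> freq ==> (%z. c * g z) \<in> freq"
 by (rule freq_mult[OF _ mults.const])

lemma IFT_bounded: "EX M. ALL z. norm (IFT g z) <= M"
proof (intro exI allI)
 fix z
 have "norm (LBINT ze. cis (z \<bullet> ze) * g ze) <= (LBINT ze. norm (cis (z \<bullet> ze) * g ze))" by (rule integral_norm_bound)
 thus "norm (IFT g z) <= norm (cor (1 / (2 * pi) ^ 2)) * (LBINT ze. norm (g ze))"
  unfolding IFT_cis norm_mult[of "cor _"] by (intro mult_left_mono) (simp_all add: norm_mult)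
qed

lemma integrable_cis_freq: "g \<in> freq ==> intble (%ze. cis (z \<bullet> ze) * g ze)"
 by (rule Bochner_Integration.integrable_bound[OF freq_regular(3)])
  (use freq_regular(2) in \<open>auto simp: norm_mult intro!: borel_measurable_times\<close>)

lemma IFT_partials:
 assumes g: "g \<in> freq"
 shows "has_partials (IFT g) (IFT (%ze. (\<i> * cf ze) * g ze)) (IFT (%ze. (\<i> * cs ze) * g ze))"
 unfolding has_partials_def
proof (intro conjI allI)
 have [measurable]: "g \<in> bmeas" by (rule freq_regular[OF g])
 have g1: "(%ze. (\<i> * cf ze) * g ze) \<in> freq" "(%ze. (\<i> * cs ze) * g ze) \<in> freq" by (intro freq_mult[OF g] mults.intros)+
 note ni = integrable_norm[OF freq_regular(3)[OF g1(1)]] integrable_norm[OF freq_regular(3)[OF g1(2)]] integrable_norm[OF freq_regular(3)[OF g]]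
 have [measurable]: "cf \<in> bmeas" "cs \<in> bmeas" unfolding cf_def[abs_def] cs_def[abs_def] by measurable
 have [measurable]: "(%ze. cis (z \<bullet> ze)) \<in> bmeas" for z :: R2 by measurable
 show "continuous_on UNIV (IFT g)"
  unfolding IFT_cis[abs_def]
 proof (rule continuous_on_mult[OF continuous_on_const], rule continuous_on_integral)
  show "continuous_on UNIV (%z. cis (z \<bullet> y) * g y)" for y by (intro continuous_intros)
  show "EX w. intble w & (ALL z y. dist z z0 <= 1 --> norm (cis (z \<bullet> y) * g y) <= w y)" for z0 :: R2
   by (rule exI[of _ "%y. norm (g y)"]) (simp add: norm_mult ni del: split_paired_All)
 qed measurable
 fix t x :: real
 have "((%s. LBINT ze. cis ((s, x) \<bullet> ze) * g ze) has_vector_derivative (LBINT ze. cis ((t, x) \<bullet> ze) * ((\<i> * cf ze) * g ze))) (at t)"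
 proof (rule has_vector_derivative_integral(2)[OF _ integrable_cis_freq[OF g] _ ni(1)])
  fix s :: real and y :: R2
  have "((%s. cis (s * fst y + x * snd y)) has_vector_derivative (\<i> * cor (fst y) * cis (s * fst y + x * snd y))) (at s)"
   by (rule cis_line_derivative)
  from has_vector_derivative_mult_left[OF this, of "g y"]
  show "((%s. cis ((s, x) \<bullet> y) * g y) has_vector_derivative (cis ((s, x) \<bullet> y) * ((\<i> * cf y) * g y))) (at s)"
   by (simp add: inner_R2 cf_def mult_ac)
 qed (simp_all add: norm_mult)
 from has_vector_derivative_mult_right[OF this, of "cor (1 / (2 * pi) ^ 2)"]
 show "((%s. IFT g (s, x)) has_vector_derivative IFT (%ze. (\<i> * cf ze) * g ze) (t, x)) (at t)" unfolding IFT_cis .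
 have "((%s. LBINT ze. cis ((t, s) \<bullet> ze) * g ze) has_vector_derivative (LBINT ze. cis ((t, x) \<bullet> ze) * ((\<i> * cs ze) * g ze))) (at x)"
 proof (rule has_vector_derivative_integral(2)[OF _ integrable_cis_freq[OF g] _ ni(2)])
  fix s :: real and y :: R2
  have "((%s. cis (s * snd y + t * fst y)) has_vector_derivative (\<i> * cor (snd y) * cis (s * snd y + t * fst y))) (at s)"
   by (rule cis_line_derivative)
  from has_vector_derivative_mult_left[OF this, of "g y"]
  show "((%s. cis ((t, s) \<bullet> y) * g y) has_vector_derivative (cis ((t, s) \<bullet> y) * ((\<i> * cs y) * g y))) (at s)"
   by (simp add: inner_R2 cs_def mult_ac add.commute)
 qed (simp_all add: norm_mult)
 from has_vector_derivative_mult_right[OF this, of "cor (1 / (2 * pi) ^ 2)"]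
 show "((%y. IFT g (t, y)) has_vector_derivative IFT (%ze. (\<i> * cs ze) * g ze) (t, x)) (at x)" unfolding IFT_cis .
qed

text \<open>Integration by parts: the partial derivative of the whole integrand has integral 0,
  which trades a factor t or x for a partial derivative of g.\<close>

lemma IFT_times:
 assumes g: "g \<in> freq"
 shows "\<exists>h\<in>freq. (%z. cor (fst z) * IFT g z) = IFT h"
  and "\<exists>h\<in>freq. (%z. cor (snd z) * IFT g z) = IFT h"
proof -
 obtain gt gx where gt: "gt \<in> freq" and gx: "gx \<in> freq" and P: "has_partials g gt gx" using freq_partials[OF g] by blast
 obtain C Ct Cx where C: "ALL z. norm (g z) <= C * ee z" and Ct: "ALL z. norm (gt z) <= Ct * ee z" and Cx: "ALL z. norm (gx z) <= Cx * ee z"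
  using freq_bound[OF g] freq_bound[OF gt] freq_bound[OF gx] by blast
 have cc: "continuous_on UNIV g" "continuous_on UNIV gt" "continuous_on UNIV gx" by (rule freq_regular(1), fact)+
 have B: "norm (cis (z \<bullet> y) * g y) <= C * ee y" for z y using C[rule_format, of y] by (simp add: norm_mult)
 have B': "norm (\<i> * cor a * (cis (z \<bullet> y) * g y) + cis (z \<bullet> y) * h y) <= (\<bar>a\<bar> * C + D) * ee y"
  if "ALL z. norm (h z) <= D * ee z" for z y a D and h :: "R2 => complex"
 proof -
  have "norm (\<i> * cor a * (cis (z \<bullet> y) * g y) + cis (z \<bullet> y) * h y) <= \<bar>a\<bar> * norm (cis (z \<bullet> y) * g y) + norm (h y)"
   by (rule order_trans[OF norm_triangle_ineq]) (simp add: norm_mult)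
  also have "... <= \<bar>a\<bar> * (C * ee y) + D * ee y" by (intro add_mono mult_left_mono B that[rule_format]) simp
  finally show ?thesis by (simp only: distrib_right mult.assoc)
 qed
 have key: "cor a * IFT g z = IFT (%ze. \<i> * h ze) z"
  if h: "h \<in> freq" and 0: "(LBINT y. \<i> * cor a * (cis (z \<bullet> y) * g y) + cis (z \<bullet> y) * h y) = 0" for a z h
 proof -
  let ?G = "(LBINT y. cis (z \<bullet> y) * g y)" let ?H = "(LBINT y. cis (z \<bullet> y) * h y)"
  have "\<i> * cor a * ?G + ?H = 0"
   using 0 integrable_cis_freq[OF g, of z] integrable_cis_freq[OF h, of z] by simp
  hence "?H = - (\<i> * cor a * ?G)" by (simp only: add_eq_0_iff2 add.inverse_inverse add_eq_0_iff)
  hence "cor a * ?G = \<i> * ?H" by (simp add: mult.assoc[symmetric])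
  moreover have "(LBINT y. cis (z \<bullet> y) * (\<i> * h y)) = \<i> * ?H" by (simp only: mult.left_commute[of _ \<i>] integral_mult_right_zero)
  ultimately show ?thesis unfolding IFT_cis by (simp only: mult.left_commute[of "cor a"])
 qed
 have "cor (fst z) * IFT g z = IFT (%ze. \<i> * gt ze) z" for z
 proof (rule key[OF gt], rule integral_partial_derivative_fst[where G="%y. cis (z \<bullet> y) * g y"])
  fix t x
  have "((%s. cis (s * fst z + x * snd z)) has_vector_derivative (\<i> * cor (fst z) * cis (t * fst z + x * snd z))) (at t)" by (rule cis_line_derivative)
  from has_vector_derivative_mult[OF this has_partialsD(4)[OF P]]
  show "((%s. cis (z \<bullet> (s, x)) * g (s, x)) has_vector_derivative \<i> * cor (fst z) * (cis (z \<bullet> (t, x)) * g (t, x)) + cis (z \<bullet> (t, x)) * gt (t, x)) (at t)"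
   by (simp add: inner_R2 mult_ac add_ac)
 next
  show "continuous_on UNIV (%y. \<i> * cor (fst z) * (cis (z \<bullet> y) * g y) + cis (z \<bullet> y) * gt y)" by (intro continuous_intros cc)
 qed (rule B B'[OF Ct])+
 thus "\<exists>h\<in>freq. (%z. cor (fst z) * IFT g z) = IFT h" using freq_const_mult[OF gt] by (intro bexI) (rule ext)
 have "cor (snd z) * IFT g z = IFT (%ze. \<i> * gx ze) z" for z
 proof (rule key[OF gx], rule integral_partial_derivative_snd[where G="%y. cis (z \<bullet> y) * g y"])
  fix t x
  have "((%s. cis (s * snd z + t * fst z)) has_vector_derivative (\<i> * cor (snd z) * cis (x * snd z + t * fst z))) (at x)" by (rule cis_line_derivative)
  from has_vector_derivative_mult[OF this has_partialsD(5)[OF P]]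
  show "((%s. cis (z \<bullet> (t, s)) * g (t, s)) has_vector_derivative \<i> * cor (snd z) * (cis (z \<bullet> (t, x)) * g (t, x)) + cis (z \<bullet> (t, x)) * gx (t, x)) (at x)"
   by (simp add: inner_R2 mult_ac add_ac)
 next
  show "continuous_on UNIV (%y. \<i> * cor (snd z) * (cis (z \<bullet> y) * g y) + cis (z \<bullet> y) * gx y)" by (intro continuous_intros cc)
 qed (rule B B'[OF Cx])+
 thus "\<exists>h\<in>freq. (%z. cor (snd z) * IFT g z) = IFT h" using freq_const_mult[OF gx] by (intro bexI) (rule ext)
qed

lemma IFT_weighted_bounded:
 assumes g: "g \<in> freq"
 shows "EX M. ALL z. norm (cor (fst z ^ a * snd z ^ b) * IFT g z) <= M"
proof -
 have 1: "\<exists>h\<in>freq. (%z. cor (fst z ^ a) * IFT g z) = IFT h" if "g \<in> freq" for g a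
 proof (induction a)
  case 0 thus ?case using that by (intro bexI[of _ g]) auto
 next
  case (Suc a)
  then obtain h where h: "h \<in> freq" "(%z. cor (fst z ^ a) * IFT g z) = IFT h" by blast
  have "cor (fst z ^ Suc a) * IFT g z = cor (fst z) * IFT h z" for z
   using fun_cong[OF h(2), of z] by simp
  thus ?case using IFT_times(1)[OF h(1)] by (simp only:)
 qed
 have 2: "\<exists>h\<in>freq. (%z. cor (snd z ^ b) * IFT g z) = IFT h" if "g \<in> freq" for g b
 proof (induction b)
  case 0 thus ?case using that by (intro bexI[of _ g]) auto
 next
  case (Suc b)
  then obtain h where h: "h \<in> freq" "(%z. cor (snd z ^ b) * IFT g z) = IFT h" by blast
  have "cor (snd z ^ Suc b) * IFT g z = cor (snd z) * IFT h z" for z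
   using fun_cong[OF h(2), of z] by simp
  thus ?case using IFT_times(2)[OF h(1)] by (simp only:)
 qed
 obtain h where h: "h \<in> freq" "(%z. cor (fst z ^ a) * IFT g z) = IFT h" using 1[OF g] by blast
 obtain k where k: "k \<in> freq" "(%z. cor (snd z ^ b) * IFT h z) = IFT k" using 2[OF h(1)] by blast
 have "cor (fst z ^ a * snd z ^ b) * IFT g z = IFT k z" for z
  unfolding fun_cong[OF k(2), of z, symmetric] fun_cong[OF h(2), of z, symmetric] by simp
 thus ?thesis using IFT_bounded[of k] by (simp only:)
qed

lemma IFT_schwartz:
 assumes g: "g \<in> freq" shows "schwartz (IFT g)"
proof -
 let ?S = "{IFT g | g. g \<in> freq}"
 have S: "\<exists>ft\<in>?S. \<exists>fx\<in>?S. has_partials f ft fx" if fS: "f \<in> ?S" for f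
 proof -
  obtain h where h: "h \<in> freq" "f = IFT h" using fS by blast
  have "(%ze. (\<i> * cf ze) * h ze) \<in> freq" "(%ze. (\<i> * cs ze) * h ze) \<in> freq" by (intro freq_mult[OF h(1)] mults.intros)+
  thus ?thesis using IFT_partials[OF h(1)] h(2) by blast
 qed
 have w: "pd w (IFT g) \<in> ?S" for w
 proof (induction w)
  case (Cons b w)
  then obtain ft fx where "ft \<in> ?S" "fx \<in> ?S" "has_partials (pd w (IFT g)) ft fx" using S by blast
  thus ?case by (auto dest: has_partialsD(1,2))
 qed (use g in auto)
 have "bounded (range (%(t, x). cor (t ^ a * x ^ b) * pd w (IFT g) (t, x)))" for w a b
 proof -
  obtain h where h: "h \<in> freq" "pd w (IFT g) = IFT h" using w[of w] by blast
  obtain M where M: "ALL z. norm (cor (fst z ^ a * snd z ^ b) * IFT h z) <= M" using IFT_weighted_bounded[OF h(1)] by blast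
  show ?thesis unfolding bounded_iff h(2)
  proof (intro exI[of _ M] ballI)
   fix y assume "y \<in> range (%(t, x). cor (t ^ a * x ^ b) * IFT h (t, x))"
   then obtain t x where "y = cor (t ^ a * x ^ b) * IFT h (t, x)" by auto
   thus "norm y <= M" using M[rule_format, of "(t, x)"] by simp
  qed
 qed
 moreover have "smooth2 (IFT g)" by (rule smooth2_coinduct[of _ ?S]) (use g S in blast)+
 ultimately show ?thesis by (simp add: schwartz_def)
qed

text \<open>The weights 1, t^2, x^2 and t^2 x^2 add up to (1 + t^2)(1 + x^2), whose reciprocal is an
  integrable product.\<close>

lemma IFT_integrable:
 assumes g: "g \<in> freq" shows "IFT g \<in> bmeas" "intble (IFT g)"
proof -
 show meas [measurable]: "IFT g \<in> bmeas"
  by (rule borel_measurable_continuous_onI[OF has_partialsD(3)[OF IFT_partials[OF g]]])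
 obtain M1 where M1: "ALL z. norm (cor (fst z ^ 0 * snd z ^ 0) * IFT g z) <= M1" using IFT_weighted_bounded[OF g, of 0 0] ..
 obtain M2 where M2: "ALL z. norm (cor (fst z ^ 2 * snd z ^ 0) * IFT g z) <= M2" using IFT_weighted_bounded[OF g, of 2 0] ..
 obtain M3 where M3: "ALL z. norm (cor (fst z ^ 0 * snd z ^ 2) * IFT g z) <= M3" using IFT_weighted_bounded[OF g, of 0 2] ..
 obtain M4 where M4: "ALL z. norm (cor (fst z ^ 2 * snd z ^ 2) * IFT g z) <= M4" using IFT_weighted_bounded[OF g, of 2 2] ..
 show "intble (IFT g)"
 proof (rule integrable_prod_dominated[OF integrable_mult_right[OF integrable_inverse_square, of "M1 + M2 + M3 + M4"] integrable_inverse_square meas])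
  fix t x :: real
  let ?n = "norm (IFT g (t, x))"
  have b: "?n <= M1" "t\<^sup>2 * ?n <= M2" "x\<^sup>2 * ?n <= M3" "t\<^sup>2 * x\<^sup>2 * ?n <= M4"
   using M1[rule_format, of "(t, x)"] M2[rule_format, of "(t, x)"] M3[rule_format, of "(t, x)"] M4[rule_format, of "(t, x)"] by (simp_all add: norm_mult norm_power)
  have "?n * ((1 + t\<^sup>2) * (1 + x\<^sup>2)) = ?n + t\<^sup>2 * ?n + x\<^sup>2 * ?n + t\<^sup>2 * x\<^sup>2 * ?n" by (simp add: algebra_simps)
  also have "... <= M1 + M2 + M3 + M4" by (intro add_mono b)
  finally have le: "?n * ((1 + t\<^sup>2) * (1 + x\<^sup>2)) <= M1 + M2 + M3 + M4" .
  have p: "1 + t\<^sup>2 > 0" "1 + x\<^sup>2 > 0" by (simp_all add: add_pos_nonneg)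
  have "0 <= ?n * ((1 + t\<^sup>2) * (1 + x\<^sup>2))" using p by simp
  hence M0: "M1 + M2 + M3 + M4 >= 0" using le by linarith
  have "?n <= (M1 + M2 + M3 + M4) / ((1 + t\<^sup>2) * (1 + x\<^sup>2))" using le p by (simp add: pos_le_divide_eq)
  thus "?n <= norm ((M1 + M2 + M3 + M4) * (1 / (1 + t\<^sup>2))) * norm (1 / (1 + x\<^sup>2))"
   using M0 p by (simp add: abs_mult)
 qed
qed

text \<open>Fourier inversion by Gaussian summation: the factor \<open>E n\<close> permits Fubini,
  and its own transform is an approximate identity at ze.\<close>

lemma FT_IFT:
 assumes g: "g \<in> freq" shows "FT (IFT g) ze = g ze"
proof -
 define h where "h = IFT g"
 have [measurable]: "h \<in> bmeas" and hi: "intble h" using IFT_integrable[OF g] by (simp_all add: h_def)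
 note [measurable] = freq_regular(2)[OF g]
 have [measurable]: "(%ze. cis (z \<bullet> ze)) \<in> bmeas" "(%ze. cis (- (ze \<bullet> z))) \<in> bmeas" for z :: R2 by measurable
 define E where "E n z = cor (exp (- (1 / real (Suc n)) * (fst z)\<^sup>2 / 2)) * cor (exp (- (1 / real (Suc n)) * (snd z)\<^sup>2 / 2))" for n and z :: R2
 have [measurable]: "E n \<in> bmeas" for n unfolding E_def by measurable
 have Ei: "intble (E n)" for n unfolding E_def by (rule gaussian_fourier2) simp
 have E1: "norm (E n z) <= 1" for n z
  unfolding E_def norm_mult norm_of_real by (intro mult_le_one) simp_all
 have FTh: "FT h ze = (LBINT z. cis (- (z \<bullet> ze)) * h z)" by (simp add: FT_def cis_conv_exp)
 have L1: "(%n. LBINT z. E n z * (cis (- (z \<bullet> ze)) * h z)) \<longlonglongrightarrow> (LBINT z. cis (- (z \<bullet> ze)) * h z)"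
 proof (rule integral_dominated_convergence[where w="%z. norm (h z)"])
  show "intble (%z. norm (h z))" by (intro integrable_norm hi)
  show "AE z in lborel. norm (E n z * (cis (- (z \<bullet> ze)) * h z)) <= norm (h z)" for n
  proof (intro AE_I2)
   show "norm (E n z * (cis (- (z \<bullet> ze)) * h z)) <= norm (h z)" for z
    using mult_right_mono[OF E1[of n z], of "norm (h z)"] by (simp add: norm_mult)
  qed
  show "AE z in lborel. (%n. E n z * (cis (- (z \<bullet> ze)) * h z)) \<longlonglongrightarrow> cis (- (z \<bullet> ze)) * h z"
  proof (intro AE_I2)
   fix z :: R2
   have l: "(%n. 1 / real (Suc n)) \<longlonglongrightarrow> 0" by (rule lim_1_over_n[THEN LIMSEQ_Suc])
   have "(%n. E n z) \<longlonglongrightarrow> cor (exp (- 0 * (fst z)\<^sup>2 / 2)) * cor (exp (- 0 * (snd z)\<^sup>2 / 2))"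
    unfolding E_def by (intro tendsto_mult tendsto_of_real tendsto_exp tendsto_divide tendsto_minus l tendsto_const) simp_all
   hence "(%n. E n z) \<longlonglongrightarrow> 1" by simp
   from tendsto_mult_right[OF this, of "cis (- (z \<bullet> ze)) * h z"]
   show "(%n. E n z * (cis (- (z \<bullet> ze)) * h z)) \<longlonglongrightarrow> cis (- (z \<bullet> ze)) * h z" by simp
  qed
 qed measurable
 have eq: "(LBINT z. E n z * (cis (- (z \<bullet> ze)) * h z)) = (LBINT y. g y * cor (gau2 (1 / real (Suc n)) (y - ze)))" for n
 proof -
  let ?c = "cor (1 / (2 * pi) ^ 2)"
  let ?F = "%y z. E n z * (cis (- (z \<bullet> ze)) * (cis (z \<bullet> y) * g y))"
  have i: "integrable (lborel \<Otimes>\<^sub>M lborel) (%(y, z). ?F y z)"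
  proof -
   have "intble (%p. ?F (fst p) (snd p))"
    by (rule integrable_prod_dominated[OF freq_regular(3)[OF g] Ei[of n]]) (simp_all add: norm_mult mult_ac)
   thus ?thesis by (simp only: lborel_prod case_prod_beta')
  qed
  have "(LBINT z. E n z * (cis (- (z \<bullet> ze)) * h z)) = (LBINT z. ?c * (LBINT y. ?F y z))"
   unfolding h_def IFT_cis by (simp only: integral_mult_right_zero mult.left_commute[of _ ?c])
  also have "... = ?c * (LBINT z. LBINT y. ?F y z)" by (rule integral_mult_right_zero)
  also have "... = ?c * (LBINT y. LBINT z. ?F y z)" by (simp only: lborel_pair.Fubini_integral[OF i])
  also have "... = ?c * (LBINT y. g y * cor ((2 * pi)\<^sup>2 * gau2 (1 / real (Suc n)) (y - ze)))"
  proof -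
   have "(LBINT z. ?F y z) = g y * cor ((2 * pi)\<^sup>2 * gau2 (1 / real (Suc n)) (y - ze))" for y
   proof -
    have "?F y z = g y * (cis (z \<bullet> (y - ze)) * E n z)" for z
    proof -
     have "cis (z \<bullet> (y - ze)) = cis (- (z \<bullet> ze)) * cis (z \<bullet> y)" by (simp add: cis_mult inner_diff_right)
     thus ?thesis by simp
    qed
    hence "(LBINT z. ?F y z) = g y * (LBINT z. cis (z \<bullet> (y - ze)) * E n z)" by (simp only: integral_mult_right_zero)
    thus ?thesis unfolding E_def by (subst (asm) gaussian_fourier2(1)) simp_all
   qed
   thus ?thesis by (simp only:)
  qed
  also have "... = (LBINT y. ?c * (g y * cor ((2 * pi)\<^sup>2 * gau2 (1 / real (Suc n)) (y - ze))))" by (rule integral_mult_right_zero[symmetric])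
  also have "... = (LBINT y. g y * cor (gau2 (1 / real (Suc n)) (y - ze)))"
   by (rule Bochner_Integration.integral_cong) simp_all
  finally show ?thesis .
 qed
 obtain C where C: "C >= 0" "ALL z. norm (g z) <= C * ee z" using freq_bound[OF g] by blast
 have L2: "(%n. LBINT y. g y * cor (gau2 (1 / real (Suc n)) (y - ze))) \<longlonglongrightarrow> g ze"
 proof (rule gau2_approximate_identity[OF freq_regular(1)[OF g]])
  fix z
  have "ee z <= 1" unfolding ee_def by (intro mult_le_one) simp_all
  hence "C * ee z <= C * 1" by (intro mult_left_mono C(1))
  thus "norm (g z) <= C" using C(2)[rule_format, of z] by simp
 qed
 show ?thesis using LIMSEQ_unique[OF L1[unfolded eq] L2] FTh unfolding h_def by (simp only:)
qed

text \<open>In frequency the Gaussian is divided by the symbol, so that \<open>PD m\<close> returns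
  the Gaussian centred at z0. Testing the definition of W^q with these functions turns a statement
  about distributions into one about the mollification of u, with f paired with translates of
  \<open>Phi\<close>.\<close>

lemma gaussian_test_function:
 defines "ph \<equiv> IFT (%ze. isy ze * Eg ze)"
 shows "schwartz ph" "PD m ph z = cor (gau2 e (z - z0))" "ph z = Phi m e (z - z0)"
proof -
 have g: "(%ze. isy ze * Eg ze) \<in> freq" unfolding freq_def using mults.isy by blast
 thus "schwartz ph" unfolding ph_def by (rule IFT_schwartz)
 have Egc: "cis (z \<bullet> ze) * Eg ze = cis (ze \<bullet> (z - z0)) * (cor (exp (- e * (fst ze)\<^sup>2 / 2)) * cor (exp (- e * (snd ze)\<^sup>2 / 2)))" for z ze
 proof -
  have "cis (ze \<bullet> (z - z0)) = cis (z \<bullet> ze) * cis (- (z0 \<bullet> ze))"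
   by (simp add: cis_mult inner_diff_right inner_commute)
  thus ?thesis unfolding Eg_eq by simp
 qed
 have "cor (symb m ze) * FT ph ze = Eg ze" for ze
 proof -
  have "symb m ze ~= 0" using symb_ge_1[of ze] by simp
  thus ?thesis unfolding ph_def unfolding FT_IFT[OF g] by (simp add: isy_def)
 qed
 hence "PD m ph z = cor (1 / (2 * pi) ^ 2) * (LBINT ze. cis (z \<bullet> ze) * Eg ze)" unfolding PD_def IFT_cis by (simp only:)
 also have "... = cor (1 / (2 * pi) ^ 2) * cor ((2 * pi)\<^sup>2 * gau2 e (z - z0))"
  unfolding Egc gaussian_fourier2(1)[OF e] ..
 finally show "PD m ph z = cor (gau2 e (z - z0))" by simp
 have "cis (z \<bullet> ze) * (isy ze * Eg ze) = cis ((z - z0) \<bullet> ze) * (cor (1 / symb m ze) * (cor (exp (- e * (fst ze)\<^sup>2 / 2)) * cor (exp (- e * (snd ze)\<^sup>2 / 2))))" for ze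
  using Egc[of z ze] by (simp only: isy_def mult.left_commute[of "cis _"] inner_commute[of ze])
 thus "ph z = Phi m e (z - z0)" unfolding ph_def Phi_def IFT_cis by (simp only:)
qed

end

lemma Wq_pairing:
 assumes "m >= 1" "e > 0" and "ALL ph. schwartz ph --> (LBINT z. u z * PD m ph z) = (LBINT z. f z * ph z)"
 shows "(LBINT z. u z * cor (gau2 e (z - z0))) = (LBINT z. f z * Phi m e (z - z0))"
 using assms(3)[rule_format, OF gaussian_test_function(1)[OF assms(1,2), of z0]] by (simp only: gaussian_test_function(2,3)[OF assms(1,2)])

section \<open>Kernel bounds for the inverse symbol\<close>

lemma fourier_derivative:
 fixes f f' :: "real => complex"
 assumes D: "!!ks. (f has_vector_derivative f' ks) (at ks)" and c: "continuous_on UNIV f'"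
  and i: "intble f" "intble f'"
  and l: "(%n. f (real n)) \<longlonglongrightarrow> 0" "(%n. f (- real n)) \<longlonglongrightarrow> 0"
 shows "(LBINT ks. f' ks * cis (ks * x)) = - (\<i> * cor x) * (LBINT ks. f ks * cis (ks * x))"
proof -
 have cf: "continuous_on UNIV f" by (intro continuous_at_imp_continuous_on ballI has_vector_derivative_continuous[OF D])
 note ci = integrable_cis_mult[OF i(1), of x] integrable_cis_mult[OF i(2), of x]
 have "(LBINT ks. f ks * (\<i> * cor x * cis (ks * x)) + f' ks * cis (ks * x)) = 0"
 proof (rule integral_derivative_UNIV[where G="%ks. f ks * cis (ks * x)"])
  fix r
  have "((%s. cis (s * x + 0)) has_vector_derivative (\<i> * cor x * cis (r * x + 0))) (at r)" by (rule cis_line_derivative)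
  from has_vector_derivative_mult[OF D this]
  show "((%ks. f ks * cis (ks * x)) has_vector_derivative f r * (\<i> * cor x * cis (r * x)) + f' r * cis (r * x)) (at r)" by simp
 next
  show "continuous_on UNIV (%ks. f ks * (\<i> * cor x * cis (ks * x)) + f' ks * cis (ks * x))" by (intro continuous_intros c cf)
  have "intble (%ks. (\<i> * cor x) * (f ks * cis (ks * x)) + f' ks * cis (ks * x))"
   by (intro Bochner_Integration.integrable_add integrable_mult_right ci)
  thus "intble (%ks. f ks * (\<i> * cor x * cis (ks * x)) + f' ks * cis (ks * x))" by (simp only: mult.left_commute)
  show "(%n. f (real n) * cis (real n * x)) \<longlonglongrightarrow> 0" "(%n. f (- real n) * cis (- real n * x)) \<longlonglongrightarrow> 0"
   by (rule tendsto_norm_zero_cancel, use l[THEN tendsto_norm] in \<open>simp add: norm_mult\<close>)+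
 qed
 hence "(LBINT ks. (\<i> * cor x) * (f ks * cis (ks * x)) + f' ks * cis (ks * x)) = 0" by (simp only: mult.left_commute)
 hence "(\<i> * cor x) * (LBINT ks. f ks * cis (ks * x)) + (LBINT ks. f' ks * cis (ks * x)) = 0"
  using Bochner_Integration.integral_add[OF integrable_mult_right[OF ci(1), of "\<i> * cor x"] ci(2)] by (simp only: integral_mult_right_zero)
 thus ?thesis by (simp only: mult_minus_left eq_neg_iff_add_eq_0 add.commute)
qed

lemma exp_rate_tendsto_0:
 fixes G :: "real => complex"
 assumes r: "r > 0" and b: "!!x. norm (G x) <= C * exp (- r * \<bar>x\<bar>)"
 shows "(%n. G (real n)) \<longlonglongrightarrow> 0" "(%n. G (- real n)) \<longlonglongrightarrow> 0"
proof -
 have "(%n. exp (- r) ^ n) \<longlonglongrightarrow> 0" using r by (intro LIMSEQ_realpow_zero) auto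
 hence l: "(%n. C * exp (- r) ^ n) \<longlonglongrightarrow> 0" by (rule tendsto_mult_right_zero)
 have "exp (- r) ^ n = exp (- r * real n)" for n by (simp add: exp_of_nat_mult[symmetric] mult.commute)
 hence "norm (G (real n)) <= C * exp (- r) ^ n" "norm (G (- real n)) <= C * exp (- r) ^ n" for n
  using b[of "real n"] b[of "- real n"] by simp_all
 thus "(%n. G (real n)) \<longlonglongrightarrow> 0" "(%n. G (- real n)) \<longlonglongrightarrow> 0"
  by (auto intro!: Lim_null_comparison[OF always_eventually l])
qed

lemma exp_rate_integral:
 fixes r :: real
 assumes r: "r > 0"
 shows "intble (%ks. exp (- r * \<bar>ks\<bar>))" "(LBINT ks. exp (- r * \<bar>ks\<bar>)) = (1 / r) * (LBINT ks. exp (- \<bar>ks\<bar>))"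
proof -
 have eq: "exp (- \<bar>0 + r * x\<bar>) = exp (- r * \<bar>x\<bar>)" for x using r by (simp add: abs_mult)
 have r0: "r ~= 0" using r by simp
 show "intble (%ks. exp (- r * \<bar>ks\<bar>))" using lborel_integrable_real_affine[OF integrable_exp_neg_abs r0, of 0] unfolding eq .
 define J where "J = (LBINT ks. exp (- r * \<bar>ks\<bar>))"
 have "(LBINT ks. exp (- \<bar>ks\<bar>)) = r * J"
  using lborel_integral_real_affine[OF r0, of "%ks. exp (- \<bar>ks\<bar>)" 0] r unfolding eq J_def by simp
 thus "J = (1 / r) * (LBINT ks. exp (- \<bar>ks\<bar>))" using r by simp
qed

text \<open>No integration by parts for the first bound, two for the second. Exponential decay of f
  and f' removes the boundary terms, whereas f'' needs only an integrable majorant w.\<close>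

lemma fmult_decay:
 fixes f f' f'' :: "real => real"
 assumes D: "!!ks. (f has_real_derivative f' ks) (at ks)" "!!ks. (f' has_real_derivative f'' ks) (at ks)" and c: "continuous_on UNIV f''"
  and r: "r > 0" and b: "!!ks. \<bar>f ks\<bar> <= A * exp (- r * \<bar>ks\<bar>)" "!!ks. \<bar>f' ks\<bar> <= A' * exp (- r * \<bar>ks\<bar>)"
  and b'': "!!ks. \<bar>f'' ks\<bar> <= w ks" and w: "intble w"
 shows "norm (fmult (%ks. cor (f ks)) x) <= A * ((1 / r) * (LBINT ks. exp (- \<bar>ks\<bar>)))"
  and "x\<^sup>2 * norm (fmult (%ks. cor (f ks)) x) <= (LBINT ks. w ks)"
  and "intble (%ks. cor (f ks))"
proof -
 let ?f = "%ks. cor (f ks)" let ?f' = "%ks. cor (f' ks)" let ?f'' = "%ks. cor (f'' ks)"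
 note ei = exp_rate_integral(1)[OF r] and eI = exp_rate_integral(2)[OF r]
 have cc: "continuous_on UNIV f" "continuous_on UNIV f'" by (intro continuous_at_imp_continuous_on ballI DERIV_isCont[OF D(1)] DERIV_isCont[OF D(2)])+
 have [measurable]: "f \<in> bmeas" "f' \<in> bmeas" "f'' \<in> bmeas"
  by (intro borel_measurable_continuous_onI cc c)+
 have dom: "intble (%ks. cor (g ks))" if [measurable]: "g \<in> bmeas" and "!!ks. \<bar>g ks\<bar> <= B * exp (- r * \<bar>ks\<bar>)" for g :: "real => real" and B
 proof (rule Bochner_Integration.integrable_bound[OF integrable_mult_right[OF ei, of B] _ AE_I2])
  show "norm (cor (g ks)) <= norm (B * exp (- r * \<bar>ks\<bar>))" for ks using that(2)[of ks] by simp
 qed simp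
 show i: "intble ?f" by (rule dom[OF _ b(1)]) simp
 have i': "intble ?f'" by (rule dom[OF _ b(2)]) simp
 have i'': "intble ?f''"
 proof (rule Bochner_Integration.integrable_bound[OF w _ AE_I2])
  show "norm (cor (f'' ks)) <= norm (w ks)" for ks using b''[of ks] by simp
 qed simp
 have VD: "(?f has_vector_derivative ?f' ks) (at ks)" "(?f' has_vector_derivative ?f'' ks) (at ks)" for ks
  by (intro bounded_linear.has_vector_derivative[OF bounded_linear_of_real] D[unfolded has_real_derivative_iff_has_vector_derivative])+
 have l: "(%n. ?f (real n)) \<longlonglongrightarrow> 0" "(%n. ?f (- real n)) \<longlonglongrightarrow> 0" "(%n. ?f' (real n)) \<longlonglongrightarrow> 0" "(%n. ?f' (- real n)) \<longlonglongrightarrow> 0"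
 proof -
  have "norm (?f ks) <= A * exp (- r * \<bar>ks\<bar>)" "norm (?f' ks) <= A' * exp (- r * \<bar>ks\<bar>)" for ks unfolding norm_of_real by (rule b)+
  thus "(%n. ?f (real n)) \<longlonglongrightarrow> 0" "(%n. ?f (- real n)) \<longlonglongrightarrow> 0" "(%n. ?f' (real n)) \<longlonglongrightarrow> 0" "(%n. ?f' (- real n)) \<longlonglongrightarrow> 0"
   using exp_rate_tendsto_0[OF r, of ?f A] exp_rate_tendsto_0[OF r, of ?f' A'] by blast+
 qed
 define I where "I = (LBINT ks. ?f ks * cis (ks * x))"
 have "(LBINT ks. ?f'' ks * cis (ks * x)) = - (\<i> * cor x) * (- (\<i> * cor x) * I)"
  unfolding I_def fourier_derivative[OF VD(2) continuous_on_of_real[OF c] i' i'' l(3,4)] fourier_derivative[OF VD(1) continuous_on_of_real[OF cc(2)] i i' l(1,2)] ..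
 also have "... = - cor (x\<^sup>2) * I" by (simp add: power2_eq_square algebra_simps)
 finally have "x\<^sup>2 * norm I = norm (LBINT ks. ?f'' ks * cis (ks * x))" by (simp add: norm_mult norm_power)
 also have "... <= (LBINT ks. norm (?f'' ks * cis (ks * x)))" by (rule integral_norm_bound)
 also have "... <= (LBINT ks. w ks)"
  by (intro integral_mono integrable_norm integrable_cis_mult i'' w) (simp only: norm_mult norm_cis norm_of_real mult_1_right b'')
 finally have 2: "x\<^sup>2 * norm I <= (LBINT ks. w ks)" .
 have "norm I <= (LBINT ks. norm (?f ks * cis (ks * x)))" unfolding I_def by (rule integral_norm_bound)
 also have "... <= (LBINT ks. A * exp (- r * \<bar>ks\<bar>))"
  by (intro integral_mono integrable_norm integrable_cis_mult i integrable_mult_right ei) (simp only: norm_mult norm_cis norm_of_real mult_1_right b(1))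
 finally have 1: "norm I <= A * ((1 / r) * (LBINT ks. exp (- \<bar>ks\<bar>)))" by (simp only: integral_mult_right_zero eI)
 have "1 <= 2 * pi" using pi_gt3 by simp
 hence p: "1 / (2 * pi) <= 1" by simp
 have "fmult ?f x = cor (1 / (2 * pi)) * I" unfolding fmult_def I_def by (simp only: mult.commute[of x])
 hence "norm (fmult ?f x) = 1 / (2 * pi) * norm I" by (simp add: norm_mult norm_divide)
 also have "... <= 1 * norm I" by (intro mult_right_mono p) simp
 finally have le: "norm (fmult ?f x) <= norm I" by simp
 show "norm (fmult ?f x) <= A * ((1 / r) * (LBINT ks. exp (- \<bar>ks\<bar>)))" by (rule order_trans[OF le 1])
 show "x\<^sup>2 * norm (fmult ?f x) <= (LBINT ks. w ks)" by (rule order_trans[OF mult_left_mono[OF le] 2]) simp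
qed

text \<open>Poisson kernel of the half plane without the factor 1/pi.\<close>

definition Pk :: "real => real => real" where "Pk y x = y / (y\<^sup>2 + x\<^sup>2)"

lemma Pk_nonneg: "y > 0 ==> Pk y x >= 0" by (simp add: Pk_def)

lemma Pk_measurable [measurable]: "f \<in> borel_measurable M ==> g \<in> borel_measurable M ==> (%z. Pk (f z) (g z)) \<in> borel_measurable M"
 unfolding Pk_def by (intro borel_measurable_divide borel_measurable_add borel_measurable_power)

text \<open>Both s^2 and t^2 times the kernel are O(s exp(-s/2)), which is Poisson decay at scale s.
  The factor exp(-s/2), available because the root is at least 1, later provides integrability in
  s.\<close>

lemma half_wave_kernel_bound:
 "EX C>0. ALL s>0. ALL t. norm (fmult (%ta. cor (exp (- s * sqrt (1 + ta\<^sup>2)))) t) <= C * exp (- s / 2) * Pk s t"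
  and half_wave_kernel_integrable: "s > 0 ==> intble (%ta. cor (exp (- s * sqrt (1 + ta\<^sup>2))))"
proof -
 define E where "E = (LBINT ks. exp (- \<bar>ks::real\<bar>))"
 define B where "B = (LBINT ks. 1 / (1 + (ks::real)\<^sup>2))"
 have EB: "E >= 0" "B >= 0" unfolding E_def B_def by (rule integral_nonneg_AE; simp)+
 have all: "norm (fmult (%ta. cor (exp (- s * sqrt (1 + ta\<^sup>2)))) t) <= (4 * E + B + 1) * exp (- s / 2) * Pk s t & intble (%ta. cor (exp (- s * sqrt (1 + ta\<^sup>2))))" if s: "s > 0" for s t
 proof -
  define W where "W ta = sqrt (1 + ta\<^sup>2)" for ta :: real
  have W1: "W ta >= 1" "W ta >= \<bar>ta\<bar>" "W ta > 0" "W ta * W ta = 1 + ta\<^sup>2" "(W ta)\<^sup>2 = 1 + ta\<^sup>2" for ta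
  proof -
   show 1: "W ta >= 1" unfolding W_def by simp
   thus "W ta > 0" by linarith
   show "W ta >= \<bar>ta\<bar>" unfolding W_def using real_sqrt_le_mono[of "ta\<^sup>2" "1 + ta\<^sup>2"] by simp
   show "W ta * W ta = 1 + ta\<^sup>2" "(W ta)\<^sup>2 = 1 + ta\<^sup>2" unfolding W_def by (simp_all add: add_nonneg_nonneg)
  qed
  have DW: "(W has_real_derivative ta / W ta) (at ta)" for ta
  proof -
   have "1 + ta\<^sup>2 > 0" by (simp add: add_pos_nonneg)
   thus ?thesis unfolding W_def[abs_def] by (auto intro!: derivative_eq_intros simp: field_simps)
  qed
  let ?f = "%ta. exp (- s * W ta)"
  let ?f' = "%ta. - s * (ta / W ta) * ?f ta"
  let ?f'' = "%ta. (s\<^sup>2 * (ta / W ta)\<^sup>2 - s * (1 / (W ta * (W ta * W ta)))) * ?f ta"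
  have D1: "(?f has_real_derivative ?f' ta) (at ta)" for ta
   by (rule derivative_eq_intros DW refl | simp)+
  have Dq: "((%ta. ta / W ta) has_real_derivative (1 / (W ta * (W ta * W ta)))) (at ta)" for ta
  proof -
   have "((%ta. ta / W ta) has_real_derivative ((1 * W ta - ta * (ta / W ta)) / (W ta * W ta))) (at ta)"
    by (rule DERIV_divide[OF DERIV_ident DW]) (use W1(3)[of ta] in simp)
   moreover have "(1 * W ta - ta * (ta / W ta)) / (W ta * W ta) = 1 / (W ta * (W ta * W ta))"
   proof -
    have "1 * W ta - ta * (ta / W ta) = (W ta * W ta - ta\<^sup>2) / W ta" using W1(3)[of ta] by (simp add: diff_divide_distrib power2_eq_square)
    also have "... = 1 / W ta" unfolding W1(4) by simp
    finally show ?thesis by simp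
   qed
   ultimately show ?thesis by (simp only:)
  qed
  have D2: "(?f' has_real_derivative ?f'' ta) (at ta)" for ta
  proof -
   have alg: "(- s * b) * f + (- s * a * f) * (- s * a) = (s\<^sup>2 * a\<^sup>2 - s * b) * f" for a b f :: real
    by (simp add: power2_eq_square algebra_simps)
   have "((%ta. (- s * (ta / W ta)) * ?f ta) has_real_derivative ((- s * (1 / (W ta * (W ta * W ta)))) * ?f ta + ?f' ta * (- s * (ta / W ta)))) (at ta)"
    by (rule DERIV_mult[OF DERIV_cmult[OF Dq] D1])
   moreover have "(- s * (1 / (W ta * (W ta * W ta)))) * ?f ta + ?f' ta * (- s * (ta / W ta)) = ?f'' ta"
    by (simp only: alg)
   ultimately show ?thesis by (simp only:)
  qed
  have cW: "continuous_on UNIV W" unfolding W_def[abs_def] by (intro continuous_intros)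
  have c: "continuous_on UNIV ?f''" using W1(3) by (intro continuous_intros cW) (simp_all add: less_imp_neq[symmetric])
  let ?e = "%ta. exp (- s / 2) * exp (- (s / 2) * \<bar>ta\<bar>)"
  have fb: "?f ta <= ?e ta" for ta
  proof -
   \<comment> \<open>Half of the exponent is kept for decay in s and half for decay in
     frequency.\<close>
   have "1 + \<bar>ta\<bar> <= 2 * W ta" using W1(1,2)[of ta] by linarith
   hence "s * (1 + \<bar>ta\<bar>) <= s * (2 * W ta)" using s by (intro mult_left_mono) auto
   thus ?thesis unfolding exp_add[symmetric] by (simp add: algebra_simps)
  qed
  have q1: "\<bar>ta / W ta\<bar> <= 1" for ta using W1(2,3)[of ta] by (simp add: abs_divide)
  have b1: "\<bar>?f ta\<bar> <= exp (- s / 2) * exp (- (s / 2) * \<bar>ta\<bar>)" for ta using fb[of ta] by simp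
  have b2: "\<bar>?f' ta\<bar> <= (s * exp (- s / 2)) * exp (- (s / 2) * \<bar>ta\<bar>)" for ta
  proof -
   have "\<bar>?f' ta\<bar> = (s * \<bar>ta / W ta\<bar>) * ?f ta" using s by (simp add: abs_mult)
   also have "... <= (s * 1) * ?e ta" using s q1[of ta] fb[of ta] by (intro mult_mono) auto
   finally show ?thesis by (simp only: mult_1_right mult.assoc)
  qed
  \<comment> \<open>The term of f'' with s^2 lives at frequencies up to 1/s, and the term with s is
    bounded by s / (1 + ta^2). Up to exp(-s/2), both have mass of order s.\<close>
  let ?w = "%ta. (s\<^sup>2 * exp (- s / 2)) * exp (- (s / 2) * \<bar>ta\<bar>) + (s * exp (- s / 2)) * (1 / (1 + ta\<^sup>2))"
  have b3: "\<bar>?f'' ta\<bar> <= ?w ta" for ta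
  proof -
   have p: "(ta / W ta)\<^sup>2 <= 1" using q1[of ta] by (simp add: abs_square_le_1)
   have "\<bar>?f'' ta\<bar> <= (s\<^sup>2 * (ta / W ta)\<^sup>2) * ?f ta + (s * (1 / (W ta * (W ta * W ta)))) * ?f ta"
    unfolding abs_mult[of _ "?f ta"] distrib_right[symmetric] abs_exp_cancel
    using s W1(3)[of ta] by (intro mult_right_mono order_trans[OF abs_triangle_ineq4]) simp_all
   also have "... <= (s\<^sup>2 * 1) * ?e ta + (s * (1 / (1 + ta\<^sup>2))) * exp (- s / 2)"
   proof (intro add_mono mult_mono mult_left_mono p fb)
    have "1 * (1 + ta\<^sup>2) <= W ta * (W ta * W ta)" unfolding W1(4) using W1(1)[of ta] by (intro mult_right_mono) auto
    thus "1 / (W ta * (W ta * W ta)) <= 1 / (1 + ta\<^sup>2)" using W1(3)[of ta] by (intro divide_left_mono) (auto simp: add_pos_nonneg)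
    have "s * (1 / 2) <= s * W ta" using s W1(1)[of ta] by (intro mult_left_mono) linarith+
    thus "?f ta <= exp (- s / 2)" by simp
   qed (use s W1(3)[of ta] in \<open>simp_all add: add_nonneg_nonneg\<close>)
   finally show ?thesis by (simp only: mult_1_right mult_ac)
  qed
  have s2: "s / 2 > 0" using s by simp
  have ei: "intble (%ks. exp (- (s / 2) * \<bar>ks\<bar>))" and eI: "(LBINT ks. exp (- (s / 2) * \<bar>ks\<bar>)) = (2 / s) * E"
   using exp_rate_integral[OF s2] unfolding E_def by simp_all
  have wi: "intble ?w" by (intro Bochner_Integration.integrable_add integrable_mult_right ei integrable_inverse_square)
  have wI: "(LBINT ta. ?w ta) = s * exp (- s / 2) * (2 * E + B)"
   unfolding Bochner_Integration.integral_add[OF integrable_mult_right[OF ei] integrable_mult_right[OF integrable_inverse_square]] integral_mult_right_zero eI B_def[symmetric]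
   using s by (simp add: power2_eq_square field_simps)
  note F = fmult_decay[OF D1 D2 c s2 b1 b2 b3 wi]
  let ?n = "norm (fmult (%ta. cor (?f ta)) t)"
  have n1: "s\<^sup>2 * ?n <= s * exp (- s / 2) * (2 * E)"
  proof -
   have "s\<^sup>2 * ?n <= s\<^sup>2 * (exp (- s / 2) * (1 / (s / 2) * E))" using F(1)[of t] unfolding E_def by (intro mult_left_mono) auto
   also have "... = s * exp (- s / 2) * (2 * E)" using s by (simp add: power2_eq_square field_simps)
   finally show ?thesis .
  qed
  have n2: "t\<^sup>2 * ?n <= s * exp (- s / 2) * (2 * E + B)" using F(2)[of t] unfolding wI .
  have pos: "s\<^sup>2 + t\<^sup>2 > 0" using s by (simp add: add_pos_nonneg)
  have "?n * (s\<^sup>2 + t\<^sup>2) <= s * exp (- s / 2) * (4 * E + B)"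
  proof -
   have "?n * (s\<^sup>2 + t\<^sup>2) = s\<^sup>2 * ?n + t\<^sup>2 * ?n" by (simp only: mult.commute[of ?n] distrib_right)
   also have "... <= s * exp (- s / 2) * (2 * E) + s * exp (- s / 2) * (2 * E + B)" by (rule add_mono[OF n1 n2])
   finally show ?thesis by (simp only: distrib_left[symmetric]) simp
  qed
  also have "... <= s * exp (- s / 2) * (4 * E + B + 1)" using s by (intro mult_left_mono) auto
  finally have "?n <= (4 * E + B + 1) * exp (- s / 2) * Pk s t" unfolding Pk_def times_divide_eq_right pos_le_divide_eq[OF pos] by (simp only: mult_ac)
  thus ?thesis using F(3) unfolding W_def by (rule conjI)
 qed
 show "s > 0 ==> intble (%ta. cor (exp (- s * sqrt (1 + ta\<^sup>2))))" using all by blast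
 show "EX C>0. ALL s>0. ALL t. norm (fmult (%ta. cor (exp (- s * sqrt (1 + ta\<^sup>2)))) t) <= C * exp (- s / 2) * Pk s t"
  using all EB by (intro exI[of _ "4 * E + B + 1"] conjI allI impI) (linarith, blast)
qed

text \<open>ks^(2m) >= ks^2 - 1 reduces the claim to the Gaussian in \<open>gp (1/2)\<close>, at the
  price of the factor exp 1.\<close>

lemma power_times_exp_bound:
 assumes m: "m >= 1"
 shows "EX C>=0. ALL ks::real. \<bar>ks\<bar> ^ k * exp (- (ks ^ (2 * m))) <= C * exp (- 1 * \<bar>ks\<bar>)"
proof -
 obtain C where C: "C >= 0" "ALL t. norm (gp (1/2) (monom 1 k) t) <= C * exp (- \<bar>t\<bar>)" using gp_bound[of "1/2" "monom 1 k"] by auto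
 have "\<bar>ks\<bar> ^ k * exp (- (ks ^ (2 * m))) <= (exp 1 * C) * exp (- 1 * \<bar>ks\<bar>)" for ks :: real
 proof -
  have "ks\<^sup>2 - 1 <= ks ^ (2 * m)"
  proof (cases "ks\<^sup>2 <= 1")
   case True
   moreover have "0 <= ks ^ (2 * m)" by (simp add: zero_le_even_power)
   ultimately show ?thesis by linarith
  next
   case False
   hence "(ks\<^sup>2) ^ 1 <= (ks\<^sup>2) ^ m" using m by (intro power_increasing) auto
   thus ?thesis by (simp add: power_mult)
  qed
  hence "exp (- (ks ^ (2 * m))) <= exp 1 * exp (- ks\<^sup>2)" unfolding exp_add[symmetric] by simp
  hence "\<bar>ks\<bar> ^ k * exp (- (ks ^ (2 * m))) <= \<bar>ks\<bar> ^ k * (exp 1 * exp (- ks\<^sup>2))" by (intro mult_left_mono) auto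
  also have "... = exp 1 * norm (gp (1/2) (monom 1 k) ks)" by (simp add: gp_def poly_monom norm_mult norm_power)
  also have "... <= exp 1 * (C * exp (- \<bar>ks\<bar>))" by (intro mult_left_mono C(2)[rule_format]) simp
  finally show ?thesis by (simp add: mult.assoc)
 qed
 thus ?thesis using C(1) by (intro exI[of _ "exp 1 * C"]) simp
qed

text \<open>At s = 1 two derivatives in frequency give the decay 1/(1 + x^2); scaling the frequency
  by y = s^(1/(2m)) turns this into Pk at scale y.\<close>

lemma heat_kernel_bound:
 assumes m: "m >= 1"
 shows "EX C>0. ALL s>0. ALL x. norm (fmult (%ks. cor (exp (- s * ks ^ (2 * m)))) x) <= C * Pk (s powr (1 / (2 * real m))) x"
  and heat_kernel_integrable: "s > 0 ==> intble (%ks. cor (exp (- s * ks ^ (2 * m))))"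
proof -
 define n where "n = 2 * m"
 have n: "n >= 2" "even n" using m by (simp_all add: n_def)
 from power_times_exp_bound[OF m, of "0"] obtain A where "A >= 0" and A: "ALL ks::real. \<bar>ks\<bar> ^ 0 * exp (- (ks ^ (2 * m))) <= A * exp (- 1 * \<bar>ks\<bar>)" by (elim exE conjE)
 from power_times_exp_bound[OF m, of "(n - 1)"] obtain A1 where "A1 >= 0" and A1: "ALL ks::real. \<bar>ks\<bar> ^ (n - 1) * exp (- (ks ^ (2 * m))) <= A1 * exp (- 1 * \<bar>ks\<bar>)" by (elim exE conjE)
 from power_times_exp_bound[OF m, of "((n - 1) + (n - 1))"] obtain A2 where "A2 >= 0" and A2: "ALL ks::real. \<bar>ks\<bar> ^ ((n - 1) + (n - 1)) * exp (- (ks ^ (2 * m))) <= A2 * exp (- 1 * \<bar>ks\<bar>)" by (elim exE conjE)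
 from power_times_exp_bound[OF m, of "(n - 1 - 1)"] obtain A3 where "A3 >= 0" and A3: "ALL ks::real. \<bar>ks\<bar> ^ (n - 1 - 1) * exp (- (ks ^ (2 * m))) <= A3 * exp (- 1 * \<bar>ks\<bar>)" by (elim exE conjE)
 let ?f = "%ks::real. exp (- (ks ^ n))"
 let ?f' = "%ks::real. - (real n * ks ^ (n - 1)) * ?f ks"
 let ?f'' = "%ks::real. ((real n)\<^sup>2 * ks ^ ((n - 1) + (n - 1)) - real n * real (n - 1) * ks ^ (n - 1 - 1)) * ?f ks"
 have D1: "(?f has_real_derivative ?f' ks) (at ks)" for ks by (auto intro!: derivative_eq_intros)
 have D2: "(?f' has_real_derivative ?f'' ks) (at ks)" for ks
 proof -
  have alg: "- (a * (b * c)) * f + (- (a * p) * f) * (- (a * p)) = (a\<^sup>2 * (p * p) - a * b * c) * f" for a b c f p :: real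
   by (simp add: power2_eq_square algebra_simps)
  have "((%ks::real. - (real n * ks ^ (n - 1))) has_real_derivative - (real n * (real (n - 1) * ks ^ (n - 1 - 1)))) (at ks)"
   by (rule derivative_eq_intros refl | simp)+
  from DERIV_mult[OF this D1] have "(?f' has_real_derivative (- (real n * (real (n - 1) * ks ^ (n - 1 - 1)))) * ?f ks + ?f' ks * (- (real n * ks ^ (n - 1)))) (at ks)" .
  moreover have "(- (real n * (real (n - 1) * ks ^ (n - 1 - 1)))) * ?f ks + ?f' ks * (- (real n * ks ^ (n - 1))) = ?f'' ks"
   by (simp only: power_add alg)
  ultimately show ?thesis by (simp only:)
 qed
 have c: "continuous_on UNIV ?f''" by (intro continuous_intros)
 have b1: "\<bar>?f ks\<bar> <= A * exp (- 1 * \<bar>ks\<bar>)" for ks using A[rule_format, of ks] by (simp add: n_def)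
 have b2: "\<bar>?f' ks\<bar> <= (real n * A1) * exp (- 1 * \<bar>ks\<bar>)" for ks
  using mult_left_mono[OF A1[rule_format, of ks], of "real n"] by (simp add: n_def abs_mult power_abs mult.assoc)
 let ?w = "%ks. ((real n)\<^sup>2 * A2 + real n * real (n - 1) * A3) * exp (- \<bar>ks\<bar>)"
 have b3: "\<bar>?f'' ks\<bar> <= ?w ks" for ks
 proof -
  have "\<bar>?f'' ks\<bar> <= (real n)\<^sup>2 * (\<bar>ks\<bar> ^ ((n - 1) + (n - 1)) * ?f ks) + real n * real (n - 1) * (\<bar>ks\<bar> ^ (n - 1 - 1) * ?f ks)"
   unfolding abs_mult[of _ "?f ks"] mult.assoc[symmetric] distrib_right[symmetric] abs_exp_cancel
   by (intro mult_right_mono order_trans[OF abs_triangle_ineq4]) (simp_all add: abs_mult power_abs)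
  also have "... <= (real n)\<^sup>2 * (A2 * exp (- 1 * \<bar>ks\<bar>)) + real n * real (n - 1) * (A3 * exp (- 1 * \<bar>ks\<bar>))"
   using A2[rule_format, of ks] A3[rule_format, of ks] by (intro add_mono mult_left_mono) (simp_all add: n_def)
  finally show ?thesis by (simp add: algebra_simps)
 qed
 have wi: "intble ?w" by (intro integrable_mult_right integrable_exp_neg_abs)
 note F = fmult_decay[OF D1 D2 c zero_less_one b1 b2 b3 wi]
 define C where "C = A * (1 / 1 * (LBINT ks. exp (- \<bar>ks\<bar>))) + (LBINT ks. ?w ks)"
 let ?F = "fmult (%ks. cor (?f ks))"
 have FC: "norm (?F x) * (1 + x\<^sup>2) <= C" for x using F(1)[of x] F(2)[of x] unfolding C_def by (simp add: algebra_simps)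
 have "0 <= norm (?F 0) * (1 + 0\<^sup>2)" by simp
 hence C0: "C >= 0" using FC[of 0] by linarith
 have all: "norm (fmult (%ks. cor (exp (- s * ks ^ n))) x) <= (C + 1) * Pk (s powr (1 / (2 * real m))) x & intble (%ks. cor (exp (- s * ks ^ n)))"
  if s: "s > 0" for s x
 proof -
  define y where "y = s powr (1 / (2 * real m))"
  have y: "y > 0" using s by (simp add: y_def)
  have "y ^ n = y powr (real n)" using y by (simp add: powr_realpow)
  also have "... = s" unfolding y_def powr_powr using s m by (simp add: n_def)
  finally have yn: "y ^ n = s" .
  have eq: "cor (exp (- s * ks ^ n)) = cor (?f (0 + y * ks))" for ks by (simp add: power_mult_distrib yn)
  have int: "intble (%ks. cor (exp (- s * ks ^ n)))"
   unfolding eq by (rule lborel_integrable_real_affine[OF F(3)]) (use y in simp)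
  have "fmult (%ks. cor (exp (- s * ks ^ n))) x = cor (1 / y) * ?F (x / y)"
  proof -
   have "(LBINT ks. cor (?f ks) * cis (x / y * ks)) = \<bar>y\<bar> *\<^sub>R (LBINT ks. cor (?f (0 + y * ks)) * cis (x / y * (0 + y * ks)))"
    by (rule lborel_integral_real_affine) (use y in simp)
   hence "(LBINT ks. cor (?f ks) * cis (x / y * ks)) = cor y * (LBINT ks. cor (exp (- s * ks ^ n)) * cis (x * ks))"
    unfolding eq using y by (simp add: scaleR_conv_of_real)
   thus ?thesis unfolding fmult_def using y by simp
  qed
  hence "norm (fmult (%ks. cor (exp (- s * ks ^ n))) x) = 1 / y * norm (?F (x / y))" using y by (simp add: norm_mult norm_divide)
  also have "... <= 1 / y * (C / (1 + (x / y)\<^sup>2))"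
  proof (intro mult_left_mono)
   have "1 + (x / y)\<^sup>2 > 0" by (simp add: add_pos_nonneg)
   thus "norm (?F (x / y)) <= C / (1 + (x / y)\<^sup>2)" using FC[of "x / y"] by (simp add: pos_le_divide_eq)
  qed (use y in simp)
  also have "... = C * Pk y x"
  proof -
   have p: "y\<^sup>2 + x\<^sup>2 > 0" using y by (simp add: add_pos_nonneg)
   have "1 + (x / y)\<^sup>2 = (y\<^sup>2 + x\<^sup>2) / y\<^sup>2" using y by (simp add: power_divide add_divide_distrib)
   thus ?thesis unfolding Pk_def using y p by (simp add: power2_eq_square)
  qed
  also have "... <= (C + 1) * Pk y x" using Pk_nonneg[OF y] by (intro mult_right_mono) auto
  finally show ?thesis using int unfolding y_def by (rule conjI)
 qed
 show "s > 0 ==> intble (%ks. cor (exp (- s * ks ^ (2 * m))))" using all unfolding n_def by blast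
 show "EX C>0. ALL s>0. ALL x. norm (fmult (%ks. cor (exp (- s * ks ^ (2 * m)))) x) <= C * Pk (s powr (1 / (2 * real m))) x"
  using all C0 unfolding n_def by (intro exI[of _ "C + 1"] conjI allI impI) (linarith, blast)
qed

text \<open>A Gaussian factor in frequency is an average over translates of the kernel, so pointwise
  kernel bounds survive the regularisation in averaged form.\<close>

lemma fmult_gaussian:
 assumes k: "intble k" and e: "e > 0"
 shows "fmult (%ta. k ta * cor (exp (- e * ta\<^sup>2 / 2))) t = (LBINT r. cor (gau e r) * fmult k (t + r))"
proof -
 have kt: "intble (%ta. k ta * cis (ta * t))" by (rule integrable_cis_mult[OF k])
 have g: "intble (%r. cor (gau e r))" by (intro integrable_of_real gau_properties e)
 have gf: "(LBINT r. cor (gau e r) * cis (r * ta)) = cor (exp (- e * ta\<^sup>2 / 2))" for ta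
 proof -
  have eq: "cor (gau e r) * cis (r * ta) = cor (1 / sqrt (2 * pi * e)) * (cor (exp (- (1 / e) * r\<^sup>2 / 2)) * cis (ta * r))" for r
   by (simp add: gau_def mult.commute)
  have "1 / e > 0" using e by simp
  from gaussian_fourier(2)[OF this, of ta] show ?thesis
   unfolding eq integral_mult_right_zero using e by (simp add: mult.commute)
 qed
 have "(LBINT r. cor (gau e r) * fmult k (t + r)) = (LBINT r. cor (1 / (2 * pi)) * (cor (gau e r) * (LBINT ta. (k ta * cis (ta * t)) * cis (r * ta))))"
 proof (rule Bochner_Integration.integral_cong[OF refl])
  fix r
  have "k ta * cis ((t + r) * ta) = (k ta * cis (ta * t)) * cis (r * ta)" for ta by (simp add: cis_mult algebra_simps)
  thus "cor (gau e r) * fmult k (t + r) = cor (1 / (2 * pi)) * (cor (gau e r) * (LBINT ta. (k ta * cis (ta * t)) * cis (r * ta)))"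
   unfolding fmult_def by (simp only: mult.left_commute)
 qed
 also have "... = cor (1 / (2 * pi)) * (LBINT ta. (k ta * cis (ta * t)) * cor (exp (- e * ta\<^sup>2 / 2)))"
  unfolding integral_mult_right_zero fourier_swap[OF g kt] gf ..
 also have "... = fmult (%ta. k ta * cor (exp (- e * ta\<^sup>2 / 2))) t"
  unfolding fmult_def by (simp add: mult_ac)
 finally show ?thesis by simp
qed

lemma inverse_as_exp_integral:
 fixes a :: real
 assumes a: "a >= 1"
 shows "(LBINT s. indicator {0..} s *\<^sub>R cor (exp (- s * a))) = cor (1 / a)"
proof -
 let ?G = "%s. cor (- exp (- s * a) / a)"
 have int: "intble (%r. indicator {0..} r *\<^sub>R cor (exp (- r * a)))"
 proof (rule integrable_exp_bound[where C=1])
  fix r :: real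
  have "exp (- r * a) <= exp (- r)" if "r >= 0" using mult_left_mono[OF a that] by simp
  thus "norm (indicator {0..} r *\<^sub>R cor (exp (- r * a))) <= 1 * exp (- \<bar>r\<bar>)" by (auto simp: indicator_def)
 qed simp
 have "(LBINT s. indicator {0..} s *\<^sub>R cor (exp (- s * a))) = - ?G 0"
 proof (rule integral_derivative_atLeast[OF _ _ int])
  fix r :: real
  have "((%s. - exp (- s * a) / a) has_real_derivative exp (- r * a)) (at r)" using a by (auto intro!: derivative_eq_intros)
  thus "(?G has_vector_derivative cor (exp (- r * a))) (at r)"
   by (intro bounded_linear.has_vector_derivative[OF bounded_linear_of_real]) (simp add: has_real_derivative_iff_has_vector_derivative)
  show "continuous_on UNIV (%r. cor (exp (- r * a)))" by (intro continuous_intros)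
  have "(%n. exp (- a) ^ n) \<longlonglongrightarrow> 0" using a by (intro LIMSEQ_realpow_zero) auto
  moreover have "exp (- a) ^ n = exp (- real n * a)" for n by (simp add: exp_of_nat_mult[symmetric])
  ultimately have "(%n. exp (- real n * a)) \<longlonglongrightarrow> 0" by simp
  from tendsto_mult[OF this tendsto_const[of "- 1 / a"]] have "(%n. - exp (- real n * a) / a) \<longlonglongrightarrow> 0" by simp
  from tendsto_of_real[OF this, where 'a=complex] show "(%n. ?G (real n)) \<longlonglongrightarrow> 0" by simp
 qed
 thus ?thesis by simp
qed

text \<open>Majorant, up to a constant, for the kernel of 1 / symb = integral of exp(-s symb) over s
  > 0: the two Pk and exp(-s/2) bound the kernels of the factors in tau and in xi.\<close>

definition HH :: "nat => R2 => ennreal" where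
 "HH m z = (NINT s. indicator {0<..} s * ennreal (exp (- s / 2) * (Pk s (fst z) * Pk (s powr (1 / (2 * real m))) (snd z))))"

lemma HH_measurable [measurable]: "HH m \<in> bmeas"
 unfolding HH_def[abs_def] by measurable

lemma fmult_gaussian_bound:
 assumes k: "intble k" and e: "e > 0" and b: "!!x. norm (fmult k x) <= b x"
 shows "ennreal (norm (fmult (%ta. k ta * cor (exp (- e * ta\<^sup>2 / 2))) t)) <= (NINT r. ennreal (gau e r * b (t + r)))"
proof -
 have "ennreal (norm (fmult (%ta. k ta * cor (exp (- e * ta\<^sup>2 / 2))) t)) <= (NINT r. ennreal (norm (cor (gau e r) * fmult k (t + r))))"
  unfolding fmult_gaussian[OF k e] by (rule norm_integral_le_nn_integral)
 also have "... <= (NINT r. ennreal (gau e r * b (t + r)))"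
 proof (intro nn_integral_mono ennreal_leI)
  fix r
  show "norm (cor (gau e r) * fmult k (t + r)) <= gau e r * b (t + r)"
   using mult_left_mono[OF b[of "t + r"] gau_properties(1)[OF e, of r]] gau_properties(1)[OF e, of r] by (simp add: norm_mult)
 qed
 finally show ?thesis .
qed

text \<open>The symbol is a sum of a function of tau and a function of xi, and the regularising
  Gaussian is a product. Once 1 / symb is written as an exponential integral, the transform
  factorises for each s.\<close>

lemma Phi_eq:
 assumes m: "m >= 1" and e: "e > 0"
 shows "Phi m e z = (LBINT s. indicator {0..} s *\<^sub>R (fmult (%ta. cor (exp (- s * sqrt (1 + ta\<^sup>2))) * cor (exp (- e * ta\<^sup>2 / 2))) (fst z)
  * fmult (%ks. cor (exp (- s * ks ^ (2 * m))) * cor (exp (- e * ks\<^sup>2 / 2))) (snd z)))"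
proof -
 define g where "g ta = cor (exp (- e * ta\<^sup>2 / 2))" for ta :: real
 have [measurable]: "g \<in> bmeas" unfolding g_def by measurable
 have gi: "intble g" unfolding g_def by (rule gaussian_fourier[OF e])
 let ?G = "%ze::R2. g (fst ze) * g (snd ze)"
 have Gi: "intble ?G" unfolding g_def by (rule gaussian_fourier2(2)[OF e])
 have [measurable]: "symb m \<in> bmeas"
  unfolding symb_def case_prod_beta' by measurable
 let ?c = "cor (1 / (2 * pi) ^ 2)"
 let ?F = "%s ze. indicator {0..} s *\<^sub>R (cis (z \<bullet> ze) * (cor (exp (- s * symb m ze)) * ?G ze))"
 have i: "integrable (lborel \<Otimes>\<^sub>M lborel) (%(s, ze). ?F s ze)"
 proof -
  have [measurable]: "(%x::real \<times> R2. cis (z \<bullet> snd x)) \<in> bmeas" by measurable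
  have "intble (%p. ?F (fst p) (snd p))"
  proof (rule integrable_prod_dominated[OF integrable_exp_neg_abs Gi])
   fix s :: real and ze :: R2
   have "exp (- s * symb m ze) <= exp (- s)" if "s >= 0" using mult_left_mono[OF symb_ge_1[OF m e, of ze] that] by simp
   hence "indicator {0..} s * exp (- s * symb m ze) <= exp (- \<bar>s\<bar>)" by (auto simp: indicator_def)
   thus "norm (?F (fst (s, ze)) (snd (s, ze))) <= norm (exp (- \<bar>s\<bar>)) * norm (?G ze)"
    using mult_right_mono[of "indicator {0..} s * exp (- s * symb m ze)" "exp (- \<bar>s\<bar>)" "norm (?G ze)"] by (simp add: norm_mult mult.assoc)
  qed measurable
  thus ?thesis by (simp only: lborel_prod case_prod_beta')
 qed
 have "Phi m e z = ?c * (LBINT ze. cis (z \<bullet> ze) * (cor (1 / symb m ze) * ?G ze))"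
  unfolding Phi_def IFT_cis g_def ..
 also have "(LBINT ze. cis (z \<bullet> ze) * (cor (1 / symb m ze) * ?G ze)) = (LBINT ze. LBINT s. ?F s ze)"
 proof (rule Bochner_Integration.integral_cong[OF refl])
  fix ze
  have "?F s ze = (cis (z \<bullet> ze) * ?G ze) * (indicator {0..} s *\<^sub>R cor (exp (- s * symb m ze)))" for s
   by (simp add: scaleR_conv_of_real)
  hence "(LBINT s. ?F s ze) = (cis (z \<bullet> ze) * ?G ze) * cor (1 / symb m ze)"
   by (simp only: integral_mult_right_zero inverse_as_exp_integral[OF symb_ge_1[OF m e]])
  thus "cis (z \<bullet> ze) * (cor (1 / symb m ze) * ?G ze) = (LBINT s. ?F s ze)" by (simp only: mult_ac)
 qed
 also have "... = (LBINT s. LBINT ze. ?F s ze)" by (rule lborel_pair.Fubini_integral[OF i])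
 also have "?c * ... = (LBINT s. ?c * (LBINT ze. ?F s ze))" by (rule integral_mult_right_zero[symmetric])
 also have "... = (LBINT s. indicator {0..} s *\<^sub>R (fmult (%ta. cor (exp (- s * sqrt (1 + ta\<^sup>2))) * g ta) (fst z)
  * fmult (%ks. cor (exp (- s * ks ^ (2 * m))) * g ks) (snd z)))"
 proof (rule Bochner_Integration.integral_cong[OF refl])
  fix s :: real
  let ?a = "%ta. cor (exp (- s * sqrt (1 + ta\<^sup>2))) * g ta * cis (fst z * ta)"
  let ?b = "%ks. cor (exp (- s * ks ^ (2 * m))) * g ks * cis (snd z * ks)"
  show "?c * (LBINT ze. ?F s ze) = indicator {0..} s *\<^sub>R (fmult (%ta. cor (exp (- s * sqrt (1 + ta\<^sup>2))) * g ta) (fst z)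
   * fmult (%ks. cor (exp (- s * ks ^ (2 * m))) * g ks) (snd z))"
  proof (cases "s >= 0")
   case True
   have dom: "intble (%ta. cor (exp (- s * k ta)) * g ta * cis (a * ta))" if [measurable]: "k \<in> bmeas" and k: "!!ta. k ta >= 0" for k :: "real => real" and a
   proof (rule Bochner_Integration.integrable_bound[OF gi _ AE_I2])
    fix ta
    have "exp (- s * k ta) <= 1" using mult_nonneg_nonneg[OF True k[of ta]] by simp
    thus "norm (cor (exp (- s * k ta)) * g ta * cis (a * ta)) <= norm (g ta)"
     using mult_right_mono[of "exp (- s * k ta)" 1 "norm (g ta)"] by (simp add: norm_mult)
   qed simp
   have ai: "intble ?a" "intble ?b" by (rule dom; simp add: zero_le_even_power)+
   have "?F s ze = ?a (fst ze) * ?b (snd ze)" for ze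
   proof -
    have "exp (- s * symb m ze) = exp (- s * sqrt (1 + (fst ze)\<^sup>2)) * exp (- s * snd ze ^ (2 * m))"
     unfolding exp_add[symmetric] symb_def case_prod_beta by (simp add: algebra_simps)
    moreover have "cis (z \<bullet> ze) = cis (fst z * fst ze) * cis (snd z * snd ze)" by (simp add: inner_R2 cis_mult)
    ultimately show ?thesis using True by (simp only: of_real_mult) simp
   qed
   hence "(LBINT ze. ?F s ze) = (LBINT ta. ?a ta) * (LBINT ks. ?b ks)" by (simp only: integral_prod_mult[OF ai])
   thus ?thesis unfolding fmult_def using True by (simp add: power2_eq_square)
  qed simp
 qed
 finally show ?thesis unfolding g_def .
qed

text \<open>The regularisation only averages \<open>HH\<close> over translates with a weight of mass
  1; therefore C is independent of e.\<close>

lemma Phi_bound: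
 assumes m: "m >= 1"
 shows "EX C>0. ALL e>0. ALL z. ennreal (norm (Phi m e z)) <= (NINT r. ennreal (gau2 e r) * (ennreal C * HH m (z + r)))"
proof -
 let ?y = "%s. s powr (1 / (2 * real m))"
 let ?A = "%s ta. cor (exp (- s * sqrt (1 + ta\<^sup>2)))" let ?B = "%s ks. cor (exp (- s * ks ^ (2 * m)))"
 from half_wave_kernel_bound obtain C1 where C1: "C1 > 0" and h1: "ALL s>0. ALL t. norm (fmult (?A s) t) <= C1 * exp (- s / 2) * Pk s t" by (elim exE conjE)
 from heat_kernel_bound[OF m] obtain C2 where C2: "C2 > 0" and h2: "ALL s>0. ALL t. norm (fmult (?B s) t) <= C2 * Pk (?y s) t" by (elim exE conjE)
 have "ennreal (norm (Phi m e z)) <= (NINT r. ennreal (gau2 e r) * (ennreal (C1 * C2) * HH m (z + r)))" if e: "e > 0" for e z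
 proof -
  note g0 = gau_properties(1)[OF e]
  let ?g = "%ta. cor (exp (- e * ta\<^sup>2 / 2))"
  let ?K = "%s r. indicator {0<..} s * (ennreal (gau2 e r) * (ennreal (C1 * C2) * ennreal (exp (- s / 2) * (Pk s (fst (z + r)) * Pk (?y s) (snd (z + r))))))"
  have "ennreal (norm (Phi m e z)) <= (NINT s. ennreal (norm (indicator {0..} s *\<^sub>R (fmult (%ta. ?A s ta * ?g ta) (fst z) * fmult (%ks. ?B s ks * ?g ks) (snd z)))))"
   unfolding Phi_eq[OF m e] by (rule norm_integral_le_nn_integral)
  also have "... <= (NINT s. NINT r. ?K s r)"
  proof (rule nn_integral_mono_AE)
   show "AE s in lborel. ennreal (norm (indicator {0..} s *\<^sub>R (fmult (%ta. ?A s ta * ?g ta) (fst z) * fmult (%ks. ?B s ks * ?g ks) (snd z)))) <= (NINT r. ?K s r)"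
    using AE_lborel_singleton[of "0::real"]
   proof eventually_elim
    case (elim s)
    show ?case
    proof (cases "s > 0")
     case True
     have y: "?y s > 0" using True by simp
     have "ennreal (norm (indicator {0..} s *\<^sub>R (fmult (%ta. ?A s ta * ?g ta) (fst z) * fmult (%ks. ?B s ks * ?g ks) (snd z))))
      = ennreal (norm (fmult (%ta. ?A s ta * ?g ta) (fst z))) * ennreal (norm (fmult (%ks. ?B s ks * ?g ks) (snd z)))"
      using True by (simp add: norm_mult ennreal_mult)
     also have "... <= (NINT r. ennreal (gau e r * (C1 * exp (- s / 2) * Pk s (fst z + r)))) * (NINT r. ennreal (gau e r * (C2 * Pk (?y s) (snd z + r))))"
      by (intro mult_mono fmult_gaussian_bound[OF half_wave_kernel_integrable[OF True] e h1[rule_format, OF True]] fmult_gaussian_bound[OF heat_kernel_integrable[OF m True] e h2[rule_format, OF True]]) simp_all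
     also have "... = (NINT r. NINT r'. ennreal (gau e r * (C1 * exp (- s / 2) * Pk s (fst z + r))) * ennreal (gau e r' * (C2 * Pk (?y s) (snd z + r'))))"
      by (simp add: nn_integral_cmult nn_integral_multc)
     also have "... = (NINT r. NINT r'. ?K s (r, r'))"
     proof (intro nn_integral_cong)
      fix r r' :: real
      have eq: "gau e r * (C1 * exp (- s / 2) * Pk s (fst z + r)) * (gau e r' * (C2 * Pk (?y s) (snd z + r')))
       = gau2 e (r, r') * (C1 * C2 * (exp (- s / 2) * (Pk s (fst (z + (r, r'))) * Pk (?y s) (snd (z + (r, r'))))))" by (simp add: gau2_def)
      show "ennreal (gau e r * (C1 * exp (- s / 2) * Pk s (fst z + r))) * ennreal (gau e r' * (C2 * Pk (?y s) (snd z + r'))) = ?K s (r, r')"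
       using True C1 C2 g0[of r] g0[of r'] Pk_nonneg[OF True] Pk_nonneg[OF y]
       by (subst ennreal_mult[symmetric]; simp only: eq; simp add: ennreal_mult gau2_def)
     qed
     also have "... = (NINT r. ?K s r)" by (rule nn_integral_R2[symmetric]) measurable
     finally show ?thesis .
    next
     case False
     hence "indicator {0..} s = (0::real)" using elim by (simp add: indicator_def)
     thus ?thesis by simp
    qed
   qed
  qed
  also have "... = (NINT r. NINT s. ?K s r)"
   by (rule lborel_pair.Fubini') (simp only: lborel_prod, measurable)
  also have "... = (NINT r. ennreal (gau2 e r) * (ennreal (C1 * C2) * HH m (z + r)))"
  proof (intro nn_integral_cong)
   fix r
   have "?K s r = (ennreal (gau2 e r) * ennreal (C1 * C2)) * (indicator {0<..} s * ennreal (exp (- s / 2) * (Pk s (fst (z + r)) * Pk (?y s) (snd (z + r)))))" for s by (simp only: mult_ac)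
   hence "(NINT s. ?K s r) = (ennreal (gau2 e r) * ennreal (C1 * C2)) * HH m (z + r)"
    unfolding HH_def by (simp only:) (rule nn_integral_cmult, measurable)
   thus "(NINT s. ?K s r) = ennreal (gau2 e r) * (ennreal (C1 * C2) * HH m (z + r))" by (simp only: mult.assoc)
  qed
  finally show ?thesis .
 qed
 thus ?thesis using C1 C2 by (intro exI[of _ "C1 * C2"] conjI allI impI) simp_all
qed

text \<open>Interpolates between 1/y, valid near the origin, and y/x^2, valid far from it.\<close>

lemma Pk_le:
 assumes y: "y > 0" and x: "x ~= 0" and k: "0 < ka" "ka < 1"
 shows "Pk y x <= y powr - (1 - ka) * \<bar>x\<bar> powr - ka"
proof (cases "\<bar>x\<bar> <= y")
 case True
 have p: "0 < y\<^sup>2 + x\<^sup>2" using y by (simp add: add_pos_nonneg)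
 have "Pk y x <= 1 / y" unfolding Pk_def using y p by (simp add: divide_simps power2_eq_square)
 also have "... = y powr - (1 - ka) * y powr - ka" using y by (simp add: powr_add[symmetric] powr_neg_one)
 also have "... <= y powr - (1 - ka) * \<bar>x\<bar> powr - ka" using True x k by (intro mult_left_mono powr_mono2') auto
 finally show ?thesis .
next
 case False
 have p: "0 < y\<^sup>2 + x\<^sup>2" using y by (simp add: add_pos_nonneg)
 have "Pk y x <= y / x\<^sup>2" unfolding Pk_def using y p x by (intro divide_left_mono) auto
 also have "... = y powr 1 * (\<bar>x\<bar> powr - (2 - ka) * \<bar>x\<bar> powr - ka)"
 proof -
  have "\<bar>x\<bar> powr - (2 - ka) * \<bar>x\<bar> powr - ka = \<bar>x\<bar> powr - 2" by (simp add: powr_add[symmetric])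
  also have "... = 1 / \<bar>x\<bar> ^ 2" using x by (simp add: powr_minus divide_inverse)
  finally show ?thesis using y by simp
 qed
 also have "... <= y powr 1 * (y powr - (2 - ka) * \<bar>x\<bar> powr - ka)" using False y k by (intro mult_left_mono mult_right_mono powr_mono2') auto
 also have "... = y powr - (1 - ka) * \<bar>x\<bar> powr - ka" unfolding mult.assoc[symmetric] powr_add[symmetric] by simp
 finally show ?thesis .
qed

text \<open>For y = s^(1/(2m)) the factor y^(-(1 - ka)) is s^(-ka), again by (1 - ka)/(2m) = ka. The
  weight exp(-s/2) is discarded, and integrating s^(-ka) against \<open>Pk s t\<close> leaves the
  power |t|^(-ka).\<close>

lemma HH_le:
 assumes m: "m >= 1" and k: "ka = 1 / (2 * real m + 1)" and t: "t ~= 0" and x: "x ~= 0"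
 shows "HH m (t, x) <= ennreal ((1 + 1 / ka) * (\<bar>t\<bar> powr - ka * \<bar>x\<bar> powr - ka))"
proof -
 have k01: "0 < ka" "ka < 1" using m by (auto simp: k)
 define T where "T = \<bar>t\<bar>"
 have T: "T > 0" using t by (simp add: T_def)
 let ?y = "%s::real. s powr (1 / (2 * real m))"
 let ?X = "\<bar>x\<bar> powr - ka"
 \<comment> \<open>Split at s = |t|. Below, Pk s t <= s/t^2 and an interval of length |t|
   contributes |t|^(-ka); above, Pk s t <= 1/s and the tail contributes |t|^(-ka)/ka. Hence the
   constant 1 + 1/ka.\<close>
 let ?G = "%s. ennreal (T powr (- 1 - ka)) * indicator {0..T} s + ennreal (s powr (- 1 - ka)) * indicator {T..} s"
 have "HH m (t, x) <= (NINT s. ennreal ?X * ?G s)"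
  unfolding HH_def fst_conv snd_conv
 proof (rule nn_integral_mono)
  fix s :: real
  show "indicator {0<..} s * ennreal (exp (- s / 2) * (Pk s t * Pk (?y s) x)) <= ennreal ?X * ?G s"
  proof (cases "s > 0")
   case s: True
   have P2: "Pk (?y s) x <= s powr - ka * ?X"
   proof -
    have e: "1 / (2 * real m) * - (1 - ka) = - ka" using m unfolding k by (simp add: field_simps)
    have "Pk (?y s) x <= ?y s powr - (1 - ka) * ?X" using s by (intro Pk_le x k01) simp
    thus ?thesis unfolding powr_powr e .
   qed
   have P1: "Pk s t <= (if s <= T then T powr -1 * (s powr 1 / T powr 1) else s powr -1)"
   proof (cases "s <= T")
    case True
    have "Pk s t <= s / t\<^sup>2" unfolding Pk_def using s t by (intro divide_left_mono) (auto simp: add_pos_nonneg add_nonneg_pos)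
    also have "t\<^sup>2 = T * T" by (simp add: T_def power2_eq_square flip: abs_mult)
    finally show ?thesis using True s T by (simp add: powr_minus divide_simps)
   next
    case False
    have "Pk s t <= s / s\<^sup>2" unfolding Pk_def using s by (intro divide_left_mono) (auto simp: add_pos_nonneg)
    thus ?thesis using False s by (simp add: powr_minus power2_eq_square divide_simps)
   qed
   have "exp (- s / 2) * (Pk s t * Pk (?y s) x) <= 1 * (Pk s t * (s powr - ka * ?X))"
    using s P2 Pk_nonneg[OF s, of t] Pk_nonneg[of "?y s" x] by (intro mult_mono mult_left_mono) auto
   also have "... <= ?X * (if s <= T then T powr (- 1 - ka) else s powr (- 1 - ka))"
   proof (cases "s <= T")
    case True
    have "Pk s t * (s powr - ka * ?X) <= (T powr -1 * (s powr 1 / T powr 1)) * (s powr - ka * ?X)" using P1 True by (intro mult_right_mono) auto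
    also have "... = ?X * (T powr -1 * (s powr (1 - ka) / T powr 1))"
    proof -
     have e1: "s powr (1 - ka) = s powr 1 * s powr - ka" by (simp only: powr_add[symmetric] diff_conv_add_uminus)
     show ?thesis unfolding e1 by (simp only: times_divide_eq_right times_divide_eq_left mult_ac)
    qed
    also have "... <= ?X * (T powr -1 * (T powr (1 - ka) / T powr 1))" using s True k01 T by (intro mult_left_mono divide_right_mono powr_mono2) auto
    also have "... = ?X * T powr (- 1 - ka)" by (simp only: powr_diff[symmetric] powr_add[symmetric]) simp
    finally show ?thesis using True by simp
   next
    case False
    have "Pk s t * (s powr - ka * ?X) <= s powr -1 * (s powr - ka * ?X)" using P1 False by (intro mult_right_mono) auto
    also have "... = ?X * s powr (- 1 - ka)"
    proof -
     have e1: "s powr (- 1 - ka) = s powr - 1 * s powr - ka" by (simp only: powr_add[symmetric] diff_conv_add_uminus)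
     show ?thesis unfolding e1 by (simp only: mult_ac)
    qed
    finally show ?thesis using False by simp
   qed
   finally have "ennreal (exp (- s / 2) * (Pk s t * Pk (?y s) x)) <= ennreal ?X * ennreal (if s <= T then T powr (- 1 - ka) else s powr (- 1 - ka))"
    by (subst ennreal_mult[symmetric]) (simp_all add: ennreal_leI)
   also have "... <= ennreal ?X * ?G s" using s by (intro mult_left_mono) (auto simp: indicator_def)
   finally show ?thesis using s by simp
  qed (simp add: indicator_def)
 qed
 also have "... = ennreal ?X * (ennreal (T powr (- 1 - ka)) * ennreal T + (NINT s. ennreal (s powr (- 1 - ka)) * indicator {T..} s))"
  using T by (simp add: nn_integral_cmult nn_integral_add nn_integral_cmult_indicator)
 also have "(NINT s. ennreal (s powr (- 1 - ka)) * indicator {T..} s) = ennreal (T powr - ka / ka)"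
 proof -
  have "((%s. s powr (- 1 - ka)) has_integral - (T powr (- 1 - ka + 1)) / (- 1 - ka + 1)) {T..}"
   using k01 T by (intro has_integral_powr_to_inf) auto
  hence "((%s. s powr (- 1 - ka)) has_integral (T powr - ka / ka)) {T..}" using k01 by simp
  thus ?thesis by (subst nn_integral_has_integral_lebesgue') auto
 qed
 also have "ennreal (T powr (- 1 - ka)) * ennreal T = ennreal (T powr - ka)"
 proof -
  have "T powr (- 1 - ka) * T powr 1 = T powr - ka" by (simp only: powr_add[symmetric]) simp
  thus ?thesis using T by (simp add: ennreal_mult[symmetric])
 qed
 also have "ennreal ?X * (ennreal (T powr - ka) + ennreal (T powr - ka / ka)) = ennreal ((1 + 1 / ka) * (\<bar>t\<bar> powr - ka * ?X))"
  using k01 unfolding T_def by (simp add: ennreal_mult[symmetric] ennreal_plus[symmetric] algebra_simps del: ennreal_plus)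
 finally show ?thesis .
qed

text \<open>The integral of \<open>Pk y\<close> does not depend on y, so only exp(-s/2) remains to
  be integrated; here the exponential factor is essential.\<close>

lemma HH_integral_finite: "(NINT z. HH m z) < \<infinity>"
proof -
 let ?y = "%s::real. s powr (1 / (2 * real m))"
 define B where "B = (LBINT x. 1 / (1 + (x::real)\<^sup>2))"
 have B0: "B >= 0" unfolding B_def by (rule integral_nonneg_AE) simp
 have PB: "(NINT x. ennreal (Pk y x)) = ennreal B" if y: "y > 0" for y
 proof -
  have "(NINT x. ennreal (Pk y x)) = ennreal \<bar>y\<bar> * (NINT x. ennreal (Pk y (0 + y * x)))"
   by (rule nn_integral_real_affine) (use y in simp_all)
  also have "... = (NINT x. ennreal \<bar>y\<bar> * ennreal (Pk y (0 + y * x)))" by (rule nn_integral_cmult[symmetric]) simp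
  also have "... = (NINT x. ennreal (1 / (1 + x\<^sup>2)))"
  proof (intro nn_integral_cong)
   fix x :: real
   have p: "1 + x\<^sup>2 > 0" by (simp add: add_pos_nonneg)
   have "y\<^sup>2 + (0 + y * x)\<^sup>2 = y * y * (1 + x\<^sup>2)" by (simp add: power2_eq_square algebra_simps)
   hence "\<bar>y\<bar> * Pk y (0 + y * x) = 1 / (1 + x\<^sup>2)" unfolding Pk_def using y by simp
   thus "ennreal \<bar>y\<bar> * ennreal (Pk y (0 + y * x)) = ennreal (1 / (1 + x\<^sup>2))"
    using Pk_nonneg[OF y] by (simp add: ennreal_mult[symmetric])
  qed
  also have "... = ennreal B" unfolding B_def by (rule nn_integral_eq_integral[OF integrable_inverse_square]) simp
  finally show ?thesis .
 qed
 let ?h = "%s t x. indicator {0<..} s * ennreal (exp (- s / 2) * (Pk s t * Pk (?y s) x))"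
 have "(NINT z. HH m z) = (NINT s. NINT z. ?h s (fst z) (snd z))"
  unfolding HH_def by (rule lborel_pair.Fubini') (simp only: lborel_prod, measurable)
 also have "... <= (NINT s. ennreal (exp (- (1 / 2) * \<bar>s\<bar>)) * (ennreal B * ennreal B))"
 proof (rule nn_integral_mono)
  fix s :: real
  show "(NINT z. ?h s (fst z) (snd z)) <= ennreal (exp (- (1 / 2) * \<bar>s\<bar>)) * (ennreal B * ennreal B)"
  proof (cases "s > 0")
   case s: True
   have y: "?y s > 0" using s by simp
   have "(NINT z. ?h s (fst z) (snd z)) = (NINT t. NINT x. ?h s t x)" by (subst nn_integral_R2) simp_all
   also have "... = (NINT t. NINT x. ennreal (exp (- s / 2)) * ennreal (Pk s t) * ennreal (Pk (?y s) x))"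
    using s Pk_nonneg[OF s] Pk_nonneg[OF y] by (intro nn_integral_cong) (simp add: ennreal_mult mult.assoc)
   also have "... = ennreal (exp (- s / 2)) * (ennreal B * ennreal B)"
    by (simp add: nn_integral_cmult nn_integral_multc PB[OF s] PB[OF y] mult.assoc)
   finally show ?thesis using s by simp
  qed simp
 qed
 also have "... = (NINT s. ennreal (exp (- (1 / 2) * \<bar>s\<bar>))) * (ennreal B * ennreal B)" by (rule nn_integral_multc) simp
 also have "... < \<infinity>"
  using nn_integral_eq_integral[OF exp_rate_integral(1)[of "1/2"]] by (simp add: ennreal_mult_less_top)
 finally show ?thesis .
qed

section \<open>Embedding of W^q into L^p and L^q\<close>

lemma slice_norms_nonneg:
 fixes F :: "R2 => real"
 assumes [measurable]: "F \<in> bmeas" and q: "q > 0" and F: "(NINT z. ennreal (F z powr q)) <= 1"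
 defines "A \<equiv> %t. enn2real (NINT x. ennreal (F (t, x) powr q))"
 shows "AE t in lborel. (NINT x. ennreal (F (t, x) powr q)) = ennreal (A t)"
  and "(NINT t. ennreal ((A t powr (1 / q)) powr q)) <= 1" and "A \<in> bmeas" and "A t >= 0"
proof -
 have le: "(NINT t. NINT x. ennreal (F (t, x) powr q)) <= 1" using F by (simp add: nn_integral_R2)
 hence "(NINT t. NINT x. ennreal (F (t, x) powr q)) ~= \<infinity>" by (auto simp: top_unique)
 hence "AE t in lborel. (NINT x. ennreal (F (t, x) powr q)) ~= \<infinity>" by (intro nn_integral_PInf_AE) simp_all
 thus "AE t in lborel. (NINT x. ennreal (F (t, x) powr q)) = ennreal (A t)"
  by eventually_elim (simp add: A_def top.not_eq_extremum)
 show "A \<in> bmeas" "A t >= 0" unfolding A_def by simp_all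
 have "(A t powr (1 / q)) powr q = A t" for t using q by (simp add: powr_powr A_def)
 hence "(NINT t. ennreal ((A t powr (1 / q)) powr q)) = (NINT t. ennreal (A t))" by (simp only:)
 also have "... <= (NINT t. NINT x. ennreal (F (t, x) powr q))"
  unfolding A_def by (intro nn_integral_mono) (simp add: ennreal_enn2real_if)
 also note le
 finally show "(NINT t. ennreal ((A t powr (1 / q)) powr q)) <= 1" .
qed

text \<open>The product bound for \<open>HH\<close> allows Hardy-Littlewood-Sobolev in x for fixed
  times and then in t for the slice norms, which accounts for the two equal factors in the
  constant.\<close>

lemma HH_bilinear_HLS:
 fixes F G :: "R2 => real"
 assumes m: "m >= 1" and k: "ka = 1 / (2 * real m + 1)" and q: "q = 2 / (2 - ka)"
  and [measurable]: "F \<in> bmeas" "G \<in> bmeas" and FG0: "!!z. F z >= 0" "!!z. G z >= 0"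
  and F: "(NINT z. ennreal (F z powr q)) <= 1" and G: "(NINT z. ennreal (G z powr q)) <= 1"
 shows "(NINT z. NINT w. ennreal (F z * G w) * HH m (z - w)) <= ennreal ((1 + 1 / ka) * (4 / (1 - ka) + 6) * (4 / (1 - ka) + 6))"
proof -
 have k01: "0 < ka" "ka < 1" using m by (auto simp: k)
 have q0: "q > 0" using k01 by (simp add: q)
 define D where "D = 1 + 1 / ka"
 define K where "K = 4 / (1 - ka) + 6"
 have DK: "D >= 0" "K >= 0" using k01 by (simp_all add: D_def K_def)
 define A where "A t = enn2real (NINT x. ennreal (F (t, x) powr q))" for t
 define B where "B t = enn2real (NINT x. ennreal (G (t, x) powr q))" for t
 have A: "AE t in lborel. (NINT x. ennreal (F (t, x) powr q)) = ennreal (A t)" "(NINT t. ennreal ((A t powr (1 / q)) powr q)) <= 1"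
  "A \<in> bmeas" "A t >= 0" for t using slice_norms_nonneg[OF _ q0 F] by (simp_all add: A_def[abs_def])
 have B: "AE t in lborel. (NINT x. ennreal (G (t, x) powr q)) = ennreal (B t)" "(NINT t. ennreal ((B t powr (1 / q)) powr q)) <= 1"
  "B \<in> bmeas" "B t >= 0" for t using slice_norms_nonneg[OF _ q0 G] by (simp_all add: B_def[abs_def])
 note [measurable] = A(3) B(3)
 let ?H = "%t x t' x'. ennreal (F (t, x) * G (t', x')) * HH m ((t, x) - (t', x'))"
 let ?p = "%t t'. (A t powr (1 / q)) * (B t' powr (1 / q)) * \<bar>t - t'\<bar> powr - ka"
 have "(NINT z. NINT w. ennreal (F z * G w) * HH m (z - w)) = (NINT t. NINT x. NINT t'. NINT x'. ?H t x t' x')"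
  by (simp add: nn_integral_R2)
 also have "... = (NINT t. NINT t'. NINT x. NINT x'. ?H t x t' x')"
  by (intro nn_integral_cong lborel_pair.Fubini') measurable
 also have "... <= (NINT t. NINT t'. ennreal (D * K) * ennreal (?p t t'))"
 proof (rule nn_integral_mono_AE)
  show "AE t in lborel. (NINT t'. NINT x. NINT x'. ?H t x t' x') <= (NINT t'. ennreal (D * K) * ennreal (?p t t'))"
   using A(1)
  proof eventually_elim
   case (elim t)
   note At = elim
   show ?case
   proof (rule nn_integral_mono_AE)
    show "AE t' in lborel. (NINT x. NINT x'. ?H t x t' x') <= ennreal (D * K) * ennreal (?p t t')"
     using B(1) AE_lborel_singleton[of t]
    proof eventually_elim
     case (elim t')
     let ?d = "D * \<bar>t - t'\<bar> powr - ka"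
     have d0: "?d >= 0" using DK by simp
     have "(NINT x. NINT x'. ?H t x t' x') <= (NINT x. NINT x'. ennreal ?d * ennreal (F (t, x) * G (t', x') * \<bar>x - x'\<bar> powr - ka))"
     proof (rule nn_integral_mono, rule nn_integral_mono_AE)
      fix x
      show "AE x' in lborel. ?H t x t' x' <= ennreal ?d * ennreal (F (t, x) * G (t', x') * \<bar>x - x'\<bar> powr - ka)"
       using AE_lborel_singleton[of x]
      proof eventually_elim
       case (elim x')
       have "HH m (t - t', x - x') <= ennreal (D * (\<bar>t - t'\<bar> powr - ka * \<bar>x - x'\<bar> powr - ka))"
        unfolding D_def by (rule HH_le[OF m k]) (use elim \<open>t' ~= t\<close> in auto)
       hence "?H t x t' x' <= ennreal (F (t, x) * G (t', x')) * ennreal (D * (\<bar>t - t'\<bar> powr - ka * \<bar>x - x'\<bar> powr - ka))"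
        by (simp add: mult_left_mono)
       also have "... = ennreal ?d * ennreal (F (t, x) * G (t', x') * \<bar>x - x'\<bar> powr - ka)"
        using FG0 DK d0 by (simp add: ennreal_mult[symmetric] mult_ac)
       finally show ?case .
      qed
     qed
     also have "... = ennreal ?d * (NINT x. NINT x'. ennreal (F (t, x) * G (t', x') * \<bar>x - x'\<bar> powr - ka))"
      by (simp add: nn_integral_cmult)
     also have "... <= ennreal ?d * ennreal (K * (A t powr (1 / q) * B t' powr (1 / q)))"
      unfolding K_def using FG0 elim At A(4) B(4) by (intro mult_left_mono HLS[OF _ _ _ _ k01 q]) simp_all
     also have "... = ennreal (D * K) * ennreal (?p t t')" using DK by (simp add: ennreal_mult[symmetric] mult_ac)
     finally show ?case .
    qed
   qed
  qed
 qed
 also have "... = ennreal (D * K) * (NINT t. NINT t'. ennreal (?p t t'))" by (simp add: nn_integral_cmult)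
 also have "... <= ennreal (D * K) * ennreal K"
  unfolding K_def using A(2) B(2) by (intro mult_left_mono HLS_normalised[OF _ _ _ _ k01 q]) simp_all
 also have "... = ennreal (D * K * K)" using DK by (simp add: ennreal_mult)
 finally show ?thesis unfolding D_def K_def .
qed

text \<open>Young's convolution inequality for the integrable kernel: the product F G is split
  pointwise, and each part integrates \<open>HH\<close> over a full translate.\<close>

lemma HH_bilinear_Young:
 fixes F G :: "R2 => real"
 assumes qp: "q > 1" "p > 1" "1 / q + 1 / p = 1"
  and [measurable]: "F \<in> bmeas" "G \<in> bmeas" and FG0: "!!z. F z >= 0" "!!z. G z >= 0"
  and F: "(NINT z. ennreal (F z powr q)) <= 1" and G: "(NINT z. ennreal (G z powr p)) <= 1"
 shows "(NINT z. NINT w. ennreal (F z * G w) * HH m (z - w)) <= 2 * (NINT z. HH m z)"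
proof -
 let ?I = "(NINT z. HH m z)"
 have s1: "(NINT w. HH m (z - w)) = ?I" for z :: R2
  using nn_integral_lborel_affine[of "HH m" "-1" z] by simp
 have s2: "(NINT z. HH m (z - w)) = ?I" for w :: R2
  using nn_integral_lborel_affine[of "HH m" 1 "- w"] by (simp add: add.commute)
 have "(NINT z. NINT w. ennreal (F z * G w) * HH m (z - w))
  <= (NINT z. NINT w. ennreal (F z powr q) * HH m (z - w) + ennreal (G w powr p) * HH m (z - w))"
 proof (intro nn_integral_mono)
  fix z w :: R2
  have "F z * G w <= F z powr q / q + G w powr p / p" by (rule Youngs_inequality[OF qp FG0(1) FG0(2)])
  also have "... <= F z powr q / 1 + G w powr p / 1" using qp by (intro add_mono divide_left_mono) auto
  finally have "ennreal (F z * G w) <= ennreal (F z powr q) + ennreal (G w powr p)" by (simp add: ennreal_leI flip: ennreal_plus)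
  thus "ennreal (F z * G w) * HH m (z - w) <= ennreal (F z powr q) * HH m (z - w) + ennreal (G w powr p) * HH m (z - w)"
   unfolding distrib_right[symmetric] by (rule mult_right_mono) simp
 qed
 also have "... = (NINT z. NINT w. ennreal (F z powr q) * HH m (z - w)) + (NINT z. NINT w. ennreal (G w powr p) * HH m (z - w))"
  by (simp add: nn_integral_add)
 also have "(NINT z. NINT w. ennreal (G w powr p) * HH m (z - w)) = (NINT w. NINT z. ennreal (G w powr p) * HH m (z - w))"
  by (rule lborel_pair.Fubini') (simp only: lborel_prod, measurable)
 also have "(NINT w. NINT z. ennreal (G w powr p) * HH m (z - w)) = (NINT w. ennreal (G w powr p)) * ?I"
  by (simp add: nn_integral_cmult nn_integral_multc s2)
 also have "(NINT z. NINT w. ennreal (F z powr q) * HH m (z - w)) = (NINT z. ennreal (F z powr q)) * ?I"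
  by (simp add: nn_integral_cmult nn_integral_multc s1)
 also have "(NINT z. ennreal (F z powr q)) * ?I + (NINT w. ennreal (G w powr p)) * ?I <= 1 * ?I + 1 * ?I"
  by (intro add_mono mult_right_mono F G) simp_all
 finally show ?thesis by (simp add: mult_2)
qed

text \<open>Shifting w moves the averaging variable r from \<open>HH\<close> into et. A bound K that
  is uniform over translates of et is therefore enough, and the Gaussian mass 1 drops out.\<close>

lemma Phi_pairing_bound:
 fixes f et :: "R2 => complex"
 assumes C: "!!z. ennreal (norm (Phi m e z)) <= (NINT r. ennreal (gau2 e r) * (ennreal C * HH m (z + r)))" and e: "e > 0"
  and [measurable]: "f \<in> bmeas" "et \<in> bmeas"
  and K: "!!r. (NINT z. NINT w. ennreal (norm (f z)) * ennreal (norm (et (w + r))) * HH m (z - w)) <= K"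
 shows "ennreal (norm (LBINT w. (LBINT z. f z * Phi m e (z - w)) * et w)) <= ennreal C * K"
proof -
 let ?X = "%w z r. ennreal (norm (et w)) * (ennreal (norm (f z)) * (ennreal (gau2 e r) * (ennreal C * HH m (z - w + r))))"
 have "ennreal (norm (LBINT w. (LBINT z. f z * Phi m e (z - w)) * et w)) <= (NINT w. ennreal (norm ((LBINT z. f z * Phi m e (z - w)) * et w)))"
  by (rule norm_integral_le_nn_integral)
 also have "... <= (NINT w. NINT z. NINT r. ?X w z r)"
 proof (rule nn_integral_mono)
  fix w
  have "ennreal (norm (LBINT z. f z * Phi m e (z - w))) <= (NINT z. ennreal (norm (f z * Phi m e (z - w))))" by (rule norm_integral_le_nn_integral)
  also have "... <= (NINT z. ennreal (norm (f z)) * (NINT r. ennreal (gau2 e r) * (ennreal C * HH m (z - w + r))))"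
   unfolding norm_mult ennreal_mult[OF norm_ge_zero norm_ge_zero] by (intro nn_integral_mono mult_left_mono C) simp
  finally have "ennreal (norm ((LBINT z. f z * Phi m e (z - w)) * et w)) <= ennreal (norm (et w)) * (NINT z. ennreal (norm (f z)) * (NINT r. ennreal (gau2 e r) * (ennreal C * HH m (z - w + r))))"
   unfolding norm_mult ennreal_mult[OF norm_ge_zero norm_ge_zero] mult.commute[of _ "ennreal (norm (et w))"] by (rule mult_left_mono) simp
  also have "... = (NINT z. NINT r. ?X w z r)" by (simp add: nn_integral_cmult)
  finally show "ennreal (norm ((LBINT z. f z * Phi m e (z - w)) * et w)) <= (NINT z. NINT r. ?X w z r)" .
 qed
 also have "... = (NINT w. NINT r. NINT z. ?X w z r)"
  by (intro nn_integral_cong lborel_pair.Fubini') (simp only: lborel_prod, measurable)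
 also have "... = (NINT r. NINT w. NINT z. ?X w z r)"
  by (rule lborel_pair.Fubini') (simp only: lborel_prod, measurable)
 also have "... = (NINT r. NINT z. NINT w. ?X w z r)"
  by (intro nn_integral_cong lborel_pair.Fubini') (simp only: lborel_prod, measurable)
 also have "... <= (NINT r. ennreal (gau2 e r) * (ennreal C * K))"
 proof (rule nn_integral_mono)
  fix r
  have "(NINT w. ?X w z r) = (NINT w. (ennreal (gau2 e r) * ennreal C) * (ennreal (norm (f z)) * ennreal (norm (et (w + r))) * HH m (z - w)))" for z
  proof -
   have "(NINT w. ?X w z r) = (NINT w. ?X (r + 1 *\<^sub>R w) z r)"
    using nn_integral_lborel_affine[of "%w. ?X w z r" 1 r] by simp
   also have "... = (NINT w. (ennreal (gau2 e r) * ennreal C) * (ennreal (norm (f z)) * ennreal (norm (et (w + r))) * HH m (z - w)))"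
    by (intro nn_integral_cong) (simp add: add.commute mult_ac)
   finally show ?thesis .
  qed
  hence "(NINT z. NINT w. ?X w z r) = (ennreal (gau2 e r) * ennreal C) * (NINT z. NINT w. ennreal (norm (f z)) * ennreal (norm (et (w + r))) * HH m (z - w))"
   by (simp add: nn_integral_cmult)
  also have "... <= (ennreal (gau2 e r) * ennreal C) * K" by (intro mult_left_mono K) simp
  finally show "(NINT z. NINT w. ?X w z r) <= ennreal (gau2 e r) * (ennreal C * K)" by (simp only: mult.assoc)
 qed
 also have "... = (NINT r. ennreal (gau2 e r)) * (ennreal C * K)" by (rule nn_integral_multc) simp
 also have "(NINT r. ennreal (gau2 e r)) = 1"
 proof -
  have i: "intble (gau2 e)" using gau2_properties(2)[OF e] by (simp only: complex_of_real_integrable_eq)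
  have "cor (LBINT z. gau2 e z) = 1" using gau2_properties(3)[OF e] by (simp only: integral_complex_of_real)
  hence "(LBINT z. gau2 e z) = 1" by (simp only: of_real_eq_1_iff)
  thus ?thesis using nn_integral_eq_integral[OF i] gau2_properties(1)[OF e] by simp
 qed
 finally show ?thesis by simp
qed

text \<open>A bilinear bound for \<open>HH\<close> with exponents q and tht places u in the dual of
  L^tht: the mollified u is f paired with \<open>Phi\<close>, the mollifier is removed against
  continuous functions, and duality yields the norm. Keeping tht free lets two different embeddings
  share this argument.\<close>

lemma Sobolev_dual:
 fixes u f :: "R2 => complex"
 assumes m: "m >= 1" and [measurable]: "u \<in> bmeas" "f \<in> bmeas"
  and ut: "intble (%z. norm (u z) / (1 + norm z) ^ N)"
  and pair: "ALL ph. schwartz ph --> (LBINT z. u z * PD m ph z) = (LBINT z. f z * ph z)"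
  and q: "q > 1" and th: "tht > 1" and f: "(NINT z. ennreal (norm (f z) powr q)) < \<infinity>"
  and K: "!!F G :: R2 => real. F \<in> bmeas ==> G \<in> bmeas ==> (!!z. F z >= 0) ==> (!!z. G z >= 0) ==>
   (NINT z. ennreal (F z powr q)) <= 1 ==> (NINT z. ennreal (G z powr tht)) <= 1 ==>
   (NINT z. NINT w. ennreal (F z * G w) * HH m (z - w)) <= ennreal K" and K0: "K >= 0"
 shows "(NINT z. ennreal (norm (u z) powr (tht / (tht - 1)))) < \<infinity>"
proof -
 obtain A where A: "A >= 0" "(NINT z. ennreal (norm (f z) powr q)) = ennreal A" using f by (cases "(NINT z. ennreal (norm (f z) powr q))") auto
 \<comment> \<open>Any c with c >= 1 and c >= A normalises f, because then A <= c^q; the case A = 0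
   causes no division by zero.\<close>
 define c where "c = A + 1"
 have c: "c >= 1" using A by (simp add: c_def)
 have normalise: "(NINT z. ennreal ((norm (g z) / b) powr s)) = ennreal (1 / b powr s) * (NINT z. ennreal (norm (g z) powr s))"
  if [measurable]: "g \<in> bmeas" and "b > 0" for g :: "R2 => complex" and b s :: real
  using that by (simp add: nn_integral_cmult[symmetric] powr_divide ennreal_mult[symmetric])
 have F1: "(NINT z. ennreal ((norm (f z) / c) powr q)) <= 1"
 proof -
  have "A <= c powr 1" using c A by (simp add: c_def)
  also have "... <= c powr q" using c q by (intro powr_mono) auto
  finally have "1 / c powr q * A <= 1" using c by (simp add: divide_le_eq)
  thus ?thesis using normalise[of f c q] c A by (simp add: ennreal_mult[symmetric])
 qed
 from Phi_bound[OF m] obtain C where C0: "C > 0" and C: "ALL e>0. ALL z. ennreal (norm (Phi m e z)) <= (NINT r. ennreal (gau2 e r) * (ennreal C * HH m (z + r)))" by (elim exE conjE)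
 let ?N = "C * (c * K)"
 have N0: "?N >= 0" using C0 c K0 by simp
 have cont: "norm (LBINT z. u z * et z) <= ?N * (LBINT z. norm (et z) powr tht) powr (1 / tht)"
  if et: "continuous_on UNIV et" and etR: "!!z. norm z > R ==> et z = 0" for et :: "R2 => complex" and R
 proof -
  have [measurable]: "et \<in> bmeas" by (intro borel_measurable_continuous_onI et)
  define a where "a = (LBINT z. norm (et z) powr tht)"
  have "bounded (et ` cball 0 R)"
   by (intro compact_imp_bounded compact_continuous_image continuous_on_subset[OF et]) auto
  then obtain M where M: "\<forall>z\<in>cball 0 R. norm (et z) <= M" by (auto simp: bounded_iff)
  have "intble (%z. cor (norm (et z) powr tht))"
  proof (rule integrable_bounded_support[where M="\<bar>M\<bar> powr tht" and R=R])
   fix z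
   show "norm (cor (norm (et z) powr tht)) <= \<bar>M\<bar> powr tht"
   proof (cases "norm z <= R")
    case True
    hence "norm (et z) <= M" using M[rule_format, of z] by simp
    hence "norm (et z) <= \<bar>M\<bar>" by simp
    thus ?thesis using th by (simp add: powr_mono2)
   next
    case False thus ?thesis using etR[of z] by simp
   qed
  qed (use etR in simp_all)
  hence eti: "intble (%z. norm (et z) powr tht)" by (simp only: complex_of_real_integrable_eq)
  have a0: "a >= 0" unfolding a_def by (rule integral_nonneg_AE) simp
  have ann: "(NINT z. ennreal (norm (et z) powr tht)) = ennreal a" unfolding a_def by (intro nn_integral_eq_integral eti) simp
  show ?thesis
  proof (cases "a = 0")
   case True
   hence "AE z in lborel. ennreal (norm (et z) powr tht) = 0" using ann by (subst nn_integral_0_iff_AE[symmetric]) simp_all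
   hence "AE z in lborel. u z * et z = 0" by eventually_elim (simp add: ennreal_eq_0_iff)
   hence "(LBINT z. u z * et z) = 0" by (subst integral_cong_AE[where g="%_. 0"]) simp_all
   thus ?thesis using N0 by simp
  next
   case False
   hence apos: "a > 0" using a0 by simp
   define b where "b = a powr (1 / tht)"
   have b: "b > 0" "b powr tht = a" using apos th by (simp_all add: b_def powr_powr)
   have Kr: "(NINT z. NINT w. ennreal (norm (f z)) * ennreal (norm (et (w + r))) * HH m (z - w)) <= ennreal (c * b * K)" for r
   proof -
    have sh: "(NINT w. ennreal (norm (et (w + r)) powr tht)) = ennreal a"
     using nn_integral_lborel_affine[of "%w. ennreal (norm (et w) powr tht)" 1 r] by (simp add: ann add.commute)
    have G1: "(NINT w. ennreal ((norm (et (w + r)) / b) powr tht)) <= 1"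
     using normalise[of "%w. et (w + r)" b tht] b apos by (simp add: sh ennreal_mult[symmetric])
    have "ennreal (norm (f z)) * ennreal (norm (et (w + r))) * HH m (z - w) = ennreal (c * b) * (ennreal (norm (f z) / c * (norm (et (w + r)) / b)) * HH m (z - w))" for z w
    proof -
     have "norm (f z) * norm (et (w + r)) = (c * b) * (norm (f z) / c * (norm (et (w + r)) / b))" using b c by simp
     hence "ennreal (norm (f z)) * ennreal (norm (et (w + r))) = ennreal (c * b) * ennreal (norm (f z) / c * (norm (et (w + r)) / b))"
      using b c by (simp only: ennreal_mult[symmetric] norm_ge_zero) (simp add: ennreal_mult[symmetric])
     thus ?thesis by (simp only: mult.assoc[symmetric])
    qed
    hence "(NINT z. NINT w. ennreal (norm (f z)) * ennreal (norm (et (w + r))) * HH m (z - w))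
     = ennreal (c * b) * (NINT z. NINT w. ennreal (norm (f z) / c * (norm (et (w + r)) / b)) * HH m (z - w))"
     by (simp add: nn_integral_cmult)
    also have "... <= ennreal (c * b) * ennreal K"
     using b c by (intro mult_left_mono K[OF _ _ _ _ F1 G1]) simp_all
    finally show ?thesis using b c K0 by (simp add: ennreal_mult)
   qed
   have "norm (LBINT z. (LBINT y. u y * cor (gau2 (1 / real (Suc n)) (y - z))) * et z) <= ?N * b" for n
   proof -
    have e: "1 / real (Suc n) > 0" by simp
    have "ennreal (norm (LBINT z. (LBINT y. u y * cor (gau2 (1 / real (Suc n)) (y - z))) * et z)) <= ennreal C * ennreal (c * b * K)"
     unfolding Wq_pairing[OF m e pair] by (rule Phi_pairing_bound[OF C[rule_format, OF e] e _ _ Kr]) simp_all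
    also have "... = ennreal (?N * b)" using C0 c b K0 by (simp add: ennreal_mult[symmetric] mult_ac)
    finally show ?thesis using N0 b by simp
   qed
   hence "norm (LBINT z. u z * et z) <= ?N * b"
    by (intro LIMSEQ_le_const2[OF tendsto_norm[OF mollify_limit[OF _ ut et etR]]] exI allI impI) simp_all
   thus ?thesis by (simp add: b_def a_def)
  qed
 qed
 have p1: "tht / (tht - 1) > 1" "tht = tht / (tht - 1) / (tht / (tht - 1) - 1)" using th by (simp_all add: field_simps)
 have "(NINT z. norm (u z) powr (tht / (tht - 1))) <= ennreal (?N powr (tht / (tht - 1)))"
 proof (rule Lp_duality[OF _ p1 N0])
  fix g :: "R2 => complex" and M R
  assume [measurable]: "g \<in> bmeas" and gM: "!!z. norm (g z) <= M" and gR: "!!z. norm z > R ==> g z = 0"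
   and gn: "(NINT z. norm (g z) powr tht) <= 1"
  thus "norm (LBINT z. u z * g z) <= ?N"
   by (intro dual_extend[where q=tht and N="?N", OF _ weighted_locally_integrable[OF _ ut] _ N0 cont _ gM gR gn]) (use th in simp_all)
 qed simp
 also have "... < \<infinity>" by simp
 finally show ?thesis .
qed

text \<open>Two choices of the dual exponent: tht = q with Hardy-Littlewood-Sobolev gives L^p, and
  tht = p with Young's inequality gives L^q. As q < 2 < p, square integrability follows.\<close>

lemma Sobolev_embedding:
 assumes m: "m >= 1" and k: "ka = 1 / (2 * real m + 1)" and q: "q = 2 / (2 - ka)" and p: "p = 2 / ka" and W: "Wq m q u"
 shows "(NINT z. ennreal (norm (u z) powr p)) < \<infinity>" "(NINT z. ennreal (norm (u z) powr q)) < \<infinity>"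
proof -
 have k01: "0 < ka" "ka < 1" using m by (auto simp: k)
 have q1: "q > 1" "p > 1" using k01 by (auto simp: q p field_simps)
 have conj: "q / (q - 1) = p" "p / (p - 1) = q" "1 / q + 1 / p = 1" using k01 by (auto simp: q p field_simps)
 from W obtain N f where [measurable]: "u \<in> bmeas" and ut: "intble (%z. norm (u z) / (1 + norm z) ^ N)" and f: "Lp q f"
  and pair: "ALL ph. schwartz ph --> (LBINT z. u z * PD m ph z) = (LBINT z. f z * ph z)" unfolding Wq_def by auto
 have [measurable]: "f \<in> bmeas" and fi: "intble (%z. norm (f z) powr q)" using f by (simp_all add: Lp_def)
 have fq: "(NINT z. ennreal (norm (f z) powr q)) < \<infinity>" by (subst nn_integral_eq_integral[OF fi]) simp_all
 have "(NINT z. ennreal (norm (u z) powr (q / (q - 1)))) < \<infinity>"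
  by (rule Sobolev_dual[OF m _ _ ut pair q1(1) q1(1) fq HH_bilinear_HLS[OF m k q]]) (use k01 in simp_all)
 thus "(NINT z. ennreal (norm (u z) powr p)) < \<infinity>" unfolding conj .
 obtain I where I: "I >= 0" "(NINT z. HH m z) = ennreal I" using HH_integral_finite[of m] by (cases "(NINT z. HH m z)") auto
 have "2 * (NINT z. HH m z) = ennreal (2 * I)" using I by (simp add: ennreal_mult)
 note Y = HH_bilinear_Young[OF q1 conj(3), of _ _ m, unfolded this]
 have "(NINT z. ennreal (norm (u z) powr (p / (p - 1)))) < \<infinity>"
  by (rule Sobolev_dual[OF m _ _ ut pair q1(1) q1(2) fq Y]) (use I in simp_all)
 thus "(NINT z. ennreal (norm (u z) powr q)) < \<infinity>" unfolding conj .
qed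

section \<open>Hoelder's inequality for products and the continuation argument\<close>

lemma Holder_nn_integral:
 fixes f g :: "'a => real"
 assumes s: "s > 1" "s' > 1" "1 / s + 1 / s' = 1" and [measurable]: "f \<in> borel_measurable M" "g \<in> borel_measurable M"
  and f0: "!!x. f x >= 0" and g0: "!!x. g x >= 0" and ab: "a >= 0" "b >= 0"
  and fa: "(\<integral>\<^sup>+x. ennreal (f x powr s) \<partial>M) = ennreal a" and gb: "(\<integral>\<^sup>+x. ennreal (g x powr s') \<partial>M) = ennreal b"
 shows "(\<integral>\<^sup>+x. ennreal (f x * g x) \<partial>M) <= ennreal (a powr (1 / s) * b powr (1 / s'))"
proof (cases "a = 0 \<or> b = 0")
 case True
 have "AE x in M. f x * g x = 0"
 proof (cases "a = 0")
  case True
  hence "AE x in M. ennreal (f x powr s) = 0" using fa by (subst nn_integral_0_iff_AE[symmetric]) simp_all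
  thus ?thesis by eventually_elim (simp add: ennreal_eq_0_iff)
 next
  case False
  hence "AE x in M. ennreal (g x powr s') = 0" using gb True by (subst nn_integral_0_iff_AE[symmetric]) simp_all
  thus ?thesis by eventually_elim (simp add: ennreal_eq_0_iff)
 qed
 hence "(\<integral>\<^sup>+x. ennreal (f x * g x) \<partial>M) = (\<integral>\<^sup>+x. 0 \<partial>M)" by (intro nn_integral_cong_AE) (auto elim!: eventually_mono)
 thus ?thesis by simp
next
 case False
 hence ab: "a > 0" "b > 0" using ab by auto
 define A where "A = a powr (1 / s)"
 define B where "B = b powr (1 / s')"
 have A: "A > 0" "A powr s = a" and B: "B > 0" "B powr s' = b" using ab s by (simp_all add: A_def B_def powr_powr)
 have "(\<integral>\<^sup>+x. ennreal (f x * g x) \<partial>M) <= (\<integral>\<^sup>+x. ennreal (A * B / (a * s)) * ennreal (f x powr s) + ennreal (A * B / (b * s')) * ennreal (g x powr s') \<partial>M)"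
 proof (rule nn_integral_mono)
  fix x
  have "f x / A * (g x / B) <= (f x / A) powr s / s + (g x / B) powr s' / s'" using A B f0 g0 by (intro Youngs_inequality s) auto
  also have "... = f x powr s / (a * s) + g x powr s' / (b * s')" using A B f0 g0 by (simp add: powr_divide)
  finally have "A * B * (f x / A * (g x / B)) <= A * B * (f x powr s / (a * s) + g x powr s' / (b * s'))" using A B by (intro mult_left_mono) auto
  hence "f x * g x <= A * B / (a * s) * f x powr s + A * B / (b * s') * g x powr s'" using A B by (simp add: distrib_left)
  hence "ennreal (f x * g x) <= ennreal (A * B / (a * s) * f x powr s + A * B / (b * s') * g x powr s')" by (rule ennreal_leI)
  also have "... = ennreal (A * B / (a * s)) * ennreal (f x powr s) + ennreal (A * B / (b * s')) * ennreal (g x powr s')"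
   using A B ab s by (subst ennreal_plus) (simp_all add: ennreal_mult[symmetric])
  finally show "ennreal (f x * g x) <= ..." .
 qed
 also have "... = ennreal (A * B / (a * s)) * ennreal a + ennreal (A * B / (b * s')) * ennreal b"
  by (simp add: nn_integral_add nn_integral_cmult fa gb)
 also have "... = ennreal (A * B * (1 / s + 1 / s'))"
  using A B ab by (simp only: distrib_left) (use A B ab s(1,2) in \<open>simp add: ennreal_mult[symmetric] ennreal_plus[symmetric] del: ennreal_plus\<close>)
 finally show ?thesis unfolding s(3) A_def B_def by simp
qed

text \<open>Hoelder's inequality with exponents r/q and p/q, applied to q-th powers.\<close>

lemma Holder_product:
 fixes f g :: "'a => real"
 assumes q: "q > 0" "r > q" "p > q" "1 / q = 1 / r + 1 / p" and [measurable]: "f \<in> borel_measurable M" "g \<in> borel_measurable M"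
  and f0: "!!x. f x >= 0" and g0: "!!x. g x >= 0" and ab: "a >= 0" "b >= 0"
  and fa: "(\<integral>\<^sup>+x. ennreal (f x powr r) \<partial>M) = ennreal a" and gb: "(\<integral>\<^sup>+x. ennreal (g x powr p) \<partial>M) = ennreal b"
 shows "(\<integral>\<^sup>+x. ennreal ((f x * g x) powr q) \<partial>M) <= ennreal (a powr (q / r) * b powr (q / p))"
proof -
 have s: "r / q > 1" "p / q > 1" using q by (simp_all add: field_simps)
 have s2: "1 / (r / q) + 1 / (p / q) = 1"
 proof -
  have "q * (1 / q) = q * (1 / r + 1 / p)" using q(4) by simp
  thus ?thesis using q(1) by (simp add: distrib_left)
 qed
 have e: "(x powr q) powr (y / q) = x powr y" for x y :: real using q(1) by (simp add: powr_powr)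
 have "(\<integral>\<^sup>+x. ennreal (f x powr q * g x powr q) \<partial>M) <= ennreal (a powr (1 / (r / q)) * b powr (1 / (p / q)))"
  by (rule Holder_nn_integral[OF s s2]) (simp_all only: e fa gb ab powr_ge_zero, measurable)
 thus ?thesis using f0 g0 by (simp add: powr_mult)
qed

text \<open>The gain comes from comparing two levels. Below the strip the weight is at most exp(l (c
  - de)), while on the upper half of the strip, where vanishing is claimed, it is at least exp(l (c
  - de/2)). Once the strip itself has been absorbed, letting l grow leaves no mass above c -
  de/2.\<close>

lemma unique_continuation_step:
 fixes u V :: "R2 => complex" and v :: R2
 assumes m: "m >= 1" and k: "ka = 1 / (2 * real m + 1)" and q: "q = 2 / (2 - ka)" and p: "p = 2 / ka" and r: "r = 1 / (1 - ka)"
  and sol: "solves m V u" and [measurable]: "u \<in> bmeas" "V \<in> bmeas"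
  and ut: "intble (%z. norm (u z) / (1 + norm z) ^ L)"
  and up: "(NINT z. ennreal (norm (u z) powr p)) < \<infinity>" and uq: "(NINT z. ennreal (norm (u z) powr q)) < \<infinity>"
  and Vr: "intble (%z. norm (V z) powr r)" and v: "norm v = 1"
  and uc: "AE z in lborel. z \<bullet> v > c --> u z = 0"
 shows "EX de>0. AE z in lborel. z \<bullet> v > c - de --> u z = 0"
proof -
 have k01: "0 < ka" "ka < 1" "ka < 1 / 2" using m by (auto simp: k field_simps)
 have q12: "q > 1" "q < 2" "p > 2" "r > q" "p > q" using k01 by (auto simp: q p r field_simps)
 have conj: "1 / q = 1 / r + 1 / p" using k01 by (simp add: q p r field_simps)
 have q0: "q > 0" using q12 by simp
 from carleman[OF m k q p] obtain C where C: "C > 0" and carl: "ALL al be V u N L. solves m V u --> u \<in> bmeas --> V \<in> bmeas -->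
  (NINT z. (exp (al * fst z + be * snd z) * norm (u z))\<^sup>2) < \<infinity> -->
  intble (%z. exp (al * fst z + be * snd z) * norm (u z) / (1 + norm z) ^ L) --> N > 0 -->
  (NINT z. (exp (al * fst z + be * snd z) * norm (V z * u z)) powr q) <= ennreal (N powr q) -->
  (NINT z. (exp (al * fst z + be * snd z) * norm (u z)) powr p) <= ennreal ((C * N) powr p)" by (elim exE conjE)
 define D where "D = C powr q"
 have D: "D > 0" using C by (simp add: D_def)
 obtain U where U: "U >= 0" "(NINT z. ennreal (norm (u z) powr p)) = ennreal U" using up by (cases "(NINT z. ennreal (norm (u z) powr p))") auto
 have V0: "(LBINT z. norm (V z) powr r) >= 0" by (rule integral_nonneg_AE) simp
 have Vn: "(NINT z. ennreal (norm (V z) powr r)) = ennreal (LBINT z. norm (V z) powr r)" by (intro nn_integral_eq_integral Vr) simp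
 define B where "B = (LBINT z. norm (V z) powr r) powr (q / r) * U powr (q / p)"
 have B0: "B >= 0" by (simp add: B_def)
 have B: "(NINT z. ennreal ((norm (V z) * norm (u z)) powr q)) <= ennreal B"
  unfolding B_def by (rule Holder_product[OF q0 q12(4,5) conj _ _ _ _ V0 U(1) Vn U(2)]) simp_all
 \<comment> \<open>These strips decrease to the hyperplane z . v = c, a null set, so the integral of
   |V|^r over them tends to 0.\<close>
 define S where "S n = {z :: R2. c - 1 / real (Suc n) < z \<bullet> v & z \<bullet> v <= c}" for n
 have [measurable]: "S n \<in> sets borel" for n unfolding S_def by measurable
 have small: "(%n. LBINT z. norm (V z) powr r * indicator (S n) z) \<longlonglongrightarrow> (\<integral>z. 0 \<partial>(lborel :: R2 measure))"
 proof (rule integral_dominated_convergence[OF _ _ Vr])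
  have "v ~= 0" using v by auto
  hence "negligible {z. v \<bullet> z = c}" by (intro negligible_hyperplane) auto
  moreover have "{z. v \<bullet> z = c} \<in> sets borel" by measurable
  ultimately have "{z. v \<bullet> z = c} \<in> null_sets lborel" using negligible_iff_null_sets null_sets_completion_iff[of "{z. v \<bullet> z = c}" lborel] by (simp add: negligible_iff_null_sets)
  hence "AE z in lborel. z \<notin> {z. v \<bullet> z = c}" by (rule AE_not_in)
  thus "AE z in lborel. (%n. norm (V z) powr r * indicator (S n) z) \<longlonglongrightarrow> 0"
  proof eventually_elim
   case (elim z)
   hence ne: "z \<bullet> v ~= c" by (simp add: inner_commute)
   have "eventually (%n. norm (V z) powr r * indicator (S n) z = 0) sequentially"
   proof (cases "z \<bullet> v > c")
    case True thus ?thesis by (simp add: S_def)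
   next
    case False
    hence "c - z \<bullet> v > 0" using ne by simp
    from reals_Archimedean[OF this] obtain n where n: "inverse (real (Suc n)) < c - z \<bullet> v" by blast
    have "\<not> c - 1 / real (Suc k) < z \<bullet> v" if "k >= n" for k
    proof -
     have "1 / real (Suc k) <= 1 / real (Suc n)" using that by (intro divide_left_mono) auto
     thus ?thesis using n by (simp add: inverse_eq_divide)
    qed
    thus ?thesis unfolding eventually_sequentially by (intro exI[of _ n]) (simp add: S_def)
   qed
   thus ?case by (rule tendsto_eventually)
  qed
  show "AE z in lborel. norm (norm (V z) powr r * indicator (S n) z) <= norm (V z) powr r" for n
   by (intro AE_I2) (simp add: indicator_def)
 qed measurable
 \<comment> \<open>Solves D e0^(q/r) = 1/2: the strip then contributes at most half of the left-hand
   side.\<close>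
 define e0 where "e0 = (1 / (2 * D)) powr (r / q)"
 have e0: "e0 > 0" using D by (simp add: e0_def)
 have "eventually (%n. (LBINT z. norm (V z) powr r * indicator (S n) z) < e0) sequentially"
  using order_tendstoD(2)[OF small, of e0] e0 by simp
 then obtain n where n: "(LBINT z. norm (V z) powr r * indicator (S n) z) < e0" by (auto simp: eventually_sequentially)
 define de where "de = 1 / real (Suc n)"
 have de: "de > 0" by (simp add: de_def)
 define e1 where "e1 = (LBINT z. norm (V z) powr r * indicator (S n) z)"
 have e10: "e1 >= 0" unfolding e1_def by (rule integral_nonneg_AE) simp
 have e1n: "(NINT z. ennreal ((norm (V z) * indicator (S n) z) powr r)) = ennreal e1"
 proof -
  have "(norm (V z) * indicator (S n) z) powr r = norm (V z) powr r * indicator (S n) z" for z using k01 by (simp add: indicator_def)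
  moreover have "intble (%z. norm (V z) powr r * indicator (S n) z)" by (rule integrable_real_mult_indicator[OF _ Vr]) simp
  ultimately show ?thesis unfolding e1_def by (simp add: nn_integral_eq_integral)
 qed
 have De: "D * e1 powr (q / r) <= 1 / 2"
 proof -
  have r0: "r > 0" using q12 by linarith
  have "e1 powr (q / r) <= e0 powr (q / r)" using n e10 q0 r0 unfolding e1_def by (intro powr_mono2) auto
  also have "... = 1 / (2 * D)" unfolding e0_def powr_powr using q0 r0 D by simp
  finally have "D * e1 powr (q / r) <= D * (1 / (2 * D))" using D by (intro mult_left_mono) auto
  thus ?thesis using D by simp
 qed
 obtain Y where Y: "Y >= 0" "(NINT z. ennreal (norm (u z) powr p * indicator {z. z \<bullet> v > c - de / 2} z)) = ennreal Y"
 proof -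
  have "(NINT z. ennreal (norm (u z) powr p * indicator {z. z \<bullet> v > c - de / 2} z)) <= (NINT z. ennreal (norm (u z) powr p))"
   by (intro nn_integral_mono ennreal_leI) (simp add: indicator_def)
  hence "(NINT z. ennreal (norm (u z) powr p * indicator {z. z \<bullet> v > c - de / 2} z)) < \<infinity>" using up by (rule le_less_trans)
  thus ?thesis using that by (cases "(NINT z. ennreal (norm (u z) powr p * indicator {z. z \<bullet> v > c - de / 2} z))") auto
 qed
 \<comment> \<open>Y is independent of l, so a fixed mass is bounded by a geometric sequence in l
   and must vanish.\<close>
 have main: "Y powr (q / p) <= 2 * D * (B + 1) * exp (- (de / 2 * q)) ^ l" for l :: nat
 proof -
  define E where "E z = exp (real l * (z \<bullet> v))" for z :: R2
  have [measurable]: "E \<in> bmeas" unfolding E_def by measurable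
  have E0: "E z > 0" for z by (simp add: E_def)
  have Ec: "exp ((real l * fst v) * fst z + (real l * snd v) * snd z) = E z" for z by (simp add: E_def inner_R2 algebra_simps)
  have Eu: "AE z in lborel. E z * norm (u z) <= exp (real l * c) * norm (u z)"
   using uc
  proof eventually_elim
   case (elim z)
   show ?case
   proof (cases "z \<bullet> v > c")
    case False
    hence "E z <= exp (real l * c)" unfolding E_def by (simp add: mult_left_mono)
    thus ?thesis by (intro mult_right_mono) auto
   qed (use elim in simp)
  qed
  \<comment> \<open>From |u|^2 <= |u|^q + |u|^p and the boundedness of the weight where u does not
    vanish.\<close>
  have h2: "(NINT z. (E z * norm (u z))\<^sup>2) < \<infinity>"
  proof -
   have "(NINT z. ennreal ((E z * norm (u z))\<^sup>2)) <= (NINT z. ennreal ((exp (real l * c))\<^sup>2) * (ennreal (norm (u z) powr q) + ennreal (norm (u z) powr p)))"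
    using Eu
   proof (intro nn_integral_mono_AE, eventually_elim)
    case (elim z)
    have a: "(norm (u z))\<^sup>2 <= norm (u z) powr q + norm (u z) powr p"
    proof (cases "u z = 0")
     case False
     hence "(norm (u z))\<^sup>2 = norm (u z) powr 2" by simp
     also have "... <= norm (u z) powr q + norm (u z) powr p"
     proof (cases "norm (u z) <= 1")
      case True
      hence "norm (u z) powr 2 <= norm (u z) powr q" using q12 False by (intro powr_mono') auto
      thus ?thesis using powr_ge_zero[of "norm (u z)" p] by linarith
     next
      case False
      hence "norm (u z) powr 2 <= norm (u z) powr p" using q12 by (intro powr_mono) auto
      thus ?thesis using powr_ge_zero[of "norm (u z)" q] by linarith
     qed
     finally show ?thesis .
    qed simp
    have "(E z * norm (u z))\<^sup>2 <= (exp (real l * c) * norm (u z))\<^sup>2" using elim E0[of z] by (intro power_mono) auto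
    also have "... <= (exp (real l * c))\<^sup>2 * (norm (u z) powr q + norm (u z) powr p)" unfolding power_mult_distrib using a by (intro mult_left_mono) auto
    finally have "ennreal ((E z * norm (u z))\<^sup>2) <= ennreal ((exp (real l * c))\<^sup>2 * (norm (u z) powr q + norm (u z) powr p))" by (rule ennreal_leI)
    thus ?case by (simp add: ennreal_mult)
   qed
   also have "... = ennreal ((exp (real l * c))\<^sup>2) * ((NINT z. ennreal (norm (u z) powr q)) + (NINT z. ennreal (norm (u z) powr p)))"
    by (simp add: nn_integral_cmult nn_integral_add)
   also have "... < \<infinity>" using up uq by (simp add: ennreal_mult_less_top)
   finally show ?thesis .
  qed
  have h3: "intble (%z. E z * norm (u z) / (1 + norm z) ^ L)"
  proof (rule Bochner_Integration.integrable_bound[OF integrable_mult_right[OF ut, of "exp (real l * c)"]])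
   show "AE z in lborel. norm (E z * norm (u z) / (1 + norm z) ^ L) <= norm (exp (real l * c) * (norm (u z) / (1 + norm z) ^ L))"
    using Eu
   proof eventually_elim
    case (elim z)
    hence "E z * norm (u z) / (1 + norm z) ^ L <= exp (real l * c) * norm (u z) / (1 + norm z) ^ L" by (intro divide_right_mono) auto
    thus ?case using E0[of z] by (simp add: abs_mult)
   qed
  qed measurable
  \<comment> \<open>X is known to be finite before the Carleman estimate is applied; only this makes
    the absorption x <= x/2 + D b meaningful.\<close>
  obtain X where X: "X >= 0" "(NINT z. ennreal ((E z * norm (u z) * indicator (S n) z) powr p)) = ennreal X"
  proof -
   have "(NINT z. ennreal ((E z * norm (u z) * indicator (S n) z) powr p)) <= (NINT z. ennreal (exp (real l * c) powr p) * ennreal (norm (u z) powr p))"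
    using Eu
   proof (intro nn_integral_mono_AE, eventually_elim)
    case (elim z)
    have "E z * norm (u z) * indicator (S n) z <= exp (real l * c) * norm (u z)" using elim by (auto simp: indicator_def)
    hence "(E z * norm (u z) * indicator (S n) z) powr p <= (exp (real l * c) * norm (u z)) powr p" using E0[of z] q12 by (intro powr_mono2) auto
    hence "ennreal ((E z * norm (u z) * indicator (S n) z) powr p) <= ennreal ((exp (real l * c) * norm (u z)) powr p)" by (rule ennreal_leI)
    thus ?case by (simp add: powr_mult ennreal_mult)
   qed
   also have "... < \<infinity>" using up by (simp add: nn_integral_cmult ennreal_mult_less_top)
   finally show ?thesis using that by (cases "(NINT z. ennreal ((E z * norm (u z) * indicator (S n) z) powr p))") auto
  qed
  define x where "x = X powr (q / p)"
  \<comment> \<open>B + 1 in place of B keeps N positive, as \<open>carleman\<close> requires, even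
    if V u vanishes.\<close>
  define b where "b = exp (real l * (c - de)) powr q * (B + 1)"
  have b: "b > 0" using B0 by (simp add: b_def)
  have x0: "x >= 0" by (simp add: x_def)
  define N where "N = (e1 powr (q / r) * x + b) powr (1 / q)"
  have inner: "e1 powr (q / r) * x + b > 0" using x0 b by (simp add: add_nonneg_pos)
  have N: "N > 0" "N powr q = e1 powr (q / r) * x + b" using inner q0 by (simp_all add: N_def powr_powr)
  have h4: "(NINT z. (E z * norm (V z * u z)) powr q) <= ennreal (N powr q)"
  proof -
   have "(NINT z. ennreal ((E z * norm (V z * u z)) powr q)) <= (NINT z. ennreal (((norm (V z) * indicator (S n) z) * (E z * norm (u z) * indicator (S n) z)) powr q)
    + ennreal (exp (real l * (c - de)) powr q) * ennreal ((norm (V z) * norm (u z)) powr q))"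
    using uc
   proof (intro nn_integral_mono_AE, eventually_elim)
    case (elim z)
    show ?case
    proof (cases "z \<in> S n \<or> u z = 0")
     case True
     hence "ennreal ((E z * norm (V z * u z)) powr q) = ennreal (((norm (V z) * indicator (S n) z) * (E z * norm (u z) * indicator (S n) z)) powr q)"
      by (auto simp: norm_mult mult_ac)
     thus ?thesis by simp
    next
     case False
     hence "z \<bullet> v <= c - de" using elim unfolding S_def de_def by auto
     hence "E z <= exp (real l * (c - de))" unfolding E_def by (simp add: mult_left_mono)
     hence "(E z * norm (V z * u z)) powr q <= (exp (real l * (c - de)) * (norm (V z) * norm (u z))) powr q"
      unfolding norm_mult using E0[of z] q0 by (intro powr_mono2 mult_right_mono) auto
     hence "ennreal ((E z * norm (V z * u z)) powr q) <= ennreal ((exp (real l * (c - de)) * (norm (V z) * norm (u z))) powr q)" by (rule ennreal_leI)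
     also have "... = ennreal (exp (real l * (c - de)) powr q) * ennreal ((norm (V z) * norm (u z)) powr q)" by (simp add: powr_mult ennreal_mult)
     finally show ?thesis by (simp add: add_increasing)
    qed
   qed
   also have "... = (NINT z. ennreal (((norm (V z) * indicator (S n) z) * (E z * norm (u z) * indicator (S n) z)) powr q))
    + ennreal (exp (real l * (c - de)) powr q) * (NINT z. ennreal ((norm (V z) * norm (u z)) powr q))"
    by (simp add: nn_integral_cmult nn_integral_add)
   also have "... <= ennreal (e1 powr (q / r) * X powr (q / p)) + ennreal (exp (real l * (c - de)) powr q) * ennreal B"
    using E0 by (intro add_mono mult_left_mono B Holder_product[OF q0 q12(4,5) conj _ _ _ _ e10 X(1) e1n X(2)]) (simp_all add: less_imp_le)
   also have "... = ennreal (e1 powr (q / r) * x + exp (real l * (c - de)) powr q * B)"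
    using B0 unfolding x_def by (simp add: ennreal_mult[symmetric] ennreal_plus[symmetric] del: ennreal_plus)
   also have "... <= ennreal (N powr q)" unfolding N b_def by (intro ennreal_leI add_mono mult_left_mono) auto
   finally show ?thesis .
  qed
  have "(NINT z. (E z * norm (u z)) powr p) <= ennreal ((C * N) powr p)"
   using carl[rule_format, of V u "real l * fst v" "real l * snd v" L N] unfolding Ec using sol h2 h3 N(1) h4 by simp
  moreover have "ennreal X <= (NINT z. (E z * norm (u z)) powr p)"
   unfolding X(2)[symmetric] using E0 q12 by (intro nn_integral_mono ennreal_leI powr_mono2) (auto simp: indicator_def less_imp_le)
  ultimately have "ennreal X <= ennreal ((C * N) powr p)" by (rule order_trans[rotated])
  hence XN: "X <= (C * N) powr p" by simp
  have "x <= ((C * N) powr p) powr (q / p)" unfolding x_def using XN X(1) q0 q12 by (intro powr_mono2) auto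
  also have "... = D * (e1 powr (q / r) * x + b)" using q12 C N by (simp add: powr_powr powr_mult D_def)
  also have "... = (D * e1 powr (q / r)) * x + D * b" by (simp add: algebra_simps)
  also have "... <= 1 / 2 * x + D * b" using De x0 b by (intro add_mono mult_right_mono) auto
  finally have xb: "x <= 2 * D * b" by simp
  let ?f = "exp (real l * (c - de / 2))"
  have "ennreal (?f powr p * Y) <= ennreal X"
  proof -
   have "ennreal (?f powr p * Y) = (NINT z. ennreal (?f powr p) * ennreal (norm (u z) powr p * indicator {z. z \<bullet> v > c - de / 2} z))"
    using Y by (simp add: nn_integral_cmult ennreal_mult)
   also have "... <= (NINT z. ennreal ((E z * norm (u z) * indicator (S n) z) powr p))"
    using uc
   proof (intro nn_integral_mono_AE, eventually_elim)
    case (elim z)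
    show ?case
    proof (cases "z \<bullet> v > c - de / 2 & u z ~= 0")
     case True
     hence "z \<in> S n" using elim de unfolding S_def de_def[symmetric] by auto
     moreover have "?f <= E z" unfolding E_def using True by (simp add: mult_left_mono)
     hence "(?f * norm (u z)) powr p <= (E z * norm (u z)) powr p" using q12 by (intro powr_mono2 mult_right_mono) auto
     hence "ennreal (?f powr p) * ennreal (norm (u z) powr p) <= ennreal ((E z * norm (u z)) powr p)"
      by (simp add: powr_mult ennreal_mult[symmetric] ennreal_leI)
     ultimately show ?thesis using True by simp
    qed (auto simp: indicator_def)
   qed
   finally show ?thesis unfolding X(2) .
  qed
  hence YX: "?f powr p * Y <= X" using X(1) by simp
  have "?f powr q * Y powr (q / p) = (?f powr p * Y) powr (q / p)" using q12 Y by (simp add: powr_mult powr_powr)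
  also have "... <= x" unfolding x_def using YX Y q0 q12 by (intro powr_mono2) auto
  also note xb
  finally have fin: "?f powr q * Y powr (q / p) <= 2 * D * b" .
  have fb: "b = ?f powr q * ((B + 1) * exp (- (de / 2 * q)) ^ l)"
  proof -
   have "exp (real l * (c - de)) powr q = ?f powr q * exp (- (de / 2 * q)) ^ l"
    unfolding exp_powr_real exp_of_nat_mult[symmetric] exp_add[symmetric] by (simp add: algebra_simps)
   thus ?thesis unfolding b_def by simp
  qed
  have "?f powr q * Y powr (q / p) <= ?f powr q * (2 * D * (B + 1) * exp (- (de / 2 * q)) ^ l)"
   using fin unfolding fb by (simp only: mult_ac)
  thus ?thesis by (rule mult_left_le_imp_le) simp
 qed
 have "(%l. exp (- (de / 2 * q)) ^ l) \<longlonglongrightarrow> 0" using de q0 by (intro LIMSEQ_realpow_zero) auto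
 hence "(%l. 2 * D * (B + 1) * exp (- (de / 2 * q)) ^ l) \<longlonglongrightarrow> 0" by (rule tendsto_mult_right_zero)
 hence "Y powr (q / p) <= 0" by (rule LIMSEQ_le_const) (use main in blast)
 hence "Y = 0" by (simp add: antisym)
 hence "AE z in lborel. ennreal (norm (u z) powr p * indicator {z. z \<bullet> v > c - de / 2} z) = 0" using Y(2) by (subst nn_integral_0_iff_AE[symmetric]) simp_all
 hence "AE z in lborel. z \<bullet> v > c - de / 2 --> u z = 0" by eventually_elim (auto simp: indicator_def ennreal_eq_0_iff)
 thus ?thesis using de by (intro exI[of _ "de / 2"]) simp
qed

theorem theorem1p2:
  fixes m :: nat and V u :: "R2 \<Rightarrow> complex" and v :: R2 and c :: real
  assumes "m \<ge> 1"
    and "Lp ((2 * real m + 1) / (2 * real m)) V"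
    and "Wq m ((4 * real m + 2) / (4 * real m + 1)) u"
    and "solves m V u"
    and "norm v = 1"
    and "AE z in lborel. z \<bullet> v > c \<longrightarrow> u z = 0"
  shows "AE z in lborel. u z = 0"
proof -
 define ka where "ka = 1 / (2 * real m + 1)"
 define q where "q = 2 / (2 - ka)"
 define p where "p = 2 / ka"
 define r where "r = 1 / (1 - ka)"
 have m: "real m > 0" using assms(1) by simp
 have q: "(4 * real m + 2) / (4 * real m + 1) = q" using m by (simp add: q_def ka_def field_simps)
 have r: "(2 * real m + 1) / (2 * real m) = r" using m by (simp add: r_def ka_def field_simps)
 note W = assms(3)[unfolded q]
 from W obtain L where [measurable]: "u \<in> bmeas" and ut: "intble (%z. norm (u z) / (1 + norm z) ^ L)" unfolding Wq_def by auto
 have V: "V \<in> bmeas" "intble (%z. norm (V z) powr r)" using assms(2) unfolding r Lp_def by simp_all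
 note step = unique_continuation_step[OF assms(1) ka_def q_def p_def r_def assms(4) _ V(1) ut Sobolev_embedding[OF assms(1) ka_def q_def p_def W] V(2) assms(5)]
 define S where "S = {c. AE z in lborel. z \<bullet> v > c --> u z = 0}"
 have cS: "c \<in> S" using assms(6) by (simp add: S_def)
 \<comment> \<open>S contains the limits of its elements from above: the exceptional null sets of
   countably many half planes form a null set.\<close>
 have lower: "AE z in lborel. z \<bullet> v > d --> u z = 0" if "!!n. \<exists>c\<in>S. c < d + 1 / real (Suc n)" for d
 proof -
  have "ALL n. EX c. c \<in> S & c < d + 1 / real (Suc n)" using that by blast
  then obtain s where s: "!!n. s n \<in> S" "!!n. s n < d + 1 / real (Suc n)" by metis
  have "AE z in lborel. ALL n. z \<bullet> v > s n --> u z = 0" unfolding AE_all_countable using s(1) by (auto simp: S_def)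
  thus ?thesis
  proof eventually_elim
   case (elim z)
   show ?case
   proof
    assume "z \<bullet> v > d"
    hence "z \<bullet> v - d > 0" by simp
    from reals_Archimedean[OF this] obtain n where "inverse (real (Suc n)) < z \<bullet> v - d" by blast
    hence "s n < z \<bullet> v" using s(2)[of n] by (simp add: inverse_eq_divide)
    thus "u z = 0" using elim by blast
   qed
  qed
 qed
 \<comment> \<open>A finite infimum would belong to S by \<open>lower\<close>, and one more
   continuation step would pass below it.\<close>
 have "\<not> bdd_below S"
 proof
  assume bdd: "bdd_below S"
  have "\<exists>c\<in>S. c < Inf S + 1 / real (Suc n)" for n
   using cS by (intro cInf_lessD) auto
  from lower[OF this] obtain de where "de > 0" "Inf S - de \<in> S" using step by (auto simp: S_def)
  thus False using cInf_lower[OF _ bdd, of "Inf S - de"] by simp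
 qed
 hence "\<exists>c\<in>S. c < d" for d unfolding bdd_below_def by (meson not_le)
 hence "AE z in lborel. z \<bullet> v > d --> u z = 0" for d using lower by blast
 hence "AE z in lborel. ALL n. z \<bullet> v > - real n --> u z = 0" unfolding AE_all_countable by blast
 thus ?thesis
 proof eventually_elim
  case (elim z)
  obtain n where "- (z \<bullet> v) < real n" using reals_Archimedean2 by blast
  thus ?case using elim[rule_format, of n] by simp
 qed
qed

end
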